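(* Let $d\in\mathbb{N}$, $\Omega=(0,+\infty)^d$, $\bullet\in\{D,N\}$, let $S\subset\mathbb{R}^d$ be $(\gamma,a)$-thick with $\gamma\in(0,1]$ and $a=(a_1,\dots,a_d)\in(0,+\infty)^d$, and let $\omega=\Omega\cap S$. Then the system $$\partial_tu(t)-\Delta^\bullet_\Omega u(t)=\chi_\omega v(t)\quad(0<t<T),\qquad u(0)=u_0\in L^2(\Omega),$$ is null-controllable in any time $T>0$ with control cost $$C_T\le\frac{1}{\sqrt T}\left(\frac{(2K)^d}{\gamma}\right)^{Kd/2}\exp\left(\frac{4K\|a\|_1^2\ln^2((2K)^d/\gamma)}{2T}\right),$$ where $\|a\|_1=a_1+\dots+a_d$ and $K>0$ is the universal constant described in the context.
   Context: Thick sets: a measurable set $S\subset\mathbb{R}^d$ is $(\gamma,a)$-thick, with $\gamma\in(0,1]$ and $a\in(0,+\infty)^d$, if $|S\cap(x+[0,a_1]\times\dots\times[0,a_d])|\ge\gamma\prod_{j=1}^da_j$ for all $x\in\mathbb{R}^d$, where $|\cdot|$ is Lebesgue measure. $\Delta_\Omega^D$ and $\Delta_\Omega^N$ are the Dirichlet and Neumann Laplacians on $L^2(\Omega)$: $-\Delta_\Omega^\bullet$ is the self-adjoint operator associated with the form $\int_\Omega\langle\nabla f,\nabla g\rangle_{\mathbb{C}^d}\,dx$ with form domain $H_0^1(\Omega)$ (for $D$) or $H^1(\Omega)$ (for $N$). The system $\partial_tu-\Delta_\Omega^\bullet u=\chi_\omega v$, $u(0)=u_0$, is null-controllable in time $T>0$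 if for every $u_0\in L^2(\Omega)$ there is $v\in L^2((0,T),L^2(\Omega))$ with $(\ast)$ $e^{T\Delta_\Omega^\bullet}u_0+\int_0^Te^{(T-s)\Delta_\Omega^\bullet}\chi_\omega v(s)\,ds=0$. Its control cost is $C_T=\sup_{\|u_0\|_{L^2(\Omega)}=1}\inf\{\|v\|_{L^2((0,T),L^2(\omega))}\colon v\text{ satisfies }(\ast)\}$. The constant $K$: $K>0$ is a universal constant with the following property (such a constant is known to exist from earlier work). For every $d\in\mathbb{N}$, every $L>0$, every $\tilde\Omega\in\{\mathbb{R}^d,(0,L)^d\}$, every $\bullet\in\{D,N\}$, every $(\gamma,a)$-thick set $S\subset\mathbb{R}^d$ (with $a_j\le L$ for all $j$ if $\tilde\Omega=(0,L)^d$), the system $\partial_tu-\Delta_{\tilde\Omega}^\bullet u=\chi_{\tilde\Omega\cap S}v$ is null-controllable in any time $T>0$ with control cost $$C_T\le\frac1{\sqrt T}\left(\frac{K^d}{\gamma}\right)^{Kd/2}\exp\left(\frac{K\|a\|_1^2\ln^2(K^d/\gamma)}{2T}\right),\qquad\|a\|_1=a_1+\dots+a_d.$$ *)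

theory Defs
  imports "HOL-Analysis.Analysis"
begin

text \<open>
  The dimension \<open>d\<close> is quantified inside the assumption on \<open>K\<close>, so it is a natural number and not a
  type: points of \<open>\<real>\<^sup>d\<close> are the extensional functions on \<open>{..<d}\<close> (coordinates \<open>0, \<dots>, d - 1\<close>).
  All spaces of functions consist of representatives, and equality in \<open>L\<^sup>2\<close> is equality almost
  everywhere.
\<close>

type_synonym point = "nat \<Rightarrow> real"

definition Rd :: "nat \<Rightarrow> point set" where
  "Rd d = PiE {..<d} (\<lambda>_. UNIV)"

definition cube :: "nat \<Rightarrow> real \<Rightarrow> point set" where
  "cube d L = PiE {..<d} (\<lambda>_. {0<..<L})"

definition orthant :: "nat \<Rightarrow> point set" where
  "orthant d = PiE {..<d} (\<lambda>_. {0<..})"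

definition leb :: "nat \<Rightarrow> point measure" where
  "leb d = completion (PiM {..<d} (\<lambda>_. lborel))"

abbreviation leb_on :: "nat \<Rightarrow> point set \<Rightarrow> point measure" where
  "leb_on d \<Omega> \<equiv> restrict_space (leb d) \<Omega>"

definition thick :: "nat \<Rightarrow> real \<Rightarrow> (nat \<Rightarrow> real) \<Rightarrow> point set \<Rightarrow> bool" where
  "thick d \<gamma> a S \<longleftrightarrow>
     0 < \<gamma> \<and> \<gamma> \<le> 1 \<and> (\<forall>j<d. 0 < a j) \<and> S \<in> sets (leb d) \<and>
     (\<forall>x\<in>Rd d. \<gamma> * (\<Prod>j<d. a j) \<le> measure (leb d) (S \<inter> PiE {..<d} (\<lambda>j. {x j..x j + a j})))"

subsection \<open>Square-integrable functions\<close>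

definition L2 :: "'a measure \<Rightarrow> ('a \<Rightarrow> complex) set" where
  "L2 M = {f \<in> borel_measurable M. integrable M (\<lambda>x. (cmod (f x))\<^sup>2)}"

definition L2_inner :: "'a measure \<Rightarrow> ('a \<Rightarrow> complex) \<Rightarrow> ('a \<Rightarrow> complex) \<Rightarrow> complex" where
  "L2_inner M f g = (\<integral>x. f x * cnj (g x) \<partial>M)"

definition L2_norm :: "'a measure \<Rightarrow> ('a \<Rightarrow> complex) \<Rightarrow> real" where
  "L2_norm M f = sqrt (\<integral>x. (cmod (f x))\<^sup>2 \<partial>M)"

subsection \<open>Sobolev spaces\<close>

definition partial_deriv :: "nat \<Rightarrow> (point \<Rightarrow> complex) \<Rightarrow> point \<Rightarrow> complex" where
  "partial_deriv i \<phi> x = vector_derivative (\<lambda>t. \<phi> (x(i := t))) (at (x i))"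

text \<open>All iterated partial derivatives exist and are continuous.\<close>

definition smooth :: "nat \<Rightarrow> (point \<Rightarrow> complex) \<Rightarrow> bool" where
  "smooth d \<phi> \<longleftrightarrow>
     (\<forall>is\<in>lists {..<d}.
        continuous_on (Rd d) (foldr partial_deriv is \<phi>) \<and>
        (\<forall>x\<in>Rd d. \<forall>i<d. (\<lambda>t. foldr partial_deriv is \<phi> (x(i := t))) differentiable (at (x i))))"

text \<open>
  \<open>C\<^sub>c\<^sup>\<infinity>(\<Omega>)\<close>. Compactness refers to the product topology on \<^typ>\<open>nat \<Rightarrow> real\<close>, which induces the
  Euclidean topology on \<open>Rd d\<close>.
\<close>

definition test_functions :: "nat \<Rightarrow> point set \<Rightarrow> (point \<Rightarrow> complex) set" where
  "test_functions d \<Omega> = {\<phi>. smooth d \<phi> \<and> (\<exists>C. compact C \<and> C \<subseteq> \<Omega> \<and> (\<forall>x\<in>Rd d - C. \<phi> x = 0))}"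

definition is_weak_deriv ::
  "nat \<Rightarrow> point set \<Rightarrow> nat \<Rightarrow> (point \<Rightarrow> complex) \<Rightarrow> (point \<Rightarrow> complex) \<Rightarrow> bool" where
  "is_weak_deriv d \<Omega> i f g \<longleftrightarrow>
     (\<forall>\<phi>\<in>test_functions d \<Omega>.
        (\<integral>x. f x * partial_deriv i \<phi> x \<partial>leb_on d \<Omega>) = - (\<integral>x. g x * \<phi> x \<partial>leb_on d \<Omega>))"

definition H1 :: "nat \<Rightarrow> point set \<Rightarrow> (point \<Rightarrow> complex) set" where
  "H1 d \<Omega> = {f \<in> L2 (leb_on d \<Omega>). \<forall>i<d. \<exists>g\<in>L2 (leb_on d \<Omega>). is_weak_deriv d \<Omega> i f g}"

definition weak_deriv :: "nat \<Rightarrow> point set \<Rightarrow> nat \<Rightarrow> (point \<Rightarrow> complex) \<Rightarrow> point \<Rightarrow> complex" where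
  "weak_deriv d \<Omega> i f = (SOME g. g \<in> L2 (leb_on d \<Omega>) \<and> is_weak_deriv d \<Omega> i f g)"

definition H1_norm :: "nat \<Rightarrow> point set \<Rightarrow> (point \<Rightarrow> complex) \<Rightarrow> real" where
  "H1_norm d \<Omega> f =
     sqrt ((L2_norm (leb_on d \<Omega>) f)\<^sup>2 + (\<Sum>i<d. (L2_norm (leb_on d \<Omega>) (weak_deriv d \<Omega> i f))\<^sup>2))"

text \<open>\<open>H\<^sub>0\<^sup>1(\<Omega>)\<close> is the closure of \<open>C\<^sub>c\<^sup>\<infinity>(\<Omega>)\<close> in \<open>H\<^sup>1(\<Omega>)\<close>.\<close>

definition H10 :: "nat \<Rightarrow> point set \<Rightarrow> (point \<Rightarrow> complex) set" where
  "H10 d \<Omega> = {f \<in> H1 d \<Omega>. \<exists>\<phi>. (\<forall>n. \<phi> n \<in> test_functions d \<Omega>) \<and>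
                   (\<lambda>n::nat. H1_norm d \<Omega> (\<lambda>x. f x - \<phi> n x)) \<longlonglongrightarrow> 0}"

subsection \<open>Dirichlet and Neumann Laplacians\<close>

datatype boundary = Dirichlet | Neumann

fun form_domain :: "boundary \<Rightarrow> nat \<Rightarrow> point set \<Rightarrow> (point \<Rightarrow> complex) set" where
  "form_domain Dirichlet d \<Omega> = H10 d \<Omega>"
| "form_domain Neumann d \<Omega> = H1 d \<Omega>"

definition energy_form ::
  "nat \<Rightarrow> point set \<Rightarrow> (point \<Rightarrow> complex) \<Rightarrow> (point \<Rightarrow> complex) \<Rightarrow> complex" where
  "energy_form d \<Omega> f g =
     (\<integral>x. (\<Sum>i<d. weak_deriv d \<Omega> i f x * cnj (weak_deriv d \<Omega> i g x)) \<partial>leb_on d \<Omega>)"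

text \<open>
  The graph of the Laplacian: \<open>f\<close> is in the domain of the operator associated with the form, and is
  mapped to \<open>-h\<close>, iff \<open>f\<close> is in the form domain and the form at \<open>(f, g)\<close> equals the inner product
  of \<open>-h\<close> and \<open>g\<close> for all \<open>g\<close> in the form domain.
\<close>

definition laplacian ::
  "boundary \<Rightarrow> nat \<Rightarrow> point set \<Rightarrow> ((point \<Rightarrow> complex) \<times> (point \<Rightarrow> complex)) set" where
  "laplacian b d \<Omega> =
     {(f, h). f \<in> form_domain b d \<Omega> \<and> h \<in> L2 (leb_on d \<Omega>) \<and>
        (\<forall>g\<in>form_domain b d \<Omega>. energy_form d \<Omega> f g = L2_inner (leb_on d \<Omega>) (\<lambda>x. - h x) g)}"

subsection \<open>Strongly continuous semigroups\<close>

definition C0_semigroup ::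
  "'a measure \<Rightarrow> (real \<Rightarrow> ('a \<Rightarrow> complex) \<Rightarrow> ('a \<Rightarrow> complex)) \<Rightarrow> bool" where
  "C0_semigroup M U \<longleftrightarrow>
     (\<forall>t\<ge>0. \<forall>f\<in>L2 M. U t f \<in> L2 M) \<and>
     (\<forall>t\<ge>0. \<forall>f\<in>L2 M. \<forall>g\<in>L2 M. \<forall>c.
        AE x in M. U t (\<lambda>y. c * f y + g y) x = c * U t f x + U t g x) \<and>
     (\<forall>t\<ge>0. \<exists>C. \<forall>f\<in>L2 M. L2_norm M (U t f) \<le> C * L2_norm M f) \<and>
     (\<forall>f\<in>L2 M. AE x in M. U 0 f x = f x) \<and>
     (\<forall>s\<ge>0. \<forall>t\<ge>0. \<forall>f\<in>L2 M. AE x in M. U (s + t) f x = U s (U t f) x) \<and>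
     (\<forall>f\<in>L2 M. ((\<lambda>t. L2_norm M (\<lambda>x. U t f x - f x)) \<longlongrightarrow> 0) (at_right 0))"

definition C0_generator ::
  "'a measure \<Rightarrow> (real \<Rightarrow> ('a \<Rightarrow> complex) \<Rightarrow> ('a \<Rightarrow> complex)) \<Rightarrow>
     (('a \<Rightarrow> complex) \<times> ('a \<Rightarrow> complex)) set" where
  "C0_generator M U =
     {(f, h). f \<in> L2 M \<and> h \<in> L2 M \<and>
        ((\<lambda>t. L2_norm M (\<lambda>x. (U t f x - f x) / of_real t - h x)) \<longlongrightarrow> 0) (at_right 0)}"

text \<open>
  \<open>heat_semigroup b d \<Omega> t\<close> is the operator \<open>exp (t \<Delta>)\<close>. A semigroup is determined by its
  generator, so the choice is unique up to equality almost everywhere.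
\<close>

definition heat_semigroup ::
  "boundary \<Rightarrow> nat \<Rightarrow> point set \<Rightarrow> real \<Rightarrow> (point \<Rightarrow> complex) \<Rightarrow> (point \<Rightarrow> complex)" where
  "heat_semigroup b d \<Omega> =
     (SOME U. C0_semigroup (leb_on d \<Omega>) U \<and> C0_generator (leb_on d \<Omega>) U = laplacian b d \<Omega>)"

subsection \<open>Bochner integration of functions with values in \<open>L\<^sup>2\<close>\<close>

text \<open>
  The library's Bochner integral needs a Banach space type. The definitions below transcribe the
  library's definition to functions from a measure space \<open>N\<close> into \<open>L2 M\<close>.
\<close>

definition L2_simple :: "'t measure \<Rightarrow> 'a measure \<Rightarrow> ('t \<Rightarrow> 'a \<Rightarrow> complex) \<Rightarrow> bool" where
  "L2_simple N M s \<longleftrightarrow>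
     simple_function N s \<and> (\<forall>t\<in>space N. s t \<in> L2 M) \<and>
     emeasure N {t \<in> space N. s t \<noteq> (\<lambda>_. 0)} \<noteq> \<infinity>"

definition L2_simple_integral :: "'t measure \<Rightarrow> ('t \<Rightarrow> 'a \<Rightarrow> complex) \<Rightarrow> 'a \<Rightarrow> complex" where
  "L2_simple_integral N s x = (\<Sum>g\<in>s ` space N. of_real (measure N (s -` {g} \<inter> space N)) * g x)"

definition L2_strongly_measurable ::
  "'t measure \<Rightarrow> 'a measure \<Rightarrow> ('t \<Rightarrow> 'a \<Rightarrow> complex) \<Rightarrow> bool" where
  "L2_strongly_measurable N M F \<longleftrightarrow>
     (\<forall>t\<in>space N. F t \<in> L2 M) \<and>
     (\<exists>s. (\<forall>n. L2_simple N M (s n)) \<and>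
          (AE t in N. (\<lambda>n::nat. L2_norm M (\<lambda>x. F t x - s n t x)) \<longlonglongrightarrow> 0))"

definition has_L2_integral ::
  "'t measure \<Rightarrow> 'a measure \<Rightarrow> ('t \<Rightarrow> 'a \<Rightarrow> complex) \<Rightarrow> ('a \<Rightarrow> complex) \<Rightarrow> bool" where
  "has_L2_integral N M F w \<longleftrightarrow>
     L2_strongly_measurable N M F \<and> w \<in> L2 M \<and>
     (\<exists>s. (\<forall>n. L2_simple N M (s n)) \<and>
          (\<lambda>n::nat. \<integral>\<^sup>+t. ennreal (L2_norm M (\<lambda>x. F t x - s n t x)) \<partial>N) \<longlonglongrightarrow> 0 \<and>
          (\<lambda>n. L2_norm M (\<lambda>x. L2_simple_integral N (s n) x - w x)) \<longlonglongrightarrow> 0)"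

text \<open>\<open>L\<^sup>2((0,T), L\<^sup>2(M))\<close> and its norm.\<close>

definition L2_time :: "real \<Rightarrow> 'a measure \<Rightarrow> (real \<Rightarrow> 'a \<Rightarrow> complex) set" where
  "L2_time T M =
     {v. L2_strongly_measurable (lebesgue_on {0<..<T}) M v \<and>
         integrable (lebesgue_on {0<..<T}) (\<lambda>t. (L2_norm M (v t))\<^sup>2)}"

definition L2_time_norm :: "real \<Rightarrow> 'a measure \<Rightarrow> (real \<Rightarrow> 'a \<Rightarrow> complex) \<Rightarrow> real" where
  "L2_time_norm T M v = sqrt (\<integral>t. (L2_norm M (v t))\<^sup>2 \<partial>lebesgue_on {0<..<T})"

subsection \<open>Null-controllability\<close>

definition null_controls ::
  "boundary \<Rightarrow> nat \<Rightarrow> point set \<Rightarrow> point set \<Rightarrow> real \<Rightarrow> (point \<Rightarrow> complex) \<Rightarrow>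
     (real \<Rightarrow> point \<Rightarrow> complex) set" where
  "null_controls b d \<Omega> \<omega> T u\<^sub>0 =
     {v \<in> L2_time T (leb_on d \<Omega>).
        \<exists>w. has_L2_integral (lebesgue_on {0<..<T}) (leb_on d \<Omega>)
               (\<lambda>s. heat_semigroup b d \<Omega> (T - s) (\<lambda>x. indicator \<omega> x * v s x)) w \<and>
            (AE x in leb_on d \<Omega>. heat_semigroup b d \<Omega> T u\<^sub>0 x + w x = 0)}"

definition null_controllable :: "boundary \<Rightarrow> nat \<Rightarrow> point set \<Rightarrow> point set \<Rightarrow> real \<Rightarrow> bool" where
  "null_controllable b d \<Omega> \<omega> T \<longleftrightarrow> (\<forall>u\<^sub>0\<in>L2 (leb_on d \<Omega>). null_controls b d \<Omega> \<omega> T u\<^sub>0 \<noteq> {})"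

definition control_cost :: "boundary \<Rightarrow> nat \<Rightarrow> point set \<Rightarrow> point set \<Rightarrow> real \<Rightarrow> ennreal" where
  "control_cost b d \<Omega> \<omega> T =
     (SUP u\<^sub>0 \<in> {u \<in> L2 (leb_on d \<Omega>). L2_norm (leb_on d \<Omega>) u = 1}.
        INF v \<in> null_controls b d \<Omega> \<omega> T u\<^sub>0. ennreal (L2_time_norm T (leb_on d \<omega>) v))"

definition universal_control_constant :: "real \<Rightarrow> bool" where
  "universal_control_constant K \<longleftrightarrow>
     0 < K \<and>
     (\<forall>d\<ge>1. \<forall>L>0. \<forall>\<Omega>\<in>{Rd d, cube d L}. \<forall>b \<gamma> a S.
        thick d \<gamma> a S \<longrightarrow> (\<Omega> = cube d L \<longrightarrow> (\<forall>j<d. a j \<le> L)) \<longrightarrow>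
        (\<forall>T>0. null_controllable b d \<Omega> (\<Omega> \<inter> S) T \<and>
           control_cost b d \<Omega> (\<Omega> \<inter> S) T \<le>
             ennreal (1 / sqrt T * (K ^ d / \<gamma>) powr (K * real d / 2) *
               exp (K * (\<Sum>j<d. a j)\<^sup>2 * (ln (K ^ d / \<gamma>))\<^sup>2 / (2 * T)))))"

end

theory Submission
  imports Defs "HOL-Computational_Algebra.Polynomial"
begin

text \<open>
  Sum the reflections of a function on \<open>\<real>\<^sup>d\<close> in the coordinate hyperplanes, with the signs of an
  even function for Neumann and of an odd function for Dirichlet conditions, and restrict the result
  to the orthant. This operator \<open>R\<close> and its adjoint, the isometric extension by reflection, map form
  domains into form domains. Hence \<open>R\<close> maps the graph of the Laplacian on \<open>\<real>\<^sup>d\<close> into that on the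
  orthant, and it intertwines the two heat semigroups. It is a contraction, so it turns a control for
  the extended initial datum, acting on the union of the reflections of \<open>\<omega>\<close>, into a control on \<open>\<omega>\<close> of
  no larger norm. This union is \<open>(\<gamma> / 2\<^sup>d, 2 a)\<close>-thick, and the bound is the known one for \<open>\<real>\<^sup>d\<close> with
  these parameters.

  The heat semigroups are obtained from the closed forms by Yosida approximation, where the
  resolvents minimize quadratic functionals.
\<close>

section \<open>Square-integrable functions\<close>

text \<open>A control for the extended datum need not share the parity of that datum, so the
  restriction of the controlled solution to the orthant may violate the boundary condition. Summing
  signed reflections projects onto the right parity class before restricting, so no symmetric
  control has to be found. Intertwining is checked on generators only: with \<open>E\<close> the
  adjoint extension, the forms satisfy a(R f, g) = a(f, E g) and the inner products <R h, g> = <h, E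
  g>, so everything rests on both maps respecting the form domains. There the boundary conditions
  enter: an odd reflection sum vanishes on the walls but not near them, and functions on the orthant
  must be integrated by parts against test functions that reach the walls. Since
  \<open>heat_semigroup\<close> is a choice among semigroups with the right generator, nothing can
  be said about it before such a semigroup is known to exist. In the bound, K^d / (\<gamma> / 2^d) =
  (2 K)^d / \<gamma>, and doubling the side lengths multiplies the square of their sum by 4.\<close>

lemma L2_measurable: "f \<in> L2 M \<Longrightarrow> f \<in> borel_measurable M"
  by (simp add: L2_def)

lemma L2_integrable_sq: "f \<in> L2 M \<Longrightarrow> integrable M (\<lambda>x. (cmod (f x))\<^sup>2)"
  by (simp add: L2_def)

lemma L2_zero [simp]: "(\<lambda>_. 0) \<in> L2 M"
  by (simp add: L2_def)

lemma L2_integrable_cmod_mult: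
  assumes "f \<in> L2 M" "g \<in> L2 M"
  shows "integrable M (\<lambda>x. cmod (f x) * cmod (g x))"
proof (rule Bochner_Integration.integrable_bound)
  show "integrable M (\<lambda>x. (cmod (f x))\<^sup>2 + (cmod (g x))\<^sup>2)"
    using assms by (simp add: L2_integrable_sq)
  show "(\<lambda>x. cmod (f x) * cmod (g x)) \<in> borel_measurable M"
    using assms by (auto dest!: L2_measurable)
  have "a * b \<le> a\<^sup>2 + b\<^sup>2" if "a \<ge> 0" "b \<ge> 0" for a b :: real
    using sum_squares_bound[of a b] mult_nonneg_nonneg[OF that] by linarith
  then show "AE x in M. norm (cmod (f x) * cmod (g x)) \<le> norm ((cmod (f x))\<^sup>2 + (cmod (g x))\<^sup>2)"
    by simp
qed

lemma L2_integrable_mult: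
  assumes "f \<in> L2 M" "g \<in> L2 M"
  shows "integrable M (\<lambda>x. f x * g x)"
  by (rule Bochner_Integration.integrable_bound[OF L2_integrable_cmod_mult[OF assms]])
    (use assms in \<open>auto dest!: L2_measurable simp: norm_mult\<close>)

lemma L2_cnj [simp]: "(\<lambda>x. cnj (f x)) \<in> L2 M \<longleftrightarrow> f \<in> L2 M"
proof -
  have "(\<lambda>x. cnj (f x)) \<in> borel_measurable M" if "f \<in> borel_measurable M" for f
    using that by (rule borel_measurable_continuous_on[OF continuous_on_cnj[OF continuous_on_id]])
  then have "(\<lambda>x. cnj (f x)) \<in> L2 M" if "f \<in> L2 M" for f
    using that by (simp add: L2_def)
  from this[of f] this[of "\<lambda>x. cnj (f x)"] show ?thesis by auto
qed

lemma L2_integrable_mult_cnj: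
  assumes "f \<in> L2 M" "g \<in> L2 M"
  shows "integrable M (\<lambda>x. f x * cnj (g x))"
  using assms by (intro L2_integrable_mult) auto

lemma L2_lincomb:
  assumes "f \<in> L2 M" "g \<in> L2 M"
  shows "(\<lambda>x. c * f x + g x) \<in> L2 M"
  unfolding L2_def
proof safe
  have "integrable M (\<lambda>x. 2 * (cmod c)\<^sup>2 * (cmod (f x))\<^sup>2 + 2 * (cmod (g x))\<^sup>2)"
    using assms by (simp add: L2_integrable_sq)
  moreover have "norm ((cmod (c * f x + g x))\<^sup>2)
      \<le> norm (2 * (cmod c)\<^sup>2 * (cmod (f x))\<^sup>2 + 2 * (cmod (g x))\<^sup>2)" for x
  proof -
    have "cmod (c * f x + g x) \<le> cmod c * cmod (f x) + cmod (g x)"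
      by (metis norm_mult norm_triangle_ineq)
    then have "(cmod (c * f x + g x))\<^sup>2 \<le> (cmod c * cmod (f x) + cmod (g x))\<^sup>2"
      by (simp add: power_mono)
    also have "\<dots> \<le> 2 * (cmod c * cmod (f x))\<^sup>2 + 2 * (cmod (g x))\<^sup>2"
      using sum_squares_bound[of "cmod c * cmod (f x)" "cmod (g x)"] by (simp add: power2_sum)
    finally show ?thesis by (simp add: power_mult_distrib)
  qed
  ultimately show "integrable M (\<lambda>x. (cmod (c * f x + g x))\<^sup>2)"
    using assms by (auto dest!: L2_measurable intro: Bochner_Integration.integrable_bound)
qed (use assms in \<open>auto dest!: L2_measurable\<close>)

lemma L2_add: "f \<in> L2 M \<Longrightarrow> g \<in> L2 M \<Longrightarrow> (\<lambda>x. f x + g x) \<in> L2 M"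
  using L2_lincomb[of f M g 1] by simp

lemma L2_mult: "f \<in> L2 M \<Longrightarrow> (\<lambda>x. c * f x) \<in> L2 M"
  using L2_lincomb[of f M "\<lambda>_. 0" c] by simp

lemma L2_diff: "f \<in> L2 M \<Longrightarrow> g \<in> L2 M \<Longrightarrow> (\<lambda>x. f x - g x) \<in> L2 M"
  using L2_lincomb[of g M f "-1"] by simp

lemma L2_uminus: "f \<in> L2 M \<Longrightarrow> (\<lambda>x. - f x) \<in> L2 M"
  using L2_mult[of f M "-1"] by simp

lemma L2_sum: "(\<And>i. i \<in> I \<Longrightarrow> f i \<in> L2 M) \<Longrightarrow> (\<lambda>x. \<Sum>i\<in>I. f i x) \<in> L2 M"
  by (induction I rule: infinite_finite_induct) (auto intro: L2_add)

lemma L2_bounded_mult: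
  assumes "f \<in> L2 M" and [measurable]: "m \<in> borel_measurable M" and "\<And>x. cmod (m x) \<le> C"
  shows "(\<lambda>x. m x * f x) \<in> L2 M"
  unfolding L2_def
proof safe
  have "integrable M (\<lambda>x. C\<^sup>2 * (cmod (f x))\<^sup>2)"
    using assms by (simp add: L2_integrable_sq)
  then show "integrable M (\<lambda>x. (cmod (m x * f x))\<^sup>2)"
  proof (rule Bochner_Integration.integrable_bound)
    show "(\<lambda>x. (cmod (m x * f x))\<^sup>2) \<in> borel_measurable M"
      using L2_measurable[OF assms(1)] by simp
    have "norm ((cmod (m x * f x))\<^sup>2) \<le> norm (C\<^sup>2 * (cmod (f x))\<^sup>2)" for x
      using assms(3)[of x] by (simp add: norm_mult power_mult_distrib mult_right_mono power_mono)
    then show "AE x in M. norm ((cmod (m x * f x))\<^sup>2) \<le> norm (C\<^sup>2 * (cmod (f x))\<^sup>2)"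
      by simp
  qed
qed (use assms in \<open>auto dest!: L2_measurable\<close>)

lemma L2_norm_nonneg [simp]: "L2_norm M f \<ge> 0"
  by (simp add: L2_norm_def)

lemma L2_norm_power2: "(L2_norm M f)\<^sup>2 = (\<integral>x. (cmod (f x))\<^sup>2 \<partial>M)"
  by (simp add: L2_norm_def)

lemma L2_norm_zero [simp]: "L2_norm M (\<lambda>_. 0) = 0"
  by (simp add: L2_norm_def)

lemma L2_norm_nn_integral:
  "f \<in> L2 M \<Longrightarrow> (\<integral>\<^sup>+x. ennreal ((cmod (f x))\<^sup>2) \<partial>M) = ennreal ((L2_norm M f)\<^sup>2)"
  by (subst nn_integral_eq_integral) (auto simp: L2_integrable_sq L2_norm_power2)

lemma L2_I_nn_integral:
  assumes "f \<in> borel_measurable M" "(\<integral>\<^sup>+x. ennreal ((cmod (f x))\<^sup>2) \<partial>M) < \<infinity>"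
  shows "f \<in> L2 M"
  using assms by (auto simp: L2_def integrable_iff_bounded)

lemma L2_norm_cong_AE:
  assumes "f \<in> borel_measurable M" "g \<in> borel_measurable M" "AE x in M. f x = g x"
  shows "L2_norm M f = L2_norm M g"
proof -
  have "(\<integral>x. (cmod (f x))\<^sup>2 \<partial>M) = (\<integral>x. (cmod (g x))\<^sup>2 \<partial>M)"
    using assms by (intro integral_cong_AE) auto
  then show ?thesis by (simp add: L2_norm_def)
qed

lemma L2_norm_mult: "L2_norm M (\<lambda>x. c * f x) = cmod c * L2_norm M f"
  by (simp add: L2_norm_def norm_mult power_mult_distrib real_sqrt_mult)

lemma L2_norm_minus_commute: "L2_norm M (\<lambda>x. f x - g x) = L2_norm M (\<lambda>x. g x - f x)"
  by (simp add: L2_norm_def norm_minus_commute)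

lemma L2_norm_eq_0_iff:
  assumes "f \<in> L2 M"
  shows "L2_norm M f = 0 \<longleftrightarrow> (AE x in M. f x = 0)"
proof -
  have "L2_norm M f = 0 \<longleftrightarrow> (\<integral>x. (cmod (f x))\<^sup>2 \<partial>M) = 0"
    by (simp add: L2_norm_def)
  also have "\<dots> \<longleftrightarrow> (AE x in M. (cmod (f x))\<^sup>2 = 0)"
    by (rule integral_nonneg_eq_0_iff_AE) (auto simp: L2_integrable_sq assms)
  finally show ?thesis by simp
qed

text \<open>With a and b the two norms, the weights b/(2a) and a/(2b) in the inequality of
  arithmetic and geometric means are chosen so that the integrated right-hand side is exactly a b. A
  vanishing norm makes the weights meaningless and is split off.\<close>

lemma L2_Cauchy_Schwarz_cmod:
  assumes "f \<in> L2 M" "g \<in> L2 M"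
  shows "(\<integral>x. cmod (f x) * cmod (g x) \<partial>M) \<le> L2_norm M f * L2_norm M g"
proof (cases "L2_norm M f = 0 \<or> L2_norm M g = 0")
  case True
  then have "AE x in M. cmod (f x) * cmod (g x) = 0"
    using assms by (auto simp: L2_norm_eq_0_iff)
  then have "(\<integral>x. cmod (f x) * cmod (g x) \<partial>M) = (\<integral>x. 0 \<partial>M)"
    using assms by (intro integral_cong_AE) (auto dest!: L2_measurable)
  then show ?thesis by simp
next
  case False
  define a b where "a = L2_norm M f" and "b = L2_norm M g"
  have ab: "a > 0" "b > 0"
    using False L2_norm_nonneg[of M f] L2_norm_nonneg[of M g] unfolding a_def b_def by linarith+
  have "cmod (f x) * cmod (g x) \<le> (b / a / 2) * (cmod (f x))\<^sup>2 + (a / b / 2) * (cmod (g x))\<^sup>2" for x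
  proof -
    have "0 \<le> (b * cmod (f x) - a * cmod (g x))\<^sup>2" by simp
    then have "2 * (a * b) * (cmod (f x) * cmod (g x)) \<le> b\<^sup>2 * (cmod (f x))\<^sup>2 + a\<^sup>2 * (cmod (g x))\<^sup>2"
      by (simp add: power2_diff power_mult_distrib algebra_simps)
    then show ?thesis using ab by (simp add: field_simps power2_eq_square)
  qed
  then have "(\<integral>x. cmod (f x) * cmod (g x) \<partial>M)
      \<le> (\<integral>x. (b / a / 2) * (cmod (f x))\<^sup>2 + (a / b / 2) * (cmod (g x))\<^sup>2 \<partial>M)"
    by (intro integral_mono) (auto simp: L2_integrable_cmod_mult L2_integrable_sq assms)
  also have "\<dots> = (b / a / 2) * a\<^sup>2 + (a / b / 2) * b\<^sup>2"
    using assms by (simp add: L2_integrable_sq a_def b_def L2_norm_power2)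
  also have "\<dots> = a * b"
    using ab by (simp add: field_simps power2_eq_square)
  finally show ?thesis by (simp add: a_def b_def)
qed

lemma L2_Cauchy_Schwarz:
  assumes "f \<in> L2 M" "g \<in> L2 M"
  shows "cmod (\<integral>x. f x * g x \<partial>M) \<le> L2_norm M f * L2_norm M g"
proof -
  have "cmod (\<integral>x. f x * g x \<partial>M) \<le> (\<integral>x. cmod (f x * g x) \<partial>M)" by (rule integral_norm_bound)
  also have "\<dots> \<le> L2_norm M f * L2_norm M g"
    using L2_Cauchy_Schwarz_cmod[OF assms] by (simp add: norm_mult)
  finally show ?thesis .
qed

lemma L2_norm_triangle:
  assumes "f \<in> L2 M" "g \<in> L2 M"
  shows "L2_norm M (\<lambda>x. f x + g x) \<le> L2_norm M f + L2_norm M g"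
proof -
  note int = L2_integrable_sq[OF L2_add[OF assms]] L2_integrable_cmod_mult[OF assms]
    L2_integrable_sq[OF assms(1)] L2_integrable_sq[OF assms(2)]
  have le: "(cmod (f x + g x))\<^sup>2 \<le> (cmod (f x))\<^sup>2 + 2 * (cmod (f x) * cmod (g x)) + (cmod (g x))\<^sup>2" for x
    using power_mono[OF norm_triangle_ineq[of "f x" "g x"], of 2] by (simp add: power2_sum)
  have "(L2_norm M (\<lambda>x. f x + g x))\<^sup>2
      \<le> (\<integral>x. (cmod (f x))\<^sup>2 + 2 * (cmod (f x) * cmod (g x)) + (cmod (g x))\<^sup>2 \<partial>M)"
    unfolding L2_norm_power2 using int
    by (intro integral_mono le Bochner_Integration.integrable_add integrable_mult_right)
  also have "\<dots> = (L2_norm M f)\<^sup>2 + 2 * (\<integral>x. cmod (f x) * cmod (g x) \<partial>M) + (L2_norm M g)\<^sup>2"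
    unfolding L2_norm_power2 using int by simp
  also have "\<dots> \<le> (L2_norm M f + L2_norm M g)\<^sup>2"
    using L2_Cauchy_Schwarz_cmod[OF assms] by (simp add: power2_sum)
  finally show ?thesis by (rule power2_le_imp_le) simp
qed

lemma L2_norm_triangle_diff:
  assumes "f \<in> L2 M" "g \<in> L2 M" "h \<in> L2 M"
  shows "L2_norm M (\<lambda>x. f x - h x) \<le> L2_norm M (\<lambda>x. f x - g x) + L2_norm M (\<lambda>x. g x - h x)"
  using L2_norm_triangle[of "\<lambda>x. f x - g x" M "\<lambda>x. g x - h x"] assms by (simp add: L2_diff)

lemma L2_norm_sum_le:
  assumes "\<And>i. i \<in> I \<Longrightarrow> f i \<in> L2 M"
  shows "L2_norm M (\<lambda>x. \<Sum>i\<in>I. f i x) \<le> (\<Sum>i\<in>I. L2_norm M (f i))"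
  using assms
proof (induction I rule: infinite_finite_induct)
  case (insert i I)
  have "L2_norm M (\<lambda>x. f i x + (\<Sum>i\<in>I. f i x)) \<le> L2_norm M (f i) + L2_norm M (\<lambda>x. \<Sum>i\<in>I. f i x)"
    by (rule L2_norm_triangle) (use insert.prems in \<open>auto intro: L2_sum\<close>)
  also have "\<dots> \<le> L2_norm M (f i) + (\<Sum>i\<in>I. L2_norm M (f i))"
    using insert.IH insert.prems by simp
  finally show ?case using insert.hyps by simp
qed simp_all

text \<open>Turns a pointwise limit into membership in L2 together with a norm bound. The bound is
  only required eventually because it is applied to the tail of a subsequence.\<close>

lemma L2_Fatou:
  fixes F :: "nat \<Rightarrow> 'a \<Rightarrow> complex"
  assumes F: "\<And>n. F n \<in> L2 M" and f: "f \<in> borel_measurable M"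
    and lim: "AE x in M. (\<lambda>n. F n x) \<longlonglongrightarrow> f x"
    and bound: "\<forall>\<^sub>F n in sequentially. L2_norm M (F n) \<le> B"
  shows "f \<in> L2 M \<and> L2_norm M f \<le> B"
proof -
  have "B \<ge> 0"
    using bound by (meson L2_norm_nonneg eventually_sequentially order_refl order_trans)
  have "(\<integral>\<^sup>+x. ennreal ((cmod (f x))\<^sup>2) \<partial>M)
      = (\<integral>\<^sup>+x. liminf (\<lambda>n. ennreal ((cmod (F n x))\<^sup>2)) \<partial>M)"
  proof (rule nn_integral_cong_AE)
    show "AE x in M. ennreal ((cmod (f x))\<^sup>2) = liminf (\<lambda>n. ennreal ((cmod (F n x))\<^sup>2))"
      using lim
    proof eventually_elim
      case (elim x)
      then have "(\<lambda>n. ennreal ((cmod (F n x))\<^sup>2)) \<longlonglongrightarrow> ennreal ((cmod (f x))\<^sup>2)"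
        by (intro tendsto_intros)
      then show ?case by (intro lim_imp_Liminf[symmetric]) auto
    qed
  qed
  also have "\<dots> \<le> liminf (\<lambda>n. \<integral>\<^sup>+x. ennreal ((cmod (F n x))\<^sup>2) \<partial>M)"
    using L2_measurable[OF F] by (intro nn_integral_liminf) simp
  also have "\<dots> = liminf (\<lambda>n. ennreal ((L2_norm M (F n))\<^sup>2))"
    by (simp add: L2_norm_nn_integral F)
  also have "\<dots> \<le> liminf (\<lambda>n::nat. ennreal (B\<^sup>2))"
    by (rule Liminf_mono) (use bound in \<open>auto elim!: eventually_mono intro!: ennreal_leI power_mono\<close>)
  also have "\<dots> = ennreal (B\<^sup>2)" by (simp add: Liminf_const)
  finally have le: "(\<integral>\<^sup>+x. ennreal ((cmod (f x))\<^sup>2) \<partial>M) \<le> ennreal (B\<^sup>2)" .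
  then have "f \<in> L2 M" by (intro L2_I_nn_integral f) (auto simp: less_top[symmetric] top_unique)
  with le have "(L2_norm M f)\<^sup>2 \<le> B\<^sup>2" by (simp add: L2_norm_nn_integral)
  then have "L2_norm M f \<le> B" using \<open>B \<ge> 0\<close> by (rule power2_le_imp_le)
  with \<open>f \<in> L2 M\<close> show ?thesis by simp
qed

text \<open>Riesz-Fischer: a rapidly converging subsequence converges almost everywhere, and Fatou
  along it turns the pointwise limit into the limit in norm.\<close>

lemma L2_complete:
  fixes F :: "nat \<Rightarrow> 'a \<Rightarrow> complex"
  assumes F: "\<And>n. F n \<in> L2 M"
    and cau: "\<And>e. e > 0 \<Longrightarrow> \<exists>N. \<forall>m\<ge>N. \<forall>n\<ge>N. L2_norm M (\<lambda>x. F m x - F n x) < e"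
  shows "\<exists>f\<in>L2 M. (\<lambda>n. L2_norm M (\<lambda>x. F n x - f x)) \<longlonglongrightarrow> 0"
proof -
  have "\<exists>N. \<forall>m\<ge>N. \<forall>n\<ge>N. L2_norm M (\<lambda>x. F m x - F n x) < (1/2)^k" for k :: nat
    by (rule cau) simp
  then obtain N where N: "\<And>k m n. m \<ge> N k \<Longrightarrow> n \<ge> N k \<Longrightarrow> L2_norm M (\<lambda>x. F m x - F n x) < (1/2)^k"
    by metis
  \<comment> \<open>Partial sums of the \<open>N i\<close> make the indices monotone while keeping
    them above \<open>N k\<close>.\<close>
  define r where "r = (\<lambda>k. (\<Sum>i\<le>k. N i))"
  have r_ge: "r k \<ge> N k" for k
    unfolding r_def by (rule member_le_sum) auto
  have r_mono: "r k \<le> r (Suc k)" for k by (simp add: r_def)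
  have r_mono': "mono r" by (rule mono_iff_le_Suc[THEN iffD2]) (simp add: r_mono)
  define g where "g = (\<lambda>k x. F (r (Suc k)) x - F (r k) x)"
  have g_L2: "g k \<in> L2 M" for k unfolding g_def by (intro L2_diff F)
  have g_norm: "L2_norm M (g k) \<le> (1/2)^k" for k
    using N[of k "r (Suc k)" "r k"] r_ge[of k] r_mono[of k] unfolding g_def by simp
  \<comment> \<open>The weights 2^k are affordable since the squared norms are at most 4^-k. They
    pay off pointwise: a finite sum forces |g k x| to be of order 2^(-k/2), so the telescoping
    series converges absolutely.\<close>
  have "(\<integral>\<^sup>+x. (\<Sum>k. ennreal (2^k * (cmod (g k x))\<^sup>2)) \<partial>M)
      = (\<Sum>k. \<integral>\<^sup>+x. ennreal (2^k * (cmod (g k x))\<^sup>2) \<partial>M)"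
    using L2_measurable[OF g_L2] by (intro nn_integral_suminf) simp
  also have "\<dots> = (\<Sum>k. ennreal (2^k * (L2_norm M (g k))\<^sup>2))"
    using L2_measurable[OF g_L2] g_L2
    by (intro suminf_cong) (simp add: ennreal_mult nn_integral_cmult L2_norm_nn_integral)
  also have "\<dots> \<le> (\<Sum>k. ennreal ((1/2)^k))"
  proof (rule suminf_le)
    fix k :: nat
    have "2^k * (L2_norm M (g k))\<^sup>2 \<le> 2^k * ((1/2)^k)\<^sup>2"
      using g_norm[of k] by (intro mult_left_mono power_mono) auto
    also have "\<dots> = (1/2)^k" by (simp add: power2_eq_square power_divide)
    finally show "ennreal (2^k * (L2_norm M (g k))\<^sup>2) \<le> ennreal ((1/2)^k)" by (rule ennreal_leI)
  qed auto
  also have "\<dots> = ennreal 2"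
    by (subst suminf_ennreal2) (auto simp: suminf_geometric)
  finally have "(\<integral>\<^sup>+x. (\<Sum>k. ennreal (2^k * (cmod (g k x))\<^sup>2)) \<partial>M) \<noteq> \<infinity>"
    by (auto simp: top_unique)
  then have "AE x in M. (\<Sum>k. ennreal (2^k * (cmod (g k x))\<^sup>2)) \<noteq> \<infinity>"
    using L2_measurable[OF g_L2] by (intro nn_integral_PInf_AE) simp_all
  then have conv: "AE x in M. convergent (\<lambda>k. F (r k) x)"
  proof eventually_elim
    case (elim x)
    then have sm: "summable (\<lambda>k. 2^k * (cmod (g k x))\<^sup>2)"
      by (intro summable_suminf_not_top) auto
    then have "Bseq (\<lambda>k. 2^k * (cmod (g k x))\<^sup>2)"
      by (intro convergent_imp_Bseq convergentI[OF summable_LIMSEQ_zero])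
    then obtain C where C: "\<And>k. norm (2^k * (cmod (g k x))\<^sup>2) \<le> C"
      by (rule BseqE) blast
    have "cmod (g k x) \<le> sqrt C * (sqrt (1/2))^k" for k
    proof -
      have "(cmod (g k x))\<^sup>2 \<le> C * (1/2)^k"
        using C[of k] by (simp add: field_simps)
      then have "cmod (g k x) \<le> sqrt (C * (1/2)^k)" by (rule real_le_rsqrt)
      then show ?thesis by (simp add: real_sqrt_mult real_sqrt_power)
    qed
    moreover have "summable (\<lambda>k. sqrt C * (sqrt (1/2))^k)"
      by (intro summable_mult summable_geometric) (auto simp: real_sqrt_divide)
    ultimately have "summable (\<lambda>k. g k x)"
      by (rule summable_comparison_test'[where N = 0, rotated])
    then have "convergent (\<lambda>n. (\<Sum>k<n. g k x) + F (r 0) x)"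
      by (intro convergent_add convergent_const) (simp add: summable_iff_convergent)
    moreover have "(\<Sum>k<n. g k x) + F (r 0) x = F (r n) x" for n
      unfolding g_def by (subst sum_lessThan_telescope) simp
    ultimately show ?case by simp
  qed
  define f where "f = (\<lambda>x. lim (\<lambda>k. F (r k) x))"
  have fm: "f \<in> borel_measurable M"
    unfolding f_def using L2_measurable[OF F] by (intro borel_measurable_lim_metric)
  have lim: "AE x in M. (\<lambda>k. F (r k) x) \<longlonglongrightarrow> f x"
    using conv unfolding f_def by eventually_elim (simp add: convergent_LIMSEQ_iff)
  have key: "(\<lambda>x. F n x - f x) \<in> L2 M \<and> L2_norm M (\<lambda>x. F n x - f x) \<le> (1/2)^k" if "n \<ge> N k" for n k
  proof (rule L2_Fatou[where F = "\<lambda>m x. F n x - F (r m) x"])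
    show "AE x in M. (\<lambda>m. F n x - F (r m) x) \<longlonglongrightarrow> F n x - f x"
      using lim by eventually_elim (intro tendsto_intros)
    show "\<forall>\<^sub>F m in sequentially. L2_norm M (\<lambda>x. F n x - F (r m) x) \<le> (1/2)^k"
      unfolding eventually_sequentially
    proof (intro exI allI impI)
      fix m assume "k \<le> m"
      then have "r m \<ge> N k" using monoD[OF r_mono' \<open>k \<le> m\<close>] r_ge[of k] by linarith
      then show "L2_norm M (\<lambda>x. F n x - F (r m) x) \<le> (1/2)^k" using N[OF that] by (simp add: less_imp_le)
    qed
  qed (use F fm L2_measurable[OF F] in \<open>auto intro: L2_diff\<close>)
  \<comment> \<open>Only differences with \<open>f\<close> are known to be square-integrable so far;
    \<open>f\<close> is recovered from one of them.\<close>
  have "(\<lambda>x. F (N 0) x - (F (N 0) x - f x)) \<in> L2 M"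
    using L2_diff[OF F[of "N 0"] conjunct1[OF key[of 0 "N 0"]]] by simp
  then have "f \<in> L2 M" by simp
  moreover have "(\<lambda>n. L2_norm M (\<lambda>x. F n x - f x)) \<longlonglongrightarrow> 0"
  proof (rule LIMSEQ_I)
    fix e :: real assume "e > 0"
    then obtain k where "(1/2)^k < e" using real_arch_pow_inv[of e "1/2"] by auto
    then have "\<forall>n\<ge>N k. norm (L2_norm M (\<lambda>x. F n x - f x) - 0) < e"
      using key[of k] by (auto intro: le_less_trans)
    then show "\<exists>N. \<forall>n\<ge>N. norm (L2_norm M (\<lambda>x. F n x - f x) - 0) < e" by blast
  qed
  ultimately show ?thesis by blast
qed

text \<open>By Cauchy-Schwarz. It lets the identities that define weak derivatives pass to limits,
  and is therefore stated without conjugation, like \<open>is_weak_deriv\<close>.\<close>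

lemma tendsto_integral_mult_L2:
  fixes F :: "nat \<Rightarrow> 'a \<Rightarrow> complex"
  assumes "\<And>n. F n \<in> L2 M" "f \<in> L2 M" "g \<in> L2 M"
    and lim: "(\<lambda>n. L2_norm M (\<lambda>x. F n x - f x)) \<longlonglongrightarrow> 0"
  shows "(\<lambda>n. \<integral>x. F n x * g x \<partial>M) \<longlonglongrightarrow> (\<integral>x. f x * g x \<partial>M)"
proof -
  have "(\<lambda>n. (\<integral>x. F n x * g x \<partial>M) - (\<integral>x. f x * g x \<partial>M)) \<longlonglongrightarrow> 0"
  proof (rule Lim_null_comparison)
    have "(\<integral>x. F n x * g x \<partial>M) - (\<integral>x. f x * g x \<partial>M) = (\<integral>x. (F n x - f x) * g x \<partial>M)" for n
      using assms by (subst Bochner_Integration.integral_diff[symmetric]) (auto simp: L2_integrable_mult algebra_simps)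
    then show "\<forall>\<^sub>F n in sequentially. norm ((\<integral>x. F n x * g x \<partial>M) - (\<integral>x. f x * g x \<partial>M))
        \<le> L2_norm M (\<lambda>x. F n x - f x) * L2_norm M g"
      using assms by (auto intro!: always_eventually L2_Cauchy_Schwarz L2_diff)
    show "(\<lambda>n. L2_norm M (\<lambda>x. F n x - f x) * L2_norm M g) \<longlonglongrightarrow> 0"
      using tendsto_mult[OF lim tendsto_const[of "L2_norm M g"]] by simp
  qed
  then show ?thesis by (rule LIM_zero_cancel)
qed

lemma L2_norm_eq_inner: "f \<in> L2 M \<Longrightarrow> L2_inner M f f = complex_of_real ((L2_norm M f)\<^sup>2)"
  unfolding L2_inner_def L2_norm_power2 by (simp add: complex_norm_square[symmetric] del: of_real_power)

section \<open>Operator semigroups on real Hilbert spaces\<close>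

subsection \<open>The Banach algebra of bounded operators\<close>

text \<open>The wrapper lets composition be the multiplication, so the exponential series and its
  calculus in Banach algebras apply to bounded operators.\<close>

typedef (overloaded) 'a endo = "UNIV :: ('a::real_normed_vector \<Rightarrow>\<^sub>L 'a) set"
  morphisms blinfun_of_endo Endo by simp

setup_lifting type_definition_endo

lift_definition endo_apply :: "'a::real_normed_vector endo \<Rightarrow> 'a \<Rightarrow> 'a" is blinfun_apply .

instantiation endo :: (real_normed_vector) real_vector
begin

lift_definition zero_endo :: "'a endo" is 0 .
lift_definition plus_endo :: "'a endo \<Rightarrow> 'a endo \<Rightarrow> 'a endo" is "(+)" .
lift_definition minus_endo :: "'a endo \<Rightarrow> 'a endo \<Rightarrow> 'a endo" is "(-)" .
lift_definition uminus_endo :: "'a endo \<Rightarrow> 'a endo" is uminus .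
lift_definition scaleR_endo :: "real \<Rightarrow> 'a endo \<Rightarrow> 'a endo" is scaleR .

instance by standard (transfer; simp add: algebra_simps)+

end

instantiation endo :: (real_normed_vector) real_normed_vector
begin

lift_definition norm_endo :: "'a endo \<Rightarrow> real" is norm .
definition dist_endo :: "'a endo \<Rightarrow> 'a endo \<Rightarrow> real" where "dist_endo S T = norm (S - T)"
definition sgn_endo :: "'a endo \<Rightarrow> 'a endo" where "sgn_endo T = T /\<^sub>R norm T"
definition uniformity_endo :: "('a endo \<times> 'a endo) filter" where
  "uniformity_endo = (INF e\<in>{0<..}. principal {(S, T). dist S T < e})"
definition open_endo :: "'a endo set \<Rightarrow> bool" where
  "open_endo U \<longleftrightarrow> (\<forall>S\<in>U. \<forall>\<^sub>F (S', T) in uniformity. S' = S \<longrightarrow> T \<in> U)"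

instance
proof
  fix S T :: "'a endo" and U :: "'a endo set" and c :: real
  show "norm S = 0 \<longleftrightarrow> S = 0" by transfer simp
  show "norm (S + T) \<le> norm S + norm T" by transfer (rule norm_triangle_ineq)
  show "norm (c *\<^sub>R S) = \<bar>c\<bar> * norm S" by transfer simp
qed (simp_all add: dist_endo_def sgn_endo_def uniformity_endo_def open_endo_def)

end

instance endo :: (banach) banach
proof
  fix X :: "nat \<Rightarrow> 'a endo" assume "Cauchy X"
  then have "Cauchy (\<lambda>n. blinfun_of_endo (X n))"
    by (simp add: Cauchy_def dist_norm norm_endo.rep_eq minus_endo.rep_eq)
  then obtain L where "(\<lambda>n. blinfun_of_endo (X n)) \<longlonglongrightarrow> L"
    using convergent_eq_Cauchy by blast
  then have "X \<longlonglongrightarrow> Endo L"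
    by (simp add: LIMSEQ_def dist_norm norm_endo.rep_eq minus_endo.rep_eq Endo_inverse)
  then show "convergent X" by (rule convergentI)
qed

text \<open>The sort \<open>perfect_space\<close> excludes the zero space, on which 0 and 1 would
  coincide.\<close>

instantiation endo :: ("{real_normed_vector, perfect_space}") real_normed_algebra_1
begin

lift_definition one_endo :: "'a endo" is id_blinfun .
lift_definition times_endo :: "'a endo \<Rightarrow> 'a endo \<Rightarrow> 'a endo" is "(o\<^sub>L)" .

instance
proof
  fix S T U :: "'a endo" and c :: real
  show "S * T * U = S * (T * U)" by transfer (rule blinfun_eqI, simp)
  show "1 * S = S" by transfer (rule blinfun_eqI, simp)
  show "S * 1 = S" by transfer (rule blinfun_eqI, simp)
  show "(S + T) * U = S * U + T * U" by transfer (rule blinfun_eqI, simp add: plus_blinfun.rep_eq)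
  show "S * (T + U) = S * T + S * U"
    by transfer (rule blinfun_eqI, simp add: plus_blinfun.rep_eq blinfun.add_right)
  show "c *\<^sub>R S * T = c *\<^sub>R (S * T)" by transfer (rule blinfun_eqI, simp add: scaleR_blinfun.rep_eq)
  show "S * c *\<^sub>R T = c *\<^sub>R (S * T)"
    by transfer (rule blinfun_eqI, simp add: scaleR_blinfun.rep_eq blinfun.scaleR_right)
  show "norm (S * T) \<le> norm S * norm T" by transfer (rule norm_blinfun_compose)
  show norm1: "norm (1 :: 'a endo) = 1" by transfer simp
  show "(0 :: 'a endo) \<noteq> 1" by (metis norm1 norm_zero zero_neq_one)
qed

end

lemma endo_apply_add: "endo_apply (S + T) x = endo_apply S x + endo_apply T x"
  by transfer (simp add: plus_blinfun.rep_eq)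

lemma endo_apply_diff: "endo_apply (S - T) x = endo_apply S x - endo_apply T x"
  by transfer (simp add: minus_blinfun.rep_eq)

lemma endo_apply_scaleR: "endo_apply (c *\<^sub>R T) x = c *\<^sub>R endo_apply T x"
  by transfer (simp add: scaleR_blinfun.rep_eq)

lemma endo_apply_mult: "endo_apply (S * T) x = endo_apply S (endo_apply T x)"
  by transfer simp

lemma endo_apply_zero: "endo_apply 0 x = 0"
  by transfer simp

lemma endo_apply_one [simp]: "endo_apply 1 x = x"
  by transfer simp

lemma norm_endo_apply: "norm (endo_apply T x) \<le> norm T * norm x"
  by transfer (rule norm_blinfun)

lemma norm_endo_bound:
  "0 \<le> b \<Longrightarrow> (\<And>x. norm (endo_apply T x) \<le> b * norm x) \<Longrightarrow> norm T \<le> b"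
  by transfer (rule norm_blinfun_bound)

lemma endo_eqI: "(\<And>x. endo_apply S x = endo_apply T x) \<Longrightarrow> S = T"
  by transfer (rule blinfun_eqI)

lemma bounded_linear_endo_apply_right: "bounded_linear (endo_apply T)"
  by transfer (rule blinfun.bounded_linear_right)

lemma bounded_linear_endo_apply_left: "bounded_linear (\<lambda>T. endo_apply T x)"
  by (rule bounded_linear_intro[where K = "norm x"])
    (simp_all add: endo_apply_add endo_apply_scaleR norm_endo_apply)

lemma endo_apply_Endo: "bounded_linear f \<Longrightarrow> endo_apply (Endo (Blinfun f)) = f"
  by (simp add: endo_apply.rep_eq Endo_inverse bounded_linear_Blinfun_apply)

text \<open>The scalar part commutes and splits off: exp(-c) cancels the bound exp(c) for the
  exponential of c J. For Yosida approximants c grows without bound, and this is what keeps their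
  exponentials contractive.\<close>

lemma norm_exp_bounded_minus_one:
  fixes J :: "'a::{banach, perfect_space} endo"
  assumes "norm J \<le> 1" "c \<ge> 0"
  shows "norm (exp (c *\<^sub>R (J - 1))) \<le> 1"
proof -
  have "exp (c *\<^sub>R (J - 1)) = exp (c *\<^sub>R J + - c *\<^sub>R 1)" by (simp add: algebra_simps)
  also have "\<dots> = exp (c *\<^sub>R J) * exp (- c *\<^sub>R 1)" by (rule exp_add_commuting) simp
  also have "exp (- c *\<^sub>R (1 :: 'a endo)) = exp (- c) *\<^sub>R 1"
    by (metis exp_of_real of_real_def)
  finally have "norm (exp (c *\<^sub>R (J - 1))) = exp (- c) * norm (exp (c *\<^sub>R J))" by simp
  also have "\<dots> \<le> exp (- c) * exp c"
  proof (intro mult_left_mono order_trans[OF norm_exp])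
    show "exp (norm (c *\<^sub>R J)) \<le> exp c" using assms by (simp add: mult_left_le)
  qed simp
  also have "\<dots> = 1" by (simp add: exp_minus)
  finally show ?thesis .
qed

text \<open>The path s -> exp(s B + (t - s) D) x joins the two sides, and its derivative is a
  contraction applied to (B - D) x. Only the action of B - D on the single vector x enters, which is
  decisive for approximants that are unbounded in norm.\<close>

lemma endo_exp_estimate:
  fixes B D :: "'a::{banach, perfect_space} endo"
  assumes comm: "B * D = D * B" and "t \<ge> 0"
    and contr: "\<And>s. 0 \<le> s \<Longrightarrow> s \<le> t \<Longrightarrow> norm (exp (s *\<^sub>R B + (t - s) *\<^sub>R D)) \<le> 1"
  shows "norm (endo_apply (exp (t *\<^sub>R B)) x - endo_apply (exp (t *\<^sub>R D)) x)
    \<le> t * norm (endo_apply B x - endo_apply D x)"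
proof -
  define f where "f = (\<lambda>s. endo_apply (exp (t *\<^sub>R D)) (endo_apply (exp (s *\<^sub>R (B - D))) x))"
  define f' where
    "f' = (\<lambda>s. endo_apply (exp (t *\<^sub>R D)) (endo_apply (exp (s *\<^sub>R (B - D)) * (B - D)) x))"
  have "(f has_vector_derivative f' s) (at s within {0..t})" for s
    unfolding f_def f'_def
    by (intro bounded_linear.has_vector_derivative[OF bounded_linear_endo_apply_right]
        bounded_linear.has_vector_derivative[OF bounded_linear_endo_apply_left]
        exp_scaleR_has_vector_derivative_right)
  then have "norm (f t - f 0) \<le> norm (endo_apply (B - D) x) * norm (t - 0)"
  proof (intro differentiable_bound[of "{0..t}" f "\<lambda>s h. h *\<^sub>R f' s"])
    fix s assume s: "s \<in> {0..t}"
    have "exp (t *\<^sub>R D) * exp (s *\<^sub>R (B - D)) = exp (t *\<^sub>R D + s *\<^sub>R (B - D))"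
      using comm by (intro exp_add_commuting[symmetric]) (simp add: algebra_simps)
    also have "t *\<^sub>R D + s *\<^sub>R (B - D) = s *\<^sub>R B + (t - s) *\<^sub>R D" by (simp add: algebra_simps)
    finally have "f' s = endo_apply (exp (s *\<^sub>R B + (t - s) *\<^sub>R D)) (endo_apply (B - D) x)"
      unfolding f'_def by (simp flip: endo_apply_mult mult.assoc)
    then have "norm (f' s) \<le> norm (exp (s *\<^sub>R B + (t - s) *\<^sub>R D)) * norm (endo_apply (B - D) x)"
      by (simp add: norm_endo_apply)
    also have "\<dots> \<le> norm (endo_apply (B - D) x)"
      using contr[of s] s by (simp add: mult_left_le_one_le)
    finally show "onorm (\<lambda>h. h *\<^sub>R f' s) \<le> norm (endo_apply (B - D) x)"
      by (simp add: onorm_scaleR_left[OF bounded_linear_ident] onorm_id)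
  qed (use \<open>t \<ge> 0\<close> in \<open>auto simp: has_vector_derivative_def\<close>)
  moreover have "f t = endo_apply (exp (t *\<^sub>R B)) x"
  proof -
    have "exp (t *\<^sub>R D) * exp (t *\<^sub>R (B - D)) = exp (t *\<^sub>R D + t *\<^sub>R (B - D))"
      using comm by (intro exp_add_commuting[symmetric]) (simp add: algebra_simps)
    then show ?thesis unfolding f_def by (simp flip: endo_apply_mult add: algebra_simps)
  qed
  ultimately show ?thesis
    using \<open>t \<ge> 0\<close> unfolding f_def by (simp add: endo_apply_diff mult.commute)
qed

text \<open>Mean value inequality for the orbit minus its linear part: the hypothesis bounds how far
  the derivative moves away from its initial value.\<close>

lemma endo_exp_derivative_estimate:
  fixes B :: "'a::{banach, perfect_space} endo"
  assumes "t \<ge> 0"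
    and "\<And>s. 0 \<le> s \<Longrightarrow> s \<le> t \<Longrightarrow> norm (endo_apply (exp (s *\<^sub>R B)) (endo_apply B x) - endo_apply B x) \<le> K"
  shows "norm (endo_apply (exp (t *\<^sub>R B)) x - x - t *\<^sub>R endo_apply B x) \<le> t * K"
proof -
  have "norm (endo_apply (exp (t *\<^sub>R B)) x - endo_apply (exp (0 *\<^sub>R B)) x
      - (t - 0) *\<^sub>R endo_apply (exp (0 *\<^sub>R B) * B) x) \<le> norm (t - 0) * K"
  proof (rule vector_differentiable_bound_linearization[where S = "{0..t}"])
    show "((\<lambda>s. endo_apply (exp (s *\<^sub>R B)) x) has_vector_derivative endo_apply (exp (s *\<^sub>R B) * B) x)
        (at s within {0..t})" for s
      by (intro bounded_linear.has_vector_derivative[OF bounded_linear_endo_apply_left]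
          exp_scaleR_has_vector_derivative_right)
  qed (use assms in \<open>auto simp: endo_apply_mult closed_segment_eq_real_ivl\<close>)
  then show ?thesis using assms(1) by simp
qed

subsection \<open>Uniform boundedness\<close>

text \<open>The closed sets of points at which all operators are bounded by k cover the space, so by
  Baire one of them contains a ball; subtracting its centre costs the factor 2.\<close>

lemma uniform_boundedness:
  fixes T :: "nat \<Rightarrow> 'a::banach \<Rightarrow> 'b::real_normed_vector"
  assumes lin: "\<And>n. bounded_linear (T n)" and bdd: "\<And>x. \<exists>C. \<forall>n. norm (T n x) \<le> C"
  shows "\<exists>C. \<forall>n x. norm (T n x) \<le> C * norm x"
proof -
  define F where "F = (\<lambda>k::nat. {x. \<forall>n. norm (T n x) \<le> real k})"
  have "F k = (\<Inter>n. {x. norm (T n x) \<le> real k})" for k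
    by (auto simp: F_def)
  moreover have "closed {x. norm (T n x) \<le> real k}" for n k
    using bounded_linear.continuous_on[OF lin continuous_on_id]
    by (intro closed_Collect_le continuous_intros) auto
  ultimately have clF: "closed (F k)" for k by (simp add: closed_INT)
  have "(\<Union>k. F k) = UNIV"
  proof -
    have "\<exists>k. x \<in> F k" for x
    proof -
      obtain C where "\<forall>n. norm (T n x) \<le> C" using bdd by blast
      moreover obtain k :: nat where "C \<le> real k" using real_arch_simple by blast
      ultimately show ?thesis unfolding F_def by (auto intro: order_trans)
    qed
    then show ?thesis by blast
  qed
  moreover have "interior (\<Union>(range F)) = {}" if "\<And>k. interior (F k) = {}"
  proof -
    have "(euclidean :: 'a topology) interior_of \<Union>(range F) = {}"
      by (rule Baire_category_alt) (use that clF completely_metrizable_space_euclidean in auto)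
    then show ?thesis by simp
  qed
  ultimately obtain k where "interior (F k) \<noteq> {}" by (metis UNIV_not_empty interior_UNIV)
  then obtain x e where e: "e > 0" "cball x e \<subseteq> F k"
    using mem_interior_cball[of _ "F k"] by blast
  have "norm (T n y) \<le> (2 * real k / e) * norm y" for n y
  proof (cases "y = 0")
    case True
    then show ?thesis using bounded_linear.linear[OF lin] by (simp add: linear_0)
  next
    case False
    interpret T: bounded_linear "T n" by (rule lin)
    define z where "z = (e / norm y) *\<^sub>R y"
    have "norm z = e" using False e by (simp add: z_def)
    then have "x + z \<in> F k" "x \<in> F k" using e by (auto simp: dist_norm subset_eq)
    then have "norm (T n (x + z)) \<le> k" "norm (T n x) \<le> k" by (auto simp: F_def)
    then have "norm (T n z) \<le> 2 * k"
      using norm_triangle_ineq4[of "T n (x + z)" "T n x"] by (simp add: T.add)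
    then show ?thesis
      using e False by (simp add: z_def T.scaleR field_simps)
  qed
  then show ?thesis by blast
qed

subsection \<open>Closed forms\<close>

text \<open>The discriminant condition, used twice below: for the Cauchy-Schwarz inequality of a
  form, and with a = 1/(n + 1) for the approximate Euler equation along a minimizing
  sequence.\<close>

lemma quadratic_nonneg_imp:
  fixes a b c :: real
  assumes "\<And>t. 0 \<le> a + 2 * t * b + t\<^sup>2 * c" "c \<ge> 0"
  shows "b\<^sup>2 \<le> a * c"
proof (cases "c = 0")
  case True
  have "b = 0"
  proof (rule ccontr)
    assume "b \<noteq> 0"
    \<comment> \<open>For c = 0 the expression is affine in t, and this t gives it the value
      -1.\<close>
    then have "a + 2 * (- (a + 1) / (2 * b)) * b = -1" by (simp add: field_simps)
    then show False using assms(1)[of "- (a + 1) / (2 * b)"] True by simp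
  qed
  then show ?thesis using True by simp
next
  case False
  have "0 \<le> (a + 2 * (- b / c) * b + (- b / c)\<^sup>2 * c) * c"
    using assms(1)[of "- b / c"] assms(2) by (rule mult_nonneg_nonneg)
  also have "\<dots> = a * c - b\<^sup>2" using False by (simp add: field_simps power2_eq_square)
  finally show ?thesis by simp
qed

lemma tendsto_diff_power2_zero:
  fixes a :: "nat \<Rightarrow> real"
  assumes "(\<lambda>n. (a n - b)\<^sup>2) \<longlonglongrightarrow> 0"
  shows "a \<longlonglongrightarrow> b"
proof -
  have "(\<lambda>n. \<bar>a n - b\<bar>) \<longlonglongrightarrow> 0"
    using tendsto_real_sqrt[OF assms] by simp
  then show ?thesis by (simp add: tendsto_rabs_zero_iff LIM_zero_iff)
qed

text \<open>Closedness appears as completeness of \<open>V\<close> in the form norm, so that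
  \<open>V\<close> need not become a space of its own. The form is real; complex forms enter through
  their real parts.\<close>

locale hilbert_form =
  fixes V :: "'h::{real_inner, complete_space} set" and q :: "'h \<Rightarrow> 'h \<Rightarrow> real"
  assumes subspace: "subspace V"
    and q_add: "x \<in> V \<Longrightarrow> y \<in> V \<Longrightarrow> z \<in> V \<Longrightarrow> q (x + y) z = q x z + q y z"
    and q_scale: "x \<in> V \<Longrightarrow> z \<in> V \<Longrightarrow> q (c *\<^sub>R x) z = c * q x z"
    and q_commute: "x \<in> V \<Longrightarrow> y \<in> V \<Longrightarrow> q x y = q y x"
    and q_nonneg: "x \<in> V \<Longrightarrow> 0 \<le> q x x"
    and form_complete: "(\<And>n::nat. X n \<in> V) \<Longrightarrow>
      (\<And>e. e > 0 \<Longrightarrow> \<exists>N. \<forall>m\<ge>N. \<forall>n\<ge>N. (norm (X m - X n))\<^sup>2 + q (X m - X n) (X m - X n) < e) \<Longrightarrow>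
      \<exists>x\<in>V. (\<lambda>n. (norm (X n - x))\<^sup>2 + q (X n - x) (X n - x)) \<longlonglongrightarrow> 0"
begin

text \<open>The direct method for Q(x) = B(x, x) - 2 <f, x>, where B(x, y) = <x, y> + l q(x, y): a
  minimizing sequence is Cauchy in the form norm, and its limit solves the Euler equation, which is
  the weak form of (1 - l A) u = f.\<close>

lemma form_minimizer:
  assumes l: "l > 0"
  shows "\<exists>u\<in>V. \<forall>g\<in>V. inner u g + l * q u g = inner f g"
proof -
  define B where "B = (\<lambda>x y. inner x y + l * q x y)"
  have V_add: "x + y \<in> V" if "x \<in> V" "y \<in> V" for x y using subspace that by (rule subspace_add)
  have V_diff: "x - y \<in> V" if "x \<in> V" "y \<in> V" for x y using subspace that by (rule subspace_diff)
  have V_sc: "c *\<^sub>R x \<in> V" if "x \<in> V" for c x using subspace that by (rule subspace_scale)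
  have B_add: "B (x + y) z = B x z + B y z" if "x \<in> V" "y \<in> V" "z \<in> V" for x y z
    using that by (simp add: B_def q_add inner_add_left algebra_simps)
  have B_sc: "B (c *\<^sub>R x) z = c * B x z" if "x \<in> V" "z \<in> V" for c x z
    using that by (simp add: B_def q_scale algebra_simps)
  have B_comm: "B x y = B y x" if "x \<in> V" "y \<in> V" for x y
    using that by (simp add: B_def q_commute inner_commute)
  have B_diff: "B (x - y) z = B x z - B y z" if "x \<in> V" "y \<in> V" "z \<in> V" for x y z
    using B_add[of x "(-1) *\<^sub>R y" z] B_sc[of y z "-1"] V_sc[of y "-1"] that by simp
  have B_expand: "B (x + t *\<^sub>R y) (x + t *\<^sub>R y) = B x x + 2 * t * B x y + t\<^sup>2 * B y y"
    if xy: "x \<in> V" "y \<in> V" for x y t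
  proof -
    define z where "z = x + t *\<^sub>R y"
    have z: "z \<in> V" unfolding z_def by (intro V_add V_sc xy)
    have zl: "B z w = B x w + t * B y w" if "w \<in> V" for w
      unfolding z_def using xy that by (simp add: B_add B_sc V_sc)
    have "B z z = B z x + t * B z y" using zl[OF z] B_comm[OF z] xy by simp
    also have "\<dots> = B x x + 2 * t * B x y + t\<^sup>2 * B y y"
      using zl[OF xy(1)] zl[OF xy(2)] B_comm[OF xy] by (simp add: power2_eq_square algebra_simps)
    finally show ?thesis by (simp add: z_def)
  qed
  have B_ge: "(norm x)\<^sup>2 \<le> B x x" if "x \<in> V" for x
    using q_nonneg[OF that] l by (simp add: B_def power2_norm_eq_inner)
  have B_nonneg: "0 \<le> B x x" if "x \<in> V" for x
    using order_trans[OF zero_le_power2 B_ge[OF that]] .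
  have B_CS: "(B x y)\<^sup>2 \<le> B x x * B y y" if "x \<in> V" "y \<in> V" for x y
  proof (rule quadratic_nonneg_imp)
    show "0 \<le> B x x + 2 * t * B x y + t\<^sup>2 * B y y" for t
      using B_nonneg[OF V_add[OF that(1) V_sc[OF that(2)]], of t] B_expand[OF that] by simp
  qed (rule B_nonneg[OF that(2)])
  define Q where "Q = (\<lambda>x. B x x - 2 * inner f x)"
  have Q_lower: "- (norm f)\<^sup>2 \<le> Q x" if "x \<in> V" for x
  proof -
    have "inner f x \<le> norm f * norm x" by (rule norm_cauchy_schwarz)
    moreover have "2 * (norm f * norm x) \<le> (norm f)\<^sup>2 + (norm x)\<^sup>2"
      using sum_squares_bound[of "norm f" "norm x"] by simp
    ultimately show ?thesis using B_ge[OF that] unfolding Q_def by linarith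
  qed
  have bb: "bdd_below (Q ` V)" using Q_lower by (intro bdd_belowI2)
  define m where "m = Inf (Q ` V)"
  have V0: "0 \<in> V" using subspace by (rule subspace_0)
  have m_le: "m \<le> Q x" if "x \<in> V" for x
    unfolding m_def using bb that by (intro cInf_lower) auto
  have "\<exists>x\<in>V. Q x < m + 1 / real (Suc n)" for n
    using cInf_lessD[of "Q ` V" "m + 1 / real (Suc n)"] V0 unfolding m_def by force
  then obtain X where X: "\<And>n. X n \<in> V" "\<And>n. Q (X n) < m + 1 / real (Suc n)" by metis
  \<comment> \<open>The parallelogram law: the midpoint cannot fall below the infimum, so two
    near-minimizers are close in B.\<close>
  have cau: "B (X i - X j) (X i - X j) \<le> 2 / real (Suc i) + 2 / real (Suc j)" for i j
  proof -
    define z where "z = (1/2) *\<^sub>R (X i + X j)"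
    have z: "z \<in> V" unfolding z_def by (intro V_sc V_add X)
    have "B (X i - X j) (X i - X j) = B (X i) (X i) + B (X j) (X j) - 2 * B (X i) (X j)"
      using B_expand[of "X i" "X j" "-1"] X by simp
    moreover have "4 * B z z = B (X i) (X i) + B (X j) (X j) + 2 * B (X i) (X j)"
    proof -
      have w: "X i + X j \<in> V" by (intro V_add X)
      have "B z z = (1/2) * B (X i + X j) z" using B_sc[OF w z] by (simp add: z_def)
      also have "B (X i + X j) z = (1/2) * B (X i + X j) (X i + X j)"
        using B_comm[OF w z] B_sc[OF w w] by (simp add: z_def)
      finally show ?thesis using B_expand[of "X i" "X j" 1] X by simp
    qed
    moreover have "inner f z = (inner f (X i) + inner f (X j)) / 2"
      unfolding z_def by (simp add: inner_add_right)
    ultimately have "B (X i - X j) (X i - X j) = 2 * Q (X i) + 2 * Q (X j) - 4 * Q z"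
      unfolding Q_def by simp
    then show ?thesis using X(2)[of i] X(2)[of j] m_le[OF z] by linarith
  qed
  \<comment> \<open>\<open>B\<close> and the form norm are equivalent; this is the constant in the
    direction that transports the Cauchy property to the form norm.\<close>
  define c where "c = min 1 l"
  have c: "c > 0" using l by (simp add: c_def)
  have form_le: "(norm x)\<^sup>2 + q x x \<le> B x x / c" if "x \<in> V" for x
  proof -
    have "c \<le> 1" "c \<le> l" by (simp_all add: c_def)
    then have "c * (norm x)\<^sup>2 \<le> 1 * (norm x)\<^sup>2" "c * q x x \<le> l * q x x"
      using q_nonneg[OF that] by (intro mult_right_mono; simp)+
    then have "c * ((norm x)\<^sup>2 + q x x) \<le> B x x"
      unfolding B_def power2_norm_eq_inner by (simp add: algebra_simps)
    then show ?thesis using c by (simp add: field_simps)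
  qed
  have "\<exists>u\<in>V. (\<lambda>n. (norm (X n - u))\<^sup>2 + q (X n - u) (X n - u)) \<longlonglongrightarrow> 0"
  proof (rule form_complete)
    fix e :: real assume "e > 0"
    then have "e * c / 4 > 0" using c by simp
    then obtain N where N: "1 / real (Suc N) < e * c / 4" using reals_Archimedean[of "e * c / 4"]
      by (auto simp: inverse_eq_divide)
    have "(norm (X i - X j))\<^sup>2 + q (X i - X j) (X i - X j) < e" if "i \<ge> N" "j \<ge> N" for i j
    proof -
      have "1 / real (Suc i) \<le> 1 / real (Suc N)" "1 / real (Suc j) \<le> 1 / real (Suc N)"
        using that by (auto simp: field_simps)
      then have "B (X i - X j) (X i - X j) < e * c"
        using cau[of i j] N by linarith
      then have "B (X i - X j) (X i - X j) / c < e" using c by (simp add: field_simps)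
      then show ?thesis using form_le[of "X i - X j"] X V_diff by fastforce
    qed
    then show "\<exists>N. \<forall>m\<ge>N. \<forall>n\<ge>N. (norm (X m - X n))\<^sup>2 + q (X m - X n) (X m - X n) < e" by blast
  qed (rule X)
  then obtain u where u: "u \<in> V" "(\<lambda>n. (norm (X n - u))\<^sup>2 + q (X n - u) (X n - u)) \<longlonglongrightarrow> 0" by blast
  have "B u g = inner f g" if g: "g \<in> V" for g
  proof -
    \<comment> \<open>Moving from \<open>X n\<close> by any multiple t of g lowers Q by less than
      1/(n + 1). This is a quadratic inequality in t, whose discriminant bounds the defect in the
      Euler equation.\<close>
    have 1: "(B (X n) g - inner f g)\<^sup>2 \<le> (1 / real (Suc n)) * B g g" for n
    proof (rule quadratic_nonneg_imp)
      fix t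
      have "m \<le> Q (X n + t *\<^sub>R g)" using X g by (intro m_le V_add V_sc)
      also have "\<dots> = Q (X n) + 2 * t * (B (X n) g - inner f g) + t\<^sup>2 * B g g"
        unfolding Q_def using B_expand[of "X n" g t] X g by (simp add: inner_add_right algebra_simps)
      finally show "0 \<le> 1 / real (Suc n) + 2 * t * (B (X n) g - inner f g) + t\<^sup>2 * B g g"
        using X(2)[of n] by linarith
    qed (rule B_nonneg[OF g])
    have "(\<lambda>n. (1 / real (Suc n)) * B g g) \<longlonglongrightarrow> 0"
      using tendsto_mult[OF LIMSEQ_Suc[OF lim_1_over_n] tendsto_const[of "B g g"]] by simp
    then have "(\<lambda>n. (B (X n) g - inner f g)\<^sup>2) \<longlonglongrightarrow> 0"
      by (rule tendsto_sandwich[OF _ _ tendsto_const, rotated -1]) (use 1 in auto)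
    then have lim1: "(\<lambda>n. B (X n) g) \<longlonglongrightarrow> inner f g"
      by (rule tendsto_diff_power2_zero)
    have 2: "(B (X n) g - B u g)\<^sup>2 \<le> (1 + l) * ((norm (X n - u))\<^sup>2 + q (X n - u) (X n - u)) * B g g" for n
    proof -
      have "(B (X n) g - B u g)\<^sup>2 \<le> B (X n - u) (X n - u) * B g g"
        using B_CS[of "X n - u" g] X u g by (simp add: B_diff V_diff)
      also have "\<dots> \<le> ((1 + l) * ((norm (X n - u))\<^sup>2 + q (X n - u) (X n - u))) * B g g"
      proof (rule mult_right_mono)
        have "0 \<le> q (X n - u) (X n - u)" using X u by (intro q_nonneg V_diff)
        then have "0 \<le> q (X n - u) (X n - u) + l * (norm (X n - u))\<^sup>2" using l by simp
        then show "B (X n - u) (X n - u) \<le> (1 + l) * ((norm (X n - u))\<^sup>2 + q (X n - u) (X n - u))"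
          unfolding B_def power2_norm_eq_inner[symmetric] by (simp add: distrib_left distrib_right)
      qed (rule B_nonneg[OF g])
      finally show ?thesis .
    qed
    have "(\<lambda>n. (1 + l) * ((norm (X n - u))\<^sup>2 + q (X n - u) (X n - u)) * B g g) \<longlonglongrightarrow> (1 + l) * 0 * B g g"
      by (intro tendsto_intros u)
    then have "(\<lambda>n. (B (X n) g - B u g)\<^sup>2) \<longlonglongrightarrow> 0"
      by (intro tendsto_sandwich[OF _ _ tendsto_const[of 0], of "\<lambda>n. (B (X n) g - B u g)\<^sup>2"
          _ "\<lambda>n. (1 + l) * ((norm (X n - u))\<^sup>2 + q (X n - u) (X n - u)) * B g g"]) (use 2 in auto)
    then have lim2: "(\<lambda>n. B (X n) g) \<longlonglongrightarrow> B u g"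
      by (rule tendsto_diff_power2_zero)
    show ?thesis by (rule LIMSEQ_unique[OF lim2 lim1])
  qed
  then show ?thesis using u unfolding B_def by blast
qed

end

subsection \<open>Strongly continuous semigroups\<close>

definition semigroup_C0 :: "(real \<Rightarrow> 'h::real_normed_vector \<Rightarrow> 'h) \<Rightarrow> bool" where
  "semigroup_C0 U \<longleftrightarrow>
     (\<forall>t\<ge>0. bounded_linear (U t)) \<and> (\<forall>x. U 0 x = x) \<and>
     (\<forall>s\<ge>0. \<forall>t\<ge>0. \<forall>x. U (s + t) x = U s (U t x)) \<and>
     (\<forall>x. ((\<lambda>t. U t x) \<longlongrightarrow> x) (at_right 0))"

definition semigroup_generator :: "(real \<Rightarrow> 'h::real_normed_vector \<Rightarrow> 'h) \<Rightarrow> ('h \<times> 'h) set" where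
  "semigroup_generator U = {(f, h). ((\<lambda>t. (U t f - f) /\<^sub>R t) \<longlongrightarrow> h) (at_right 0)}"

lemma at_right_0_iff:
  "(\<forall>\<^sub>F t in at_right (0::real). P t) \<longleftrightarrow> (\<exists>d>0. \<forall>t. 0 < t \<and> t < d \<longrightarrow> P t)"
  by (auto simp: eventually_at_right_field)

text \<open>If the norms were unbounded near 0, some times tau_n -> 0 would have U(tau_n) of norm
  above n; but the vectors U(tau_n) x converge to x, which contradicts uniform boundedness. Longer
  times are cut into equal short steps.\<close>

lemma semigroup_C0_locally_bounded:
  fixes U :: "real \<Rightarrow> 'h::banach \<Rightarrow> 'h"
  assumes U: "semigroup_C0 U"
  shows "\<exists>C\<ge>0. \<forall>t. 0 \<le> t \<and> t \<le> T \<longrightarrow> (\<forall>x. norm (U t x) \<le> C * norm x)"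
proof -
  have lin: "bounded_linear (U t)" if "t \<ge> 0" for t using U that by (simp add: semigroup_C0_def)
  have sg: "U (s + t) x = U s (U t x)" if "s \<ge> 0" "t \<ge> 0" for s t x
    using U that by (simp add: semigroup_C0_def)
  have lim: "((\<lambda>t. U t x) \<longlongrightarrow> x) (at_right 0)" for x using U by (simp add: semigroup_C0_def)
  have "\<exists>d>0. \<exists>C. \<forall>t. 0 < t \<and> t < d \<longrightarrow> (\<forall>x. norm (U t x) \<le> C * norm x)"
  proof (rule ccontr)
    assume neg: "\<not> ?thesis"
    have "\<exists>t. 0 < t \<and> t < 1 / real (Suc n) \<and> \<not> (\<forall>x. norm (U t x) \<le> real n * norm x)" for n
    proof -
      have "0 < 1 / real (Suc n)" by simp
      then show ?thesis using neg by blast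
    qed
    then obtain \<tau> where \<tau>: "\<And>n. 0 < \<tau> n" "\<And>n. \<tau> n < 1 / real (Suc n)"
      "\<And>n. \<not> (\<forall>x. norm (U (\<tau> n) x) \<le> real n * norm x)" by metis
    have "\<tau> \<longlonglongrightarrow> 0"
      by (rule tendsto_sandwich[OF _ _ tendsto_const LIMSEQ_Suc[OF lim_1_over_n]])
        (use \<tau> in \<open>auto intro!: always_eventually less_imp_le\<close>)
    then have fl: "filterlim \<tau> (at_right 0) sequentially"
      using \<tau>(1) less_imp_neq[OF \<tau>(1)] by (auto simp: filterlim_at intro!: always_eventually)
    have "\<exists>C. \<forall>n x. norm (U (\<tau> n) x) \<le> C * norm x"
    proof (rule uniform_boundedness)
      show "bounded_linear (U (\<tau> n))" for n using \<tau>(1)[of n] by (intro lin) simp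
      fix x
      have "(\<lambda>n. U (\<tau> n) x) \<longlonglongrightarrow> x" by (rule filterlim_compose[OF lim fl])
      then have "Bseq (\<lambda>n. U (\<tau> n) x)" by (intro convergent_imp_Bseq convergentI)
      then show "\<exists>C. \<forall>n. norm (U (\<tau> n) x) \<le> C" by (auto simp: Bseq_def)
    qed
    then obtain C where C: "\<And>n x. norm (U (\<tau> n) x) \<le> C * norm x" by blast
    obtain n :: nat where n: "C \<le> real n" using real_arch_simple by blast
    have "norm (U (\<tau> n) x) \<le> real n * norm x" for x
      using C[of n x] mult_right_mono[OF n norm_ge_zero[of x]] by linarith
    then show False using \<tau>(3)[of n] by blast
  qed
  then obtain d C0 where d: "d > 0" and C0: "\<And>t x. 0 < t \<Longrightarrow> t < d \<Longrightarrow> norm (U t x) \<le> C0 * norm x"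
    by blast
  define C where "C = max 1 C0"
  have C: "norm (U t x) \<le> C * norm x" if "0 \<le> t" "t < d" for t x
  proof (cases "t = 0")
    case True
    have "1 * norm x \<le> C * norm x" by (intro mult_right_mono) (auto simp: C_def)
    then show ?thesis using U True by (simp add: semigroup_C0_def)
  next
    case False
    have "C0 * norm x \<le> C * norm x" by (intro mult_right_mono) (auto simp: C_def)
    then show ?thesis using C0[of t x] that False by linarith
  qed
  have C1: "C \<ge> 1" by (simp add: C_def)
  have step: "norm (U t x) \<le> C ^ Suc n * norm x" if "0 \<le> t" "t < real (Suc n) * d" for n t x
    using that
  proof (induction n arbitrary: t)
    case 0
    then show ?case using C by simp
  next
    case (Suc n)
    define r where "r = t / real (Suc (Suc n))"
    have r: "0 \<le> r" "r < d" using Suc.prems by (auto simp: r_def field_simps)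
    have "t = real (Suc (Suc n)) * r" by (simp add: r_def del: of_nat_Suc)
    then have t: "t = r + real (Suc n) * r" by (simp add: algebra_simps)
    have "norm (U t x) = norm (U r (U (real (Suc n) * r) x))"
      using sg[of r "real (Suc n) * r" x] r t by simp
    also have "\<dots> \<le> C * norm (U (real (Suc n) * r) x)" using r by (rule C)
    also have "\<dots> \<le> C * (C ^ Suc n * norm x)"
      using r C1 by (intro mult_left_mono Suc.IH) (auto intro!: mult_strict_left_mono)
    finally show ?case by simp
  qed
  obtain n :: nat where n: "T / d < real n" using reals_Archimedean2 by blast
  have "T < real (Suc n) * d"
    using n d by (simp add: field_simps)
  then have "\<forall>t. 0 \<le> t \<and> t \<le> T \<longrightarrow> (\<forall>x. norm (U t x) \<le> C ^ Suc n * norm x)"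
    using step[of _ n] by auto
  then show ?thesis using C1 by (intro exI[of _ "C ^ Suc n"]) auto
qed

text \<open>Right continuity at 0 gives continuity from both sides, because |U r x - U s x| <= C |U
  (r - s) x - x| for s < r with a constant that is uniform on [0, T].\<close>

lemma semigroup_C0_continuous_on:
  fixes U :: "real \<Rightarrow> 'h::banach \<Rightarrow> 'h"
  assumes U: "semigroup_C0 U"
  shows "continuous_on {0..T} (\<lambda>t. U t x)"
proof (rule continuous_onI)
  obtain C where C: "C \<ge> 0" "\<And>t x. 0 \<le> t \<Longrightarrow> t \<le> T \<Longrightarrow> norm (U t x) \<le> C * norm x"
    using semigroup_C0_locally_bounded[OF U, of T] by blast
  have lin: "bounded_linear (U t)" if "t \<ge> 0" for t using U that by (simp add: semigroup_C0_def)
  have sg: "U (s + t) x = U s (U t x)" if "s \<ge> 0" "t \<ge> 0" for s t x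
    using U that by (simp add: semigroup_C0_def)
  fix t e :: real assume t: "t \<in> {0..T}" and e: "e > 0"
  have "((\<lambda>t. U t x) \<longlongrightarrow> x) (at_right 0)" using U by (simp add: semigroup_C0_def)
  then have "\<forall>\<^sub>F t in at_right 0. dist (U t x) x < e / (C + 1)"
    using e C(1) by (intro tendstoD) auto
  then obtain d where d: "d > 0" "\<And>t. 0 < t \<Longrightarrow> t < d \<Longrightarrow> dist (U t x) x < e / (C + 1)"
    by (auto simp: at_right_0_iff)
  have main: "norm (U r x - U s x) \<le> e" if "0 \<le> s" "s < r" "r \<le> T" "r - s < d" for r s
  proof -
    interpret bounded_linear "U s" using that by (intro lin) simp
    have "U r x - U s x = U s (U (r - s) x - x)"
      using sg[of s "r - s" x] that by (simp add: diff)
    then have "norm (U r x - U s x) \<le> C * norm (U (r - s) x - x)"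
      using C(2)[of s] that by simp
    also have "\<dots> \<le> C * (e / (C + 1))"
      using d(2)[of "r - s"] that C(1) by (intro mult_left_mono) (auto simp: dist_norm)
    also have "\<dots> \<le> e" using C(1) e by (simp add: field_simps)
    finally show ?thesis .
  qed
  have "dist (U s x) (U t x) \<le> e" if "s \<in> {0..T}" "dist s t < d" for s
    using main[of s t] main[of t s] that t e
    by (cases s t rule: linorder_cases) (auto simp: dist_norm norm_minus_commute)
  then show "\<exists>d>0. \<forall>s\<in>{0..T}. dist s t < d \<longrightarrow> dist (U s x) (U t x) \<le> e"
    using d(1) by blast
qed

lemma semigroup_generator_invariant:
  assumes U: "semigroup_C0 U" and f: "(f, h) \<in> semigroup_generator U" and t: "t \<ge> 0"
  shows "(U t f, U t h) \<in> semigroup_generator U"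
proof -
  interpret bounded_linear "U t" using U t by (simp add: semigroup_C0_def)
  have lim: "((\<lambda>s. (U s f - f) /\<^sub>R s) \<longlongrightarrow> h) (at_right 0)"
    using f by (simp add: semigroup_generator_def)
  have "((\<lambda>s. U t ((U s f - f) /\<^sub>R s)) \<longlongrightarrow> U t h) (at_right 0)"
    by (rule tendsto[OF lim])
  moreover have "\<forall>\<^sub>F s in at_right 0. U t ((U s f - f) /\<^sub>R s) = (U s (U t f) - U t f) /\<^sub>R s"
  proof (rule eventually_mono[OF eventually_at_right_less])
    fix s :: real assume "0 < s"
    then have "U s (U t f) = U t (U s f)"
      using U t unfolding semigroup_C0_def by (metis add.commute less_imp_le)
    then show "U t ((U s f - f) /\<^sub>R s) = (U s (U t f) - U t f) /\<^sub>R s"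
      by (simp add: scaleR diff)
  qed
  ultimately show ?thesis
    unfolding semigroup_generator_def by (auto elim: Lim_transform_eventually)
qed

text \<open>A generator only yields derivatives from the right, so the mean value theorem is
  replaced by a supremum argument with an extra slope e > 0, which is sent to 0 at the end.\<close>

lemma nonincreasing_of_right_derivative:
  fixes \<phi> :: "real \<Rightarrow> real"
  assumes cont: "continuous_on {0..T} \<phi>" and "T \<ge> 0"
    and right: "\<And>t e. 0 \<le> t \<Longrightarrow> t < T \<Longrightarrow> e > 0 \<Longrightarrow> \<exists>d>0. \<forall>h. 0 < h \<and> h < d \<longrightarrow> \<phi> (t + h) \<le> \<phi> t + e * h"
  shows "\<phi> T \<le> \<phi> 0"
proof -
  have key: "\<phi> T \<le> \<phi> 0 + e * T" if e: "e > 0" for e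
  proof -
    \<comment> \<open>Requiring the bound on all of [0, t] makes \<open>S\<close> an initial
      segment, so that a step beyond its supremum gives a contradiction.\<close>
    define S where "S = {t \<in> {0..T}. \<forall>s\<in>{0..t}. \<phi> s \<le> \<phi> 0 + e * s}"
    have S0: "0 \<in> S" using \<open>T \<ge> 0\<close> by (auto simp: S_def)
    have bS: "bdd_above S" by (intro bdd_aboveI[of _ T]) (auto simp: S_def)
    define m where "m = Sup S"
    have m: "0 \<le> m" "m \<le> T" unfolding m_def
      using S0 bS by (auto intro!: cSup_upper cSup_least simp: S_def)
    have below: "\<phi> s \<le> \<phi> 0 + e * s" if s: "0 \<le> s" "s < m" for s
    proof -
      obtain t where "t \<in> S" "s < t" using less_cSupD[of S s] S0 s(2) unfolding m_def by blast
      then show ?thesis using s(1) by (auto simp: S_def)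
    qed
    have at: "\<phi> m \<le> \<phi> 0 + e * m"
    proof (cases "m = 0")
      case False
      then have "m > 0" using m by simp
      have c: "continuous_on {0..m} \<phi>" by (rule continuous_on_subset[OF cont]) (use m in auto)
      have "continuous_on {0..m} (\<lambda>s. \<phi> s - (\<phi> 0 + e * s))" by (intro continuous_intros c)
      moreover have "closure {0..<m} = {0..m}" using \<open>m > 0\<close> by simp
      ultimately have "\<phi> m - (\<phi> 0 + e * m) \<le> 0"
        using continuous_le_on_closure[of "{0..<m}" "\<lambda>s. \<phi> s - (\<phi> 0 + e * s)" m 0] below m by auto
      then show ?thesis by simp
    qed simp
    have "\<phi> s \<le> \<phi> 0 + e * s" if "0 \<le> s" "s \<le> m" for s
      using below[of s] at that by (cases "s = m") auto
    then have mS: "m \<in> S" using m by (auto simp: S_def)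
    have "m = T"
    proof (rule ccontr)
      assume "m \<noteq> T"
      then have "m < T" using m by simp
      then obtain d where d: "d > 0" "\<And>h. 0 < h \<Longrightarrow> h < d \<Longrightarrow> \<phi> (m + h) \<le> \<phi> m + e * h"
        using right[OF m(1) _ e] by blast
      define r where "r = m + min (d / 2) (T - m)"
      have r: "m < r" "r \<le> T" "r - m < d" using d \<open>m < T\<close> by (auto simp: r_def min_def)
      have "\<phi> s \<le> \<phi> 0 + e * s" if "0 \<le> s" "s \<le> r" for s
      proof (cases "s \<le> m")
        case True
        then show ?thesis using mS that by (auto simp: S_def)
      next
        case False
        then have "\<phi> s \<le> \<phi> m + e * (s - m)" using d(2)[of "s - m"] that r by simp
        then show ?thesis using at by (simp add: algebra_simps)
      qed
      then have "r \<in> S" using r m by (auto simp: S_def)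
      then have "r \<le> m" unfolding m_def using bS by (rule cSup_upper)
      then show False using r by simp
    qed
    then show ?thesis using at by simp
  qed
  show ?thesis
  proof (rule field_le_epsilon)
    fix e :: real assume "e > 0"
    then have "\<phi> T \<le> \<phi> 0 + e / (T + 1) * T" using \<open>T \<ge> 0\<close> by (intro key) simp
    also have "e / (T + 1) * T \<le> e" using \<open>e > 0\<close> \<open>T \<ge> 0\<close> by (simp add: field_simps)
    finally show "\<phi> T \<le> \<phi> 0 + e" by simp
  qed
qed

text \<open>
  The difference of the two evolutions satisfies a dissipative evolution equation with initial
  value zero, so its norm does not increase.
\<close>

theorem semigroup_intertwining:
  fixes U1 :: "real \<Rightarrow> 'h1::banach \<Rightarrow> 'h1" and U2 :: "real \<Rightarrow> 'h2::{real_inner, banach} \<Rightarrow> 'h2"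
  assumes U1: "semigroup_C0 U1" and U2: "semigroup_C0 U2" and R: "bounded_linear R"
    and dense: "closure (Domain (semigroup_generator U1)) = UNIV"
    and RA: "\<And>f h. (f, h) \<in> semigroup_generator U1 \<Longrightarrow> (R f, R h) \<in> semigroup_generator U2"
    and diss: "\<And>f h. (f, h) \<in> semigroup_generator U2 \<Longrightarrow> inner f h \<le> 0"
    and T: "T \<ge> 0"
  shows "R (U1 T f) = U2 T (R f)"
proof -
  interpret R: bounded_linear R by (rule R)
  interpret L1: bounded_linear "U1 T" using U1 T by (simp add: semigroup_C0_def)
  interpret L2: bounded_linear "U2 T" using U2 T by (simp add: semigroup_C0_def)
  have main: "R (U1 T f) = U2 T (R f)" if fh: "(f, h) \<in> semigroup_generator U1" for f h
  proof -
    define w where "w = (\<lambda>t. R (U1 t f) - U2 t (R f))"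
    define w' where "w' = (\<lambda>t. R (U1 t h) - U2 t (R h))"
    have w_gen: "(w t, w' t) \<in> semigroup_generator U2" if t: "t \<ge> 0" for t
    proof -
      have "(R (U1 t f), R (U1 t h)) \<in> semigroup_generator U2"
        by (intro RA semigroup_generator_invariant U1 fh t)
      moreover have "(U2 t (R f), U2 t (R h)) \<in> semigroup_generator U2"
        by (intro RA semigroup_generator_invariant U2 fh t)
      ultimately have "((\<lambda>s. (U2 s (R (U1 t f)) - R (U1 t f)) /\<^sub>R s - (U2 s (U2 t (R f)) - U2 t (R f)) /\<^sub>R s)
          \<longlongrightarrow> w' t) (at_right 0)"
        unfolding semigroup_generator_def w'_def by (auto intro: tendsto_diff)
      moreover have "\<forall>\<^sub>F s in at_right 0. (U2 s (R (U1 t f)) - R (U1 t f)) /\<^sub>R s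
          - (U2 s (U2 t (R f)) - U2 t (R f)) /\<^sub>R s = (U2 s (w t) - w t) /\<^sub>R s"
      proof (rule eventually_mono[OF eventually_at_right_less])
        fix s :: real assume "0 < s"
        then interpret bounded_linear "U2 s" using U2 by (simp add: semigroup_C0_def)
        show "(U2 s (R (U1 t f)) - R (U1 t f)) /\<^sub>R s
          - (U2 s (U2 t (R f)) - U2 t (R f)) /\<^sub>R s = (U2 s (w t) - w t) /\<^sub>R s"
          by (simp add: w_def diff algebra_simps)
      qed
      ultimately show ?thesis
        unfolding semigroup_generator_def by (auto elim: Lim_transform_eventually)
    qed
    have w_step: "w (t + s) = R (U1 s (U1 t f)) - U2 s (U2 t (R f))" if "s \<ge> 0" "t \<ge> 0" for s t
      using that U1 U2 by (simp add: w_def semigroup_C0_def add.commute)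
    have right: "\<exists>d>0. \<forall>s. 0 < s \<and> s < d \<longrightarrow> (norm (w (t + s)))\<^sup>2 \<le> (norm (w t))\<^sup>2 + e * s"
      if t: "0 \<le> t" and e: "e > 0" for t e
    proof -
      have "((\<lambda>s. R ((U1 s (U1 t f) - U1 t f) /\<^sub>R s) - (U2 s (U2 t (R f)) - U2 t (R f)) /\<^sub>R s)
          \<longlongrightarrow> w' t) (at_right 0)"
        unfolding w'_def
        using semigroup_generator_invariant[OF U1 fh t] semigroup_generator_invariant[OF U2 RA[OF fh] t]
        by (intro tendsto_diff R.tendsto) (auto simp: semigroup_generator_def)
      then have lim: "((\<lambda>s. (w (t + s) - w t) /\<^sub>R s) \<longlongrightarrow> w' t) (at_right 0)"
        by (rule Lim_transform_eventually)
          (auto intro!: eventually_mono[OF eventually_at_right_less] simp: w_step t,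
            auto simp: w_def R.scaleR R.diff algebra_simps)
      \<comment> \<open>The difference quotient of the squared norm of \<open>w\<close> at t. Its
        limit is twice the inner product of \<open>w t\<close> and \<open>w' t\<close>, which
        dissipativity makes nonpositive.\<close>
      define g where "g = (\<lambda>s. 2 * inner (w t) ((w (t + s) - w t) /\<^sub>R s) + s * (norm ((w (t + s) - w t) /\<^sub>R s))\<^sup>2)"
      have "(g \<longlongrightarrow> 2 * inner (w t) (w' t) + 0 * (norm (w' t))\<^sup>2) (at_right 0)"
        unfolding g_def by (intro tendsto_intros lim)
      moreover have "2 * inner (w t) (w' t) + 0 * (norm (w' t))\<^sup>2 < e"
        using diss[OF w_gen[OF t]] e by simp
      ultimately have "\<forall>\<^sub>F s in at_right 0. g s < e" by (rule order_tendstoD)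
      then obtain d where d: "d > 0" "\<And>s. 0 < s \<Longrightarrow> s < d \<Longrightarrow> g s < e" by (auto simp: at_right_0_iff)
      have "(norm (w (t + s)))\<^sup>2 \<le> (norm (w t))\<^sup>2 + e * s" if "0 < s" "s < d" for s
      proof -
        define z where "z = (w (t + s) - w t) /\<^sub>R s"
        have "w (t + s) = w t + s *\<^sub>R z" using that by (simp add: z_def)
        then have "(norm (w (t + s)))\<^sup>2 = (norm (w t))\<^sup>2 + s * g s"
          unfolding g_def z_def[symmetric] power2_norm_eq_inner
          by (simp add: inner_add inner_commute power2_eq_square algebra_simps)
        also have "s * g s \<le> s * e" using d(2)[OF that] that by (intro mult_left_mono) auto
        finally show ?thesis by (simp add: mult.commute)
      qed
      then show ?thesis using d(1) by blast
    qed
    have "(norm (w T))\<^sup>2 \<le> (norm (w 0))\<^sup>2"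
    proof (rule nonincreasing_of_right_derivative[OF _ T])
      show "continuous_on {0..T} (\<lambda>t. (norm (w t))\<^sup>2)" unfolding w_def
        by (intro continuous_intros R.continuous_on semigroup_C0_continuous_on U1 U2)
    qed (use right in blast)
    moreover have "w 0 = 0" using U1 U2 by (simp add: w_def semigroup_C0_def)
    ultimately show ?thesis by (simp add: w_def)
  qed
  have "closed {f. R (U1 T f) = U2 T (R f)}"
    by (intro closed_Collect_eq R.continuous_on L1.continuous_on L2.continuous_on continuous_on_id)
  moreover have "Domain (semigroup_generator U1) \<subseteq> {f. R (U1 T f) = U2 T (R f)}"
    using main by blast
  ultimately have "closure (Domain (semigroup_generator U1)) \<subseteq> {f. R (U1 T f) = U2 T (R f)}"
    by (rule closure_minimal[rotated])
  then show ?thesis using dense by blast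
qed

subsection \<open>The semigroup generated by a closed form\<close>

lemma norm_triangle3: "norm (a + b + c) \<le> norm a + norm b + norm (c :: 'a::real_normed_vector)"
  using norm_triangle_ineq[of "a + b" c] norm_triangle_ineq[of a b] by linarith

lemma subspace_closure:
  fixes V :: "'h::real_normed_vector set"
  assumes V: "subspace V"
  shows "subspace (closure V)"
  unfolding subspace_def
proof (intro conjI ballI allI)
  show "0 \<in> closure V" using closure_subset subspace_0[OF V] by blast
  fix x assume x: "x \<in> closure V"
  then obtain X where X: "\<forall>n. X n \<in> V" "X \<longlonglongrightarrow> x" by (auto simp: closure_sequential)
  show "c *\<^sub>R x \<in> closure V" for c
    unfolding closure_sequential using X
    by (intro exI[of _ "\<lambda>n. c *\<^sub>R X n"]) (auto intro: subspace_scale[OF V] tendsto_intros)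
  fix y assume "y \<in> closure V"
  then obtain Y where "\<forall>n. Y n \<in> V" "Y \<longlonglongrightarrow> y" by (auto simp: closure_sequential)
  then show "x + y \<in> closure V"
    unfolding closure_sequential using X
    by (intro exI[of _ "\<lambda>n. X n + Y n"]) (auto intro: subspace_add[OF V] tendsto_intros)
qed

text \<open>The minimization lemma for the zero form is the projection onto a closed subspace.\<close>

lemma dense_subspace_of_orthogonal_zero:
  fixes V :: "'h::{real_inner, complete_space} set"
  assumes V: "subspace V" and orth: "\<And>g. (\<And>f. f \<in> V \<Longrightarrow> inner g f = 0) \<Longrightarrow> g = 0"
  shows "closure V = UNIV"
proof -
  interpret hilbert_form "closure V" "\<lambda>_ _. 0"
  proof
    show "subspace (closure V)" using V by (rule subspace_closure)
    fix X :: "nat \<Rightarrow> 'h"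
    assume X: "\<And>n. X n \<in> closure V"
      and cau: "\<And>e. e > 0 \<Longrightarrow> \<exists>N. \<forall>m\<ge>N. \<forall>n\<ge>N. (norm (X m - X n))\<^sup>2 + 0 < e"
    have "Cauchy X"
    proof (rule CauchyI)
      fix e :: real assume "e > 0"
      then obtain N where "\<forall>m\<ge>N. \<forall>n\<ge>N. (norm (X m - X n))\<^sup>2 + 0 < e\<^sup>2" using cau[of "e\<^sup>2"] by auto
      then have "\<forall>m\<ge>N. \<forall>n\<ge>N. norm (X m - X n) < e"
        using \<open>e > 0\<close> by (auto intro: power2_less_imp_less)
      then show "\<exists>N. \<forall>m\<ge>N. \<forall>n\<ge>N. norm (X m - X n) < e" by blast
    qed
    then obtain x where x: "X \<longlonglongrightarrow> x" using convergent_eq_Cauchy by blast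
    then have "x \<in> closure V" using X closed_sequentially[OF closed_closure] by blast
    moreover have "(\<lambda>n. (norm (X n - x))\<^sup>2 + 0) \<longlonglongrightarrow> (norm (x - x))\<^sup>2 + 0"
      by (intro tendsto_intros x)
    ultimately show "\<exists>x\<in>closure V. (\<lambda>n. (norm (X n - x))\<^sup>2 + 0) \<longlonglongrightarrow> 0" by auto
  qed auto
  have "f \<in> closure V" for f
  proof -
    obtain u where u: "u \<in> closure V" "\<forall>g\<in>closure V. inner u g + 1 * 0 = inner f g"
      using form_minimizer[of 1 f] by auto
    have "f - u = 0"
      using u closure_subset[of V] by (intro orth) (auto simp: inner_diff_left)
    then show ?thesis using u by simp
  qed
  then show ?thesis by blast
qed

text \<open>The additional assumption is density of \<open>V\<close>, in the orthogonality form that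
  the fundamental lemma of the calculus of variations provides. The sort
  \<open>perfect_space\<close> makes the bounded operators a unital Banach algebra.\<close>

locale dense_hilbert_form = hilbert_form V q
  for V :: "'h::{real_inner, banach, perfect_space} set" and q +
  assumes orthogonal_zero: "(\<And>f. f \<in> V \<Longrightarrow> inner g f = 0) \<Longrightarrow> g = 0"
begin

definition form_graph :: "('h \<times> 'h) set" where
  "form_graph = {(u, h). u \<in> V \<and> (\<forall>g\<in>V. q u g = - inner h g)}"

text \<open>With A the operator whose graph is \<open>form_graph\<close>, this is the inverse of 1 -
  l A; small l thus corresponds to a large spectral parameter 1/l.\<close>

definition resolvent :: "real \<Rightarrow> 'h \<Rightarrow> 'h" where
  "resolvent l f = (SOME u. u \<in> V \<and> (\<forall>g\<in>V. inner u g + l * q u g = inner f g))"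

lemma V_dense: "closure V = UNIV"
  by (rule dense_subspace_of_orthogonal_zero[OF subspace orthogonal_zero])

lemma V_add: "x \<in> V \<Longrightarrow> y \<in> V \<Longrightarrow> x + y \<in> V" using subspace by (rule subspace_add)
lemma V_diff: "x \<in> V \<Longrightarrow> y \<in> V \<Longrightarrow> x - y \<in> V" using subspace by (rule subspace_diff)
lemma V_scale: "x \<in> V \<Longrightarrow> c *\<^sub>R x \<in> V" using subspace by (rule subspace_scale)

lemma q_diff: "x \<in> V \<Longrightarrow> y \<in> V \<Longrightarrow> z \<in> V \<Longrightarrow> q (x - y) z = q x z - q y z"
  using q_add[of x "(-1) *\<^sub>R y" z] q_scale[of y z "-1"] V_scale[of y "-1"] by simp

section \<open>Resolvents of the operator of a closed form\<close>

lemma resolvent_props: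
  assumes "l > 0"
  shows "resolvent l f \<in> V" "g \<in> V \<Longrightarrow> inner (resolvent l f) g + l * q (resolvent l f) g = inner f g"
proof -
  have "\<exists>u. u \<in> V \<and> (\<forall>g\<in>V. inner u g + l * q u g = inner f g)"
    using form_minimizer[OF assms] by blast
  from someI_ex[OF this] show "resolvent l f \<in> V"
    "g \<in> V \<Longrightarrow> inner (resolvent l f) g + l * q (resolvent l f) g = inner f g"
    unfolding resolvent_def by auto
qed

lemma resolvent_unique:
  assumes l: "l > 0" and u: "u \<in> V" "\<And>g. g \<in> V \<Longrightarrow> inner u g + l * q u g = inner f g"
  shows "resolvent l f = u"
proof -
  define w where "w = resolvent l f - u"
  have w: "w \<in> V" unfolding w_def by (intro V_diff resolvent_props l u)
  have "q w w = q (resolvent l f) w - q u w"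
    using q_diff[OF resolvent_props(1)[OF l, of f] u(1) w] by (simp add: w_def)
  moreover have "inner w w = inner (resolvent l f) w - inner u w"
    by (simp add: w_def inner_diff_left)
  ultimately have "inner w w + l * q w w = 0"
    using resolvent_props(2)[OF l w, of f] u(2)[OF w] by (simp add: right_diff_distrib)
  moreover have "l * q w w \<ge> 0" using l q_nonneg[OF w] by simp
  ultimately have "inner w w = 0" using inner_ge_zero[of w] by linarith
  then show ?thesis by (simp add: w_def)
qed

lemma resolvent_norm: "l > 0 \<Longrightarrow> norm (resolvent l f) \<le> norm f"
proof -
  assume l: "l > 0"
  define u where "u = resolvent l f"
  have "(norm u)\<^sup>2 \<le> inner f u"
  proof -
    have u: "u \<in> V" unfolding u_def by (rule resolvent_props[OF l])
    have "inner u u + l * q u u = inner f u"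
      unfolding u_def by (rule resolvent_props[OF l]) (rule resolvent_props[OF l])
    moreover have "0 \<le> l * q u u" using l q_nonneg[OF u] by simp
    ultimately show ?thesis by (simp add: power2_norm_eq_inner)
  qed
  also have "\<dots> \<le> norm f * norm u" by (rule norm_cauchy_schwarz)
  finally have "norm u * norm u \<le> norm f * norm u" by (simp add: power2_eq_square)
  then have "norm u \<le> norm f"
    by (cases "norm u = 0") (simp_all add: mult_le_cancel_right)
  then show ?thesis by (simp add: u_def)
qed

lemma resolvent_bounded_linear: "l > 0 \<Longrightarrow> bounded_linear (resolvent l)"
proof (rule bounded_linear_intro[where K = 1])
  fix f g :: 'h and c assume l: "l > 0"
  show "resolvent l (f + g) = resolvent l f + resolvent l g"
    using resolvent_props[OF l]
    by (intro resolvent_unique[OF l]) (auto simp: V_add q_add inner_add_left distrib_left algebra_simps)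
  show "resolvent l (c *\<^sub>R f) = c *\<^sub>R resolvent l f"
  proof (rule resolvent_unique[OF l])
    fix g assume g: "g \<in> V"
    have "inner (c *\<^sub>R resolvent l f) g + l * q (c *\<^sub>R resolvent l f) g
        = c * (inner (resolvent l f) g + l * q (resolvent l f) g)"
      using resolvent_props(1)[OF l] g by (simp add: q_scale algebra_simps)
    then show "inner (c *\<^sub>R resolvent l f) g + l * q (c *\<^sub>R resolvent l f) g = inner (c *\<^sub>R f) g"
      using resolvent_props(2)[OF l g] by simp
  qed (intro V_scale resolvent_props l)
  show "norm (resolvent l f) \<le> norm f * 1" using resolvent_norm[OF l] by simp
qed

lemma form_graph_unique: "(u, h) \<in> form_graph \<Longrightarrow> (u, h') \<in> form_graph \<Longrightarrow> h = h'"
  using orthogonal_zero[of "h - h'"] by (auto simp: form_graph_def inner_diff_left)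

lemma form_graph_dissipative: "(u, h) \<in> form_graph \<Longrightarrow> inner u h \<le> 0"
  using q_nonneg[of u] by (auto simp: form_graph_def inner_commute)

lemma resolvent_form_graph:
  assumes l: "l > 0"
  shows "(resolvent l f, (resolvent l f - f) /\<^sub>R l) \<in> form_graph"
  unfolding form_graph_def
proof safe
  show "resolvent l f \<in> V" by (rule resolvent_props[OF l])
  fix g assume "g \<in> V"
  from resolvent_props(2)[OF l this, of f]
  show "q (resolvent l f) g = - inner ((resolvent l f - f) /\<^sub>R l) g"
    using l by (simp add: inner_diff_left field_simps)
qed

lemma resolvent_inverse:
  assumes l: "l > 0" and u: "(u, h) \<in> form_graph"
  shows "resolvent l (u - l *\<^sub>R h) = u"
  using u by (intro resolvent_unique[OF l]) (auto simp: form_graph_def inner_diff_left)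

text \<open>Applying J = \<open>resolvent l\<close> to u - l h gives back u, so J h is the
  difference quotient (J u - u) / l, which is also the image of J u under A.\<close>

lemma resolvent_form_graph_commute:
  assumes l: "l > 0" and u: "(u, h) \<in> form_graph"
  shows "(resolvent l u, resolvent l h) \<in> form_graph"
proof -
  interpret J: bounded_linear "resolvent l" by (rule resolvent_bounded_linear[OF l])
  have "(resolvent l u - u) /\<^sub>R l = resolvent l h"
  proof -
    have "u = resolvent l u - l *\<^sub>R resolvent l h"
      using resolvent_inverse[OF l u] by (simp add: J.diff J.scaleR)
    then have "resolvent l u - u = l *\<^sub>R resolvent l h" by (metis add_diff_cancel_left' diff_add_cancel)
    then show ?thesis using l by simp
  qed
  then show ?thesis using resolvent_form_graph[OF l, of u] by simp
qed

text \<open>Both sides solve (1 - m A) y = \<open>resolvent l f\<close>, since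
  \<open>resolvent l\<close> preserves the graph of A.\<close>

lemma resolvent_commute:
  assumes l: "l > 0" and m: "m > 0"
  shows "resolvent l (resolvent m f) = resolvent m (resolvent l f)"
proof -
  interpret J: bounded_linear "resolvent l" by (rule resolvent_bounded_linear[OF l])
  define u where "u = resolvent m f"
  define h where "h = (u - f) /\<^sub>R m"
  have "(resolvent l u, resolvent l h) \<in> form_graph"
    using resolvent_form_graph_commute[OF l resolvent_form_graph[OF m, of f]]
    by (simp add: u_def h_def)
  then have "resolvent m (resolvent l u - m *\<^sub>R resolvent l h) = resolvent l u"
    by (rule resolvent_inverse[OF m])
  moreover have "resolvent l u - m *\<^sub>R resolvent l h = resolvent l f"
    using m by (simp add: h_def J.scaleR J.diff)
  ultimately show ?thesis by (simp add: u_def)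
qed

text \<open>For v in the form domain, testing the resolvent equation with u - v gives |u - v|^2 <= l
  q(v, v), where u is the resolvent of v. Density of \<open>V\<close> and contractivity extend the
  convergence to all f.\<close>

lemma resolvent_tendsto:
  assumes l: "\<And>n. l n > 0" and lim: "l \<longlonglongrightarrow> 0"
  shows "(\<lambda>n. resolvent (l n) f) \<longlonglongrightarrow> f"
proof (rule LIMSEQ_I)
  fix e :: real assume e: "e > 0"
  have "f \<in> closure V" using V_dense by simp
  then obtain v where v: "v \<in> V" "dist v f < e / 4"
    using e unfolding closure_approachable by (meson divide_pos_pos zero_less_numeral)
  have est: "(norm (resolvent (l n) v - v))\<^sup>2 \<le> l n * q v v" for n
  proof -
    define u where "u = resolvent (l n) v"
    have u: "u \<in> V" unfolding u_def by (rule resolvent_props[OF l])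
    have "inner u (u - v) + l n * q u (u - v) = inner v (u - v)"
      unfolding u_def by (rule resolvent_props[OF l]) (intro V_diff resolvent_props l v)
    then have "(norm (u - v))\<^sup>2 = - (l n * q u (u - v))"
      unfolding power2_norm_eq_inner by (simp add: inner_diff_left)
    moreover have "q u (u - v) = q u u - q v u"
      using u v V_diff[OF u v(1)] q_commute[of u "u - v"] by (simp add: q_diff)
    moreover have "q v u \<le> q u u + q v v"
    proof -
      have "0 \<le> q (u - v) (u - v)" using u v by (intro q_nonneg V_diff)
      also have "\<dots> = q u u - 2 * q v u + q v v"
        using u v V_diff[OF u v(1)] q_commute[of u "u - v"] q_commute[of v "u - v"] q_commute[of u v]
        by (simp add: q_diff)
      finally show ?thesis using q_nonneg[OF u] q_nonneg[OF v(1)] by linarith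
    qed
    ultimately have "(norm (u - v))\<^sup>2 = l n * (q v u - q u u)" by (simp add: algebra_simps)
    also have "\<dots> \<le> l n * q v v"
      using \<open>q v u \<le> q u u + q v v\<close> l[of n] by (intro mult_left_mono) auto
    finally show ?thesis by (simp add: u_def)
  qed
  have "(\<lambda>n. l n * q v v) \<longlonglongrightarrow> 0 * q v v" by (intro tendsto_intros lim)
  then have "\<forall>\<^sub>F n in sequentially. l n * q v v < (e / 4)\<^sup>2" using e by (intro order_tendstoD) auto
  then obtain N where N: "\<And>n. n \<ge> N \<Longrightarrow> l n * q v v < (e / 4)\<^sup>2" by (auto simp: eventually_sequentially)
  have "norm (resolvent (l n) f - f) < e" if "n \<ge> N" for n
  proof -
    interpret J: bounded_linear "resolvent (l n)" by (rule resolvent_bounded_linear[OF l])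
    have "(norm (resolvent (l n) v - v))\<^sup>2 < (e / 4)\<^sup>2" using est[of n] N[OF that] by linarith
    then have 1: "norm (resolvent (l n) v - v) < e / 4" by (rule power2_less_imp_less) (use e in simp)
    have 2: "norm (resolvent (l n) (f - v)) \<le> norm (f - v)" by (rule resolvent_norm[OF l])
    have "resolvent (l n) f - f = resolvent (l n) (f - v) + (resolvent (l n) v - v) + (v - f)"
      by (simp add: J.diff)
    then have "norm (resolvent (l n) f - f)
        \<le> norm (resolvent (l n) (f - v)) + norm (resolvent (l n) v - v) + norm (v - f)"
      by (metis norm_triangle3)
    moreover have "norm (v - f) < e / 4" "norm (f - v) < e / 4"
      using v(2) by (simp_all add: dist_norm norm_minus_commute)
    ultimately show ?thesis using 1 2 e by linarith
  qed
  then show "\<exists>N. \<forall>n\<ge>N. norm (resolvent (l n) f - f) < e" by blast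
qed

lemma form_graph_domain_dense: "closure (Domain form_graph) = UNIV"
proof -
  have "f \<in> closure (Domain form_graph)" for f
    unfolding closure_sequential
  proof (intro exI conjI allI)
    show "resolvent (1 / real (Suc n)) f \<in> Domain form_graph" for n
      using resolvent_form_graph[of "1 / real (Suc n)" f] by auto
    show "(\<lambda>n. resolvent (1 / real (Suc n)) f) \<longlonglongrightarrow> f"
      by (rule resolvent_tendsto[OF _ LIMSEQ_Suc[OF lim_1_over_n]]) simp
  qed
  then show ?thesis by blast
qed

text \<open>The Yosida approximation (J - 1) / l with J = \<open>resolvent l\<close> and l = 1/(n +
  1): a bounded operator that equals A J.\<close>

definition yosida :: "nat \<Rightarrow> 'h endo" where
  "yosida n = real (Suc n) *\<^sub>R (Endo (Blinfun (resolvent (1 / real (Suc n)))) - 1)"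

lemma yosida_apply:
  "endo_apply (yosida n) x = real (Suc n) *\<^sub>R (resolvent (1 / real (Suc n)) x - x)"
  unfolding yosida_def
  by (simp add: endo_apply_scaleR endo_apply_diff endo_apply_Endo resolvent_bounded_linear del: of_nat_Suc)

text \<open>The approximant acts on the domain of A as J A, hence converges strongly there although
  its norm may blow up.\<close>

lemma yosida_form_graph:
  assumes "(u, h) \<in> form_graph"
  shows "endo_apply (yosida n) u = resolvent (1 / real (Suc n)) h"
proof -
  have "(resolvent (1 / real (Suc n)) u, resolvent (1 / real (Suc n)) h) \<in> form_graph"
    by (rule resolvent_form_graph_commute[OF _ assms]) simp
  moreover have "(resolvent (1 / real (Suc n)) u, (resolvent (1 / real (Suc n)) u - u) /\<^sub>R (1 / real (Suc n))) \<in> form_graph"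
    by (rule resolvent_form_graph) simp
  ultimately have "(resolvent (1 / real (Suc n)) u - u) /\<^sub>R (1 / real (Suc n)) = resolvent (1 / real (Suc n)) h"
    by (rule form_graph_unique[rotated])
  then show ?thesis by (simp add: yosida_apply del: of_nat_Suc)
qed

lemma yosida_commute: "yosida m * yosida n = yosida n * yosida m"
proof -
  have "Endo (Blinfun (resolvent l)) * Endo (Blinfun (resolvent l'))
      = Endo (Blinfun (resolvent l')) * Endo (Blinfun (resolvent l))" if "l > 0" "l' > 0" for l l'
    using that by (intro endo_eqI)
      (simp add: endo_apply_mult endo_apply_Endo resolvent_bounded_linear resolvent_commute)
  then show ?thesis unfolding yosida_def by (simp add: algebra_simps del: of_nat_Suc)
qed

lemma yosida_exp_norm: "t \<ge> 0 \<Longrightarrow> norm (exp (t *\<^sub>R yosida n)) \<le> 1"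
proof -
  assume t: "t \<ge> 0"
  have "norm (Endo (Blinfun (resolvent (1 / real (Suc n))))) \<le> 1"
    by (rule norm_endo_bound) (simp_all add: endo_apply_Endo resolvent_bounded_linear resolvent_norm del: of_nat_Suc)
  from norm_exp_bounded_minus_one[OF this, of "t * real (Suc n)"] t show ?thesis
    by (simp add: yosida_def del: of_nat_Suc)
qed

lemma yosida_contraction: "t \<ge> 0 \<Longrightarrow> norm (endo_apply (exp (t *\<^sub>R yosida n)) x) \<le> norm x"
  using norm_endo_apply[of "exp (t *\<^sub>R yosida n)" x] yosida_exp_norm[of t n]
  by (meson mult_left_le_one_le norm_ge_zero order_trans)

lemma yosida_estimate:
  assumes "t \<ge> 0"
  shows "norm (endo_apply (exp (t *\<^sub>R yosida m)) x - endo_apply (exp (t *\<^sub>R yosida n)) x)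
    \<le> t * norm (endo_apply (yosida m) x - endo_apply (yosida n) x)"
proof (rule endo_exp_estimate[OF yosida_commute assms])
  fix s assume s: "0 \<le> s" "s \<le> t"
  have "exp (s *\<^sub>R yosida m + (t - s) *\<^sub>R yosida n) = exp (s *\<^sub>R yosida m) * exp ((t - s) *\<^sub>R yosida n)"
    by (rule exp_add_commuting) (simp add: yosida_commute)
  then have "norm (exp (s *\<^sub>R yosida m + (t - s) *\<^sub>R yosida n))
      \<le> norm (exp (s *\<^sub>R yosida m)) * norm (exp ((t - s) *\<^sub>R yosida n))"
    by (simp add: norm_mult_ineq)
  also have "\<dots> \<le> 1 * 1" using s by (intro mult_mono yosida_exp_norm) auto
  finally show "norm (exp (s *\<^sub>R yosida m + (t - s) *\<^sub>R yosida n)) \<le> 1" by simp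
qed

lemma yosida_tendsto:
  assumes "(u, h) \<in> form_graph"
  shows "(\<lambda>n. endo_apply (yosida n) u) \<longlonglongrightarrow> h"
  unfolding yosida_form_graph[OF assms]
  by (rule resolvent_tendsto[OF _ LIMSEQ_Suc[OF lim_1_over_n]]) simp

definition evolution :: "real \<Rightarrow> 'h \<Rightarrow> 'h" where
  "evolution t x = lim (\<lambda>n. endo_apply (exp (t *\<^sub>R yosida n)) x)"

text \<open>On the domain of A the approximants converge, so \<open>yosida_estimate\<close> makes
  the exponentials Cauchy. All exponentials are contractions, so an approximation of x from the
  dense domain suffices.\<close>

lemma evolution_tendsto:
  assumes t: "t \<ge> 0"
  shows "(\<lambda>n. endo_apply (exp (t *\<^sub>R yosida n)) x) \<longlonglongrightarrow> evolution t x"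
proof -
  have "Cauchy (\<lambda>n. endo_apply (exp (t *\<^sub>R yosida n)) x)"
  proof (rule CauchyI)
    fix e :: real assume e: "e > 0"
    have "x \<in> closure (Domain form_graph)" using form_graph_domain_dense by simp
    then obtain u h where u: "(u, h) \<in> form_graph" "dist u x < e / 4"
      using e unfolding closure_approachable by (metis Domain.cases divide_pos_pos zero_less_numeral)
    have "Cauchy (\<lambda>n. endo_apply (yosida n) u)"
      using yosida_tendsto[OF u(1)] by (rule LIMSEQ_imp_Cauchy)
    moreover have "e / (4 * (t + 1)) > 0" using e t by simp
    ultimately obtain N where N: "\<And>m n. m \<ge> N \<Longrightarrow> n \<ge> N \<Longrightarrow>
        norm (endo_apply (yosida m) u - endo_apply (yosida n) u) < e / (4 * (t + 1))"
      by (meson CauchyD)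
    have "norm (endo_apply (exp (t *\<^sub>R yosida m)) x - endo_apply (exp (t *\<^sub>R yosida n)) x) < e"
      if "m \<ge> N" "n \<ge> N" for m n
    proof -
      have split: "endo_apply (exp (t *\<^sub>R yosida k)) x
          = endo_apply (exp (t *\<^sub>R yosida k)) (x - u) + endo_apply (exp (t *\<^sub>R yosida k)) u" for k
        using bounded_linear.linear[OF bounded_linear_endo_apply_right]
        by (metis diff_add_cancel linear_add)
      have 1: "norm (endo_apply (exp (t *\<^sub>R yosida k)) (x - u)) < e / 4" for k
        using yosida_contraction[OF t, of k "x - u"] u(2) by (simp add: dist_norm norm_minus_commute)
      have "norm (endo_apply (exp (t *\<^sub>R yosida m)) u - endo_apply (exp (t *\<^sub>R yosida n)) u)
          \<le> t * (e / (4 * (t + 1)))"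
        using yosida_estimate[OF t, of m u n] mult_left_mono[OF less_imp_le[OF N[OF that]] t]
        by linarith
      also have "\<dots> \<le> e / 4" using t e by (simp add: field_simps)
      finally have 2: "norm (endo_apply (exp (t *\<^sub>R yosida m)) u - endo_apply (exp (t *\<^sub>R yosida n)) u) \<le> e / 4" .
      have "norm ((a + b) - (c + d)) \<le> norm a + norm c + norm (b - d)" for a b c d :: 'h
        using norm_triangle3[of a "- c" "b - d"] by (simp add: algebra_simps)
      from this[of "endo_apply (exp (t *\<^sub>R yosida m)) (x - u)" "endo_apply (exp (t *\<^sub>R yosida m)) u"
          "endo_apply (exp (t *\<^sub>R yosida n)) (x - u)" "endo_apply (exp (t *\<^sub>R yosida n)) u"]
      show ?thesis using 1[of m] 1[of n] 2 e unfolding split[symmetric] by linarith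
    qed
    then show "\<exists>N. \<forall>m\<ge>N. \<forall>n\<ge>N.
        norm (endo_apply (exp (t *\<^sub>R yosida m)) x - endo_apply (exp (t *\<^sub>R yosida n)) x) < e" by blast
  qed
  then show ?thesis
    unfolding evolution_def by (simp add: Cauchy_convergent_iff convergent_LIMSEQ_iff)
qed

lemma evolution_norm:
  assumes t: "t \<ge> 0"
  shows "norm (evolution t x) \<le> norm x"
  by (rule LIMSEQ_le_const2[OF tendsto_norm[OF evolution_tendsto[OF t]]])
    (use yosida_contraction[OF t] in blast)

lemma evolution_bounded_linear:
  assumes t: "t \<ge> 0"
  shows "bounded_linear (evolution t)"
proof (rule bounded_linear_intro[where K = 1])
  fix x y :: 'h and c
  have lin: "linear (endo_apply T)" for T :: "'h endo"
    by (rule bounded_linear.linear[OF bounded_linear_endo_apply_right])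
  show "evolution t (x + y) = evolution t x + evolution t y"
    using tendsto_add[OF evolution_tendsto[OF t, of x] evolution_tendsto[OF t, of y]]
    by (intro LIMSEQ_unique[OF evolution_tendsto[OF t]]) (simp add: linear_add[OF lin])
  show "evolution t (c *\<^sub>R x) = c *\<^sub>R evolution t x"
    using tendsto_scaleR[OF tendsto_const evolution_tendsto[OF t, of x], of c]
    by (intro LIMSEQ_unique[OF evolution_tendsto[OF t]]) (simp add: linear_scale[OF lin])
  show "norm (evolution t x) \<le> norm x * 1" using evolution_norm[OF t] by simp
qed

text \<open>A quantitative form of U(t) u = u + t A u + o(t). Since h = A u need not lie in the
  domain, its orbit is compared with that of a nearby v in the domain, which moves with speed at
  most |A v| = |k|. Strong continuity and the generator both follow from it.\<close>

lemma evolution_estimate: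
  assumes u: "(u, h) \<in> form_graph" and v: "(v, k) \<in> form_graph" and t: "t \<ge> 0"
  shows "norm (evolution t u - u - t *\<^sub>R h) \<le> t * (2 * norm (h - v) + t * norm k)"
proof -
  have Y1: "norm (endo_apply (exp (s *\<^sub>R yosida n)) v - v) \<le> s * norm k" if "s \<ge> 0" for s n
  proof -
    have "norm (endo_apply (exp (s *\<^sub>R yosida n)) v - endo_apply (exp (s *\<^sub>R 0)) v)
        \<le> s * norm (endo_apply (yosida n) v - endo_apply 0 v)"
      using that yosida_exp_norm by (intro endo_exp_estimate) auto
    also have "\<dots> = s * norm (resolvent (1 / real (Suc n)) k)"
      by (simp add: yosida_form_graph[OF v] endo_apply_zero)
    also have "\<dots> \<le> s * norm k" using that by (intro mult_left_mono resolvent_norm) auto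
    finally show ?thesis by simp
  qed
  have est: "norm (endo_apply (exp (t *\<^sub>R yosida n)) u - u - t *\<^sub>R endo_apply (yosida n) u)
      \<le> t * (2 * norm (endo_apply (yosida n) u - v) + t * norm k)" for n
  proof (rule endo_exp_derivative_estimate[OF t])
    fix s assume s: "0 \<le> s" "s \<le> t"
    define y where "y = endo_apply (yosida n) u"
    interpret E: bounded_linear "endo_apply (exp (s *\<^sub>R yosida n))"
      by (rule bounded_linear_endo_apply_right)
    have "endo_apply (exp (s *\<^sub>R yosida n)) y - y
        = endo_apply (exp (s *\<^sub>R yosida n)) (y - v) - (y - v) + (endo_apply (exp (s *\<^sub>R yosida n)) v - v)"
      by (simp add: E.diff)
    also have "norm \<dots> \<le> norm (endo_apply (exp (s *\<^sub>R yosida n)) (y - v)) + norm (y - v)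
        + norm (endo_apply (exp (s *\<^sub>R yosida n)) v - v)"
      by (intro norm_triangle_mono norm_triangle_ineq4 order_refl)
    also have "\<dots> \<le> norm (y - v) + norm (y - v) + t * norm k"
      using yosida_contraction[OF s(1), of n "y - v"] Y1[OF s(1), of n]
        mult_right_mono[OF s(2) norm_ge_zero[of k]] by linarith
    finally show "norm (endo_apply (exp (s *\<^sub>R yosida n)) (endo_apply (yosida n) u) - endo_apply (yosida n) u)
        \<le> 2 * norm (endo_apply (yosida n) u - v) + t * norm k" by (simp add: y_def)
  qed
  show ?thesis
  proof (rule LIMSEQ_le)
    show "(\<lambda>n. norm (endo_apply (exp (t *\<^sub>R yosida n)) u - u - t *\<^sub>R endo_apply (yosida n) u))
        \<longlonglongrightarrow> norm (evolution t u - u - t *\<^sub>R h)"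
      by (intro tendsto_intros evolution_tendsto t yosida_tendsto u)
    show "(\<lambda>n. t * (2 * norm (endo_apply (yosida n) u - v) + t * norm k))
        \<longlonglongrightarrow> t * (2 * norm (h - v) + t * norm k)"
      by (intro tendsto_intros yosida_tendsto u)
  qed (use est in blast)
qed

theorem evolution_semigroup: "semigroup_C0 evolution"
  unfolding semigroup_C0_def
proof (intro conjI allI impI)
  show "bounded_linear (evolution t)" if "t \<ge> 0" for t using that by (rule evolution_bounded_linear)
  show "evolution 0 x = x" for x
    using evolution_tendsto[of 0 x] by (simp add: LIMSEQ_const_iff)
  show "evolution (s + t) x = evolution s (evolution t x)" if s: "s \<ge> 0" and t: "t \<ge> 0" for s t x
  proof (rule LIMSEQ_unique)
    have lin: "linear (endo_apply T)" for T :: "'h endo"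
      by (rule bounded_linear.linear[OF bounded_linear_endo_apply_right])
    show "(\<lambda>n. endo_apply (exp ((s + t) *\<^sub>R yosida n)) x) \<longlonglongrightarrow> evolution (s + t) x"
      using s t by (intro evolution_tendsto) simp
    \<comment> \<open>In the product both factors vary with n; uniform contractivity absorbs the
      change of the inner vector, and the outer factor then acts on a fixed one.\<close>
    have eq: "endo_apply (exp ((s + t) *\<^sub>R yosida n)) x
        = endo_apply (exp (s *\<^sub>R yosida n)) (endo_apply (exp (t *\<^sub>R yosida n)) x - evolution t x)
          + endo_apply (exp (s *\<^sub>R yosida n)) (evolution t x)" for n
      by (simp add: linear_diff[OF lin] scaleR_add_left exp_add_commuting endo_apply_mult)
    have "(\<lambda>n. endo_apply (exp (s *\<^sub>R yosida n)) (endo_apply (exp (t *\<^sub>R yosida n)) x - evolution t x)) \<longlonglongrightarrow> 0"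
    proof (rule Lim_null_comparison)
      show "\<forall>\<^sub>F n in sequentially. norm (endo_apply (exp (s *\<^sub>R yosida n)) (endo_apply (exp (t *\<^sub>R yosida n)) x - evolution t x))
          \<le> norm (endo_apply (exp (t *\<^sub>R yosida n)) x - evolution t x)"
        using yosida_contraction[OF s] by (intro always_eventually) auto
      show "(\<lambda>n. norm (endo_apply (exp (t *\<^sub>R yosida n)) x - evolution t x)) \<longlonglongrightarrow> 0"
        using evolution_tendsto[OF t, of x] by (simp add: LIM_zero tendsto_norm_zero)
    qed
    from tendsto_add[OF this evolution_tendsto[OF s, of "evolution t x"]]
    show "(\<lambda>n. endo_apply (exp ((s + t) *\<^sub>R yosida n)) x) \<longlonglongrightarrow> evolution s (evolution t x)"
      by (simp add: eq)
  qed
  show "((\<lambda>t. evolution t x) \<longlongrightarrow> x) (at_right 0)" for x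
  proof (rule tendstoI)
    fix e :: real assume e: "e > 0"
    have "x \<in> closure (Domain form_graph)" using form_graph_domain_dense by simp
    then obtain u h where u: "(u, h) \<in> form_graph" "dist u x < e / 4"
      using e unfolding closure_approachable by (metis Domain.cases divide_pos_pos zero_less_numeral)
    have "h \<in> closure (Domain form_graph)" using form_graph_domain_dense by simp
    \<comment> \<open>Any v in the domain would do here, as the whole error carries a factor
      t.\<close>
    then obtain v k where v: "(v, k) \<in> form_graph" "dist v h < 1"
      unfolding closure_approachable by (metis Domain.cases zero_less_one)
    have "((\<lambda>t. t * (2 * norm (h - v) + t * norm k) + norm (t *\<^sub>R h)) \<longlongrightarrow>
        0 * (2 * norm (h - v) + 0 * norm k) + norm (0 *\<^sub>R h)) (at_right 0)"
      by (intro tendsto_intros)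
    then have "\<forall>\<^sub>F t in at_right 0. t * (2 * norm (h - v) + t * norm k) + norm (t *\<^sub>R h) < e / 4"
      using e by (intro order_tendstoD) auto
    moreover have "\<forall>\<^sub>F t in at_right 0. (0::real) < t" by (rule eventually_at_right_less)
    ultimately show "\<forall>\<^sub>F t in at_right 0. dist (evolution t x) x < e"
    proof eventually_elim
      case (elim t)
      interpret E: bounded_linear "evolution t" using elim by (intro evolution_bounded_linear) simp
      have "norm (evolution t u - u) \<le> norm (evolution t u - u - t *\<^sub>R h) + norm (t *\<^sub>R h)"
        by (metis diff_add_cancel norm_triangle_ineq)
      then have 1: "norm (evolution t u - u) < e / 4"
        using evolution_estimate[OF u(1) v(1), of t] elim by linarith
      have "evolution t x - x = evolution t (x - u) + (evolution t u - u) + (u - x)" by (simp add: E.diff)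
      then have "norm (evolution t x - x) \<le> norm (evolution t (x - u)) + norm (evolution t u - u) + norm (u - x)"
        by (metis norm_triangle3)
      moreover have "norm (u - x) < e / 4" "norm (x - u) < e / 4"
        using u(2) by (simp_all add: dist_norm norm_minus_commute)
      ultimately show ?case
        using 1 evolution_norm[of t "x - u"] elim e unfolding dist_norm by linarith
    qed
  qed
qed

text \<open>The estimate above gives one inclusion. The other is maximality: the form operator A is
  such that 1 - A is onto, and a dissipative extension of A cannot be larger.\<close>

theorem evolution_generator: "semigroup_generator evolution = form_graph"
proof (intro set_eqI iffI; clarify)
  have sub: "(u, h) \<in> semigroup_generator evolution" if u: "(u, h) \<in> form_graph" for u h
    unfolding semigroup_generator_def mem_Collect_eq prod.case
  proof (rule tendstoI)
    fix e :: real assume e: "e > 0"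
    have "h \<in> closure (Domain form_graph)" using form_graph_domain_dense by simp
    then obtain v k where v: "(v, k) \<in> form_graph" "dist v h < e / 4"
      using e unfolding closure_approachable by (metis Domain.cases divide_pos_pos zero_less_numeral)
    have "((\<lambda>t. t * norm k) \<longlongrightarrow> 0 * norm k) (at_right 0)" by (intro tendsto_intros)
    then have "\<forall>\<^sub>F t in at_right 0. t * norm k < e / 4" using e by (intro order_tendstoD) auto
    moreover have "\<forall>\<^sub>F t in at_right 0. (0::real) < t" by (rule eventually_at_right_less)
    ultimately show "\<forall>\<^sub>F t in at_right 0. dist ((evolution t u - u) /\<^sub>R t) h < e"
    proof eventually_elim
      case (elim t)
      have "(evolution t u - u) /\<^sub>R t - h = (evolution t u - u - t *\<^sub>R h) /\<^sub>R t"
        using elim(2) by (simp add: scaleR_diff_right)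
      then have "norm ((evolution t u - u) /\<^sub>R t - h) = norm (evolution t u - u - t *\<^sub>R h) / t"
        using elim(2) by (simp add: divide_inverse mult.commute)
      also have "\<dots> \<le> 2 * norm (h - v) + t * norm k"
        using evolution_estimate[OF u v(1), of t] elim(2) by (simp add: divide_le_eq mult.commute)
      also have "\<dots> < e"
      proof -
        have "norm (h - v) < e / 4" using v(2) by (simp add: dist_norm norm_minus_commute)
        then show ?thesis using elim e by linarith
      qed
      finally show ?case by (simp add: dist_norm)
    qed
  qed
  show "(u, h) \<in> semigroup_generator evolution" if "(u, h) \<in> form_graph" for u h
    using that by (rule sub)
  fix f h assume fh: "(f, h) \<in> semigroup_generator evolution"
  \<comment> \<open>u solves u - A u = f - h, so z = f - u satisfies G z = z for the generator G,
    whereas contractivity gives <G z, z> <= 0; hence z = 0.\<close>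
  define u where "u = resolvent 1 (f - h)"
  define k where "k = u - (f - h)"
  have uk: "(u, k) \<in> form_graph"
    using resolvent_form_graph[of 1 "f - h"] by (simp add: u_def k_def)
  have "((\<lambda>t. (evolution t f - f) /\<^sub>R t - (evolution t u - u) /\<^sub>R t) \<longlongrightarrow> h - k) (at_right 0)"
    using fh sub[OF uk] unfolding semigroup_generator_def by (intro tendsto_diff) auto
  then have "((\<lambda>t. inner ((evolution t f - f) /\<^sub>R t - (evolution t u - u) /\<^sub>R t) (f - u))
      \<longlongrightarrow> inner (h - k) (f - u)) (at_right 0)"
    by (rule tendsto_inner[OF _ tendsto_const])
  moreover have "\<forall>\<^sub>F t in at_right 0.
      inner ((evolution t f - f) /\<^sub>R t - (evolution t u - u) /\<^sub>R t) (f - u) \<le> 0"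
  proof (rule eventually_mono[OF eventually_at_right_less])
    fix t :: real assume t: "0 < t"
    interpret E: bounded_linear "evolution t" using t by (intro evolution_bounded_linear) simp
    have "inner (evolution t (f - u)) (f - u) \<le> norm (evolution t (f - u)) * norm (f - u)"
      by (rule norm_cauchy_schwarz)
    also have "\<dots> \<le> norm (f - u) * norm (f - u)"
      using t by (intro mult_right_mono evolution_norm) auto
    finally have "inner (evolution t (f - u) - (f - u)) (f - u) \<le> 0"
      by (simp add: inner_diff_left power2_norm_eq_inner[symmetric] power2_eq_square)
    moreover have "(evolution t f - f) /\<^sub>R t - (evolution t u - u) /\<^sub>R t
        = (evolution t (f - u) - (f - u)) /\<^sub>R t"
      by (simp add: E.diff scaleR_diff_right)
    ultimately show "inner ((evolution t f - f) /\<^sub>R t - (evolution t u - u) /\<^sub>R t) (f - u) \<le> 0"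
      using t by (simp add: mult_nonneg_nonpos)
  qed
  ultimately have "inner (h - k) (f - u) \<le> 0"
    by (rule tendsto_upperbound) simp
  moreover have "h - k = f - u" by (simp add: k_def)
  ultimately have "f - u = 0"
    using inner_ge_zero[of "f - u"] by (metis antisym inner_eq_zero_iff)
  then show "(f, h) \<in> form_graph" using uk \<open>h - k = f - u\<close> by simp
qed

end

section \<open>The Hilbert space of square-integrable functions\<close>

text \<open>
  A type cannot depend on a measure, so the quotient of \<^term>\<open>L2 M\<close> by equality almost everywhere
  is formed for the measure attached to a type class parameter. Statements about an arbitrary pair
  of measures are recovered at the end: two concrete index types carry a counterexample to the
  statement, if there is one.
\<close>

definition nontrivial_L2 :: "'a measure \<Rightarrow> bool" where
  "nontrivial_L2 M \<longleftrightarrow> (\<exists>f\<in>L2 M. L2_norm M f \<noteq> 0)"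

class l2_index =
  fixes l2_measure :: "'a itself \<Rightarrow> point measure"
  assumes nontrivial_l2_measure: "nontrivial_L2 (l2_measure TYPE('a))"

text \<open>The choice depends only on the class of \<open>f\<close> modulo equality almost
  everywhere, so the quotient can be carved out as the set of functions that are their own canonical
  representative.\<close>

definition L2_canon :: "'a measure \<Rightarrow> ('a \<Rightarrow> complex) \<Rightarrow> 'a \<Rightarrow> complex" where
  "L2_canon M f = (SOME g. g \<in> L2 M \<and> (AE x in M. f x = g x))"

lemma L2_canon:
  assumes "f \<in> L2 M"
  shows "L2_canon M f \<in> L2 M" "AE x in M. f x = L2_canon M f x"
proof -
  have "\<exists>g. g \<in> L2 M \<and> (AE x in M. f x = g x)" using assms by (intro exI[of _ f]) simp
  from someI_ex[OF this] show "L2_canon M f \<in> L2 M" "AE x in M. f x = L2_canon M f x"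
    unfolding L2_canon_def by auto
qed

lemma L2_canon_cong:
  assumes "AE x in M. f x = g x"
  shows "L2_canon M f = L2_canon M g"
proof -
  have "(AE x in M. f x = h x) \<longleftrightarrow> (AE x in M. g x = h x)" for h
  proof
    assume "AE x in M. f x = h x"
    with assms show "AE x in M. g x = h x" by eventually_elim simp
  next
    assume "AE x in M. g x = h x"
    with assms show "AE x in M. f x = h x" by eventually_elim simp
  qed
  then show ?thesis by (simp add: L2_canon_def)
qed

typedef (overloaded) 'i l2 =
  "{f \<in> L2 (l2_measure TYPE('i::l2_index)). L2_canon (l2_measure TYPE('i)) f = f}"
  morphisms rep_l2 Abs_l2
proof -
  let ?M = "l2_measure TYPE('i)"
  have "L2_canon ?M (L2_canon ?M (\<lambda>_. 0)) = L2_canon ?M (\<lambda>_. 0)"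
    using L2_canon(2)[OF L2_zero, of ?M] by (intro L2_canon_cong) auto
  then show ?thesis using L2_canon(1)[OF L2_zero, of ?M] by blast
qed

definition abs_l2 :: "(point \<Rightarrow> complex) \<Rightarrow> 'i::l2_index l2" where
  "abs_l2 f = Abs_l2 (L2_canon (l2_measure TYPE('i)) f)"

lemma rep_l2_in: "rep_l2 (x :: 'i::l2_index l2) \<in> L2 (l2_measure TYPE('i))"
  using rep_l2[of x] by simp

lemma abs_rep_l2 [simp]: "abs_l2 (rep_l2 x) = x"
  using rep_l2[of x] by (simp add: abs_l2_def rep_l2_inverse)

lemma rep_abs_l2_canon:
  assumes "f \<in> L2 (l2_measure TYPE('i::l2_index))"
  shows "rep_l2 (abs_l2 f :: 'i l2) = L2_canon (l2_measure TYPE('i)) f"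
proof -
  have "L2_canon (l2_measure TYPE('i)) (L2_canon (l2_measure TYPE('i)) f) = L2_canon (l2_measure TYPE('i)) f"
    using L2_canon(2)[OF assms] by (intro L2_canon_cong) auto
  then show ?thesis using L2_canon(1)[OF assms] by (simp add: abs_l2_def Abs_l2_inverse)
qed

lemma rep_abs_l2:
  assumes "f \<in> L2 (l2_measure TYPE('i::l2_index))"
  shows "AE x in l2_measure TYPE('i). rep_l2 (abs_l2 f :: 'i l2) x = f x"
  using L2_canon(2)[OF assms] by (auto simp: rep_abs_l2_canon[OF assms])

lemma abs_l2_cong:
  "AE x in l2_measure TYPE('i::l2_index). f x = g x \<Longrightarrow> (abs_l2 f :: 'i l2) = abs_l2 g"
  by (simp add: abs_l2_def L2_canon_cong)

lemma abs_l2_eq_iff: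
  assumes "f \<in> L2 (l2_measure TYPE('i::l2_index))" "g \<in> L2 (l2_measure TYPE('i))"
  shows "(abs_l2 f :: 'i l2) = abs_l2 g \<longleftrightarrow> (AE x in l2_measure TYPE('i). f x = g x)"
proof
  assume eq: "(abs_l2 f :: 'i l2) = abs_l2 g"
  show "AE x in l2_measure TYPE('i). f x = g x"
    using rep_abs_l2[OF assms(1)] rep_abs_l2[OF assms(2)] unfolding eq by eventually_elim simp
qed (rule abs_l2_cong)

lemma l2_cases [cases type]:
  obtains f where "x = (abs_l2 f :: 'i::l2_index l2)" "f \<in> L2 (l2_measure TYPE('i))"
  using abs_rep_l2[of x] rep_l2_in[of x] by metis

lemma L2_inner_cong_AE:
  assumes "f \<in> L2 M" "f' \<in> L2 M" "g \<in> L2 M" "g' \<in> L2 M"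
    and "AE x in M. f x = f' x" "AE x in M. g x = g' x"
  shows "L2_inner M f g = L2_inner M f' g'"
  unfolding L2_inner_def
proof (rule integral_cong_AE)
  show "AE x in M. f x * cnj (g x) = f' x * cnj (g' x)"
    using assms(5,6) by eventually_elim simp
qed (use assms in \<open>auto intro!: borel_measurable_integrable L2_integrable_mult_cnj\<close>)

section \<open>The real Hilbert space structure on the quotient\<close>

instantiation l2 :: (l2_index) "{zero, plus, minus, uminus, scaleR, inverse}"
begin

definition zero_l2 :: "'a l2" where "0 = abs_l2 (\<lambda>_. 0)"
definition plus_l2 :: "'a l2 \<Rightarrow> 'a l2 \<Rightarrow> 'a l2" where
  "f + g = abs_l2 (\<lambda>x. rep_l2 f x + rep_l2 g x)"
definition minus_l2 :: "'a l2 \<Rightarrow> 'a l2 \<Rightarrow> 'a l2" where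
  "f - g = abs_l2 (\<lambda>x. rep_l2 f x - rep_l2 g x)"
definition uminus_l2 :: "'a l2 \<Rightarrow> 'a l2" where
  "- f = abs_l2 (\<lambda>x. - rep_l2 f x)"
definition scaleR_l2 :: "real \<Rightarrow> 'a l2 \<Rightarrow> 'a l2" where
  "c *\<^sub>R f = abs_l2 (\<lambda>x. complex_of_real c * rep_l2 f x)"

instance ..

end

lemma abs_l2_add:
  assumes "f \<in> L2 (l2_measure TYPE('i::l2_index))" "g \<in> L2 (l2_measure TYPE('i))"
  shows "(abs_l2 f :: 'i l2) + abs_l2 g = abs_l2 (\<lambda>x. f x + g x)"
  unfolding plus_l2_def
  by (rule abs_l2_cong, use rep_abs_l2[OF assms(1)] rep_abs_l2[OF assms(2)] in eventually_elim, simp)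

lemma abs_l2_diff:
  assumes "f \<in> L2 (l2_measure TYPE('i::l2_index))" "g \<in> L2 (l2_measure TYPE('i))"
  shows "(abs_l2 f :: 'i l2) - abs_l2 g = abs_l2 (\<lambda>x. f x - g x)"
  unfolding minus_l2_def
  by (rule abs_l2_cong, use rep_abs_l2[OF assms(1)] rep_abs_l2[OF assms(2)] in eventually_elim, simp)

lemma abs_l2_uminus:
  assumes "f \<in> L2 (l2_measure TYPE('i::l2_index))"
  shows "- (abs_l2 f :: 'i l2) = abs_l2 (\<lambda>x. - f x)"
  unfolding uminus_l2_def
  by (rule abs_l2_cong, use rep_abs_l2[OF assms] in eventually_elim, simp)

lemma abs_l2_scaleR:
  assumes "f \<in> L2 (l2_measure TYPE('i::l2_index))"
  shows "c *\<^sub>R (abs_l2 f :: 'i l2) = abs_l2 (\<lambda>x. complex_of_real c * f x)"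
  unfolding scaleR_l2_def
  by (rule abs_l2_cong, use rep_abs_l2[OF assms] in eventually_elim, simp)

instance l2 :: (l2_index) real_vector
proof
  fix a b :: real and x y z :: "'a l2"
  obtain f where f: "x = abs_l2 f" "f \<in> L2 (l2_measure TYPE('a))" by (cases x)
  obtain g where g: "y = abs_l2 g" "g \<in> L2 (l2_measure TYPE('a))" by (cases y)
  obtain h where h: "z = abs_l2 h" "h \<in> L2 (l2_measure TYPE('a))" by (cases z)
  note [simp] = f g h abs_l2_add abs_l2_diff abs_l2_uminus abs_l2_scaleR zero_l2_def
    L2_add L2_diff L2_uminus L2_mult algebra_simps
  show "x + y + z = x + (y + z)" "x + y = y + x" "0 + x = x" "- x + x = 0" "x - y = x + - y"
    "a *\<^sub>R (x + y) = a *\<^sub>R x + a *\<^sub>R y" "(a + b) *\<^sub>R x = a *\<^sub>R x + b *\<^sub>R x"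
    "a *\<^sub>R b *\<^sub>R x = (a * b) *\<^sub>R x" "1 *\<^sub>R x = x"
    by simp_all
qed

instantiation l2 :: (l2_index) real_inner
begin

definition inner_l2 :: "'a l2 \<Rightarrow> 'a l2 \<Rightarrow> real" where
  "inner f g = Re (L2_inner (l2_measure TYPE('a)) (rep_l2 f) (rep_l2 g))"
definition norm_l2 :: "'a l2 \<Rightarrow> real" where "norm f = L2_norm (l2_measure TYPE('a)) (rep_l2 f)"
definition dist_l2 :: "'a l2 \<Rightarrow> 'a l2 \<Rightarrow> real" where "dist_l2 f g = norm (f - g)"
definition sgn_l2 :: "'a l2 \<Rightarrow> 'a l2" where "sgn_l2 f = f /\<^sub>R norm f"
definition uniformity_l2 :: "('a l2 \<times> 'a l2) filter" where
  "uniformity_l2 = (INF e\<in>{0<..}. principal {(f, g). dist f g < e})"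
definition open_l2 :: "'a l2 set \<Rightarrow> bool" where
  "open_l2 U \<longleftrightarrow> (\<forall>f\<in>U. \<forall>\<^sub>F (f', g) in uniformity. f' = f \<longrightarrow> g \<in> U)"

lemma abs_l2_inner:
  assumes "f \<in> L2 (l2_measure TYPE('a))" "g \<in> L2 (l2_measure TYPE('a))"
  shows "inner (abs_l2 f :: 'a l2) (abs_l2 g) = Re (L2_inner (l2_measure TYPE('a)) f g)"
  unfolding inner_l2_def
  by (intro arg_cong[of _ _ Re] L2_inner_cong_AE rep_l2_in assms rep_abs_l2)

lemma abs_l2_norm:
  assumes "f \<in> L2 (l2_measure TYPE('a))"
  shows "norm (abs_l2 f :: 'a l2) = L2_norm (l2_measure TYPE('a)) f"
  unfolding norm_l2_def
  by (intro L2_norm_cong_AE L2_measurable rep_l2_in assms rep_abs_l2)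

instance
proof
  fix x y z :: "'a l2" and U :: "'a l2 set" and c :: real
  let ?M = "l2_measure TYPE('a)"
  obtain f where f: "x = abs_l2 f" "f \<in> L2 ?M" by (cases x)
  obtain g where g: "y = abs_l2 g" "g \<in> L2 ?M" by (cases y)
  obtain h where h: "z = abs_l2 h" "h \<in> L2 ?M" by (cases z)
  note [simp] = f g h abs_l2_add abs_l2_scaleR L2_add L2_mult abs_l2_inner abs_l2_norm
  show "inner x y = inner y x"
  proof -
    have "L2_inner ?M g f = cnj (L2_inner ?M f g)"
      unfolding L2_inner_def by (subst Bochner_Integration.integral_cnj[symmetric]) (simp add: mult.commute)
    then show ?thesis by simp
  qed
  show "inner (x + y) z = inner x z + inner y z"
    by (simp add: L2_inner_def distrib_right L2_integrable_mult_cnj)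
  show "inner (c *\<^sub>R x) y = c * inner x y"
    by (simp add: L2_inner_def mult.assoc)
  show "0 \<le> inner x x"
    by (simp add: L2_norm_eq_inner del: of_real_power)
  show "inner x x = 0 \<longleftrightarrow> x = 0"
    by (simp add: L2_norm_eq_inner L2_norm_eq_0_iff zero_l2_def abs_l2_eq_iff del: of_real_power)
  show "norm x = sqrt (inner x x)"
    by (simp add: L2_norm_eq_inner del: of_real_power)
qed (simp_all add: dist_l2_def sgn_l2_def uniformity_l2_def open_l2_def)

end

lemmas abs_l2_arith = abs_l2_add abs_l2_diff abs_l2_scaleR abs_l2_inner abs_l2_norm

lemmas abs_l2_zero = zero_l2_def[symmetric] and norm_eq_L2_norm = norm_l2_def

instance l2 :: (l2_index) banach
proof
  fix X :: "nat \<Rightarrow> 'a l2" assume "Cauchy X"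
  have nd: "norm (X m - X n) = L2_norm (l2_measure TYPE('a)) (\<lambda>x. rep_l2 (X m) x - rep_l2 (X n) x)" for m n
    using abs_l2_arith(2)[OF rep_l2_in rep_l2_in, of "X m" "X n"]
      abs_l2_arith(5)[OF L2_diff[OF rep_l2_in rep_l2_in], of "X m" "X n"]
    by simp
  have "\<exists>N. \<forall>m\<ge>N. \<forall>n\<ge>N. L2_norm (l2_measure TYPE('a)) (\<lambda>x. rep_l2 (X m) x - rep_l2 (X n) x) < e"
    if "e > 0" for e
    using \<open>Cauchy X\<close> that unfolding nd[symmetric] by (auto dest: CauchyD)
  then obtain f where f: "f \<in> L2 (l2_measure TYPE('a))"
    "(\<lambda>n. L2_norm (l2_measure TYPE('a)) (\<lambda>x. rep_l2 (X n) x - f x)) \<longlonglongrightarrow> 0"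
    using L2_complete[of "\<lambda>n. rep_l2 (X n)" "l2_measure TYPE('a)"] rep_l2_in by blast
  have "norm (X n - abs_l2 f) = L2_norm (l2_measure TYPE('a)) (\<lambda>x. rep_l2 (X n) x - f x)" for n
    using abs_l2_diff[OF rep_l2_in f(1), of "X n"] abs_l2_norm[OF L2_diff[OF rep_l2_in f(1)], of "X n"]
    by (simp only: abs_rep_l2)
  then have "(\<lambda>n. norm (X n - abs_l2 f)) \<longlonglongrightarrow> 0"
    using f(2) by (simp only:)
  then have "X \<longlonglongrightarrow> abs_l2 f"
    by (rule LIM_zero_cancel[OF tendsto_norm_zero_cancel])
  then show "convergent X" by (rule convergentI)
qed

instance l2 :: (l2_index) perfect_space
proof
  fix x :: "'a l2"
  obtain f where f: "f \<in> L2 (l2_measure TYPE('a))" "L2_norm (l2_measure TYPE('a)) f \<noteq> 0"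
    using nontrivial_l2_measure unfolding nontrivial_L2_def by blast
  define v where "v = (abs_l2 f :: 'a l2)"
  have v: "v \<noteq> 0" using f abs_l2_arith(5)[OF f(1)] by (auto simp: v_def)
  show "\<not> open {x}"
  proof
    assume "open {x}"
    then obtain e where e: "e > 0" "ball x e \<subseteq> {x}" by (auto simp: open_contains_ball)
    define y where "y = x + (e / (2 * norm v)) *\<^sub>R v"
    have "dist x y = e / 2" using e v by (simp add: y_def dist_norm)
    then have "y \<in> ball x e" using e by simp
    then have "y = x" using e by blast
    then show False using \<open>dist x y = e / 2\<close> e by simp
  qed
qed

text \<open>The quotient is treated as a real Hilbert space. The complex structure survives only as
  this operator, and complex linearity becomes commutation with it.\<close>

definition iscale :: "'i::l2_index l2 \<Rightarrow> 'i l2" where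
  "iscale f = abs_l2 (\<lambda>x. \<i> * rep_l2 f x)"

lemma iscale_abs:
  assumes "f \<in> L2 (l2_measure TYPE('i::l2_index))"
  shows "iscale (abs_l2 f :: 'i l2) = abs_l2 (\<lambda>x. \<i> * f x)"
  unfolding iscale_def
  by (rule abs_l2_cong, use rep_abs_l2[OF assms] in eventually_elim, simp)

lemma bounded_linear_iscale: "bounded_linear iscale"
proof (rule bounded_linear_intro[where K = 1])
  fix x y :: "'a l2" and c
  let ?M = "l2_measure TYPE('a)"
  obtain f where f: "x = abs_l2 f" "f \<in> L2 ?M" by (cases x)
  obtain g where g: "y = abs_l2 g" "g \<in> L2 ?M" by (cases y)
  note [simp] = f g abs_l2_arith L2_add L2_mult iscale_abs
  show "iscale (x + y) = iscale x + iscale y" by (simp add: algebra_simps)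
  show "iscale (c *\<^sub>R x) = c *\<^sub>R iscale x" by (simp add: algebra_simps)
  show "norm (iscale x) \<le> norm x * 1" by (simp add: L2_norm_mult)
qed

lemma abs_l2_lincomb:
  assumes "f \<in> L2 (l2_measure TYPE('i::l2_index))" "g \<in> L2 (l2_measure TYPE('i))"
  shows "(abs_l2 (\<lambda>x. c * f x + g x) :: 'i l2)
    = Re c *\<^sub>R abs_l2 f + Im c *\<^sub>R iscale (abs_l2 f) + abs_l2 g"
proof -
  have "c * f x + g x = complex_of_real (Re c) * f x + complex_of_real (Im c) * (\<i> * f x) + g x" for x
    by (subst (1) complex_eq[of c]) (simp add: algebra_simps)
  then show ?thesis
    using assms by (simp add: iscale_abs abs_l2_arith L2_mult L2_add)
qed

subsection \<open>Semigroups on functions and on the quotient\<close>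

definition lift_semigroup ::
  "(real \<Rightarrow> (point \<Rightarrow> complex) \<Rightarrow> (point \<Rightarrow> complex)) \<Rightarrow> real \<Rightarrow> 'i::l2_index l2 \<Rightarrow> 'i l2" where
  "lift_semigroup U t x = abs_l2 (U t (rep_l2 x))"

lemma C0_semigroup_in: "C0_semigroup M U \<Longrightarrow> t \<ge> 0 \<Longrightarrow> f \<in> L2 M \<Longrightarrow> U t f \<in> L2 M"
  by (simp add: C0_semigroup_def)

lemma C0_semigroup_diff:
  assumes U: "C0_semigroup M U" and "t \<ge> 0" "f \<in> L2 M" "g \<in> L2 M"
  shows "AE x in M. U t (\<lambda>y. g y - f y) x = U t g x - U t f x"
proof -
  have "AE x in M. U t (\<lambda>y. (-1) * f y + g y) x = (-1) * U t f x + U t g x"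
    using assms unfolding C0_semigroup_def by blast
  moreover have "(\<lambda>y. (-1) * f y + g y) = (\<lambda>y. g y - f y)" by auto
  ultimately show ?thesis by simp
qed

text \<open>Boundedness sends null functions to null functions, so a semigroup on representatives
  descends to the quotient.\<close>

lemma C0_semigroup_cong_AE:
  assumes U: "C0_semigroup M U" and t: "t \<ge> 0" and fg: "f \<in> L2 M" "g \<in> L2 M" "AE x in M. f x = g x"
  shows "AE x in M. U t f x = U t g x"
proof -
  obtain C where C: "\<forall>f\<in>L2 M. L2_norm M (U t f) \<le> C * L2_norm M f"
    using U t unfolding C0_semigroup_def by blast
  have d: "(\<lambda>x. g x - f x) \<in> L2 M" using fg by (intro L2_diff)
  have "L2_norm M (\<lambda>x. g x - f x) = 0"
    using fg by (subst L2_norm_eq_0_iff[OF d]) auto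
  then have "L2_norm M (U t (\<lambda>x. g x - f x)) \<le> 0" using C d by fastforce
  then have "AE x in M. U t (\<lambda>x. g x - f x) x = 0"
    using L2_norm_eq_0_iff[OF C0_semigroup_in[OF U t d]] by (simp add: antisym)
  with C0_semigroup_diff[OF U t fg(1,2)] show ?thesis by eventually_elim simp
qed

lemma lift_semigroup_abs:
  assumes U: "C0_semigroup (l2_measure TYPE('i::l2_index)) U" and t: "t \<ge> 0"
    and f: "f \<in> L2 (l2_measure TYPE('i))"
  shows "lift_semigroup U t (abs_l2 f :: 'i l2) = abs_l2 (U t f)"
  unfolding lift_semigroup_def
  by (subst abs_l2_eq_iff)
    (auto intro!: C0_semigroup_in[OF U t] rep_l2_in f C0_semigroup_cong_AE[OF U t] rep_abs_l2)

lemma lift_semigroup_C0: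
  assumes U: "C0_semigroup (l2_measure TYPE('i::l2_index)) U"
  shows "semigroup_C0 (lift_semigroup U :: real \<Rightarrow> 'i l2 \<Rightarrow> 'i l2)"
  unfolding semigroup_C0_def
proof (intro conjI allI impI)
  let ?M = "l2_measure TYPE('i)"
  note U' = U[unfolded C0_semigroup_def]
  note inL2 = C0_semigroup_in[OF U _ rep_l2_in]
  have lincomb: "lift_semigroup U t (abs_l2 (\<lambda>y. c * rep_l2 x y + rep_l2 z y))
      = (abs_l2 (\<lambda>y. c * U t (rep_l2 x) y + U t (rep_l2 z) y) :: 'i l2)"
    if t: "t \<ge> 0" for t c and x z :: "'i l2"
  proof -
    have "AE y in ?M. U t (\<lambda>y. c * rep_l2 x y + rep_l2 z y) y = c * U t (rep_l2 x) y + U t (rep_l2 z) y"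
      using U' t rep_l2_in[of x] rep_l2_in[of z] by blast
    then show ?thesis
      unfolding lift_semigroup_abs[OF U t L2_lincomb[OF rep_l2_in rep_l2_in]] by (rule abs_l2_cong)
  qed
  have abs_eq: "abs_l2 (\<lambda>y. complex_of_real c * rep_l2 x y + rep_l2 z y) = c *\<^sub>R x + (z :: 'i l2)" for c x z
    using abs_l2_lincomb[OF rep_l2_in rep_l2_in, of "complex_of_real c" x z] by simp
  have lin: "lift_semigroup U t (c *\<^sub>R x + z) = c *\<^sub>R lift_semigroup U t x + lift_semigroup U t (z :: 'i l2)"
    if t: "t \<ge> 0" for t c x z
    using lincomb[OF t, of "complex_of_real c" x z]
      abs_l2_lincomb[OF inL2[OF t] inL2[OF t], of "complex_of_real c" x z]
    by (simp add: abs_eq lift_semigroup_def)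
  show "bounded_linear (lift_semigroup U t :: 'i l2 \<Rightarrow> 'i l2)" if t: "t \<ge> 0" for t
  proof -
    obtain C where C: "\<forall>f\<in>L2 ?M. L2_norm ?M (U t f) \<le> C * L2_norm ?M f" using U' t by blast
    have zero: "lift_semigroup U t (0 :: 'i l2) = 0" using lin[OF t, of 1 0 0] by simp
    show ?thesis
    proof (rule bounded_linear_intro[where K = C])
      show "lift_semigroup U t (x + y :: 'i l2) = lift_semigroup U t x + lift_semigroup U t y" for x y
        using lin[OF t, of 1 x y] by simp
      show "lift_semigroup U t (c *\<^sub>R x :: 'i l2) = c *\<^sub>R lift_semigroup U t x" for c x
        using lin[OF t, of c x 0] zero by simp
      show "norm (lift_semigroup U t (x :: 'i l2)) \<le> norm x * C" for x
        using C rep_l2_in[of x] abs_l2_arith(5)[OF inL2[OF t], of x]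
        by (simp add: lift_semigroup_def norm_eq_L2_norm[of x] mult.commute)
    qed
  qed
  show "lift_semigroup U 0 x = (x :: 'i l2)" for x
  proof -
    have "abs_l2 (U 0 (rep_l2 x)) = (abs_l2 (rep_l2 x) :: 'i l2)"
      using U' rep_l2_in[of x] by (intro abs_l2_cong) blast
    then show ?thesis by (simp add: lift_semigroup_def)
  qed
  show "lift_semigroup U (s + t) x = lift_semigroup U s (lift_semigroup U t (x :: 'i l2))"
    if "s \<ge> 0" "t \<ge> 0" for s t x
  proof -
    have "lift_semigroup U s (lift_semigroup U t x) = (abs_l2 (U s (U t (rep_l2 x))) :: 'i l2)"
      unfolding lift_semigroup_def[of U t x] using that by (intro lift_semigroup_abs[OF U] inL2)
    also have "\<dots> = abs_l2 (U (s + t) (rep_l2 x))"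
    proof (rule abs_l2_cong)
      have "AE y in ?M. U (s + t) (rep_l2 x) y = U s (U t (rep_l2 x)) y"
        using U' rep_l2_in[of x] that by blast
      then show "AE y in ?M. U s (U t (rep_l2 x)) y = U (s + t) (rep_l2 x) y" by eventually_elim simp
    qed
    finally show ?thesis by (simp add: lift_semigroup_def)
  qed
  show "((\<lambda>t. lift_semigroup U t x) \<longlongrightarrow> (x :: 'i l2)) (at_right 0)" for x
  proof -
    have "((\<lambda>t. L2_norm ?M (\<lambda>y. U t (rep_l2 x) y - rep_l2 x y)) \<longlongrightarrow> 0) (at_right 0)"
      using U' rep_l2_in[of x] by blast
    moreover have "\<forall>\<^sub>F t in at_right 0. L2_norm ?M (\<lambda>y. U t (rep_l2 x) y - rep_l2 x y)
        = norm (lift_semigroup U t x - x)"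
    proof (rule eventually_mono[OF eventually_at_right_less])
      fix t :: real assume "0 < t"
      then have t: "t \<ge> 0" by simp
      show "L2_norm ?M (\<lambda>y. U t (rep_l2 x) y - rep_l2 x y) = norm (lift_semigroup U t x - x)"
        using abs_l2_arith(2)[OF inL2[OF t] rep_l2_in, of x x]
          abs_l2_arith(5)[OF L2_diff[OF inL2[OF t] rep_l2_in], of x x]
        by (simp add: lift_semigroup_def)
    qed
    ultimately have "((\<lambda>t. norm (lift_semigroup U t x - x)) \<longlongrightarrow> 0) (at_right 0)"
      by (rule Lim_transform_eventually)
    then show ?thesis by (simp only: tendsto_norm_zero_iff LIM_zero_iff)
  qed
qed

text \<open>\<open>U\<close> and \<open>V\<close> merely correspond under the quotient map. Thus the
  lemma serves both to lift a given semigroup and to bring down the one constructed on the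
  quotient.\<close>

lemma lift_semigroup_generator:
  assumes inL2: "\<And>t f. t \<ge> 0 \<Longrightarrow> f \<in> L2 (l2_measure TYPE('i::l2_index)) \<Longrightarrow> U t f \<in> L2 (l2_measure TYPE('i))"
    and abs: "\<And>t f. t \<ge> 0 \<Longrightarrow> f \<in> L2 (l2_measure TYPE('i)) \<Longrightarrow> V t (abs_l2 f :: 'i l2) = abs_l2 (U t f)"
    and f: "f \<in> L2 (l2_measure TYPE('i))" and h: "h \<in> L2 (l2_measure TYPE('i))"
  shows "(abs_l2 f, abs_l2 h) \<in> semigroup_generator V \<longleftrightarrow> (f, h) \<in> C0_generator (l2_measure TYPE('i)) U"
proof -
  let ?M = "l2_measure TYPE('i)"
  have ev: "\<forall>\<^sub>F t in at_right 0. L2_norm ?M (\<lambda>x. (U t f x - f x) / of_real t - h x)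
      = norm ((V t (abs_l2 f) - abs_l2 f) /\<^sub>R t - abs_l2 h)"
  proof (rule eventually_mono[OF eventually_at_right_less])
    fix t :: real assume "0 < t"
    then have t: "t \<ge> 0" by simp
    note Uf = inL2[OF t f]
    have d: "(\<lambda>x. U t f x - f x) \<in> L2 ?M" using Uf f by (intro L2_diff)
    have s: "(\<lambda>x. complex_of_real (inverse t) * (U t f x - f x)) \<in> L2 ?M" using d by (rule L2_mult)
    have "(V t (abs_l2 f) - abs_l2 f) /\<^sub>R t - abs_l2 h
        = (abs_l2 (\<lambda>x. complex_of_real (inverse t) * (U t f x - f x) - h x) :: 'i l2)"
      using abs_l2_arith(2)[OF s h]
      by (simp add: abs[OF t f] abs_l2_diff[OF Uf f] abs_l2_scaleR[OF d] del: of_real_inverse)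
    then show "L2_norm ?M (\<lambda>x. (U t f x - f x) / of_real t - h x)
      = norm ((V t (abs_l2 f) - abs_l2 f) /\<^sub>R t - abs_l2 h)"
      using abs_l2_arith(5)[OF L2_diff[OF s h]] by (simp add: field_simps)
  qed
  have "(abs_l2 f, abs_l2 h) \<in> semigroup_generator V
      \<longleftrightarrow> ((\<lambda>t. norm ((V t (abs_l2 f) - abs_l2 f) /\<^sub>R t - abs_l2 h)) \<longlongrightarrow> 0) (at_right 0)"
    unfolding semigroup_generator_def mem_Collect_eq prod.case
    by (simp only: tendsto_norm_zero_iff LIM_zero_iff)
  also have "\<dots> \<longleftrightarrow> (f, h) \<in> C0_generator ?M U"
    unfolding C0_generator_def using f h filterlim_cong[OF refl refl ev] by simp
  finally show ?thesis .
qed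

subsection \<open>Closed sesquilinear forms\<close>

text \<open>The fourth condition makes domain and form independent of representatives, the last one
  expresses density through orthogonality, and the one before it is closedness as completeness in
  the form norm.\<close>

definition closed_form ::
  "'a measure \<Rightarrow> ('a \<Rightarrow> complex) set \<Rightarrow> (('a \<Rightarrow> complex) \<Rightarrow> ('a \<Rightarrow> complex) \<Rightarrow> complex) \<Rightarrow> bool" where
  "closed_form M V a \<longleftrightarrow>
     V \<subseteq> L2 M \<and> (\<lambda>_. 0) \<in> V \<and> (\<forall>f\<in>V. \<forall>g\<in>V. \<forall>c. (\<lambda>x. c * f x + g x) \<in> V) \<and>
     (\<forall>f\<in>V. \<forall>g\<in>L2 M. (AE x in M. f x = g x) \<longrightarrow> g \<in> V \<and> (\<forall>h\<in>V. a g h = a f h)) \<and>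
     (\<forall>f\<in>V. \<forall>g\<in>V. \<forall>h\<in>V. \<forall>c. a (\<lambda>x. c * f x + g x) h = c * a f h + a g h) \<and>
     (\<forall>f\<in>V. \<forall>g\<in>V. a g f = cnj (a f g)) \<and> (\<forall>f\<in>V. 0 \<le> Re (a f f)) \<and>
     (\<forall>F. (\<forall>n::nat. F n \<in> V) \<longrightarrow>
        (\<forall>e>0. \<exists>N. \<forall>m\<ge>N. \<forall>n\<ge>N. (L2_norm M (\<lambda>x. F m x - F n x))\<^sup>2
           + Re (a (\<lambda>x. F m x - F n x) (\<lambda>x. F m x - F n x)) < e) \<longrightarrow>
        (\<exists>f\<in>V. (\<lambda>n. (L2_norm M (\<lambda>x. F n x - f x))\<^sup>2
           + Re (a (\<lambda>x. F n x - f x) (\<lambda>x. F n x - f x))) \<longlonglongrightarrow> 0)) \<and>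
     (\<forall>g\<in>L2 M. (\<forall>f\<in>V. L2_inner M g f = 0) \<longrightarrow> (AE x in M. g x = 0))"

definition form_operator ::
  "'a measure \<Rightarrow> ('a \<Rightarrow> complex) set \<Rightarrow> (('a \<Rightarrow> complex) \<Rightarrow> ('a \<Rightarrow> complex) \<Rightarrow> complex) \<Rightarrow>
    (('a \<Rightarrow> complex) \<times> ('a \<Rightarrow> complex)) set" where
  "form_operator M V a =
     {(f, h). f \<in> V \<and> h \<in> L2 M \<and> (\<forall>g\<in>V. a f g = L2_inner M (\<lambda>x. - h x) g)}"

lemma closed_formD:
  assumes "closed_form M V a"
  shows closed_form_L2: "f \<in> V \<Longrightarrow> f \<in> L2 M"
    and closed_form_zero: "(\<lambda>_. 0) \<in> V"
    and closed_form_lincomb: "f \<in> V \<Longrightarrow> g \<in> V \<Longrightarrow> (\<lambda>x. c * f x + g x) \<in> V"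
    and closed_form_AE: "f \<in> V \<Longrightarrow> g \<in> L2 M \<Longrightarrow> (AE x in M. f x = g x) \<Longrightarrow> g \<in> V"
    and closed_form_cong: "f \<in> V \<Longrightarrow> g \<in> L2 M \<Longrightarrow> (AE x in M. f x = g x) \<Longrightarrow> h \<in> V \<Longrightarrow> a g h = a f h"
    and closed_form_linear: "f \<in> V \<Longrightarrow> g \<in> V \<Longrightarrow> h \<in> V \<Longrightarrow> a (\<lambda>x. c * f x + g x) h = c * a f h + a g h"
    and closed_form_hermitian: "f \<in> V \<Longrightarrow> g \<in> V \<Longrightarrow> a g f = cnj (a f g)"
    and closed_form_nonneg: "f \<in> V \<Longrightarrow> 0 \<le> Re (a f f)"
    and closed_form_complete: "(\<And>n. F n \<in> V) \<Longrightarrow>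
        (\<And>e. e > 0 \<Longrightarrow> \<exists>N. \<forall>m\<ge>N. \<forall>n\<ge>N. (L2_norm M (\<lambda>x. F m x - F n x))\<^sup>2
           + Re (a (\<lambda>x. F m x - F n x) (\<lambda>x. F m x - F n x)) < e) \<Longrightarrow>
        \<exists>f\<in>V. (\<lambda>n. (L2_norm M (\<lambda>x. F n x - f x))\<^sup>2
           + Re (a (\<lambda>x. F n x - f x) (\<lambda>x. F n x - f x))) \<longlonglongrightarrow> 0"
    and closed_form_orthogonal: "g \<in> L2 M \<Longrightarrow> (\<And>f. f \<in> V \<Longrightarrow> L2_inner M g f = 0) \<Longrightarrow> AE x in M. g x = 0"
  using assms unfolding closed_form_def by blast+

lemma closed_form_diff: "closed_form M V a \<Longrightarrow> f \<in> V \<Longrightarrow> g \<in> V \<Longrightarrow> (\<lambda>x. f x - g x) \<in> V"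
  using closed_form_lincomb[of M V a g f "-1"] by simp

lemma closed_form_mult: "closed_form M V a \<Longrightarrow> f \<in> V \<Longrightarrow> (\<lambda>x. c * f x) \<in> V"
  using closed_form_lincomb[of M V a f "\<lambda>_. 0" c] closed_form_zero[of M V a] by simp

lemma closed_form_scale_left:
  assumes "closed_form M V a" "f \<in> V" "h \<in> V"
  shows "a (\<lambda>x. c * f x) h = c * a f h"
proof -
  have z: "(\<lambda>_. 0) \<in> V" using assms(1) by (rule closed_form_zero)
  have "a (\<lambda>_. 0) h = 0"
    using closed_form_linear[OF assms(1) z z assms(3), of 1] by simp
  then show ?thesis using closed_form_linear[OF assms(1,2) z assms(3), of c] by simp
qed

lemma L2_inner_mult_left: "L2_inner M (\<lambda>x. c * f x) h = c * L2_inner M f h"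
  by (simp add: L2_inner_def mult.assoc)

lemma L2_inner_mult_right: "L2_inner M f (\<lambda>x. c * h x) = cnj c * L2_inner M f h"
  by (simp add: L2_inner_def mult.left_commute)

lemma L2_inner_uminus_left: "L2_inner M (\<lambda>x. - f x) h = - L2_inner M f h"
  by (simp add: L2_inner_def)

context
  fixes V :: "(point \<Rightarrow> complex) set" and a :: "(point \<Rightarrow> complex) \<Rightarrow> (point \<Rightarrow> complex) \<Rightarrow> complex"
  assumes cf: "closed_form (l2_measure TYPE('i::l2_index)) V a"
begin

text \<open>Passing to the real part loses nothing: the domain is closed under multiplication by the
  imaginary unit, and testing with i g recovers the imaginary part.\<close>

interpretation lifted: dense_hilbert_form "abs_l2 ` V :: 'i l2 set" "\<lambda>x y. Re (a (rep_l2 x) (rep_l2 y))"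
proof
  let ?M = "l2_measure TYPE('i)"
  let ?V = "abs_l2 ` V :: 'i l2 set"
  let ?q = "\<lambda>x y :: 'i l2. Re (a (rep_l2 x) (rep_l2 y))"
  note VL2 = closed_form_L2[OF cf]
  have repV: "rep_l2 (abs_l2 f :: 'i l2) \<in> V" if "f \<in> V" for f
    by (rule closed_form_AE[OF cf that rep_l2_in]) (use rep_abs_l2[OF VL2[OF that]] in \<open>eventually_elim, simp\<close>)
  have repV': "rep_l2 x \<in> V" if "x \<in> ?V" for x using that repV by auto
  have absV: "abs_l2 f \<in> ?V" if "f \<in> V" for f using that by simp
  have a_left: "a (rep_l2 (abs_l2 f :: 'i l2)) h = a f h" if "f \<in> V" "h \<in> V" for f h
    by (rule closed_form_cong[OF cf that(1) rep_l2_in _ that(2)])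
      (use rep_abs_l2[OF VL2[OF that(1)]] in \<open>eventually_elim, simp\<close>)
  have a_both: "a (rep_l2 (abs_l2 f :: 'i l2)) (rep_l2 (abs_l2 h :: 'i l2)) = a f h" if "f \<in> V" "h \<in> V" for f h
    using a_left[OF that(1) repV[OF that(2)]] a_left[OF that(2,1)]
      closed_form_hermitian[OF cf that(1) repV[OF that(2)]] closed_form_hermitian[OF cf that]
    by simp
  have lin: "abs_l2 (\<lambda>t. complex_of_real c * rep_l2 x t + rep_l2 y t) = c *\<^sub>R x + (y :: 'i l2)" for c x y
    using abs_l2_lincomb[OF rep_l2_in rep_l2_in, of "complex_of_real c" x y] by simp
  have linV: "c *\<^sub>R x + y \<in> ?V" if "x \<in> ?V" "y \<in> ?V" for c and x y :: "'i l2"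
    unfolding lin[symmetric] by (intro absV closed_form_lincomb[OF cf] repV' that)
  have zeroV: "0 \<in> ?V" unfolding zero_l2_def by (intro absV closed_form_zero[OF cf])
  have q_lin: "?q (c *\<^sub>R x + y) z = c * ?q x z + ?q y z" if "x \<in> ?V" "y \<in> ?V" "z \<in> ?V" for c x y z
    unfolding lin[symmetric]
    using a_left[OF closed_form_lincomb[OF cf repV'[OF that(1)] repV'[OF that(2)]] repV'[OF that(3)],
        of "complex_of_real c"]
      closed_form_linear[OF cf repV'[OF that(1)] repV'[OF that(2)] repV'[OF that(3)], of "complex_of_real c"]
    by simp
  show "subspace ?V"
    unfolding subspace_def using zeroV linV[of _ _ 1] linV[OF _ zeroV] by simp
  fix x y z :: "'i l2" and c
  show "?q (x + y) z = ?q x z + ?q y z" if "x \<in> ?V" "y \<in> ?V" "z \<in> ?V"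
    using q_lin[OF that, of 1] by simp
  show "?q (c *\<^sub>R x) z = c * ?q x z" if "x \<in> ?V" "z \<in> ?V"
    using q_lin[OF that(1) zeroV that(2), of c] q_lin[OF zeroV zeroV that(2), of 1] by simp
  show "?q x y = ?q y x" if "x \<in> ?V" "y \<in> ?V"
    using closed_form_hermitian[OF cf repV'[OF that(1)] repV'[OF that(2)]] by simp
  show "0 \<le> ?q x x" if "x \<in> ?V"
    using closed_form_nonneg[OF cf repV'[OF that]] .
  show "x = 0" if orth: "\<And>f. f \<in> ?V \<Longrightarrow> inner x f = 0"
  proof -
    have "L2_inner ?M (rep_l2 x) f = 0" if f: "f \<in> V" for f
    proof -
      have r: "Re (L2_inner ?M (rep_l2 x) g) = 0" if "g \<in> V" for g
        using orth[OF absV[OF that]] abs_l2_inner[OF rep_l2_in VL2[OF that], of x] by simp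
      \<comment> \<open>Real orthogonality to i f is orthogonality of the imaginary part to
        f.\<close>
      have "Im (L2_inner ?M (rep_l2 x) f) = 0"
        using r[OF closed_form_mult[OF cf f, of \<i>]] by (simp add: L2_inner_mult_right)
      then show ?thesis using r[OF f] by (simp add: complex_eq_iff)
    qed
    then have "AE t in ?M. rep_l2 x t = 0" by (rule closed_form_orthogonal[OF cf rep_l2_in])
    then have "abs_l2 (rep_l2 x) = (abs_l2 (\<lambda>_. 0) :: 'i l2)" by (rule abs_l2_cong)
    then show ?thesis by (simp add: zero_l2_def)
  qed
  fix X :: "nat \<Rightarrow> 'i l2"
  assume X: "\<And>n. X n \<in> ?V"
    and cau: "\<And>e. e > 0 \<Longrightarrow> \<exists>N. \<forall>m\<ge>N. \<forall>n\<ge>N. (norm (X m - X n))\<^sup>2 + ?q (X m - X n) (X m - X n) < e"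
  have eq: "(norm (X m - abs_l2 g))\<^sup>2 + ?q (X m - abs_l2 g) (X m - abs_l2 g)
      = (L2_norm ?M (\<lambda>x. rep_l2 (X m) x - g x))\<^sup>2
        + Re (a (\<lambda>x. rep_l2 (X m) x - g x) (\<lambda>x. rep_l2 (X m) x - g x))" if g: "g \<in> V" for m g
  proof -
    have d: "(\<lambda>x. rep_l2 (X m) x - g x) \<in> V" by (intro closed_form_diff[OF cf] repV' X g)
    have "X m - abs_l2 g = abs_l2 (\<lambda>x. rep_l2 (X m) x - g x)"
      using abs_l2_diff[OF rep_l2_in VL2[OF g], of "X m"] by (simp only: abs_rep_l2)
    then show ?thesis using a_both[OF d d] abs_l2_norm[OF VL2[OF d]] by simp
  qed
  have "\<exists>f\<in>V. (\<lambda>n. (L2_norm ?M (\<lambda>x. rep_l2 (X n) x - f x))\<^sup>2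
           + Re (a (\<lambda>x. rep_l2 (X n) x - f x) (\<lambda>x. rep_l2 (X n) x - f x))) \<longlonglongrightarrow> 0"
  proof (rule closed_form_complete[OF cf])
    show "rep_l2 (X n) \<in> V" for n by (intro repV' X)
    show "\<exists>N. \<forall>m\<ge>N. \<forall>n\<ge>N. (L2_norm ?M (\<lambda>x. rep_l2 (X m) x - rep_l2 (X n) x))\<^sup>2
           + Re (a (\<lambda>x. rep_l2 (X m) x - rep_l2 (X n) x) (\<lambda>x. rep_l2 (X m) x - rep_l2 (X n) x)) < e"
      if "e > 0" for e
      using cau[OF that] eq[OF repV'[OF X]] by (simp only: abs_rep_l2)
  qed
  then obtain f where f: "f \<in> V" and lim: "(\<lambda>n. (L2_norm ?M (\<lambda>x. rep_l2 (X n) x - f x))\<^sup>2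
           + Re (a (\<lambda>x. rep_l2 (X n) x - f x) (\<lambda>x. rep_l2 (X n) x - f x))) \<longlonglongrightarrow> 0" by blast
  have "(\<lambda>n. (norm (X n - abs_l2 f))\<^sup>2 + ?q (X n - abs_l2 f) (X n - abs_l2 f)) \<longlonglongrightarrow> 0"
    using lim by (simp only: eq[OF f])
  then show "\<exists>x\<in>?V. (\<lambda>n. (norm (X n - x))\<^sup>2 + ?q (X n - x) (X n - x)) \<longlonglongrightarrow> 0"
    using absV[OF f] by blast
qed

text \<open>The graph of the real form consists of the pairs that satisfy the real part of the
  complex identity; replacing g by i g supplies the imaginary part.\<close>

lemma form_graph_abs_iff:
  assumes f: "f \<in> L2 (l2_measure TYPE('i))" and h: "h \<in> L2 (l2_measure TYPE('i))"
  shows "(abs_l2 f, abs_l2 h) \<in> lifted.form_graph \<longleftrightarrow> (f, h) \<in> form_operator (l2_measure TYPE('i)) V a"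
proof -
  let ?M = "l2_measure TYPE('i)"
  note VL2 = closed_form_L2[OF cf]
  have fV: "f \<in> V" if "(abs_l2 f :: 'i l2) \<in> abs_l2 ` V"
  proof -
    obtain g where g: "g \<in> V" "(abs_l2 f :: 'i l2) = abs_l2 g" using \<open>abs_l2 f \<in> abs_l2 ` V\<close> by blast
    then have "AE x in ?M. f x = g x" using abs_l2_eq_iff[OF f VL2[OF g(1)]] by blast
    then have "AE x in ?M. g x = f x" by eventually_elim simp
    then show ?thesis by (rule closed_form_AE[OF cf g(1) f])
  qed
  have repV: "rep_l2 (abs_l2 f :: 'i l2) \<in> V" if "f \<in> V" for f
    by (rule closed_form_AE[OF cf that rep_l2_in]) (use rep_abs_l2[OF VL2[OF that]] in \<open>eventually_elim, simp\<close>)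
  have a_left: "a (rep_l2 (abs_l2 f :: 'i l2)) h = a f h" if "f \<in> V" "h \<in> V" for f h
    by (rule closed_form_cong[OF cf that(1) rep_l2_in _ that(2)])
      (use rep_abs_l2[OF VL2[OF that(1)]] in \<open>eventually_elim, simp\<close>)
  have a_both: "a (rep_l2 (abs_l2 f :: 'i l2)) (rep_l2 (abs_l2 h :: 'i l2)) = a f h" if "f \<in> V" "h \<in> V" for f h
    using a_left[OF that(1) repV[OF that(2)]] a_left[OF that(2,1)]
      closed_form_hermitian[OF cf that(1) repV[OF that(2)]] closed_form_hermitian[OF cf that]
    by simp
  have inner_eq: "inner (abs_l2 h :: 'i l2) (abs_l2 g) = Re (L2_inner ?M h g)" if "g \<in> V" for g
    by (rule abs_l2_inner[OF h VL2[OF that]])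
  have mem: "(abs_l2 f :: 'i l2) \<in> abs_l2 ` V \<longleftrightarrow> f \<in> V" using fV by blast
  have "(abs_l2 f, abs_l2 h) \<in> lifted.form_graph \<longleftrightarrow> f \<in> V \<and>
      (\<forall>g\<in>V. Re (a (rep_l2 (abs_l2 f :: 'i l2)) (rep_l2 (abs_l2 g :: 'i l2))) = - inner (abs_l2 h :: 'i l2) (abs_l2 g))"
    unfolding lifted.form_graph_def mem_Collect_eq prod.case mem by (simp add: ball_simps)
  also have "\<dots> \<longleftrightarrow> f \<in> V \<and> (\<forall>g\<in>V. Re (a f g) = - Re (L2_inner ?M h g))"
    by (intro conj_cong refl ball_cong) (simp add: a_both inner_eq)
  also have "\<dots> \<longleftrightarrow> f \<in> V \<and> (\<forall>g\<in>V. a f g = - L2_inner ?M h g)"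
  proof (intro conj_cong refl iffI ballI)
    fix g assume fV: "f \<in> V" and re: "\<forall>g\<in>V. Re (a f g) = - Re (L2_inner ?M h g)" and g: "g \<in> V"
    have ig: "(\<lambda>x. \<i> * g x) \<in> V" by (rule closed_form_mult[OF cf g])
    have "a f (\<lambda>x. \<i> * g x) = cnj (a (\<lambda>x. \<i> * g x) f)" by (rule closed_form_hermitian[OF cf ig fV])
    also have "\<dots> = - \<i> * a f g"
      using closed_form_scale_left[OF cf g fV, of \<i>] closed_form_hermitian[OF cf g fV] by simp
    finally have "Im (a f g) = - Im (L2_inner ?M h g)"
      using re[rule_format, OF ig] by (simp add: L2_inner_mult_right)
    then show "a f g = - L2_inner ?M h g" using re[rule_format, OF g] by (simp add: complex_eq_iff)
  qed simp
  also have "\<dots> \<longleftrightarrow> (f, h) \<in> form_operator ?M V a"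
    unfolding form_operator_def using h by (auto simp: L2_inner_uminus_left)
  finally show ?thesis .
qed

lemma form_operator_lifted_semigroup:
  assumes inL2: "\<And>t f. t \<ge> 0 \<Longrightarrow> f \<in> L2 (l2_measure TYPE('i)) \<Longrightarrow> U t f \<in> L2 (l2_measure TYPE('i))"
    and abs: "\<And>t f. t \<ge> 0 \<Longrightarrow> f \<in> L2 (l2_measure TYPE('i)) \<Longrightarrow> W t (abs_l2 f :: 'i l2) = abs_l2 (U t f)"
  shows "C0_generator (l2_measure TYPE('i)) U = form_operator (l2_measure TYPE('i)) V a
    \<longleftrightarrow> semigroup_generator W = lifted.form_graph"
proof
  let ?M = "l2_measure TYPE('i)"
  have gen: "(abs_l2 f, abs_l2 h) \<in> semigroup_generator W \<longleftrightarrow> (f, h) \<in> C0_generator ?M U"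
    if "f \<in> L2 ?M" "h \<in> L2 ?M" for f h
    using inL2 abs that by (rule lift_semigroup_generator)
  assume eq: "C0_generator ?M U = form_operator ?M V a"
  show "semigroup_generator W = lifted.form_graph"
  proof (intro set_eqI; clarify)
    fix x y
    show "(x, y) \<in> semigroup_generator W \<longleftrightarrow> (x, y) \<in> lifted.form_graph"
      using gen[OF rep_l2_in rep_l2_in, of x y] form_graph_abs_iff[OF rep_l2_in rep_l2_in, of x y] eq
      by simp
  qed
next
  let ?M = "l2_measure TYPE('i)"
  have gen: "(abs_l2 f, abs_l2 h) \<in> semigroup_generator W \<longleftrightarrow> (f, h) \<in> C0_generator ?M U"
    if "f \<in> L2 ?M" "h \<in> L2 ?M" for f h
    using inL2 abs that by (rule lift_semigroup_generator)
  assume eq: "semigroup_generator W = lifted.form_graph"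
  show "C0_generator ?M U = form_operator ?M V a"
  proof (intro set_eqI; clarify)
    fix f h
    show "(f, h) \<in> C0_generator ?M U \<longleftrightarrow> (f, h) \<in> form_operator ?M V a"
    proof (cases "f \<in> L2 ?M \<and> h \<in> L2 ?M")
      case True
      then show ?thesis using gen[of f h] form_graph_abs_iff[of f h] eq by simp
    next
      case False
      then show ?thesis using closed_form_L2[OF cf] by (auto simp: C0_generator_def form_operator_def)
    qed
  qed
qed

lemma lifted_form_graph_dense: "closure (Domain lifted.form_graph) = UNIV"
  by (rule lifted.form_graph_domain_dense)

lemma lifted_form_graph_dissipative: "(x, y) \<in> lifted.form_graph \<Longrightarrow> inner x y \<le> 0"
  by (rule lifted.form_graph_dissipative)

lemma C0_generator_lifted:
  assumes U: "C0_semigroup (l2_measure TYPE('i)) U"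
    and gen: "C0_generator (l2_measure TYPE('i)) U = form_operator (l2_measure TYPE('i)) V a"
  shows "semigroup_generator (lift_semigroup U :: real \<Rightarrow> 'i l2 \<Rightarrow> 'i l2) = lifted.form_graph"
  using form_operator_lifted_semigroup[of U "lift_semigroup U"] C0_semigroup_in[OF U]
    lift_semigroup_abs[OF U] gen by blast

text \<open>The intertwining theorem for the semigroup with itself and multiplication by i, which
  preserves the graph of a complex form. This restores the complex linearity that the real
  construction leaves open.\<close>

lemma lifted_evolution_iscale:
  assumes t: "t \<ge> 0"
  shows "iscale (lifted.evolution t x) = lifted.evolution t (iscale x)"
proof (rule semigroup_intertwining[OF lifted.evolution_semigroup lifted.evolution_semigroup
      bounded_linear_iscale _ _ _ t])
  let ?M = "l2_measure TYPE('i)"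
  show "closure (Domain (semigroup_generator lifted.evolution)) = UNIV"
    by (simp add: lifted.evolution_generator lifted.form_graph_domain_dense)
  show "inner x y \<le> 0" if "(x, y) \<in> semigroup_generator lifted.evolution" for x y
    using that by (simp add: lifted.evolution_generator lifted.form_graph_dissipative)
  fix x y :: "'i l2" assume "(x, y) \<in> semigroup_generator lifted.evolution"
  then have xy: "(x, y) \<in> lifted.form_graph" by (simp add: lifted.evolution_generator)
  obtain f where f: "x = abs_l2 f" "f \<in> L2 ?M" by (cases x)
  obtain h where h: "y = abs_l2 h" "h \<in> L2 ?M" by (cases y)
  have fh: "(f, h) \<in> form_operator ?M V a"
    using xy form_graph_abs_iff[OF f(2) h(2)] by (simp add: f(1) h(1))
  then have fV: "f \<in> V" and op: "\<And>g. g \<in> V \<Longrightarrow> a f g = L2_inner ?M (\<lambda>x. - h x) g"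
    by (auto simp: form_operator_def)
  have "(\<lambda>x. \<i> * f x, \<lambda>x. \<i> * h x) \<in> form_operator ?M V a"
    unfolding form_operator_def
  proof (clarsimp, intro conjI ballI)
    show "(\<lambda>x. \<i> * f x) \<in> V" by (rule closed_form_mult[OF cf fV])
    show "(\<lambda>x. \<i> * h x) \<in> L2 ?M" by (rule L2_mult[OF h(2)])
    fix g assume g: "g \<in> V"
    show "a (\<lambda>x. \<i> * f x) g = L2_inner ?M (\<lambda>x. - (\<i> * h x)) g"
      using closed_form_scale_left[OF cf fV g, of \<i>] op[OF g]
      by (simp add: L2_inner_uminus_left L2_inner_mult_left)
  qed
  then have "(abs_l2 (\<lambda>x. \<i> * f x), abs_l2 (\<lambda>x. \<i> * h x)) \<in> lifted.form_graph"
    using form_graph_abs_iff[OF L2_mult[OF f(2)] L2_mult[OF h(2)]] by blast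
  then show "(iscale x, iscale y) \<in> semigroup_generator lifted.evolution"
    by (simp add: lifted.evolution_generator f(1) h(1) iscale_abs[OF f(2)] iscale_abs[OF h(2)])
qed

lemma lifted_generation:
  "\<exists>U. C0_semigroup (l2_measure TYPE('i)) U \<and>
     C0_generator (l2_measure TYPE('i)) U = form_operator (l2_measure TYPE('i)) V a"
proof -
  let ?M = "l2_measure TYPE('i)"
  define W where "W = lifted.evolution"
  define U where "U = (\<lambda>t f. rep_l2 (W t (abs_l2 f)))"
  have U_in: "U t f \<in> L2 ?M" for t f unfolding U_def by (rule rep_l2_in)
  have U_abs: "abs_l2 (U t f) = W t (abs_l2 f)" for t f by (simp add: U_def)
  have Weq: "AE x in ?M. U t f x = g x" if "W t (abs_l2 f) = abs_l2 g" "g \<in> L2 ?M" for t f g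
    using rep_abs_l2[OF that(2)] by (simp add: U_def that(1))
  have W: "semigroup_C0 W" unfolding W_def by (rule lifted.evolution_semigroup)
  have W_lin: "bounded_linear (W t)" if "t \<ge> 0" for t using W that by (simp add: semigroup_C0_def)
  have C0: "C0_semigroup ?M U"
    unfolding C0_semigroup_def
  proof (intro conjI allI impI ballI)
    fix t :: real and f g c assume t: "0 \<le> t" and f: "f \<in> L2 ?M" and g: "g \<in> L2 ?M"
    interpret bounded_linear "W t" by (rule W_lin[OF t])
    show "AE x in ?M. U t (\<lambda>y. c * f y + g y) x = c * U t f x + U t g x"
    proof (rule Weq)
      have "W t (abs_l2 (\<lambda>y. c * f y + g y))
          = Re c *\<^sub>R W t (abs_l2 f) + Im c *\<^sub>R iscale (W t (abs_l2 f)) + W t (abs_l2 g)"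
        using lifted_evolution_iscale[OF t, of "abs_l2 f"]
        by (simp add: abs_l2_lincomb[OF f g] add scaleR flip: W_def)
      also have "\<dots> = abs_l2 (\<lambda>x. c * U t f x + U t g x)"
        by (simp add: abs_l2_lincomb[OF U_in U_in] U_abs)
      finally show "W t (abs_l2 (\<lambda>y. c * f y + g y)) = abs_l2 (\<lambda>x. c * U t f x + U t g x)" .
    qed (intro L2_lincomb U_in)
  next
    fix t :: real assume t: "0 \<le> t"
    have "L2_norm ?M (U t f) \<le> 1 * L2_norm ?M f" if "f \<in> L2 ?M" for f
    proof -
      have "L2_norm ?M (U t f) = norm (W t (abs_l2 f))" by (simp add: U_def norm_l2_def)
      also have "\<dots> \<le> norm (abs_l2 f :: 'i l2)" unfolding W_def by (rule lifted.evolution_norm[OF t])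
      finally show ?thesis by (simp add: abs_l2_norm[OF that])
    qed
    then show "\<exists>C. \<forall>f\<in>L2 ?M. L2_norm ?M (U t f) \<le> C * L2_norm ?M f" by blast
  next
    fix f assume f: "f \<in> L2 ?M"
    show "AE x in ?M. U 0 f x = f x"
      using W by (intro Weq f) (simp add: semigroup_C0_def)
    show "((\<lambda>t. L2_norm ?M (\<lambda>x. U t f x - f x)) \<longlongrightarrow> 0) (at_right 0)"
    proof -
      have "L2_norm ?M (\<lambda>x. U t f x - f x) = norm (W t (abs_l2 f) - abs_l2 f)" for t
        using abs_l2_norm[OF L2_diff[OF U_in f], of t f] abs_l2_diff[OF U_in f, of t f] by (simp add: U_abs)
      then show ?thesis
        using W unfolding semigroup_C0_def by (simp add: tendsto_norm_zero LIM_zero)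
    qed
    fix s t :: real assume "0 \<le> s" "0 \<le> t"
    then have "W (s + t) (abs_l2 f) = abs_l2 (U s (U t f))"
      using W unfolding semigroup_C0_def by (simp add: U_abs)
    then show "AE x in ?M. U (s + t) f x = U s (U t f) x" by (rule Weq[OF _ U_in])
  qed (rule U_in)
  moreover have "C0_generator ?M U = form_operator ?M V a"
    using form_operator_lifted_semigroup[of U W] U_in U_abs lifted.evolution_generator
    unfolding W_def by auto
  ultimately show ?thesis by blast
qed

end

section \<open>Transfer from the index types to arbitrary measures\<close>

definition generation_property :: "'a measure \<Rightarrow> bool" where
  "generation_property M \<longleftrightarrow>
     (\<forall>V a. closed_form M V a \<longrightarrow> (\<exists>U. C0_semigroup M U \<and> C0_generator M U = form_operator M V a))"

definition intertwining_property :: "'a measure \<Rightarrow> 'b measure \<Rightarrow> bool" where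
  "intertwining_property M N \<longleftrightarrow>
     (\<forall>V a W b U S R.
        closed_form M V a \<longrightarrow> C0_semigroup M U \<longrightarrow> C0_generator M U = form_operator M V a \<longrightarrow>
        closed_form N W b \<longrightarrow> C0_semigroup N S \<longrightarrow> C0_generator N S = form_operator N W b \<longrightarrow>
        (\<forall>f\<in>L2 M. R f \<in> L2 N) \<longrightarrow>
        (\<forall>f\<in>L2 M. \<forall>g\<in>L2 M. \<forall>c. AE x in N. R (\<lambda>y. c * f y + g y) x = c * R f x + R g x) \<longrightarrow>
        (\<exists>C. \<forall>f\<in>L2 M. L2_norm N (R f) \<le> C * L2_norm M f) \<longrightarrow>
        (\<forall>(f, h)\<in>form_operator M V a. (R f, R h) \<in> form_operator N W b) \<longrightarrow>
        (\<forall>t\<ge>0. \<forall>f\<in>L2 M. AE x in N. R (U t f) x = S t (R f) x))"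

lemma generation_property_l2: "generation_property (l2_measure TYPE('i::l2_index))"
  unfolding generation_property_def using lifted_generation by blast

lemma intertwining_property_l2:
  "intertwining_property (l2_measure TYPE('i::l2_index)) (l2_measure TYPE('j::l2_index))"
  unfolding intertwining_property_def
proof (intro allI impI ballI)
  let ?M = "l2_measure TYPE('i)" and ?N = "l2_measure TYPE('j)"
  fix V a W b U S R and t :: real and f
  assume cf1: "closed_form ?M V a" and U: "C0_semigroup ?M U" and gU: "C0_generator ?M U = form_operator ?M V a"
    and cf2: "closed_form ?N W b" and S: "C0_semigroup ?N S" and gS: "C0_generator ?N S = form_operator ?N W b"
    and R: "\<forall>f\<in>L2 ?M. R f \<in> L2 ?N"
    and lin: "\<forall>f\<in>L2 ?M. \<forall>g\<in>L2 ?M. \<forall>c. AE x in ?N. R (\<lambda>y. c * f y + g y) x = c * R f x + R g x"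
    and bdd: "\<exists>C. \<forall>f\<in>L2 ?M. L2_norm ?N (R f) \<le> C * L2_norm ?M f"
    and graph: "\<forall>(f, h)\<in>form_operator ?M V a. (R f, R h) \<in> form_operator ?N W b"
    and t: "0 \<le> t" and f: "f \<in> L2 ?M"
  obtain C where C: "\<And>f. f \<in> L2 ?M \<Longrightarrow> L2_norm ?N (R f) \<le> C * L2_norm ?M f" using bdd by blast
  have R_in: "R f \<in> L2 ?N" if "f \<in> L2 ?M" for f using R that by blast
  have R_cong: "AE x in ?N. R f x = R g x" if fg: "f \<in> L2 ?M" "g \<in> L2 ?M" "AE x in ?M. f x = g x" for f g
  proof -
    have d: "(\<lambda>x. (-1) * g x + f x) \<in> L2 ?M" using fg by (intro L2_lincomb)
    have "L2_norm ?M (\<lambda>x. (-1) * g x + f x) = 0"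
      using fg by (subst L2_norm_eq_0_iff[OF d]) auto
    then have "L2_norm ?N (R (\<lambda>x. (-1) * g x + f x)) \<le> 0" using C[OF d] by simp
    then have "L2_norm ?N (R (\<lambda>x. (-1) * g x + f x)) = 0" by (simp add: antisym)
    then have "AE x in ?N. R (\<lambda>x. (-1) * g x + f x) x = 0"
      by (simp only: L2_norm_eq_0_iff[OF R_in[OF d]])
    moreover have "AE x in ?N. R (\<lambda>y. (-1) * g y + f y) x = (-1) * R g x + R f x" using lin fg by blast
    ultimately show ?thesis by eventually_elim simp
  qed
  define Q where "Q = (\<lambda>x :: 'i l2. abs_l2 (R (rep_l2 x)) :: 'j l2)"
  have Q_abs: "Q (abs_l2 g) = abs_l2 (R g)" if g: "g \<in> L2 ?M" for g
    unfolding Q_def by (rule abs_l2_cong) (rule R_cong[OF rep_l2_in g rep_abs_l2[OF g]])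
  have Q_lin: "Q (c *\<^sub>R x + y) = c *\<^sub>R Q x + Q y" for c x y
  proof -
    have "c *\<^sub>R x + y = abs_l2 (\<lambda>z. complex_of_real c * rep_l2 x z + rep_l2 y z)"
      using abs_l2_lincomb[OF rep_l2_in rep_l2_in, of "complex_of_real c" x y] by simp
    then have "Q (c *\<^sub>R x + y) = abs_l2 (R (\<lambda>z. complex_of_real c * rep_l2 x z + rep_l2 y z))"
      using Q_abs[OF L2_lincomb[OF rep_l2_in rep_l2_in]] by simp
    also have "\<dots> = abs_l2 (\<lambda>z. complex_of_real c * R (rep_l2 x) z + R (rep_l2 y) z)"
      using lin rep_l2_in[of x] rep_l2_in[of y] by (intro abs_l2_cong) blast
    also have "\<dots> = c *\<^sub>R Q x + Q y"
      using abs_l2_lincomb[OF R_in[OF rep_l2_in] R_in[OF rep_l2_in], of "complex_of_real c" x y] by (simp add: Q_def)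
    finally show ?thesis .
  qed
  have Q_zero: "Q 0 = 0" using Q_lin[of 1 0 0] by simp
  have Q_bl: "bounded_linear Q"
  proof (rule bounded_linear_intro[where K = C])
    show "Q (x + y) = Q x + Q y" for x y using Q_lin[of 1 x y] by simp
    show "Q (c *\<^sub>R x) = c *\<^sub>R Q x" for c x using Q_lin[of c x 0] Q_zero by simp
    show "norm (Q x) \<le> norm x * C" for x
      using C[OF rep_l2_in] abs_l2_norm[OF R_in[OF rep_l2_in], of x] by (simp add: Q_def norm_l2_def mult.commute)
  qed
  note genU = C0_generator_lifted[OF cf1 U gU] and genS = C0_generator_lifted[OF cf2 S gS]
  have "Q (lift_semigroup U t (abs_l2 f)) = lift_semigroup S t (Q (abs_l2 f))"
  proof (rule semigroup_intertwining[OF lift_semigroup_C0[OF U] lift_semigroup_C0[OF S] Q_bl _ _ _ t])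
    show "closure (Domain (semigroup_generator (lift_semigroup U :: real \<Rightarrow> 'i l2 \<Rightarrow> 'i l2))) = UNIV"
      unfolding genU by (rule lifted_form_graph_dense[OF cf1])
    show "inner x y \<le> 0" if "(x, y) \<in> semigroup_generator (lift_semigroup S :: real \<Rightarrow> 'j l2 \<Rightarrow> 'j l2)" for x y
      using that unfolding genS by (rule lifted_form_graph_dissipative[OF cf2])
    fix x y :: "'i l2" assume xy: "(x, y) \<in> semigroup_generator (lift_semigroup U)"
    obtain g where g: "x = abs_l2 g" "g \<in> L2 ?M" by (cases x)
    obtain h where h: "y = abs_l2 h" "h \<in> L2 ?M" by (cases y)
    have "(g, h) \<in> form_operator ?M V a"
      using xy form_graph_abs_iff[OF cf1 g(2) h(2)] by (simp add: genU g(1) h(1))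
    then have "(R g, R h) \<in> form_operator ?N W b" using graph by blast
    then show "(Q x, Q y) \<in> semigroup_generator (lift_semigroup S)"
      unfolding genS g(1) h(1) Q_abs[OF g(2)] Q_abs[OF h(2)]
      using form_graph_abs_iff[OF cf2 R_in[OF g(2)] R_in[OF h(2)]] by blast
  qed
  then have "(abs_l2 (R (U t f)) :: 'j l2) = abs_l2 (S t (R f))"
    using C0_semigroup_in[OF U t f]
    by (simp add: lift_semigroup_abs[OF U t f] Q_abs Q_abs[OF f] lift_semigroup_abs[OF S t R_in[OF f]])
  then show "AE x in ?N. R (U t f) x = S t (R f) x"
    using abs_l2_eq_iff[OF R_in[OF C0_semigroup_in[OF U t f]] C0_semigroup_in[OF S t R_in[OF f]]] by blast
qed

definition L2_property :: "point measure \<times> point measure \<Rightarrow> bool" where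
  "L2_property p \<longleftrightarrow> generation_property (fst p) \<and> intertwining_property (fst p) (snd p)"

definition worst_measures :: "point measure \<times> point measure" where
  "worst_measures = (SOME p. nontrivial_L2 (fst p) \<and> nontrivial_L2 (snd p) \<and>
     ((\<exists>p. nontrivial_L2 (fst p) \<and> nontrivial_L2 (snd p) \<and> \<not> L2_property p) \<longrightarrow> \<not> L2_property p))"

lemma nontrivial_count_space: "nontrivial_L2 (count_space {x})"
  unfolding nontrivial_L2_def
  by (rule bexI[of _ "\<lambda>_. 1"]) (simp_all add: L2_norm_def L2_def lebesgue_integral_count_space_finite integrable_count_space)

text \<open>The chosen pair violates the property as soon as any nontrivial pair does, so a proof
  for it alone is a proof for all. Counting measures on a point ensure that a nontrivial pair exists
  even if there is no counterexample, as the class instances require.\<close>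

lemma worst_measures:
  "nontrivial_L2 (fst worst_measures)" "nontrivial_L2 (snd worst_measures)"
  "nontrivial_L2 (fst p) \<Longrightarrow> nontrivial_L2 (snd p) \<Longrightarrow> L2_property worst_measures \<Longrightarrow> L2_property p"
proof -
  let ?bad = "\<exists>p. nontrivial_L2 (fst p) \<and> nontrivial_L2 (snd p) \<and> \<not> L2_property p"
  have "\<exists>p :: point measure \<times> point measure. nontrivial_L2 (fst p) \<and> nontrivial_L2 (snd p) \<and> (?bad \<longrightarrow> \<not> L2_property p)"
  proof (cases ?bad)
    case False
    then show ?thesis
      by (intro exI[of _ "(count_space {undefined}, count_space {undefined})"])
        (use False nontrivial_count_space in auto)
  qed blast
  from someI_ex[OF this] show "nontrivial_L2 (fst worst_measures)" "nontrivial_L2 (snd worst_measures)"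
    "nontrivial_L2 (fst p) \<Longrightarrow> nontrivial_L2 (snd p) \<Longrightarrow> L2_property worst_measures \<Longrightarrow> L2_property p"
    unfolding worst_measures_def by blast+
qed

text \<open>Two index types, because the two measures of an intertwining may differ.\<close>

datatype first_index = First_Index
datatype second_index = Second_Index

instantiation first_index :: l2_index
begin
definition l2_measure_first_index :: "first_index itself \<Rightarrow> point measure" where
  "l2_measure_first_index _ = fst worst_measures"
instance by standard (simp add: l2_measure_first_index_def worst_measures)
end

instantiation second_index :: l2_index
begin
definition l2_measure_second_index :: "second_index itself \<Rightarrow> point measure" where
  "l2_measure_second_index _ = snd worst_measures"
instance by standard (simp add: l2_measure_second_index_def worst_measures)
end

lemma L2_property_nontrivial:
  fixes M N :: "point measure"
  assumes "nontrivial_L2 M" "nontrivial_L2 N"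
  shows "generation_property M" "intertwining_property M N"
proof -
  have "L2_property worst_measures"
    using generation_property_l2[where 'i = first_index]
      intertwining_property_l2[where 'i = first_index and 'j = second_index]
    unfolding L2_property_def l2_measure_first_index_def l2_measure_second_index_def by blast
  then have "L2_property (M, N)" by (rule worst_measures(3)[rotated 2]) (simp_all add: assms)
  then show "generation_property M" "intertwining_property M N" by (simp_all add: L2_property_def)
qed

theorem closed_form_generates_semigroup:
  assumes "nontrivial_L2 (M :: point measure)" "closed_form M V a"
  shows "\<exists>U. C0_semigroup M U \<and> C0_generator M U = form_operator M V a"
  using L2_property_nontrivial(1)[OF assms(1) assms(1)] assms(2) unfolding generation_property_def by blast

theorem closed_form_semigroups_intertwining:
  fixes M N :: "point measure"
  assumes "nontrivial_L2 M" "nontrivial_L2 N"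
    and "closed_form M V a" "C0_semigroup M U" "C0_generator M U = form_operator M V a"
    and "closed_form N W b" "C0_semigroup N S" "C0_generator N S = form_operator N W b"
    and "\<And>f. f \<in> L2 M \<Longrightarrow> R f \<in> L2 N"
    and "\<And>f g c. f \<in> L2 M \<Longrightarrow> g \<in> L2 M \<Longrightarrow> AE x in N. R (\<lambda>y. c * f y + g y) x = c * R f x + R g x"
    and "\<And>f. f \<in> L2 M \<Longrightarrow> L2_norm N (R f) \<le> C * L2_norm M f"
    and "\<And>f h. (f, h) \<in> form_operator M V a \<Longrightarrow> (R f, R h) \<in> form_operator N W b"
    and "t \<ge> 0" "f \<in> L2 M"
  shows "AE x in N. R (U t f) x = S t (R f) x"
proof -
  note ip = L2_property_nontrivial(2)[OF assms(1,2), unfolded intertwining_property_def, rule_format]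
  have "\<exists>C. \<forall>f\<in>L2 M. L2_norm N (R f) \<le> C * L2_norm M f" using assms(11) by blast
  then show ?thesis
    by (intro ip[where V = V and a = a and W = W and b = b and U = U and S = S and R = R])
      (use assms in auto)
qed

section \<open>Test functions\<close>

subsection \<open>Smoothness\<close>

lemma Rd_upd: "x \<in> Rd d \<Longrightarrow> i < d \<Longrightarrow> x(i := t) \<in> Rd d"
  by (auto simp: Rd_def PiE_def extensional_def)

lemma partial_deriv_eq:
  "((\<lambda>t. \<phi> (x(i := t))) has_vector_derivative D) (at (x i)) \<Longrightarrow> partial_deriv i \<phi> x = D"
  unfolding partial_deriv_def by (rule vector_derivative_at)

lemma partial_deriv_cong:
  assumes "\<And>x. x \<in> Rd d \<Longrightarrow> \<phi> x = \<psi> x" "x \<in> Rd d" "i < d"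
  shows "partial_deriv i \<phi> x = partial_deriv i \<psi> x"
proof -
  have "(\<lambda>t. \<phi> (x(i := t))) = (\<lambda>t. \<psi> (x(i := t)))" using assms by (auto simp: Rd_upd)
  then show ?thesis by (simp add: partial_deriv_def)
qed

text \<open>Iterated derivatives stay in the class \<open>P\<close> up to their values off
  \<open>Rd d\<close>, which the definition of smoothness never sees. This replaces an induction
  over lists of axes in each of the later smoothness proofs.\<close>

lemma smooth_coinduct:
  assumes "P \<phi>"
    and cont: "\<And>\<psi>. P \<psi> \<Longrightarrow> continuous_on (Rd d) \<psi>"
    and step: "\<And>\<psi> i. P \<psi> \<Longrightarrow> i < d \<Longrightarrow> \<exists>\<psi>'. P \<psi>' \<and>
      (\<forall>x\<in>Rd d. ((\<lambda>t. \<psi> (x(i := t))) has_vector_derivative \<psi>' x) (at (x i)))"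
  shows "smooth d \<phi>"
proof -
  have iter: "\<exists>\<psi>. P \<psi> \<and> (\<forall>x\<in>Rd d. foldr partial_deriv is \<phi> x = \<psi> x)" if "is \<in> lists {..<d}" for "is"
    using that
  proof (induction "is")
    case Nil
    then show ?case using assms(1) by auto
  next
    case (Cons i "is")
    then obtain \<psi> where \<psi>: "P \<psi>" "\<And>x. x \<in> Rd d \<Longrightarrow> foldr partial_deriv is \<phi> x = \<psi> x" by auto
    have i: "i < d" using Cons.hyps by simp
    obtain \<psi>' where \<psi>': "P \<psi>'"
      "\<And>x. x \<in> Rd d \<Longrightarrow> ((\<lambda>t. \<psi> (x(i := t))) has_vector_derivative \<psi>' x) (at (x i))"
      using step[OF \<psi>(1) i] by blast
    have "foldr partial_deriv (i # is) \<phi> x = \<psi>' x" if x: "x \<in> Rd d" for x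
      using partial_deriv_cong[OF \<psi>(2) x i] partial_deriv_eq[OF \<psi>'(2)[OF x]] by simp
    then show ?case using \<psi>'(1) by blast
  qed
  show ?thesis
    unfolding smooth_def
  proof (intro ballI conjI allI impI)
    fix "is" assume "is \<in> lists {..<d}"
    then obtain \<psi> where \<psi>: "P \<psi>" "\<And>x. x \<in> Rd d \<Longrightarrow> foldr partial_deriv is \<phi> x = \<psi> x" using iter by blast
    show "continuous_on (Rd d) (foldr partial_deriv is \<phi>)"
      using cont[OF \<psi>(1)] \<psi>(2) by (simp cong: continuous_on_cong)
    fix x i assume x: "x \<in> Rd d" and i: "i < d"
    have "(\<lambda>t. foldr partial_deriv is \<phi> (x(i := t))) = (\<lambda>t. \<psi> (x(i := t)))"
      using \<psi>(2) Rd_upd[OF x i] by auto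
    then show "(\<lambda>t. foldr partial_deriv is \<phi> (x(i := t))) differentiable at (x i)"
      using step[OF \<psi>(1) i] x by (auto intro: differentiableI_vector)
  qed
qed

lemma smooth_continuous: "smooth d \<phi> \<Longrightarrow> continuous_on (Rd d) \<phi>"
  unfolding smooth_def by (drule bspec[of _ _ "[]"]) auto

lemma smooth_has_partial_deriv:
  assumes "smooth d \<phi>" "x \<in> Rd d" "i < d"
  shows "((\<lambda>t. \<phi> (x(i := t))) has_vector_derivative partial_deriv i \<phi> x) (at (x i))"
proof -
  have "(\<lambda>t. \<phi> (x(i := t))) differentiable at (x i)"
    using assms unfolding smooth_def by (auto dest!: bspec[of _ _ "[]"])
  then show ?thesis unfolding partial_deriv_def by (simp add: vector_derivative_works)
qed

lemma smooth_partial_deriv: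
  assumes "smooth d \<phi>" "i < d"
  shows "smooth d (partial_deriv i \<phi>)"
  unfolding smooth_def
proof (intro ballI)
  fix "is" assume "is \<in> lists {..<d}"
  then have "is @ [i] \<in> lists {..<d}" using assms(2) by simp
  then have "continuous_on (Rd d) (foldr partial_deriv (is @ [i]) \<phi>) \<and>
      (\<forall>x\<in>Rd d. \<forall>j<d. (\<lambda>t. foldr partial_deriv (is @ [i]) \<phi> (x(j := t))) differentiable at (x j))"
    using assms(1) unfolding smooth_def by blast
  then show "continuous_on (Rd d) (foldr partial_deriv is (partial_deriv i \<phi>)) \<and>
      (\<forall>x\<in>Rd d. \<forall>j<d. (\<lambda>t. foldr partial_deriv is (partial_deriv i \<phi>) (x(j := t))) differentiable at (x j))"
    by simp
qed

text \<open>The derivative of a product is a sum of products, so products alone are no invariant for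
  \<open>smooth_coinduct\<close>; the closure under sums and products is one.\<close>

inductive smooth_algebra :: "nat \<Rightarrow> (point \<Rightarrow> complex) \<Rightarrow> bool" for d where
  base: "smooth d \<phi> \<Longrightarrow> smooth_algebra d \<phi>"
| add: "smooth_algebra d \<phi> \<Longrightarrow> smooth_algebra d \<psi> \<Longrightarrow> smooth_algebra d (\<lambda>x. \<phi> x + \<psi> x)"
| mult: "smooth_algebra d \<phi> \<Longrightarrow> smooth_algebra d \<psi> \<Longrightarrow> smooth_algebra d (\<lambda>x. \<phi> x * \<psi> x)"

lemma smooth_algebra_smooth:
  assumes "smooth_algebra d \<phi>"
  shows "smooth d \<phi>"
proof (rule smooth_coinduct[of "smooth_algebra d", OF assms])
  fix \<psi> assume "smooth_algebra d \<psi>"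
  then show "continuous_on (Rd d) \<psi>"
    by induction (auto intro: smooth_continuous continuous_intros)
next
  fix \<psi> i assume "smooth_algebra d \<psi>" "i < d"
  then show "\<exists>\<psi>'. smooth_algebra d \<psi>' \<and>
      (\<forall>x\<in>Rd d. ((\<lambda>t. \<psi> (x(i := t))) has_vector_derivative \<psi>' x) (at (x i)))"
  proof induction
    case (base \<phi>)
    show ?case
      by (intro exI[of _ "partial_deriv i \<phi>"] conjI ballI smooth_algebra.base
          smooth_partial_deriv[OF base] smooth_has_partial_deriv[OF base(1) _ base(2)])
  next
    case (add \<phi> \<psi>)
    then obtain \<phi>' \<psi>' where
      *: "smooth_algebra d \<phi>'" "\<forall>x\<in>Rd d. ((\<lambda>t. \<phi> (x(i := t))) has_vector_derivative \<phi>' x) (at (x i))"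
      "smooth_algebra d \<psi>'" "\<forall>x\<in>Rd d. ((\<lambda>t. \<psi> (x(i := t))) has_vector_derivative \<psi>' x) (at (x i))"
      by blast
    show ?case
      by (intro exI[of _ "\<lambda>x. \<phi>' x + \<psi>' x"] conjI ballI smooth_algebra.add has_vector_derivative_add *
          *(2)[rule_format] *(4)[rule_format])
  next
    case (mult \<phi> \<psi>)
    then obtain \<phi>' \<psi>' where
      *: "smooth_algebra d \<phi>'" "\<forall>x\<in>Rd d. ((\<lambda>t. \<phi> (x(i := t))) has_vector_derivative \<phi>' x) (at (x i))"
      "smooth_algebra d \<psi>'" "\<forall>x\<in>Rd d. ((\<lambda>t. \<psi> (x(i := t))) has_vector_derivative \<psi>' x) (at (x i))"
      by blast
    have "((\<lambda>t. \<phi> (x(i := t)) * \<psi> (x(i := t))) has_vector_derivative \<phi> x * \<psi>' x + \<phi>' x * \<psi> x) (at (x i))"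
      if "x \<in> Rd d" for x
      using has_vector_derivative_mult[OF *(2)[rule_format, OF that] *(4)[rule_format, OF that]] by simp
    then show ?case
      by (intro exI[of _ "\<lambda>x. \<phi> x * \<psi>' x + \<phi>' x * \<psi> x"] conjI ballI smooth_algebra.add
          smooth_algebra.mult * mult.hyps)
  qed
qed

lemma smooth_add: "smooth d \<phi> \<Longrightarrow> smooth d \<psi> \<Longrightarrow> smooth d (\<lambda>x. \<phi> x + \<psi> x)"
  by (rule smooth_algebra_smooth[OF smooth_algebra.add[OF smooth_algebra.base smooth_algebra.base]])

lemma smooth_mult: "smooth d \<phi> \<Longrightarrow> smooth d \<psi> \<Longrightarrow> smooth d (\<lambda>x. \<phi> x * \<psi> x)"
  by (rule smooth_algebra_smooth[OF smooth_algebra.mult[OF smooth_algebra.base smooth_algebra.base]])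

lemma smooth_const: "smooth d (\<lambda>_. c)"
  by (rule smooth_coinduct[of "\<lambda>\<psi>. \<exists>c. \<psi> = (\<lambda>_. c)"]) (auto intro!: exI[of _ "\<lambda>_. 0"])

lemma smooth_sum: "(\<And>k. k \<in> K \<Longrightarrow> smooth d (\<phi> k)) \<Longrightarrow> smooth d (\<lambda>x. \<Sum>k\<in>K. \<phi> k x)"
  by (induction K rule: infinite_finite_induct) (auto intro: smooth_add smooth_const)

lemma smooth_prod: "(\<And>k. k \<in> K \<Longrightarrow> smooth d (\<phi> k)) \<Longrightarrow> smooth d (\<lambda>x. \<Prod>k\<in>K. \<phi> k x)"
  by (induction K rule: infinite_finite_induct) (auto intro: smooth_mult smooth_const)

lemma partial_deriv_mult:
  assumes "smooth d \<phi>" "smooth d \<psi>" "x \<in> Rd d" "i < d"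
  shows "partial_deriv i (\<lambda>x. \<phi> x * \<psi> x) x = \<phi> x * partial_deriv i \<psi> x + partial_deriv i \<phi> x * \<psi> x"
  using has_vector_derivative_mult[OF smooth_has_partial_deriv[OF assms(1,3,4)]
      smooth_has_partial_deriv[OF assms(2,3,4)]]
  by (intro partial_deriv_eq) simp

lemma partial_deriv_sum:
  assumes "\<And>k. k \<in> K \<Longrightarrow> smooth d (\<phi> k)" "x \<in> Rd d" "i < d"
  shows "partial_deriv i (\<lambda>x. \<Sum>k\<in>K. \<phi> k x) x = (\<Sum>k\<in>K. partial_deriv i (\<phi> k) x)"
  by (intro partial_deriv_eq has_vector_derivative_sum smooth_has_partial_deriv[OF assms(1) assms(2,3)])

subsection \<open>A smooth function vanishing on the negative half-line\<close>

text \<open>The polynomial factor makes the class closed under differentiation; p = 1 is the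
  classical function exp(-1/x).\<close>

definition flat :: "real poly \<Rightarrow> real \<Rightarrow> real" where
  "flat p x = (if x > 0 then poly p (1 / x) * exp (- 1 / x) else 0)"

text \<open>With y = 1/x, the derivative of p(y) exp(-y) in x is -y^2 (p'(y) - p(y))
  exp(-y).\<close>

definition flat_deriv :: "real poly \<Rightarrow> real poly" where
  "flat_deriv p = monom 1 2 * (p - pderiv p)"

lemma poly_exp_tendsto_0: "((\<lambda>y. poly p y * exp (- y)) \<longlongrightarrow> 0) (at_top :: real filter)"
proof -
  have "((\<lambda>y. \<Sum>i\<le>degree p. coeff p i * (y ^ i / exp y)) \<longlongrightarrow> (\<Sum>i\<le>degree p. coeff p i * 0)) (at_top :: real filter)"
    by (intro tendsto_intros tendsto_power_div_exp_0)
  then show ?thesis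
    by (simp add: poly_altdef sum_divide_distrib exp_minus flip: divide_inverse)
qed

lemma has_derivative_flat: "(flat p has_real_derivative flat (flat_deriv p) x) (at x)"
proof (cases x "0 :: real" rule: linorder_cases)
  case greater
  have d: "((\<lambda>x. poly p (1 / x) * exp (- 1 / x)) has_real_derivative
      flat (flat_deriv p) x) (at x)"
    using greater
    by (auto intro!: derivative_eq_intros simp: flat_def flat_deriv_def poly_monom power2_eq_square field_simps)
  have ev: "\<forall>\<^sub>F y in nhds x. poly p (1 / y) * exp (- 1 / y) = flat p y"
    using eventually_nhds_in_open[of "{0<..}" x] greater
    by (auto elim!: eventually_mono simp: flat_def)
  from DERIV_cong_ev[OF refl ev refl] d show ?thesis by (rule iffD1)
next
  case less
  have d: "((\<lambda>_. 0) has_real_derivative flat (flat_deriv p) x) (at x)"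
    using less by (simp add: flat_def)
  have ev: "\<forall>\<^sub>F y in nhds x. 0 = flat p y"
    using eventually_nhds_in_open[of "{..<0}" x] less
    by (auto elim!: eventually_mono simp: flat_def)
  from DERIV_cong_ev[OF refl ev refl] d show ?thesis by (rule iffD1)
next
  case equal
  have "((\<lambda>h. flat p h / h) \<longlongrightarrow> 0) (at_right 0)"
  proof -
    \<comment> \<open>With y = 1/h the difference quotient at 0 is y p(y) exp(-y), and the extra y
      is absorbed into the polynomial.\<close>
    have "((\<lambda>h. poly (monom 1 1 * p) (1 / h) * exp (- (1 / h))) \<longlongrightarrow> 0) (at_right 0)"
      by (rule filterlim_compose[OF poly_exp_tendsto_0])
        (simp add: filterlim_inverse_at_top_right flip: inverse_eq_divide)
    then show ?thesis
      by (rule Lim_transform_eventually)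
        (auto intro!: eventually_mono[OF eventually_at_right_less] simp: flat_def poly_monom)
  qed
  moreover have "((\<lambda>h. flat p h / h) \<longlongrightarrow> 0) (at_left 0)"
    by (rule Lim_transform_eventually[OF tendsto_const])
      (simp add: eventually_at_filter flat_def)
  ultimately have "((\<lambda>h. flat p h / h) \<longlongrightarrow> 0) (at 0)"
    by (simp add: filterlim_at_split)
  then show ?thesis
    using equal by (simp add: DERIV_def flat_def)
qed

lemma has_derivative_flat_affine:
  "((\<lambda>t. flat p (u + v * t)) has_real_derivative v * flat (flat_deriv p) (u + v * s)) (at s)"
proof -
  have "((\<lambda>t. u + v * t) has_real_derivative v) (at s)"
    by (auto intro!: derivative_eq_intros)
  from DERIV_chain2[OF has_derivative_flat this] show ?thesis by (simp add: mult.commute)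
qed

lemma flat_one_bounds: "0 \<le> flat 1 x" "flat 1 x \<le> 1"
  by (auto simp: flat_def)

lemma flat_one_tendsto: "x > 0 \<Longrightarrow> (\<lambda>n. flat 1 (real n * x - 1)) \<longlonglongrightarrow> 1"
proof -
  assume x: "x > 0"
  have "filterlim (\<lambda>n. - 1 + real n * x) at_top sequentially"
    using x by (intro filterlim_tendsto_add_at_top[OF tendsto_const] filterlim_at_top_mult_tendsto_pos[OF tendsto_const]
        filterlim_real_sequentially) auto
  then have "(\<lambda>n. exp (- inverse (- 1 + real n * x))) \<longlonglongrightarrow> exp (- 0)"
    by (intro tendsto_intros tendsto_inverse_0_at_top)
  then have "(\<lambda>n. exp (- 1 / (real n * x - 1))) \<longlonglongrightarrow> 1"
    by (simp add: divide_inverse)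
  moreover have "\<forall>\<^sub>F n in sequentially. exp (- 1 / (real n * x - 1)) = flat 1 (real n * x - 1)"
  proof -
    obtain N :: nat where "1 / x < real N" using reals_Archimedean2 by blast
    then have "real n * x > 1" if "n \<ge> N" for n
      using x that by (meson divide_less_eq less_le_trans mult_right_mono of_nat_le_iff less_imp_le)
    then show ?thesis unfolding eventually_sequentially by (auto simp: flat_def intro!: exI[of _ N])
  qed
  ultimately show ?thesis by (rule Lim_transform_eventually)
qed

text \<open>The derivative of the cutoff grows like n, but only where x is of order 1/n. With y =
  1/(n x - 1) the product is (y + y^2) exp(-y), and exp y >= 1 + y + y^2 / 2 gives the
  bound.\<close>

lemma flat_deriv_one_bound:
  assumes "n \<ge> 0"
  shows "\<bar>n * flat (flat_deriv 1) (n * x - 1) * x\<bar> \<le> 2"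
proof (cases "n * x - 1 > 0")
  case True
  define y where "y = 1 / (n * x - 1)"
  have y: "y > 0" using True by (simp add: y_def)
  have nx: "n * x = 1 / y + 1" using True by (simp add: y_def)
  have "n * flat (flat_deriv 1) (n * x - 1) * x = (n * x) * (y\<^sup>2 * exp (- y))"
    using True by (simp add: flat_def flat_deriv_def poly_monom y_def)
  also have "\<dots> = (y + y\<^sup>2) * exp (- y)"
    unfolding nx using y by (simp add: field_simps power2_eq_square)
  finally have eq: "n * flat (flat_deriv 1) (n * x - 1) * x = (y + y\<^sup>2) * exp (- y)" .
  have "1 + y + y\<^sup>2 / 2 \<le> exp y" using exp_lower_Taylor_quadratic[of y] y by simp
  then have "y + y\<^sup>2 \<le> 2 * exp y" using y by (simp add: power2_eq_square)
  then have "(y + y\<^sup>2) * exp (- y) \<le> 2" by (simp add: exp_minus field_simps)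
  moreover have "0 \<le> (y + y\<^sup>2) * exp (- y)" using y by simp
  ultimately show ?thesis unfolding eq by simp
next
  case False
  then show ?thesis by (simp add: flat_def)
qed

text \<open>The invariant carries a scalar c, which absorbs the chain rule factor v and is 0 for
  derivatives along the other axes.\<close>

lemma smooth_flat:
  assumes "i < d"
  shows "smooth d (\<lambda>x. complex_of_real (flat p (u + v * x i)))"
proof (rule smooth_coinduct[of "\<lambda>\<psi>. \<exists>p c. \<psi> = (\<lambda>x. complex_of_real (c * flat p (u + v * x i)))"])
  have cont: "continuous_on UNIV (flat p)" for p
    using has_derivative_flat[of p]
    by (auto intro!: continuous_at_imp_continuous_on DERIV_isCont)
  show "\<exists>q c. (\<lambda>x. complex_of_real (flat p (u + v * x i))) = (\<lambda>x. complex_of_real (c * flat q (u + v * x i)))"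
    by (intro exI[of _ p] exI[of _ 1]) simp
  fix \<psi> assume "\<exists>p c. \<psi> = (\<lambda>x. complex_of_real (c * flat p (u + v * x i)))"
  then obtain p c where \<psi>: "\<psi> = (\<lambda>x. complex_of_real (c * flat p (u + v * x i)))" by blast
  have "continuous_on (Rd d) (\<lambda>x. u + v * x i)"
    by (intro continuous_intros continuous_on_subset[OF continuous_on_product_coordinates]) auto
  from continuous_on_compose2[OF cont this subset_UNIV]
  show "continuous_on (Rd d) \<psi>" unfolding \<psi> by (intro continuous_intros)
  fix k assume "k < d"
  show "\<exists>\<psi>'. (\<exists>p c. \<psi>' = (\<lambda>x. complex_of_real (c * flat p (u + v * x i)))) \<and>
      (\<forall>x\<in>Rd d. ((\<lambda>t. \<psi> (x(k := t))) has_vector_derivative \<psi>' x) (at (x k)))"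
  proof (cases "k = i")
    case True
    have "((\<lambda>t. c * flat p (u + v * t)) has_real_derivative c * v * flat (flat_deriv p) (u + v * s)) (at s)" for s
      using DERIV_cmult[OF has_derivative_flat_affine, of c p u v s] by (simp add: mult.assoc)
    then have "((\<lambda>t. complex_of_real (c * flat p (u + v * t))) has_vector_derivative
        complex_of_real (c * v * flat (flat_deriv p) (u + v * s))) (at s)" for s
      by (intro has_vector_derivative_of_real) (simp add: has_real_derivative_iff_has_vector_derivative)
    moreover have "\<exists>q e. (\<lambda>x. complex_of_real (c * v * flat (flat_deriv p) (u + v * x i)))
        = (\<lambda>x. complex_of_real (e * flat q (u + v * x i)))"
      by (intro exI[of _ "flat_deriv p"] exI[of _ "c * v"] refl)
    ultimately show ?thesis unfolding \<psi> True
      by (intro exI[of _ "\<lambda>x. complex_of_real (c * v * flat (flat_deriv p) (u + v * x i))"]) auto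
  next
    case False
    moreover have "\<exists>q e. (\<lambda>x. complex_of_real (0 * flat p (u + v * x i)))
        = (\<lambda>x. complex_of_real (e * flat q (u + v * x i)))"
      by (intro exI[of _ p] exI[of _ 0] refl)
    ultimately show ?thesis unfolding \<psi>
      by (intro exI[of _ "\<lambda>x. complex_of_real (0 * flat p (u + v * x i))"]) auto
  qed
qed

lemma partial_deriv_flat:
  "partial_deriv i (\<lambda>x. complex_of_real (flat p (u + v * x i))) x
    = complex_of_real (v * flat (flat_deriv p) (u + v * x i))"
proof (rule partial_deriv_eq)
  have "((\<lambda>t. flat p (u + v * t)) has_real_derivative v * flat (flat_deriv p) (u + v * x i)) (at (x i))"
    by (rule has_derivative_flat_affine)
  then show "((\<lambda>t. complex_of_real (flat p (u + v * (x(i := t)) i))) has_vector_derivative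
      complex_of_real (v * flat (flat_deriv p) (u + v * x i))) (at (x i))"
    by (intro has_vector_derivative_of_real) (simp add: has_real_derivative_iff_has_vector_derivative)
qed

subsection \<open>Lebesgue measure on extensional functions\<close>

text \<open>The product measure before completion. Fubini and the uniqueness of product measures
  apply to it, and the results are then carried over to \<open>leb\<close>.\<close>

definition bleb :: "nat \<Rightarrow> point measure" where
  "bleb d = PiM {..<d} (\<lambda>_. lborel)"

interpretation lborel_product: product_sigma_finite "\<lambda>_ :: nat. lborel :: real measure" ..

lemma leb_eq: "leb d = completion (bleb d)"
  by (simp add: leb_def bleb_def)

lemma space_bleb [simp]: "space (bleb d) = Rd d"
  by (simp add: bleb_def space_PiM Rd_def)

lemma space_leb [simp]: "space (leb d) = Rd d"
  by (simp add: leb_eq)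

lemma bleb_measurable_leb: "f \<in> borel_measurable (bleb d) \<Longrightarrow> f \<in> borel_measurable (leb d)"
  by (simp add: leb_eq measurable_completion)

lemma bleb_sets_leb: "A \<in> sets (bleb d) \<Longrightarrow> A \<in> sets (leb d)"
  by (simp add: leb_eq)

lemma coordinate_measurable_bleb: "(\<lambda>x. x i) \<in> borel_measurable (bleb d)"
proof (cases "i < d")
  case True
  then show ?thesis unfolding bleb_def by (intro measurable_component_singleton[of i _ "\<lambda>_. lborel", simplified]) auto
next
  case False
  then have "(\<lambda>x. x i) \<in> borel_measurable (bleb d) \<longleftrightarrow> (\<lambda>_. undefined :: real) \<in> borel_measurable (bleb d)"
    by (intro measurable_cong) (auto simp: Rd_def PiE_def extensional_def)
  then show ?thesis by simp
qed

text \<open>Connects the product sigma-algebra of finitely many axes with the topology on all of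
  \<open>nat \<Rightarrow> real\<close>: the identity is measurable coordinate by
  coordinate.\<close>

lemma continuous_on_Rd_measurable:
  fixes \<phi> :: "point \<Rightarrow> 'b::topological_space"
  assumes "continuous_on (Rd d) \<phi>"
  shows "\<phi> \<in> borel_measurable (bleb d)"
proof -
  have "(\<lambda>x. x) \<in> borel_measurable (bleb d)"
    by (rule measurable_coordinatewise_then_product) (rule coordinate_measurable_bleb)
  then have "(\<lambda>x. x) \<in> measurable (bleb d) (restrict_space borel (Rd d))"
    by (intro measurable_restrict_space2) auto
  from measurable_compose[OF this borel_measurable_continuous_on_restrict[OF assms]]
  show ?thesis .
qed

definition obox :: "nat \<Rightarrow> (nat \<Rightarrow> real) \<Rightarrow> (nat \<Rightarrow> real) \<Rightarrow> point set" where
  "obox d l u = PiE {..<d} (\<lambda>j. {l j<..<u j})"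

lemma PiE_sets_bleb: "(\<And>j. j < d \<Longrightarrow> A j \<in> sets borel) \<Longrightarrow> PiE {..<d} A \<in> sets (bleb d)"
  unfolding bleb_def by (intro sets_PiM_I_finite) auto

lemma obox_sets [simp]: "obox d l u \<in> sets (bleb d)" "obox d l u \<in> sets (leb d)"
  by (auto simp: obox_def intro!: PiE_sets_bleb bleb_sets_leb)

lemma obox_subset: "obox d l u \<subseteq> Rd d"
  by (auto simp: obox_def Rd_def)

lemma emeasure_bleb_PiE:
  "(\<And>j. j < d \<Longrightarrow> A j \<in> sets borel) \<Longrightarrow> emeasure (bleb d) (PiE {..<d} A) = (\<Prod>j<d. emeasure lborel (A j))"
  unfolding bleb_def by (subst lborel_product.emeasure_PiM) auto

lemma emeasure_obox_finite: "emeasure (leb d) (obox d l u) < \<infinity>"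
proof -
  have "emeasure (leb d) (obox d l u) = (\<Prod>j<d. emeasure lborel {l j<..<u j})"
    by (simp add: leb_eq obox_def emeasure_bleb_PiE PiE_sets_bleb)
  also have "\<dots> < \<infinity>"
  proof -
    have "emeasure lborel {l j<..<u j} < \<infinity>" for j by (rule emeasure_bounded_finite) simp
    then show ?thesis
      by (auto simp: less_top[symmetric] ennreal_prod_eq_top)
  qed
  finally show ?thesis .
qed

lemma compact_in_obox:
  assumes "compact C" "C \<subseteq> Rd d"
  obtains N where "N > 0" "C \<subseteq> obox d (\<lambda>_. - N) (\<lambda>_. N)"
proof -
  have "\<exists>B. \<forall>x\<in>C. \<bar>x j\<bar> \<le> B" for j
  proof -
    have "compact ((\<lambda>x. x j) ` C)"
      using assms(1) by (intro compact_continuous_image continuous_on_subset[OF continuous_on_product_coordinates]) auto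
    then have "bounded ((\<lambda>x. x j) ` C)" by (rule compact_imp_bounded)
    then show ?thesis by (auto simp: bounded_iff)
  qed
  then obtain B where B: "\<And>j x. x \<in> C \<Longrightarrow> \<bar>x j\<bar> \<le> B j" by metis
  define N where "N = 1 + (\<Sum>j<d. \<bar>B j\<bar>)"
  have N: "\<bar>x j\<bar> < N" if "x \<in> C" "j < d" for x j
  proof -
    have "\<bar>B j\<bar> \<le> (\<Sum>j<d. \<bar>B j\<bar>)" using that(2) by (intro member_le_sum) auto
    then show ?thesis using B[OF that(1), of j] by (simp add: N_def)
  qed
  show ?thesis
  proof
    show "N > 0" unfolding N_def by (intro add_pos_nonneg sum_nonneg) auto
    show "C \<subseteq> obox d (\<lambda>_. - N) (\<lambda>_. N)"
    proof
      fix x assume x: "x \<in> C"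
      then have "x \<in> Rd d" using assms(2) by blast
      moreover have "- N < x j \<and> x j < N" if "j < d" for j using N[OF x that] by (simp add: abs_less_iff)
      ultimately show "x \<in> obox d (\<lambda>_. - N) (\<lambda>_. N)" by (simp add: obox_def Rd_def PiE_iff)
    qed
  qed
qed

lemma continuous_on_fun_upd: "continuous_on UNIV (\<lambda>t. (x :: point)(i := t))"
proof (rule continuous_on_coordinatewise_then_product)
  show "continuous_on UNIV (\<lambda>t. (x(i := t)) j)" for j
    by (cases "j = i") (auto intro: continuous_on_id)
qed

subsection \<open>Properties of test functions\<close>

lemma test_functionsE:
  assumes "\<phi> \<in> test_functions d \<Omega>"
  obtains C where "smooth d \<phi>" "compact C" "C \<subseteq> \<Omega>" "\<And>x. x \<in> Rd d \<Longrightarrow> x \<notin> C \<Longrightarrow> \<phi> x = 0"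
  using assms unfolding test_functions_def by blast

lemma test_functionsI:
  assumes "smooth d \<phi>" "compact C" "C \<subseteq> \<Omega>" "\<And>x. x \<in> Rd d \<Longrightarrow> x \<notin> C \<Longrightarrow> \<phi> x = 0"
  shows "\<phi> \<in> test_functions d \<Omega>"
  using assms unfolding test_functions_def by blast

lemma test_smooth: "\<phi> \<in> test_functions d \<Omega> \<Longrightarrow> smooth d \<phi>"
  by (auto elim: test_functionsE)

lemma test_mono: "\<phi> \<in> test_functions d \<Omega> \<Longrightarrow> \<Omega> \<subseteq> \<Omega>' \<Longrightarrow> \<phi> \<in> test_functions d \<Omega>'"
  unfolding test_functions_def by blast

text \<open>The complement of the compact support is open, so from a point outside the function
  vanishes along a whole piece of the coordinate line.\<close>

lemma test_partial_deriv:
  assumes \<phi>: "\<phi> \<in> test_functions d \<Omega>" and i: "i < d"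
  shows "partial_deriv i \<phi> \<in> test_functions d \<Omega>"
proof -
  obtain C where C: "smooth d \<phi>" "compact C" "C \<subseteq> \<Omega>" "\<And>x. x \<in> Rd d \<Longrightarrow> x \<notin> C \<Longrightarrow> \<phi> x = 0"
    using \<phi> by (rule test_functionsE) blast
  show ?thesis
  proof (rule test_functionsI[OF smooth_partial_deriv[OF C(1) i] C(2,3)])
    fix x assume x: "x \<in> Rd d" "x \<notin> C"
    have "open ((\<lambda>t. x(i := t)) -` (- C))"
      using C(2) continuous_on_fun_upd[of x i] by (intro open_vimage) (auto dest: compact_imp_closed)
    then have "\<forall>\<^sub>F t in nhds (x i). t \<in> (\<lambda>t. x(i := t)) -` (- C)"
      using x by (intro eventually_nhds_in_open) auto
    then have ev: "\<forall>\<^sub>F t in nhds (x i). \<phi> (x(i := t)) = 0"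
      by eventually_elim (use C(4) Rd_upd[OF x(1) i] in auto)
    have "((\<lambda>t. \<phi> (x(i := t))) has_vector_derivative 0) (at (x i))"
      using has_vector_derivative_const[of 0 "at (x i)"] x ev
      by (subst has_vector_derivative_cong_ev[where g = "\<lambda>_. 0"])
        (auto simp: C(4) elim: eventually_mono)
    then show "partial_deriv i \<phi> x = 0" by (rule partial_deriv_eq)
  qed
qed

lemma test_mult:
  assumes "smooth d \<phi>" "\<psi> \<in> test_functions d \<Omega>"
  shows "(\<lambda>x. \<phi> x * \<psi> x) \<in> test_functions d \<Omega>"
  using assms(2)
  by (rule test_functionsE) (auto intro!: test_functionsI[where \<Omega> = \<Omega>] smooth_mult assms(1))

lemma test_lincomb:
  assumes "\<phi> \<in> test_functions d \<Omega>" "\<psi> \<in> test_functions d \<Omega>"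
  shows "(\<lambda>x. c * \<phi> x + \<psi> x) \<in> test_functions d \<Omega>"
proof -
  obtain C where C: "smooth d \<phi>" "compact C" "C \<subseteq> \<Omega>" "\<And>x. x \<in> Rd d \<Longrightarrow> x \<notin> C \<Longrightarrow> \<phi> x = 0"
    using assms(1) by (rule test_functionsE) blast
  obtain D where D: "smooth d \<psi>" "compact D" "D \<subseteq> \<Omega>" "\<And>x. x \<in> Rd d \<Longrightarrow> x \<notin> D \<Longrightarrow> \<psi> x = 0"
    using assms(2) by (rule test_functionsE) blast
  show ?thesis
    by (rule test_functionsI[where C = "C \<union> D"])
      (use C D smooth_add[OF smooth_mult[OF smooth_const C(1)] D(1)] in auto)
qed

lemma test_zero: "(\<lambda>_. 0) \<in> test_functions d \<Omega>"
  by (rule test_functionsI[where C = "{}"]) (auto intro: smooth_const)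

lemma test_bounded:
  assumes \<phi>: "\<phi> \<in> test_functions d \<Omega>" and \<Omega>: "\<Omega> \<subseteq> Rd d"
  obtains N B where "N > 0" "B \<ge> 0"
    "\<And>x. x \<in> Rd d \<Longrightarrow> cmod (\<phi> x) \<le> B * indicator (obox d (\<lambda>_. - N) (\<lambda>_. N)) x"
proof -
  obtain C where C: "smooth d \<phi>" "compact C" "C \<subseteq> \<Omega>" "\<And>x. x \<in> Rd d \<Longrightarrow> x \<notin> C \<Longrightarrow> \<phi> x = 0"
    using \<phi> by (rule test_functionsE) blast
  have CR: "C \<subseteq> Rd d" using C(3) \<Omega> by blast
  obtain N where N: "N > 0" "C \<subseteq> obox d (\<lambda>_. - N) (\<lambda>_. N)" using compact_in_obox[OF C(2) CR] .
  have "compact (\<phi> ` C)"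
    using C(2) continuous_on_subset[OF smooth_continuous[OF C(1)] CR] by (rule compact_continuous_image[rotated])
  then have "bounded (\<phi> ` C)" by (rule compact_imp_bounded)
  then obtain B where B: "\<And>x. x \<in> C \<Longrightarrow> cmod (\<phi> x) \<le> B" by (auto simp: bounded_iff)
  show ?thesis
  proof (rule that[of N "max B 0"])
    fix x assume x: "x \<in> Rd d"
    show "cmod (\<phi> x) \<le> max B 0 * indicator (obox d (\<lambda>_. - N) (\<lambda>_. N)) x"
    proof (cases "x \<in> C")
      case True
      then have "x \<in> obox d (\<lambda>_. - N) (\<lambda>_. N)" using N(2) by blast
      then show ?thesis using B[OF True] by simp
    next
      case False
      then show ?thesis using C(4)[OF x] by simp
    qed
  qed (use N in auto)
qed

lemma integrable_indicator_obox: "integrable (leb d) (\<lambda>x. c * indicator (obox d l u) x :: real)"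
  using emeasure_obox_finite[of d l u] by (intro integrable_mult_right integrable_real_indicator) auto

lemma L2_bounded_obox:
  assumes "f \<in> borel_measurable (leb d)"
    and "\<And>x. x \<in> Rd d \<Longrightarrow> cmod (f x) \<le> B * indicator (obox d l u) x"
  shows "f \<in> L2 (leb d)" "integrable (leb d) f"
proof -
  have "integrable (leb d) (\<lambda>x. (cmod (f x))\<^sup>2)"
  proof (rule Bochner_Integration.integrable_bound[OF integrable_indicator_obox])
    show "AE x in leb d. norm ((cmod (f x))\<^sup>2) \<le> norm (B\<^sup>2 * indicator (obox d l u) x :: real)"
    proof (rule AE_I2)
      fix x assume "x \<in> space (leb d)"
      then have "(cmod (f x))\<^sup>2 \<le> (B * indicator (obox d l u) x)\<^sup>2" using assms(2) by (intro power_mono) auto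
      then show "norm ((cmod (f x))\<^sup>2) \<le> norm (B\<^sup>2 * indicator (obox d l u) x :: real)"
        by (auto simp: indicator_def split: if_splits)
    qed
  qed (use assms(1) in simp)
  then show "f \<in> L2 (leb d)" using assms(1) by (simp add: L2_def)
  show "integrable (leb d) f"
    by (rule Bochner_Integration.integrable_bound[OF integrable_indicator_obox[of d B l u] assms(1)])
      (use assms(2) in \<open>auto intro!: AE_I2 order_trans[OF _ abs_ge_self]\<close>)
qed

lemma test_measurable: "\<phi> \<in> test_functions d \<Omega> \<Longrightarrow> \<phi> \<in> borel_measurable (bleb d)"
  by (intro continuous_on_Rd_measurable smooth_continuous test_smooth)

lemma test_L2:
  assumes "\<phi> \<in> test_functions d \<Omega>" "\<Omega> \<subseteq> Rd d"
  shows "\<phi> \<in> L2 (leb d)" "integrable (leb d) \<phi>"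
proof -
  obtain N B where "\<And>x. x \<in> Rd d \<Longrightarrow> cmod (\<phi> x) \<le> B * indicator (obox d (\<lambda>_. - N) (\<lambda>_. N)) x"
    by (rule test_bounded[OF assms]) blast
  note L2_bounded_obox[OF bleb_measurable_leb[OF test_measurable[OF assms(1)]] this]
  then show "\<phi> \<in> L2 (leb d)" "integrable (leb d) \<phi>" by auto
qed

text \<open>Fubini with the axis i innermost, and the fundamental theorem of calculus on each
  line.\<close>

lemma integral_partial_deriv_test:
  assumes \<phi>: "\<phi> \<in> test_functions d \<Omega>" and \<Omega>: "\<Omega> \<subseteq> Rd d" and i: "i < d"
  shows "(\<integral>x. partial_deriv i \<phi> x \<partial>leb d) = 0"
proof -
  let ?I = "{..<d} - {i}"
  have ins: "insert i ?I = {..<d}" using i by auto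
  note pd = test_partial_deriv[OF \<phi> i]
  have m: "partial_deriv i \<phi> \<in> borel_measurable (bleb d)" by (rule test_measurable[OF pd])
  have "integrable (bleb d) (partial_deriv i \<phi>)"
    using test_L2(2)[OF pd \<Omega>] integrable_completion[OF m] by (simp add: leb_eq)
  then have int: "integrable (PiM (insert i ?I) (\<lambda>_. lborel)) (partial_deriv i \<phi>)"
    unfolding ins by (simp add: bleb_def)
  obtain N B where N: "N > 0" "B \<ge> 0"
    "\<And>x. x \<in> Rd d \<Longrightarrow> cmod (\<phi> x) \<le> B * indicator (obox d (\<lambda>_. - N) (\<lambda>_. N)) x"
    by (rule test_bounded[OF \<phi> \<Omega>]) blast
  obtain N' B' where N': "N' > 0" "B' \<ge> 0"
    "\<And>x. x \<in> Rd d \<Longrightarrow> cmod (partial_deriv i \<phi> x) \<le> B' * indicator (obox d (\<lambda>_. - N') (\<lambda>_. N')) x"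
    by (rule test_bounded[OF pd \<Omega>]) blast
  \<comment> \<open>From distance \<open>L\<close> on, both the function and its derivative vanish
    on every line: the former removes the boundary terms, the latter the integral outside
    [-L, L].\<close>
  define L where "L = max N N'"
  have inner: "(\<integral>y. partial_deriv i \<phi> (x(i := y)) \<partial>lborel) = 0" if x: "x \<in> space (PiM ?I (\<lambda>_. lborel))" for x :: point
  proof -
    have xy: "x(i := y) \<in> Rd d" for y
      using x i by (auto simp: space_PiM Rd_def PiE_def extensional_def)
    have zero: "\<phi> (x(i := y)) = 0" if "\<bar>y\<bar> \<ge> L" for y
    proof -
      have "x(i := y) \<notin> obox d (\<lambda>_. - N) (\<lambda>_. N)"
        using that i unfolding obox_def L_def by (auto simp: PiE_iff abs_if split: if_splits)
      then show ?thesis using N(3)[OF xy[of y]] by simp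
    qed
    have zero': "partial_deriv i \<phi> (x(i := y)) = 0" if "\<bar>y\<bar> \<ge> L" for y
    proof -
      have "x(i := y) \<notin> obox d (\<lambda>_. - N') (\<lambda>_. N')"
        using that i unfolding obox_def L_def by (auto simp: PiE_iff abs_if split: if_splits)
      then show ?thesis using N'(3)[OF xy[of y]] by simp
    qed
    have L: "L > 0" using N by (simp add: L_def)
    have "(\<integral>y. indicator {- L..L} y *\<^sub>R partial_deriv i \<phi> (x(i := y)) \<partial>lborel)
        = \<phi> (x(i := L)) - \<phi> (x(i := - L))"
    proof (rule integral_FTC_Icc)
      show "((\<lambda>y. \<phi> (x(i := y))) has_vector_derivative partial_deriv i \<phi> (x(i := y))) (at y within {- L..L})" for y
        using smooth_has_partial_deriv[OF test_smooth[OF \<phi>] xy i, of y]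
        by (auto intro: has_vector_derivative_at_within)
      have "continuous_on UNIV (\<lambda>y. partial_deriv i \<phi> (x(i := y)))"
        by (rule continuous_on_compose2[OF smooth_continuous[OF test_smooth[OF pd]] continuous_on_fun_upd])
          (use xy in auto)
      then show "continuous_on {- L..L} (\<lambda>y. partial_deriv i \<phi> (x(i := y)))"
        by (rule continuous_on_subset) simp
    qed (use L in auto)
    also have "\<dots> = 0" using zero[of L] zero[of "- L"] L by simp
    finally have "(\<integral>y. indicator {- L..L} y *\<^sub>R partial_deriv i \<phi> (x(i := y)) \<partial>lborel) = 0" .
    moreover have "indicator {- L..L} y *\<^sub>R partial_deriv i \<phi> (x(i := y)) = partial_deriv i \<phi> (x(i := y))" for y
      using zero'[of y] by (auto simp: indicator_def)
    ultimately show ?thesis by simp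
  qed
  have "(\<integral>x. partial_deriv i \<phi> x \<partial>leb d) = (\<integral>x. partial_deriv i \<phi> x \<partial>bleb d)"
    unfolding leb_eq by (rule integral_completion[OF m])
  also have "\<dots> = (\<integral>x. partial_deriv i \<phi> x \<partial>PiM (insert i ?I) (\<lambda>_. lborel))"
    unfolding ins by (simp add: bleb_def)
  also have "\<dots> = (\<integral>x. (\<integral>y. partial_deriv i \<phi> (x(i := y)) \<partial>lborel) \<partial>PiM ?I (\<lambda>_. lborel))"
    by (rule lborel_product.product_integral_insert[OF _ _ int]) auto
  also have "\<dots> = (\<integral>x. 0 \<partial>PiM ?I (\<lambda>_. lborel))"
    using inner by (simp cong: Bochner_Integration.integral_cong)
  finally show ?thesis by simp
qed

lemma test_integration_by_parts:
  assumes \<phi>: "\<phi> \<in> test_functions d \<Omega>" and \<psi>: "\<psi> \<in> test_functions d \<Omega>" and \<Omega>: "\<Omega> \<subseteq> Rd d" and i: "i < d"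
  shows "(\<integral>x. \<phi> x * partial_deriv i \<psi> x \<partial>leb d) = - (\<integral>x. partial_deriv i \<phi> x * \<psi> x \<partial>leb d)"
proof -
  have "0 = (\<integral>x. partial_deriv i (\<lambda>x. \<phi> x * \<psi> x) x \<partial>leb d)"
    using integral_partial_deriv_test[OF test_mult[OF test_smooth[OF \<phi>] \<psi>] \<Omega> i] by simp
  also have "\<dots> = (\<integral>x. \<phi> x * partial_deriv i \<psi> x + partial_deriv i \<phi> x * \<psi> x \<partial>leb d)"
    using partial_deriv_mult[OF test_smooth[OF \<phi>] test_smooth[OF \<psi>] _ i]
    by (intro Bochner_Integration.integral_cong) auto
  also have "\<dots> = (\<integral>x. \<phi> x * partial_deriv i \<psi> x \<partial>leb d) + (\<integral>x. partial_deriv i \<phi> x * \<psi> x \<partial>leb d)"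
    using assms by (intro Bochner_Integration.integral_add L2_integrable_mult)
      (auto intro!: test_L2 test_partial_deriv)
  finally show ?thesis by (simp add: eq_neg_iff_add_eq_0)
qed

subsection \<open>The fundamental lemma of the calculus of variations\<close>

text \<open>Open boxes are stable under intersection, so this generator makes Dynkin's argument
  available for integrals over boxes.\<close>

lemma sets_bleb_eq_obox: "sets (bleb d) = sigma_sets (Rd d) (range (\<lambda>(l, u). obox d l u))"
proof -
  let ?E = "range (\<lambda>(a, b). {a<..<b :: real})"
  let ?P = "{{f \<in> PiE {..<d} (\<lambda>_. UNIV). \<forall>i\<in>j. f i \<in> A i} | A j. j \<in> {{..<d}} \<and> A \<in> Pi j (\<lambda>_. ?E)}"
  have "sets (bleb d) = sets (PiM {..<d} (\<lambda>_ :: nat. sigma (UNIV :: real set) ?E))"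
    unfolding bleb_def
    by (intro sets_PiM_cong refl) (simp only: sets_lborel borel_eq_box box_real)
  also have "\<dots> = sets (sigma (PiE {..<d} (\<lambda>_. UNIV)) ?P)"
  proof (rule sets_PiM_sigma)
    have "\<exists>n :: nat. - real n < x \<and> x < real n" for x
    proof -
      obtain n :: nat where "\<bar>x\<bar> < real n" using reals_Archimedean2 by blast
      then have "- real n < x \<and> x < real n" by linarith
      then show ?thesis by blast
    qed
    then have "UNIV = \<Union> (range (\<lambda>n :: nat. {- real n<..<real n}))" by auto
    then show "\<exists>S\<subseteq>?E. countable S \<and> UNIV = \<Union> S"
      by (intro exI[of _ "range (\<lambda>n :: nat. {- real n<..<real n})"]) auto
  qed auto
  also have "\<dots> = sigma_sets (Rd d) ?P"
    unfolding Rd_def by (rule sets_measure_of) auto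
  also have "?P = range (\<lambda>(l, u). obox d l u)"
  proof (intro set_eqI iffI)
    fix B assume "B \<in> ?P"
    then obtain A where B: "B = {f \<in> PiE {..<d} (\<lambda>_. UNIV). \<forall>i\<in>{..<d}. f i \<in> A i}" and A: "A \<in> Pi {..<d} (\<lambda>_. ?E)"
      by auto
    have "\<forall>i\<in>{..<d}. \<exists>p. A i = {fst p<..<snd p}"
    proof
      fix i assume "i \<in> {..<d}"
      with A have "A i \<in> ?E" by blast
      then show "\<exists>p. A i = {fst p<..<snd p}" by auto
    qed
    then obtain p where "\<forall>i\<in>{..<d}. A i = {fst (p i)<..<snd (p i)}" by metis
    then have "B = obox d (\<lambda>i. fst (p i)) (\<lambda>i. snd (p i))"
      unfolding B obox_def by (auto simp: PiE_iff extensional_def)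
    then show "B \<in> range (\<lambda>(l, u). obox d l u)" by auto
  next
    fix B assume "B \<in> range (\<lambda>(l, u). obox d l u)"
    then obtain l u where "B = obox d l u" by auto
    moreover have "obox d l u = {f \<in> PiE {..<d} (\<lambda>_. UNIV). \<forall>i\<in>{..<d}. f i \<in> {l i<..<u i}}"
      unfolding obox_def by (rule set_eqI) (simp only: mem_Collect_eq PiE_iff UNIV_I, blast)
    moreover have "(\<lambda>i. {l i<..<u i}) \<in> {..<d} \<rightarrow> ?E"
    proof (rule Pi_I)
      fix i
      show "{l i<..<u i} \<in> ?E" by (rule range_eqI[of _ _ "(l i, u i)"]) simp
    qed
    ultimately show "B \<in> ?P"
      unfolding mem_Collect_eq by (intro exI[of _ "\<lambda>i. {l i<..<u i}"] exI[of _ "{..<d}"]) simp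
  qed
  finally show ?thesis .
qed

lemma obox_Int: "obox d l u \<inter> obox d l' u' = obox d (\<lambda>j. max (l j) (l' j)) (\<lambda>j. min (u j) (u' j))"
  by (auto simp: obox_def PiE_Int)

text \<open>Truncation to a large box makes h integrable, Dynkin's argument extends the vanishing of
  the integral from boxes to all measurable sets, and the sets where h is positive or negative
  finish the proof.\<close>

lemma AE_zero_of_obox_integrals:
  fixes h :: "point \<Rightarrow> real"
  assumes [measurable]: "h \<in> borel_measurable (bleb d)"
    and int: "\<And>l u. integrable (bleb d) (\<lambda>x. indicator (obox d l u) x * h x)"
    and zero: "\<And>l u. (\<integral>x. indicator (obox d l u) x * h x \<partial>bleb d) = 0"
  shows "AE x in bleb d. h x = 0"
proof -
  have "AE x in bleb d. indicator (obox d (\<lambda>_. - real N) (\<lambda>_. real N)) x * h x = 0" for N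
  proof -
    define B where "B = obox d (\<lambda>_. - real N) (\<lambda>_. real N)"
    define k where "k = (\<lambda>x. indicator B x * h x)"
    have k: "integrable (bleb d) k" unfolding k_def B_def by (rule int)
    have ki: "integrable (bleb d) (\<lambda>x. indicator A x * k x)" if "A \<in> sets (bleb d)" for A
      using integrable_mult_indicator[OF that k] by simp
    have P: "(\<integral>x. indicator A x * k x \<partial>bleb d) = 0" if "A \<in> sets (bleb d)" for A
    proof -
      have "Int_stable (range (\<lambda>(l, u). obox d l u))"
        by (auto simp: Int_stable_def obox_Int)
      moreover have "range (\<lambda>(l, u). obox d l u) \<subseteq> Pow (Rd d)" using obox_subset by auto
      moreover have "A \<in> sigma_sets (Rd d) (range (\<lambda>(l, u). obox d l u))" using that sets_bleb_eq_obox by simp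
      ultimately show ?thesis
      proof (induction A rule: sigma_sets_induct_disjoint)
        case (basic A)
        then obtain l u where A: "A = obox d l u" by auto
        have "indicator A x * k x = indicator (A \<inter> B) x * h x" for x
          by (simp add: k_def indicator_def)
        then show ?case unfolding A B_def obox_Int by (simp only: zero)
      next
        case (compl A)
        then have A: "A \<in> sets (bleb d)" using sets_bleb_eq_obox by simp
        have "(\<integral>x. indicator (Rd d - A) x * k x \<partial>bleb d) = (\<integral>x. k x - indicator A x * k x \<partial>bleb d)"
          by (intro Bochner_Integration.integral_cong) (auto simp: indicator_def)
        also have "\<dots> = (\<integral>x. k x \<partial>bleb d) - 0"
          using compl.IH by (simp add: k ki[OF A])
        also have "(\<integral>x. k x \<partial>bleb d) = 0" unfolding k_def B_def by (rule zero)
        finally show ?case by simp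
      next
        case (union A)
        have A: "A i \<in> sets (bleb d)" for i using union(2) sets_bleb_eq_obox by auto
        have "(LINT x:(\<Union>i. A i)|bleb d. k x) = (\<Sum>i. (LINT x:(A i)|bleb d. k x))"
        proof (rule lebesgue_integral_countable_add)
          show "A i \<inter> A j = {}" if "i \<noteq> j" for i j using union(1) that by (auto simp: disjoint_family_on_def)
          show "set_integrable (bleb d) (\<Union>i. A i) k"
            unfolding set_integrable_def using A by (intro integrable_mult_indicator k) auto
        qed (rule A)
        then show ?case using union(3) by (simp add: set_lebesgue_integral_def)
      qed simp
    qed
    have [measurable]: "k \<in> borel_measurable (bleb d)" using k by auto
    have half: "AE x in bleb d. s * k x \<le> 0" if s: "s \<in> {1, -1}" for s :: real
    proof -
      define A where "A = {x \<in> space (bleb d). s * k x > 0}"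
      have A: "A \<in> sets (bleb d)" unfolding A_def by measurable
      have "(\<integral>x. indicator A x * (s * k x) \<partial>bleb d) = s * (\<integral>x. indicator A x * k x \<partial>bleb d)"
        by (subst integral_mult_right_zero[symmetric]) (simp add: mult.left_commute)
      then have "(\<integral>x. indicator A x * (s * k x) \<partial>bleb d) = 0" using P[OF A] by simp
      moreover have "integrable (bleb d) (\<lambda>x. indicator A x * (s * k x))"
        using integrable_mult_right[OF ki[OF A], of s] by (simp add: mult.left_commute)
      ultimately have "AE x in bleb d. indicator A x * (s * k x) = 0"
        by (subst (asm) integral_nonneg_eq_0_iff_AE) (auto simp: A_def indicator_def)
      then show ?thesis
        by (rule AE_mp) (auto simp: A_def indicator_def not_less intro!: AE_I2)
    qed
    show ?thesis
      using half[of 1] half[of "-1"] unfolding k_def B_def by (auto elim: eventually_elim2)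
  qed
  then have "AE x in bleb d. \<forall>N :: nat. indicator (obox d (\<lambda>_. - real N) (\<lambda>_. real N)) x * h x = 0"
    by (simp only: AE_all_countable) blast
  then show ?thesis
  proof (rule AE_mp, intro AE_I2 impI)
    fix x assume x: "x \<in> space (bleb d)" and z: "\<forall>N :: nat. indicator (obox d (\<lambda>_. - real N) (\<lambda>_. real N)) x * h x = 0"
    obtain N :: nat where N: "(\<Sum>j<d. \<bar>x j\<bar>) < real N" using reals_Archimedean2 by blast
    have "- real N < x j \<and> x j < real N" if "j < d" for j
    proof -
      have "\<bar>x j\<bar> < real N"
        using member_le_sum[of j "{..<d}" "\<lambda>j. \<bar>x j\<bar>"] that N by simp
      then show ?thesis by linarith
    qed
    then have "x \<in> obox d (\<lambda>_. - real N) (\<lambda>_. real N)"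
      using x by (simp add: obox_def Rd_def PiE_iff)
    then show "h x = 0" using z[rule_format, of N] by simp
  qed
qed

lemma indicator_obox_L2: "(\<lambda>x. indicator (obox d l u) x :: complex) \<in> L2 (leb d)"
proof (rule L2_bounded_obox(1)[where B = 1 and l = l and u = u])
  show "(\<lambda>x. indicator (obox d l u) x :: complex) \<in> borel_measurable (leb d)"
    by (rule borel_measurable_indicator) simp
qed (simp add: indicator_def)

text \<open>Real and imaginary part are treated separately, and each is replaced by a Borel version,
  because Dynkin's argument runs in the sigma-algebra before completion.\<close>

lemma L2_zero_of_obox_integrals:
  assumes g: "g \<in> L2 (leb d)" and zero: "\<And>l u. (\<integral>x. g x * indicator (obox d l u) x \<partial>leb d) = 0"
  shows "AE x in leb d. g x = 0"
proof -
  have part: "AE x in leb d. h x = 0"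
    if h: "h \<in> borel_measurable (leb d)"
      and hi: "\<And>l u. integrable (leb d) (\<lambda>x. indicator (obox d l u) x * h x)"
      and hz: "\<And>l u. (\<integral>x. indicator (obox d l u) x * h x \<partial>leb d) = 0" for h :: "point \<Rightarrow> real"
  proof -
    obtain h' where h': "h' \<in> borel_measurable (bleb d)" "AE x in bleb d. h x = h' x"
      using completion_ex_borel_measurable_real[of h "bleb d"] h unfolding leb_eq by blast
    have ae: "AE x in leb d. h x = h' x" using h'(2) unfolding leb_eq by (rule AE_completion)
    have m[measurable]: "(\<lambda>x. indicator (obox d l u) x * h' x) \<in> borel_measurable (bleb d)" for l u
      using h'(1) by (intro borel_measurable_times borel_measurable_indicator) auto
    have ae': "AE x in leb d. indicator (obox d l u) x * h x = indicator (obox d l u) x * h' x" for l u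
      using ae by eventually_elim simp
    have i': "integrable (leb d) (\<lambda>x. indicator (obox d l u) x * h' x)" for l u
      using hi[of l u] by (rule integrable_cong_AE_imp) (use ae' bleb_measurable_leb[OF m] in \<open>auto elim: eventually_mono\<close>)
    have "AE x in bleb d. h' x = 0"
    proof (rule AE_zero_of_obox_integrals[OF h'(1)])
      fix l u
      show "integrable (bleb d) (\<lambda>x. indicator (obox d l u) x * h' x)"
        using i'[of l u] integrable_completion[OF m] by (simp add: leb_eq)
      have "(\<integral>x. indicator (obox d l u) x * h' x \<partial>bleb d) = (\<integral>x. indicator (obox d l u) x * h' x \<partial>leb d)"
        unfolding leb_eq by (rule integral_completion[OF m, symmetric])
      also have "\<dots> = (\<integral>x. indicator (obox d l u) x * h x \<partial>leb d)"
      proof (rule integral_cong_AE)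
        show "AE x in leb d. indicator (obox d l u) x * h' x = indicator (obox d l u) x * h x"
          using ae'[of l u] by eventually_elim (rule sym)
      qed (use hi[of l u] i'[of l u] in auto)
      finally show "(\<integral>x. indicator (obox d l u) x * h' x \<partial>bleb d) = 0" using hz by simp
    qed
    then have "AE x in leb d. h' x = 0" unfolding leb_eq by (rule AE_completion)
    with ae show ?thesis by eventually_elim simp
  qed
  have gi: "integrable (leb d) (\<lambda>x. g x * indicator (obox d l u) x)" for l u
    by (intro L2_integrable_mult g indicator_obox_L2)
  have gm: "g \<in> borel_measurable (leb d)" by (rule L2_measurable[OF g])
  have Re_eq: "Re (g x * indicator (obox d l u) x) = indicator (obox d l u) x * Re (g x)"
    and Im_eq: "Im (g x * indicator (obox d l u) x) = indicator (obox d l u) x * Im (g x)" for x l u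
    by (auto simp: indicator_def)
  have "AE x in leb d. Re (g x) = 0"
  proof (rule part)
    show "integrable (leb d) (\<lambda>x. indicator (obox d l u) x * Re (g x))" for l u
      using integrable_Re[OF gi[of l u]] by (simp only: Re_eq)
    show "(\<integral>x. indicator (obox d l u) x * Re (g x) \<partial>leb d) = 0" for l u
      using integral_Re[OF gi[of l u]] zero[of l u] by (simp only: Re_eq zero_complex.simps)
  qed (use gm in simp)
  moreover have "AE x in leb d. Im (g x) = 0"
  proof (rule part)
    show "integrable (leb d) (\<lambda>x. indicator (obox d l u) x * Im (g x))" for l u
      using integrable_Im[OF gi[of l u]] by (simp only: Im_eq)
    show "(\<integral>x. indicator (obox d l u) x * Im (g x) \<partial>leb d) = 0" for l u
      using integral_Im[OF gi[of l u]] zero[of l u] by (simp only: Im_eq zero_complex.simps)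
  qed (use gm in simp)
  ultimately show ?thesis by eventually_elim (simp add: complex_eq_iff)
qed

text \<open>An extensional box is a full product with the compact factor {undefined} on the
  remaining axes, so Tychonoff applies.\<close>

lemma compact_closed_box: "compact (PiE {..<d} (\<lambda>j. {a j..b j :: real}))"
proof -
  have "PiE {..<d} (\<lambda>j. {a j..b j}) = PiE UNIV (\<lambda>j. if j < d then {a j..b j} else {undefined})"
    by (auto simp: PiE_iff extensional_def split: if_splits)
  moreover have "compactin (product_topology (\<lambda>_. euclidean) UNIV) (PiE UNIV (\<lambda>j. if j < d then {a j..b j} else {undefined}))"
    by (simp add: compactin_PiE)
  ultimately show ?thesis by (simp add: euclidean_product_topology)
qed

text \<open>The shift by -1 leaves a margin of 1/n to the faces, which makes the support compact in
  the open box. The affine arguments are written as u + v x to match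
  \<open>smooth_flat\<close>.\<close>

definition bump :: "nat \<Rightarrow> (nat \<Rightarrow> real) \<Rightarrow> (nat \<Rightarrow> real) \<Rightarrow> nat \<Rightarrow> point \<Rightarrow> complex" where
  "bump d l u n x = (\<Prod>j<d. of_real (flat 1 ((- real n * l j - 1) + real n * x j)) *
      of_real (flat 1 ((real n * u j - 1) + (- real n) * x j)))"

lemma bump_eq_0:
  assumes "j < d"
    and "flat 1 ((- real n * l j - 1) + real n * x j) = 0 \<or> flat 1 ((real n * u j - 1) + (- real n) * x j) = 0"
  shows "bump d l u n x = 0"
  unfolding bump_def
proof (rule prod_zero)
  have "complex_of_real (flat 1 ((- real n * l j - 1) + real n * x j)) *
      of_real (flat 1 ((real n * u j - 1) + (- real n) * x j)) = 0"
    using assms(2) by (simp only: mult_eq_0_iff of_real_eq_0_iff)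
  with assms(1) show "\<exists>j\<in>{..<d}. complex_of_real (flat 1 ((- real n * l j - 1) + real n * x j)) *
      of_real (flat 1 ((real n * u j - 1) + (- real n) * x j)) = 0" by blast
qed simp

lemma bump_test:
  assumes n: "n > 0"
  shows "bump d l u n \<in> test_functions d (obox d l u)"
proof (rule test_functionsI)
  let ?C = "PiE {..<d} (\<lambda>j. {l j + 1 / real n..u j - 1 / real n})"
  show "smooth d (bump d l u n)"
    unfolding bump_def by (intro smooth_prod smooth_mult smooth_flat) auto
  show "compact ?C" by (rule compact_closed_box)
  show "?C \<subseteq> obox d l u"
    unfolding obox_def
  proof (rule PiE_mono)
    fix j
    have "1 / real n > 0" using n by simp
    then show "{l j + 1 / real n..u j - 1 / real n} \<subseteq> {l j<..<u j}"
      by (intro subsetI) (simp only: atLeastAtMost_iff greaterThanLessThan_iff, linarith)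
  qed
  fix x assume "x \<in> Rd d" "x \<notin> ?C"
  then obtain j where j: "j < d" "x j < l j + 1 / real n \<or> x j > u j - 1 / real n"
    by (auto simp: Rd_def PiE_iff not_le)
  have "x j < l j + 1 / real n \<Longrightarrow> real n * x j < real n * l j + 1"
    "x j > u j - 1 / real n \<Longrightarrow> real n * x j > real n * u j - 1"
    using n by (auto simp: field_simps)
  then have "flat 1 ((- real n * l j - 1) + real n * x j) = 0 \<or> flat 1 ((real n * u j - 1) + (- real n) * x j) = 0"
    using j(2) by (auto simp: flat_def)
  then show "bump d l u n x = 0" by (rule bump_eq_0[OF j(1)])
qed

lemma bump_norm: "cmod (bump d l u n x) \<le> 1"
proof -
  have "cmod (bump d l u n x) = (\<Prod>j<d. flat 1 ((- real n * l j - 1) + real n * x j) *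
      flat 1 ((real n * u j - 1) + (- real n) * x j))"
    unfolding bump_def by (simp add: norm_mult flat_one_bounds flip: prod_norm)
  also have "\<dots> \<le> (\<Prod>j<d. 1 :: real)"
    by (intro prod_mono conjI mult_nonneg_nonneg mult_le_one flat_one_bounds)
  finally show ?thesis by simp
qed

lemma bump_zero:
  assumes "x \<in> Rd d" "x \<notin> obox d l u"
  shows "bump d l u n x = 0"
proof -
  obtain j where j: "j < d" "x j \<le> l j \<or> u j \<le> x j"
    using assms by (auto simp: Rd_def obox_def PiE_iff not_less)
  then have "real n * x j \<le> real n * l j \<or> real n * u j \<le> real n * x j"
    by (auto intro: mult_left_mono)
  then have "flat 1 ((- real n * l j - 1) + real n * x j) = 0 \<or> flat 1 ((real n * u j - 1) + (- real n) * x j) = 0"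
    by (auto simp: flat_def)
  then show ?thesis by (rule bump_eq_0[OF j(1)])
qed

lemma bump_tendsto:
  assumes "x \<in> Rd d"
  shows "(\<lambda>n. bump d l u n x) \<longlonglongrightarrow> indicator (obox d l u) x"
proof (cases "x \<in> obox d l u")
  case True
  have "(\<lambda>n. bump d l u n x) \<longlonglongrightarrow> (\<Prod>j<d. of_real 1 * of_real 1)"
    unfolding bump_def
  proof (intro tendsto_prod tendsto_mult tendsto_of_real)
    fix j assume "j \<in> {..<d}"
    then have j: "l j < x j" "x j < u j" using True by (simp_all add: obox_def PiE_iff)
    have eq: "(- real n * l j - 1) + real n * x j = real n * (x j - l j) - 1"
      "(real n * u j - 1) + (- real n) * x j = real n * (u j - x j) - 1" for n
      by (simp_all add: algebra_simps)
    show "(\<lambda>n. flat 1 ((- real n * l j - 1) + real n * x j)) \<longlonglongrightarrow> 1"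
      unfolding eq by (rule flat_one_tendsto) (use j in simp)
    show "(\<lambda>n. flat 1 ((real n * u j - 1) + (- real n) * x j)) \<longlonglongrightarrow> 1"
      unfolding eq by (rule flat_one_tendsto) (use j in simp)
  qed
  then show ?thesis using True by simp
next
  case False
  then show ?thesis using bump_zero[OF assms] by simp
qed

text \<open>What the whole space and the orthant share: intersections with boxes are boxes again, so
  bump functions of boxes are enough test functions.\<close>

definition box_domain :: "nat \<Rightarrow> point set \<Rightarrow> bool" where
  "box_domain d \<Omega> \<longleftrightarrow> \<Omega> \<in> sets (bleb d) \<and> \<Omega> \<subseteq> Rd d \<and>
     (\<forall>l u. \<exists>l' u'. \<Omega> \<inter> obox d l u = obox d l' u')"

lemma box_domain_Rd: "box_domain d (Rd d)"
  unfolding box_domain_def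
proof (intro conjI allI)
  show "Rd d \<in> sets (bleb d)" using sets.top[of "bleb d"] by simp
  show "\<exists>l' u'. Rd d \<inter> obox d l u = obox d l' u'" for l u
    using obox_subset[of d l u] by (intro exI[of _ l] exI[of _ u]) auto
qed simp

lemma box_domain_orthant: "box_domain d (orthant d)"
  unfolding box_domain_def
proof (intro conjI allI)
  show "orthant d \<in> sets (bleb d)" unfolding orthant_def by (rule PiE_sets_bleb) simp
  show "orthant d \<subseteq> Rd d" by (auto simp: orthant_def Rd_def PiE_iff)
  show "\<exists>l' u'. orthant d \<inter> obox d l u = obox d l' u'" for l u
  proof (intro exI)
    show "orthant d \<inter> obox d l u = obox d (\<lambda>j. max 0 (l j)) u"
      unfolding orthant_def obox_def PiE_Int by (rule PiE_cong) auto
  qed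
qed

text \<open>Boxes inside the domain are exhausted by bump functions, so the integral over each box vanishes.\<close>

lemma fundamental_lemma:
  assumes \<Omega>: "box_domain d \<Omega>" and g: "g \<in> L2 (leb d)"
    and supp: "\<And>x. x \<in> Rd d \<Longrightarrow> x \<notin> \<Omega> \<Longrightarrow> g x = 0"
    and zero: "\<And>\<phi>. \<phi> \<in> test_functions d \<Omega> \<Longrightarrow> (\<integral>x. g x * \<phi> x \<partial>leb d) = 0"
  shows "AE x in leb d. g x = 0"
proof (rule L2_zero_of_obox_integrals[OF g])
  fix l u
  obtain l' u' where lu: "\<Omega> \<inter> obox d l u = obox d l' u'" using \<Omega> unfolding box_domain_def by blast
  have gm: "g \<in> borel_measurable (leb d)" by (rule L2_measurable[OF g])
  have "(\<integral>x. g x * indicator (obox d l u) x \<partial>leb d) = (\<integral>x. g x * indicator (obox d l' u') x \<partial>leb d)"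
    using supp lu[symmetric] by (intro Bochner_Integration.integral_cong) (auto simp: indicator_def)
  also have "\<dots> = 0"
  proof (rule LIMSEQ_unique)
    \<comment> \<open>The index starts at 1, as the margin 1/n of the support requires.\<close>
    have bm: "bump d l' u' (Suc n) \<in> test_functions d \<Omega>" for n
      using lu by (intro test_mono[OF bump_test]) auto
    have "(\<integral>x. g x * bump d l' u' (Suc n) x \<partial>leb d) = 0" for n by (rule zero[OF bm])
    then show "(\<lambda>n. \<integral>x. g x * bump d l' u' (Suc n) x \<partial>leb d) \<longlonglongrightarrow> 0" by simp
    show "(\<lambda>n. \<integral>x. g x * bump d l' u' (Suc n) x \<partial>leb d) \<longlonglongrightarrow> (\<integral>x. g x * indicator (obox d l' u') x \<partial>leb d)"
    proof (rule integral_dominated_convergence)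
      show "integrable (leb d) (\<lambda>x. cmod (g x) * cmod (indicator (obox d l' u') x))"
        by (intro L2_integrable_cmod_mult g indicator_obox_L2)
      show "AE x in leb d. (\<lambda>n. g x * bump d l' u' (Suc n) x) \<longlonglongrightarrow> g x * indicator (obox d l' u') x"
        by (intro AE_I2 tendsto_intros LIMSEQ_Suc bump_tendsto) simp
      show "AE x in leb d. norm (g x * bump d l' u' (Suc n) x) \<le> cmod (g x) * cmod (indicator (obox d l' u') x)" for n
      proof (rule AE_I2)
        fix x assume "x \<in> space (leb d)"
        then show "norm (g x * bump d l' u' (Suc n) x) \<le> cmod (g x) * cmod (indicator (obox d l' u') x)"
          using bump_zero[of x d l' u' "Suc n"] bump_norm[of d l' u' "Suc n" x]
          by (cases "x \<in> obox d l' u'") (auto simp: norm_mult mult_left_le)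
      qed
      show "(\<lambda>x. g x * indicator (obox d l' u') x) \<in> borel_measurable (leb d)"
        using gm by (intro borel_measurable_times borel_measurable_indicator) auto
      show "(\<lambda>x. g x * bump d l' u' (Suc n) x) \<in> borel_measurable (leb d)" for n
        using gm bleb_measurable_leb[OF test_measurable[OF bm[of n]]] by (rule borel_measurable_times)
    qed
  qed
  finally show "(\<integral>x. g x * indicator (obox d l u) x \<partial>leb d) = 0" .
qed

section \<open>Sobolev spaces on box domains\<close>

lemma smooth_cnj:
  assumes "smooth d \<phi>"
  shows "smooth d (\<lambda>x. cnj (\<phi> x))"
proof (rule smooth_coinduct[of "\<lambda>\<psi>. \<exists>\<phi>. smooth d \<phi> \<and> \<psi> = (\<lambda>x. cnj (\<phi> x))"])
  show "\<exists>\<phi>'. smooth d \<phi>' \<and> (\<lambda>x. cnj (\<phi> x)) = (\<lambda>x. cnj (\<phi>' x))" using assms by blast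
  fix \<psi> assume "\<exists>\<phi>. smooth d \<phi> \<and> \<psi> = (\<lambda>x. cnj (\<phi> x))"
  then obtain \<phi> where \<phi>: "smooth d \<phi>" "\<psi> = (\<lambda>x. cnj (\<phi> x))" by blast
  show "continuous_on (Rd d) \<psi>" unfolding \<phi>(2) by (intro continuous_intros smooth_continuous \<phi>)
  fix i assume i: "i < d"
  have "((\<lambda>t. cnj (\<phi> (x(i := t)))) has_vector_derivative cnj (partial_deriv i \<phi> x)) (at (x i))" if "x \<in> Rd d" for x
    by (rule bounded_linear.has_vector_derivative[OF bounded_linear_cnj smooth_has_partial_deriv[OF \<phi>(1) that i]])
  then show "\<exists>\<psi>'. (\<exists>\<phi>. smooth d \<phi> \<and> \<psi>' = (\<lambda>x. cnj (\<phi> x))) \<and>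
      (\<forall>x\<in>Rd d. ((\<lambda>t. \<psi> (x(i := t))) has_vector_derivative \<psi>' x) (at (x i)))"
    unfolding \<phi>(2) using smooth_partial_deriv[OF \<phi>(1) i]
    by (intro exI[of _ "\<lambda>x. cnj (partial_deriv i \<phi> x)"]) blast
qed

lemma test_cnj: "\<phi> \<in> test_functions d \<Omega> \<Longrightarrow> (\<lambda>x. cnj (\<phi> x)) \<in> test_functions d \<Omega>"
  by (erule test_functionsE, rule test_functionsI[OF smooth_cnj], assumption+) simp

locale box_domain_locale =
  fixes d :: nat and \<Omega> :: "point set"
  assumes box_domain: "box_domain d \<Omega>"
begin

abbreviation M :: "point measure" where "M \<equiv> leb_on d \<Omega>"

lemma domain_sets: "\<Omega> \<in> sets (leb d)" and domain_subset: "\<Omega> \<subseteq> Rd d"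
  using box_domain by (auto simp: box_domain_def bleb_sets_leb)

lemma domain_Int: "\<Omega> \<inter> space (leb d) \<in> sets (leb d)"
  using domain_sets domain_subset by (simp add: Int_absorb2)

lemma space_M: "space M = \<Omega>"
  using domain_subset by (auto simp: space_restrict_space)

lemma integral_M: "(\<integral>x. f x \<partial>M) = (\<integral>x. indicator \<Omega> x * f x \<partial>leb d)" for f :: "point \<Rightarrow> complex"
proof -
  have "indicator \<Omega> x *\<^sub>R f x = indicator \<Omega> x * f x" for x by (simp add: indicator_def)
  then show ?thesis by (simp add: integral_restrict_space[OF domain_Int])
qed

lemma L2_M_iff: "f \<in> L2 M \<longleftrightarrow> (\<lambda>x. indicator \<Omega> x * f x) \<in> L2 (leb d)"
proof -
  have "indicator \<Omega> x *\<^sub>R f x = indicator \<Omega> x * f x"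
    "indicator \<Omega> x *\<^sub>R (cmod (f x))\<^sup>2 = (cmod (indicator \<Omega> x * f x))\<^sup>2" for x
    by (simp_all add: indicator_def)
  then show ?thesis
    unfolding L2_def
    by (simp add: borel_measurable_restrict_space_iff[OF domain_Int] integrable_restrict_space[OF domain_Int])
qed

lemma AE_M_iff: "(AE x in M. P x) \<longleftrightarrow> (AE x in leb d. x \<in> \<Omega> \<longrightarrow> P x)"
  by (rule AE_restrict_space_iff[OF domain_Int])

lemma L2_norm_M: "L2_norm M f = L2_norm (leb d) (\<lambda>x. indicator \<Omega> x * f x)"
proof -
  have "indicator \<Omega> x *\<^sub>R (cmod (f x))\<^sup>2 = (cmod (indicator \<Omega> x * f x))\<^sup>2" for x
    by (simp add: indicator_def)
  then show ?thesis by (simp add: L2_norm_def integral_restrict_space[OF domain_Int])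
qed

lemma L2_indicator: "f \<in> L2 (leb d) \<Longrightarrow> (\<lambda>x. indicator \<Omega> x * f x) \<in> L2 (leb d)"
  by (rule L2_bounded_mult[where C = 1]) (use domain_sets in \<open>auto simp: indicator_def intro: borel_measurable_indicator\<close>)

lemma L2_restrict: "f \<in> L2 (leb d) \<Longrightarrow> f \<in> L2 M"
  unfolding L2_M_iff by (rule L2_indicator)

lemma test_L2_M: "\<phi> \<in> test_functions d \<Omega>' \<Longrightarrow> \<Omega>' \<subseteq> Rd d \<Longrightarrow> \<phi> \<in> L2 M"
  by (intro L2_restrict test_L2)

lemma fundamental_lemma_M:
  assumes g: "g \<in> L2 M" and zero: "\<And>\<phi>. \<phi> \<in> test_functions d \<Omega> \<Longrightarrow> (\<integral>x. g x * \<phi> x \<partial>M) = 0"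
  shows "AE x in M. g x = 0"
proof -
  have "AE x in leb d. indicator \<Omega> x * g x = 0"
  proof (rule fundamental_lemma[OF box_domain])
    show "(\<lambda>x. indicator \<Omega> x * g x) \<in> L2 (leb d)" using g by (simp only: L2_M_iff)
    show "(\<integral>x. indicator \<Omega> x * g x * \<phi> x \<partial>leb d) = 0" if "\<phi> \<in> test_functions d \<Omega>" for \<phi>
      using zero[OF that] by (simp add: integral_M mult.assoc)
  qed simp
  then show ?thesis unfolding AE_M_iff by eventually_elim auto
qed

subsection \<open>Weak derivatives\<close>

lemma is_weak_deriv_lincomb:
  assumes "i < d" "f \<in> L2 M" "f' \<in> L2 M" "g \<in> L2 M" "g' \<in> L2 M"
    and "is_weak_deriv d \<Omega> i f g" "is_weak_deriv d \<Omega> i f' g'"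
  shows "is_weak_deriv d \<Omega> i (\<lambda>x. c * f x + f' x) (\<lambda>x. c * g x + g' x)"
  unfolding is_weak_deriv_def
proof
  fix \<phi> assume \<phi>: "\<phi> \<in> test_functions d \<Omega>"
  have L: "\<phi> \<in> L2 M" "partial_deriv i \<phi> \<in> L2 M"
    using \<phi> assms(1) by (auto intro!: test_L2_M[OF _ domain_subset] test_partial_deriv)
  have "(\<integral>x. (c * f x + f' x) * partial_deriv i \<phi> x \<partial>M)
      = (\<integral>x. c * (f x * partial_deriv i \<phi> x) + f' x * partial_deriv i \<phi> x \<partial>M)"
    by (simp add: distrib_right mult.assoc)
  also have "\<dots> = c * (\<integral>x. f x * partial_deriv i \<phi> x \<partial>M) + (\<integral>x. f' x * partial_deriv i \<phi> x \<partial>M)"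
    using L2_integrable_mult[OF assms(2) L(2)] L2_integrable_mult[OF assms(3) L(2)] by simp
  also have "\<dots> = - (c * (\<integral>x. g x * \<phi> x \<partial>M) + (\<integral>x. g' x * \<phi> x \<partial>M))"
    using assms(6,7) \<phi> by (simp add: is_weak_deriv_def)
  also have "\<dots> = - (\<integral>x. c * (g x * \<phi> x) + g' x * \<phi> x \<partial>M)"
    using L2_integrable_mult[OF assms(4) L(1)] L2_integrable_mult[OF assms(5) L(1)] by simp
  also have "\<dots> = - (\<integral>x. (c * g x + g' x) * \<phi> x \<partial>M)"
    by (simp add: distrib_right mult.assoc)
  finally show "(\<integral>x. (c * f x + f' x) * partial_deriv i \<phi> x \<partial>M) = - (\<integral>x. (c * g x + g' x) * \<phi> x \<partial>M)" .
qed

lemma is_weak_deriv_cong: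
  assumes "i < d" "f \<in> L2 M" "f' \<in> L2 M" "AE x in M. f x = f' x" "is_weak_deriv d \<Omega> i f g"
  shows "is_weak_deriv d \<Omega> i f' g"
  unfolding is_weak_deriv_def
proof
  fix \<phi> assume \<phi>: "\<phi> \<in> test_functions d \<Omega>"
  have L: "partial_deriv i \<phi> \<in> L2 M"
    using \<phi> assms(1) by (auto intro!: test_L2_M[OF _ domain_subset] test_partial_deriv)
  have "(\<integral>x. f' x * partial_deriv i \<phi> x \<partial>M) = (\<integral>x. f x * partial_deriv i \<phi> x \<partial>M)"
  proof (rule integral_cong_AE)
    show "AE x in M. f' x * partial_deriv i \<phi> x = f x * partial_deriv i \<phi> x"
      using assms(4) by eventually_elim simp
  qed (use L2_integrable_mult[OF assms(2) L] L2_integrable_mult[OF assms(3) L] in auto)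
  then show "(\<integral>x. f' x * partial_deriv i \<phi> x \<partial>M) = - (\<integral>x. g x * \<phi> x \<partial>M)"
    using assms(5) \<phi> by (simp add: is_weak_deriv_def)
qed

lemma is_weak_deriv_limit:
  assumes i: "i < d" and F: "\<And>n::nat. F n \<in> L2 M" and G: "\<And>n. G n \<in> L2 M" and f: "f \<in> L2 M" and g: "g \<in> L2 M"
    and w: "\<And>n. is_weak_deriv d \<Omega> i (F n) (G n)"
    and lF: "(\<lambda>n. L2_norm M (\<lambda>x. F n x - f x)) \<longlonglongrightarrow> 0" and lG: "(\<lambda>n. L2_norm M (\<lambda>x. G n x - g x)) \<longlonglongrightarrow> 0"
  shows "is_weak_deriv d \<Omega> i f g"
  unfolding is_weak_deriv_def
proof
  fix \<phi> assume \<phi>: "\<phi> \<in> test_functions d \<Omega>"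
  have L: "\<phi> \<in> L2 M" "partial_deriv i \<phi> \<in> L2 M"
    using \<phi> i by (auto intro!: test_L2_M[OF _ domain_subset] test_partial_deriv)
  have "(\<lambda>n. - (\<integral>x. G n x * \<phi> x \<partial>M)) \<longlonglongrightarrow> - (\<integral>x. g x * \<phi> x \<partial>M)"
    by (intro tendsto_minus tendsto_integral_mult_L2 G g L lG)
  moreover have "(\<lambda>n. \<integral>x. F n x * partial_deriv i \<phi> x \<partial>M) \<longlonglongrightarrow> (\<integral>x. f x * partial_deriv i \<phi> x \<partial>M)"
    by (intro tendsto_integral_mult_L2 F f L lF)
  moreover have "(\<integral>x. F n x * partial_deriv i \<phi> x \<partial>M) = - (\<integral>x. G n x * \<phi> x \<partial>M)" for n
    using w \<phi> by (simp add: is_weak_deriv_def)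
  ultimately show "(\<integral>x. f x * partial_deriv i \<phi> x \<partial>M) = - (\<integral>x. g x * \<phi> x \<partial>M)"
    by (simp add: LIMSEQ_unique)
qed

lemma is_weak_deriv_unique:
  assumes i: "i < d" and g: "g \<in> L2 M" "g' \<in> L2 M"
    and w: "is_weak_deriv d \<Omega> i f g" "is_weak_deriv d \<Omega> i f g'"
  shows "AE x in M. g x = g' x"
proof -
  have "AE x in M. g x - g' x = 0"
  proof (rule fundamental_lemma_M[OF L2_diff[OF g]])
    fix \<phi> assume \<phi>: "\<phi> \<in> test_functions d \<Omega>"
    have L: "\<phi> \<in> L2 M" using \<phi> by (rule test_L2_M[OF _ domain_subset])
    have "(\<integral>x. (g x - g' x) * \<phi> x \<partial>M) = (\<integral>x. g x * \<phi> x \<partial>M) - (\<integral>x. g' x * \<phi> x \<partial>M)"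
      using L2_integrable_mult[OF g(1) L] L2_integrable_mult[OF g(2) L] by (simp add: left_diff_distrib)
    then show "(\<integral>x. (g x - g' x) * \<phi> x \<partial>M) = 0"
      using w \<phi> by (simp add: is_weak_deriv_def)
  qed
  then show ?thesis by eventually_elim simp
qed

abbreviation D :: "nat \<Rightarrow> (point \<Rightarrow> complex) \<Rightarrow> point \<Rightarrow> complex" where
  "D i f \<equiv> weak_deriv d \<Omega> i f"

abbreviation H :: "(point \<Rightarrow> complex) set" where "H \<equiv> H1 d \<Omega>"

lemma H1_L2: "f \<in> H \<Longrightarrow> f \<in> L2 M" by (simp add: H1_def)

lemma weak_deriv_exists:
  assumes "g \<in> L2 M" "is_weak_deriv d \<Omega> i f g"
  shows "D i f \<in> L2 M" "is_weak_deriv d \<Omega> i f (D i f)"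
proof -
  have "\<exists>g. g \<in> L2 M \<and> is_weak_deriv d \<Omega> i f g" using assms by blast
  from someI_ex[OF this] show "D i f \<in> L2 M" "is_weak_deriv d \<Omega> i f (D i f)"
    unfolding weak_deriv_def by auto
qed

lemma H1_weak_deriv:
  assumes "f \<in> H" "i < d"
  shows "D i f \<in> L2 M" "is_weak_deriv d \<Omega> i f (D i f)"
proof -
  obtain g where "g \<in> L2 M" "is_weak_deriv d \<Omega> i f g" using assms by (auto simp: H1_def)
  then show "D i f \<in> L2 M" "is_weak_deriv d \<Omega> i f (D i f)" by (rule weak_deriv_exists)+
qed

lemma weak_deriv_AE:
  assumes "i < d" "g \<in> L2 M" "is_weak_deriv d \<Omega> i f g"
  shows "AE x in M. D i f x = g x"
  using assms weak_deriv_exists[OF assms(2,3)] by (intro is_weak_deriv_unique[of i _ _ f])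

lemma H1_I: "f \<in> L2 M \<Longrightarrow> (\<And>i. i < d \<Longrightarrow> G i \<in> L2 M \<and> is_weak_deriv d \<Omega> i f (G i)) \<Longrightarrow> f \<in> H"
  unfolding H1_def by blast

text \<open>\<open>weak_deriv\<close> is a choice among functions that are equal almost everywhere,
  so it is linear only almost everywhere; this is the form of all calculation rules for it.\<close>

lemma H1_lincomb:
  assumes f: "f \<in> H" and g: "g \<in> H"
  shows "(\<lambda>x. c * f x + g x) \<in> H"
    and "i < d \<Longrightarrow> AE x in M. D i (\<lambda>x. c * f x + g x) x = c * D i f x + D i g x"
proof -
  have w: "(\<lambda>x. c * D i f x + D i g x) \<in> L2 M \<and>
      is_weak_deriv d \<Omega> i (\<lambda>x. c * f x + g x) (\<lambda>x. c * D i f x + D i g x)" if "i < d" for i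
    using that H1_weak_deriv[OF f that] H1_weak_deriv[OF g that] H1_L2[OF f] H1_L2[OF g]
    by (auto intro: L2_lincomb is_weak_deriv_lincomb)
  then show "(\<lambda>x. c * f x + g x) \<in> H"
    by (rule H1_I[OF L2_lincomb[OF H1_L2[OF f] H1_L2[OF g]]])
  show "AE x in M. D i (\<lambda>x. c * f x + g x) x = c * D i f x + D i g x" if "i < d"
    using weak_deriv_AE[OF that] w[OF that] by blast
qed

lemma H1_diff:
  assumes f: "f \<in> H" and g: "g \<in> H"
  shows "(\<lambda>x. f x - g x) \<in> H" and "i < d \<Longrightarrow> AE x in M. D i (\<lambda>x. f x - g x) x = D i f x - D i g x"
proof -
  have eq: "(\<lambda>x. (-1) * g x + f x) = (\<lambda>x. f x - g x)" by auto
  show "(\<lambda>x. f x - g x) \<in> H" using H1_lincomb(1)[OF g f, of "-1"] unfolding eq .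
  show "AE x in M. D i (\<lambda>x. f x - g x) x = D i f x - D i g x" if "i < d"
    using H1_lincomb(2)[OF g f that, of "-1"] unfolding eq by eventually_elim simp
qed

lemma H1_cong:
  assumes f: "f \<in> H" and g: "g \<in> L2 M" and ae: "AE x in M. f x = g x"
  shows "g \<in> H" and "i < d \<Longrightarrow> AE x in M. D i g x = D i f x"
proof -
  have w: "is_weak_deriv d \<Omega> i g (D i f)" if "i < d" for i
    using that H1_L2[OF f] g ae H1_weak_deriv(2)[OF f that] by (rule is_weak_deriv_cong)
  then show "g \<in> H" using H1_weak_deriv(1)[OF f] by (intro H1_I[OF g, where G = "\<lambda>i. D i f"]) blast
  show "AE x in M. D i g x = D i f x" if "i < d"
    using that H1_weak_deriv(1)[OF f that] w[OF that] by (rule weak_deriv_AE)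
qed

lemma H1_diff_norm:
  assumes "f \<in> H" "g \<in> H" "i < d"
  shows "L2_norm M (D i (\<lambda>x. f x - g x)) = L2_norm M (\<lambda>x. D i f x - D i g x)"
  using H1_weak_deriv(1)[OF H1_diff(1)[OF assms(1,2)] assms(3)]
    H1_weak_deriv(1)[OF assms(1,3)] H1_weak_deriv(1)[OF assms(2,3)] H1_diff(2)[OF assms]
  by (intro L2_norm_cong_AE) (auto intro: L2_measurable L2_diff)

lemma test_weak_deriv:
  assumes \<phi>: "\<phi> \<in> test_functions d \<Omega>" and i: "i < d"
  shows "is_weak_deriv d \<Omega> i \<phi> (partial_deriv i \<phi>)"
  unfolding is_weak_deriv_def
proof
  fix \<psi> assume \<psi>: "\<psi> \<in> test_functions d \<Omega>"
  have off: "\<eta> x = 0" if "\<eta> \<in> test_functions d \<Omega>" "x \<in> Rd d" "x \<notin> \<Omega>" for \<eta> x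
    using that(1) by (rule test_functionsE) (use that in blast)
  have "(\<integral>x. \<phi> x * partial_deriv i \<psi> x \<partial>M) = (\<integral>x. \<phi> x * partial_deriv i \<psi> x \<partial>leb d)"
    unfolding integral_M using off[OF \<phi>]
    by (intro Bochner_Integration.integral_cong) (auto simp: indicator_def)
  moreover have "(\<integral>x. partial_deriv i \<phi> x * \<psi> x \<partial>M) = (\<integral>x. partial_deriv i \<phi> x * \<psi> x \<partial>leb d)"
    unfolding integral_M using off[OF \<psi>]
    by (intro Bochner_Integration.integral_cong) (auto simp: indicator_def)
  ultimately show "(\<integral>x. \<phi> x * partial_deriv i \<psi> x \<partial>M) = - (\<integral>x. partial_deriv i \<phi> x * \<psi> x \<partial>M)"
    using test_integration_by_parts[OF \<phi> \<psi> domain_subset i] by simp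
qed

lemma test_H1:
  assumes "\<phi> \<in> test_functions d \<Omega>"
  shows "\<phi> \<in> H"
  using test_L2_M[OF assms domain_subset] test_weak_deriv[OF assms]
    test_L2_M[OF test_partial_deriv[OF assms] domain_subset]
  by (intro H1_I[where G = "\<lambda>i. partial_deriv i \<phi>"]) auto

text \<open>Convergence in H1 expressed through differences of the chosen derivatives instead of the
  chosen derivative of the difference, which would require an almost everywhere argument at each
  use.\<close>

definition H1_conv :: "(nat \<Rightarrow> point \<Rightarrow> complex) \<Rightarrow> (point \<Rightarrow> complex) \<Rightarrow> bool" where
  "H1_conv F f \<longleftrightarrow> (\<lambda>n. L2_norm M (\<lambda>x. F n x - f x)) \<longlonglongrightarrow> 0 \<and>
     (\<forall>i<d. (\<lambda>n. L2_norm M (\<lambda>x. D i (F n) x - D i f x)) \<longlonglongrightarrow> 0)"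

lemma H1_norm_diff:
  assumes "f \<in> H" "g \<in> H"
  shows "(H1_norm d \<Omega> (\<lambda>x. f x - g x))\<^sup>2
    = (L2_norm M (\<lambda>x. f x - g x))\<^sup>2 + (\<Sum>i<d. (L2_norm M (\<lambda>x. D i f x - D i g x))\<^sup>2)"
  unfolding H1_norm_def using H1_diff_norm[OF assms] by (simp add: add_nonneg_nonneg sum_nonneg)

lemma H1_norm_tendsto_iff:
  assumes F: "\<And>n. F n \<in> H" and f: "f \<in> H"
  shows "(\<lambda>n. (L2_norm M (\<lambda>x. F n x - f x))\<^sup>2 + (\<Sum>i<d. (L2_norm M (\<lambda>x. D i (F n) x - D i f x))\<^sup>2)) \<longlonglongrightarrow> 0
    \<longleftrightarrow> H1_conv F f"
proof
  let ?S = "\<lambda>n. (L2_norm M (\<lambda>x. F n x - f x))\<^sup>2 + (\<Sum>i<d. (L2_norm M (\<lambda>x. D i (F n) x - D i f x))\<^sup>2)"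
  assume lim: "?S \<longlonglongrightarrow> 0"
  have from_le: "a \<longlonglongrightarrow> 0" if "\<And>n. (a n)\<^sup>2 \<le> ?S n" for a :: "nat \<Rightarrow> real"
  proof -
    have "(\<lambda>n. (a n)\<^sup>2) \<longlonglongrightarrow> 0"
      by (rule tendsto_sandwich[OF _ _ tendsto_const lim]) (use that in auto)
    then show ?thesis using tendsto_diff_power2_zero[of a 0] by simp
  qed
  show "H1_conv F f"
    unfolding H1_conv_def
  proof (intro conjI allI impI from_le)
    show "(L2_norm M (\<lambda>x. F n x - f x))\<^sup>2 \<le> ?S n" for n by (simp add: sum_nonneg)
    show "(L2_norm M (\<lambda>x. D i (F n) x - D i f x))\<^sup>2 \<le> ?S n" if "i < d" for i n
      using member_le_sum[of i "{..<d}" "\<lambda>i. (L2_norm M (\<lambda>x. D i (F n) x - D i f x))\<^sup>2"] that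
      by (simp add: add_increasing)
  qed
next
  assume "H1_conv F f"
  then have "(\<lambda>n. (L2_norm M (\<lambda>x. F n x - f x))\<^sup>2 + (\<Sum>i<d. (L2_norm M (\<lambda>x. D i (F n) x - D i f x))\<^sup>2))
      \<longlonglongrightarrow> 0\<^sup>2 + (\<Sum>i<d. 0\<^sup>2)"
    unfolding H1_conv_def by (intro tendsto_add tendsto_power tendsto_sum) auto
  then show "(\<lambda>n. (L2_norm M (\<lambda>x. F n x - f x))\<^sup>2 + (\<Sum>i<d. (L2_norm M (\<lambda>x. D i (F n) x - D i f x))\<^sup>2)) \<longlonglongrightarrow> 0"
    by simp
qed

section \<open>The closure of the test functions in H1\<close>

lemma H10_iff: "f \<in> H10 d \<Omega> \<longleftrightarrow> f \<in> H \<and> (\<exists>\<phi>. (\<forall>n. \<phi> n \<in> test_functions d \<Omega>) \<and> H1_conv \<phi> f)"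
proof -
  have "(\<lambda>n. H1_norm d \<Omega> (\<lambda>x. f x - \<phi> n x)) \<longlonglongrightarrow> 0 \<longleftrightarrow> H1_conv \<phi> f"
    if f: "f \<in> H" and \<phi>: "\<And>n. \<phi> n \<in> test_functions d \<Omega>" for \<phi> :: "nat \<Rightarrow> point \<Rightarrow> complex"
  proof -
    have \<phi>H: "\<phi> n \<in> H" for n by (rule test_H1[OF \<phi>])
    have nonneg: "0 \<le> H1_norm d \<Omega> g" for g
      unfolding H1_norm_def by (simp add: add_nonneg_nonneg sum_nonneg)
    have "(\<lambda>n. H1_norm d \<Omega> (\<lambda>x. f x - \<phi> n x)) \<longlonglongrightarrow> 0 \<longleftrightarrow> (\<lambda>n. (H1_norm d \<Omega> (\<lambda>x. f x - \<phi> n x))\<^sup>2) \<longlonglongrightarrow> 0"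
      using tendsto_diff_power2_zero[of "\<lambda>n. H1_norm d \<Omega> (\<lambda>x. f x - \<phi> n x)" 0]
        tendsto_power[of "\<lambda>n. H1_norm d \<Omega> (\<lambda>x. f x - \<phi> n x)" 0 sequentially 2] by auto
    also have "\<dots> \<longleftrightarrow> H1_conv \<phi> f"
      unfolding H1_norm_diff[OF f \<phi>H] H1_norm_tendsto_iff[OF \<phi>H f, symmetric]
      by (simp only: L2_norm_minus_commute[of M f] L2_norm_minus_commute[of M "D _ f"])
    finally show ?thesis .
  qed
  then show ?thesis unfolding H10_def by blast
qed

lemma H10_H1: "f \<in> H10 d \<Omega> \<Longrightarrow> f \<in> H" by (simp add: H10_def)

lemma H1_conv_test_H10:
  "f \<in> H \<Longrightarrow> (\<And>n. \<phi> n \<in> test_functions d \<Omega>) \<Longrightarrow> H1_conv \<phi> f \<Longrightarrow> f \<in> H10 d \<Omega>"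
  unfolding H10_iff by blast

lemma H1_conv_triangle:
  assumes f: "f \<in> H" and F: "\<And>n. F n \<in> H" and G: "\<And>n. G n \<in> H" and FG: "H1_conv F f"
    and l0: "(\<lambda>n. L2_norm M (\<lambda>x. G n x - F n x)) \<longlonglongrightarrow> 0"
    and l1: "\<And>i. i < d \<Longrightarrow> (\<lambda>n. L2_norm M (\<lambda>x. D i (G n) x - D i (F n) x)) \<longlonglongrightarrow> 0"
  shows "H1_conv G f"
  unfolding H1_conv_def
proof (intro conjI allI impI)
  have squeeze: "(\<lambda>n. L2_norm M (\<lambda>x. c n x - e x)) \<longlonglongrightarrow> 0"
    if "\<And>n. a n \<in> L2 M" "\<And>n. c n \<in> L2 M" "e \<in> L2 M"
      "(\<lambda>n. L2_norm M (\<lambda>x. c n x - a n x)) \<longlonglongrightarrow> 0" "(\<lambda>n. L2_norm M (\<lambda>x. a n x - e x)) \<longlonglongrightarrow> 0"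
    for a c :: "nat \<Rightarrow> point \<Rightarrow> complex" and e
  proof (rule tendsto_sandwich[OF _ _ tendsto_const])
    show "(\<lambda>n. L2_norm M (\<lambda>x. c n x - a n x) + L2_norm M (\<lambda>x. a n x - e x)) \<longlonglongrightarrow> 0"
      using tendsto_add[OF that(4,5)] by simp
  qed (use L2_norm_triangle_diff[OF that(2) that(1) that(3)] in auto)
  show "(\<lambda>n. L2_norm M (\<lambda>x. G n x - f x)) \<longlonglongrightarrow> 0"
    by (rule squeeze[OF H1_L2[OF F] H1_L2[OF G] H1_L2[OF f] l0]) (use FG in \<open>simp add: H1_conv_def\<close>)
  show "(\<lambda>n. L2_norm M (\<lambda>x. D i (G n) x - D i f x)) \<longlonglongrightarrow> 0" if i: "i < d" for i
    by (rule squeeze[OF H1_weak_deriv(1)[OF F i] H1_weak_deriv(1)[OF G i] H1_weak_deriv(1)[OF f i] l1[OF i]])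
      (use FG i in \<open>simp add: H1_conv_def\<close>)
qed

text \<open>A diagonal argument: each \<open>F n\<close> is replaced by a test function at distance
  less than 1/(n + 1).\<close>

lemma H10_closed:
  assumes f: "f \<in> H" and F: "\<And>n. F n \<in> H10 d \<Omega>" and conv: "H1_conv F f"
  shows "f \<in> H10 d \<Omega>"
proof -
  note FH = H10_H1[OF F]
  have "\<exists>\<phi>. \<phi> \<in> test_functions d \<Omega> \<and> L2_norm M (\<lambda>x. \<phi> x - F n x) < 1 / real (Suc n) \<and>
      (\<forall>i<d. L2_norm M (\<lambda>x. D i \<phi> x - D i (F n) x) < 1 / real (Suc n))" for n
  proof -
    obtain \<phi> where \<phi>: "\<And>k. \<phi> k \<in> test_functions d \<Omega>" "H1_conv \<phi> (F n)" using F[of n] unfolding H10_iff by blast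
    have "\<forall>\<^sub>F k in sequentially. L2_norm M (\<lambda>x. \<phi> k x - F n x) < 1 / real (Suc n)"
      using \<phi>(2) unfolding H1_conv_def by (intro order_tendstoD[of _ 0]) auto
    moreover have "\<forall>\<^sub>F k in sequentially. \<forall>i\<in>{..<d}. L2_norm M (\<lambda>x. D i (\<phi> k) x - D i (F n) x) < 1 / real (Suc n)"
    proof (intro eventually_ball_finite ballI)
      fix i assume "i \<in> {..<d}"
      then show "\<forall>\<^sub>F k in sequentially. L2_norm M (\<lambda>x. D i (\<phi> k) x - D i (F n) x) < 1 / real (Suc n)"
        using \<phi>(2) unfolding H1_conv_def by (intro order_tendstoD[of _ 0]) auto
    qed simp
    ultimately have "\<forall>\<^sub>F k in sequentially. L2_norm M (\<lambda>x. \<phi> k x - F n x) < 1 / real (Suc n) \<and>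
      (\<forall>i\<in>{..<d}. L2_norm M (\<lambda>x. D i (\<phi> k) x - D i (F n) x) < 1 / real (Suc n))"
      by (rule eventually_conj)
    then obtain k where "L2_norm M (\<lambda>x. \<phi> k x - F n x) < 1 / real (Suc n) \<and>
      (\<forall>i\<in>{..<d}. L2_norm M (\<lambda>x. D i (\<phi> k) x - D i (F n) x) < 1 / real (Suc n))"
      using eventually_happens'[OF sequentially_bot] by blast
    then show ?thesis using \<phi>(1)[of k] by (intro exI[of _ "\<phi> k"]) simp
  qed
  then have "\<forall>n. \<exists>\<phi>. \<phi> \<in> test_functions d \<Omega> \<and> L2_norm M (\<lambda>x. \<phi> x - F n x) < 1 / real (Suc n) \<and>
      (\<forall>i<d. L2_norm M (\<lambda>x. D i \<phi> x - D i (F n) x) < 1 / real (Suc n))" ..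
  from choice[OF this] obtain \<phi> where \<phi>: "\<And>n. \<phi> n \<in> test_functions d \<Omega>"
    "\<And>n. L2_norm M (\<lambda>x. \<phi> n x - F n x) < 1 / real (Suc n)"
    "\<And>n i. i < d \<Longrightarrow> L2_norm M (\<lambda>x. D i (\<phi> n) x - D i (F n) x) < 1 / real (Suc n)" by blast
  have small: "a \<longlonglongrightarrow> 0" if "\<And>n. 0 \<le> a n" "\<And>n. a n < 1 / real (Suc n)" for a :: "nat \<Rightarrow> real"
    by (rule tendsto_sandwich[OF _ _ tendsto_const LIMSEQ_Suc[OF lim_1_over_n]])
      (use that in \<open>auto intro: always_eventually less_imp_le\<close>)
  have "H1_conv \<phi> f"
    by (rule H1_conv_triangle[OF f FH test_H1[OF \<phi>(1)] conv]) (auto intro!: small \<phi>(2,3))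
  then show ?thesis by (rule H1_conv_test_H10[OF f \<phi>(1)])
qed

lemma H10_lincomb:
  assumes f: "f \<in> H10 d \<Omega>" and g: "g \<in> H10 d \<Omega>"
  shows "(\<lambda>x. c * f x + g x) \<in> H10 d \<Omega>"
proof -
  obtain \<phi> \<psi> where \<phi>: "\<And>n. \<phi> n \<in> test_functions d \<Omega>" "H1_conv \<phi> f"
    and \<psi>: "\<And>n. \<psi> n \<in> test_functions d \<Omega>" "H1_conv \<psi> g"
    using f g unfolding H10_iff by blast
  note fH = H10_H1[OF f] and gH = H10_H1[OF g] and \<phi>H = test_H1[OF \<phi>(1)] and \<psi>H = test_H1[OF \<psi>(1)]
  have lin: "(\<lambda>n. L2_norm M (\<lambda>x. (c * a n x + b n x) - (c * e x + h x))) \<longlonglongrightarrow> 0"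
    if "\<And>n. a n \<in> L2 M" "\<And>n. b n \<in> L2 M" "e \<in> L2 M" "h \<in> L2 M"
      "(\<lambda>n. L2_norm M (\<lambda>x. a n x - e x)) \<longlonglongrightarrow> 0" "(\<lambda>n. L2_norm M (\<lambda>x. b n x - h x)) \<longlonglongrightarrow> 0"
    for a b :: "nat \<Rightarrow> point \<Rightarrow> complex" and e h
  proof (rule tendsto_sandwich[OF _ _ tendsto_const])
    have "L2_norm M (\<lambda>x. (c * a n x + b n x) - (c * e x + h x))
        \<le> cmod c * L2_norm M (\<lambda>x. a n x - e x) + L2_norm M (\<lambda>x. b n x - h x)" for n
    proof -
      have eq: "(\<lambda>x. (c * a n x + b n x) - (c * e x + h x)) = (\<lambda>x. c * (a n x - e x) + (b n x - h x))"
        by (simp add: algebra_simps)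
      show ?thesis
        using L2_norm_triangle[OF L2_mult[OF L2_diff[OF that(1)[of n] that(3)], of c] L2_diff[OF that(2)[of n] that(4)]]
        unfolding eq L2_norm_mult .
    qed
    then show "\<forall>\<^sub>F n in sequentially. L2_norm M (\<lambda>x. (c * a n x + b n x) - (c * e x + h x))
        \<le> cmod c * L2_norm M (\<lambda>x. a n x - e x) + L2_norm M (\<lambda>x. b n x - h x)" by simp
    show "(\<lambda>n. cmod c * L2_norm M (\<lambda>x. a n x - e x) + L2_norm M (\<lambda>x. b n x - h x)) \<longlonglongrightarrow> 0"
      using tendsto_add[OF tendsto_mult[OF tendsto_const that(5)] that(6)] by simp
  qed simp
  have "H1_conv (\<lambda>n x. c * \<phi> n x + \<psi> n x) (\<lambda>x. c * f x + g x)"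
    unfolding H1_conv_def
  proof (intro conjI allI impI)
    show "(\<lambda>n. L2_norm M (\<lambda>x. (c * \<phi> n x + \<psi> n x) - (c * f x + g x))) \<longlonglongrightarrow> 0"
      using \<phi>(2) \<psi>(2) by (intro lin H1_L2 \<phi>H \<psi>H fH gH) (simp_all add: H1_conv_def)
    fix i assume i: "i < d"
    have "L2_norm M (\<lambda>x. D i (\<lambda>x. c * \<phi> n x + \<psi> n x) x - D i (\<lambda>x. c * f x + g x) x)
        = L2_norm M (\<lambda>x. (c * D i (\<phi> n) x + D i (\<psi> n) x) - (c * D i f x + D i g x))" for n
    proof (rule L2_norm_cong_AE)
      show "AE x in M. D i (\<lambda>x. c * \<phi> n x + \<psi> n x) x - D i (\<lambda>x. c * f x + g x) x
          = (c * D i (\<phi> n) x + D i (\<psi> n) x) - (c * D i f x + D i g x)"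
        using H1_lincomb(2)[OF \<phi>H \<psi>H i, of c n n] H1_lincomb(2)[OF fH gH i, of c] by eventually_elim simp
    qed (intro L2_measurable L2_diff L2_lincomb H1_weak_deriv H1_lincomb \<phi>H \<psi>H fH gH i)+
    moreover have "(\<lambda>n. L2_norm M (\<lambda>x. (c * D i (\<phi> n) x + D i (\<psi> n) x) - (c * D i f x + D i g x))) \<longlonglongrightarrow> 0"
      using \<phi>(2) \<psi>(2) i by (intro lin H1_weak_deriv \<phi>H \<psi>H fH gH) (simp_all add: H1_conv_def)
    ultimately show "(\<lambda>n. L2_norm M (\<lambda>x. D i (\<lambda>x. c * \<phi> n x + \<psi> n x) x - D i (\<lambda>x. c * f x + g x) x)) \<longlonglongrightarrow> 0"
      by simp
  qed
  then show ?thesis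
    using H1_lincomb(1)[OF fH gH] test_lincomb[OF \<phi>(1) \<psi>(1)]
    by (intro H1_conv_test_H10[of _ "\<lambda>n x. c * \<phi> n x + \<psi> n x"]) auto
qed

lemma H1_conv_const_AE:
  assumes f: "f \<in> H" and g: "g \<in> H" and F: "\<And>n. F n \<in> H" and ae: "AE x in M. f x = g x" and conv: "H1_conv F f"
  shows "H1_conv F g"
proof -
  have "L2_norm M (\<lambda>x. F n x - f x) = L2_norm M (\<lambda>x. F n x - g x)" for n
    by (rule L2_norm_cong_AE[OF L2_measurable[OF L2_diff[OF H1_L2[OF F] H1_L2[OF f]]]
        L2_measurable[OF L2_diff[OF H1_L2[OF F] H1_L2[OF g]]]], use ae in eventually_elim, simp)
  moreover have "L2_norm M (\<lambda>x. D i (F n) x - D i f x) = L2_norm M (\<lambda>x. D i (F n) x - D i g x)" if "i < d" for i n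
    by (rule L2_norm_cong_AE[OF L2_measurable[OF L2_diff[OF H1_weak_deriv(1)[OF F that] H1_weak_deriv(1)[OF f that]]]
        L2_measurable[OF L2_diff[OF H1_weak_deriv(1)[OF F that] H1_weak_deriv(1)[OF g that]]]],
        use H1_cong(2)[OF f H1_L2[OF g] ae that] in eventually_elim, simp)
  ultimately show ?thesis using conv by (simp add: H1_conv_def)
qed

lemma H10_cong:
  assumes f: "f \<in> H10 d \<Omega>" and g: "g \<in> L2 M" and ae: "AE x in M. f x = g x"
  shows "g \<in> H10 d \<Omega>"
proof -
  obtain \<phi> where \<phi>: "\<And>n. \<phi> n \<in> test_functions d \<Omega>" "H1_conv \<phi> f" using f unfolding H10_iff by blast
  have gH: "g \<in> H" by (rule H1_cong(1)[OF H10_H1[OF f] g ae])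
  have "H1_conv \<phi> g" by (rule H1_conv_const_AE[OF H10_H1[OF f] gH test_H1[OF \<phi>(1)] ae \<phi>(2)])
  then show ?thesis by (rule H1_conv_test_H10[OF gH \<phi>(1)])
qed

lemma test_H10: "\<phi> \<in> test_functions d \<Omega> \<Longrightarrow> \<phi> \<in> H10 d \<Omega>"
  by (rule H1_conv_test_H10[of _ "\<lambda>_. \<phi>"]) (auto simp: H1_conv_def test_H1)

subsection \<open>The energy form\<close>

lemma form_domain_cases: "form_domain b d \<Omega> = (if b = Neumann then H else H10 d \<Omega>)"
  by (cases b) auto

lemma form_domain_H1: "f \<in> form_domain b d \<Omega> \<Longrightarrow> f \<in> H"
  by (auto simp: form_domain_cases H10_H1 split: if_splits)

lemma test_form_domain: "\<phi> \<in> test_functions d \<Omega> \<Longrightarrow> \<phi> \<in> form_domain b d \<Omega>"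
  by (auto simp: form_domain_cases test_H1 test_H10)

lemma energy_form_sum:
  assumes "f \<in> H" "g \<in> H"
  shows "energy_form d \<Omega> f g = (\<Sum>i<d. L2_inner M (D i f) (D i g))"
  unfolding energy_form_def L2_inner_def
  by (rule Bochner_Integration.integral_sum) (auto intro!: L2_integrable_mult_cnj H1_weak_deriv assms)

lemma energy_form_cong:
  assumes "f \<in> H" "g \<in> H" and "\<And>i. i < d \<Longrightarrow> u i \<in> L2 M" "\<And>i. i < d \<Longrightarrow> v i \<in> L2 M"
    and "\<And>i. i < d \<Longrightarrow> AE x in M. D i f x = u i x" "\<And>i. i < d \<Longrightarrow> AE x in M. D i g x = v i x"
  shows "energy_form d \<Omega> f g = (\<Sum>i<d. L2_inner M (u i) (v i))"
  unfolding energy_form_sum[OF assms(1,2)]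
  by (rule sum.cong[OF refl], rule L2_inner_cong_AE) (use assms in \<open>auto intro: H1_weak_deriv\<close>)

lemma energy_form_diff:
  assumes "f \<in> H" "g \<in> H"
  shows "Re (energy_form d \<Omega> (\<lambda>x. f x - g x) (\<lambda>x. f x - g x)) = (\<Sum>i<d. (L2_norm M (\<lambda>x. D i f x - D i g x))\<^sup>2)"
proof -
  have L: "(\<lambda>x. D i f x - D i g x) \<in> L2 M" if "i < d" for i
    by (intro L2_diff H1_weak_deriv assms that)
  have "energy_form d \<Omega> (\<lambda>x. f x - g x) (\<lambda>x. f x - g x)
      = (\<Sum>i<d. L2_inner M (\<lambda>x. D i f x - D i g x) (\<lambda>x. D i f x - D i g x))"
    using L H1_diff[OF assms] by (intro energy_form_cong) auto
  then show ?thesis using L by (simp add: L2_norm_eq_inner del: of_real_power)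
qed

text \<open>The form norm is the H1 norm. A Cauchy sequence converges in L2 together with each
  derivative, and the weak derivative identities survive the limit. Density comes from the
  fundamental lemma, for which test functions lie in both form domains.\<close>

lemma closed_energy_form: "closed_form M (form_domain b d \<Omega>) (energy_form d \<Omega>)"
  unfolding closed_form_def
proof (intro conjI ballI allI impI)
  let ?V = "form_domain b d \<Omega>"
  show "?V \<subseteq> L2 M" using form_domain_H1 H1_L2 by blast
  show "(\<lambda>_. 0) \<in> ?V" by (rule test_form_domain[OF test_zero])
  show lin: "(\<lambda>x. c * f x + g x) \<in> ?V" if "f \<in> ?V" "g \<in> ?V" for f g c
    using that H1_lincomb(1) H10_lincomb by (auto simp: form_domain_cases split: if_splits)
  show ae: "g \<in> ?V" if "f \<in> ?V" "g \<in> L2 M" "AE x in M. f x = g x" for f g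
    using that H1_cong(1) H10_cong by (auto simp: form_domain_cases split: if_splits)
  show "energy_form d \<Omega> g h = energy_form d \<Omega> f h"
    if f: "f \<in> ?V" and g: "g \<in> L2 M" and fg: "AE x in M. f x = g x" and h: "h \<in> ?V" for f g h
    unfolding energy_form_sum[OF form_domain_H1[OF f] form_domain_H1[OF h]]
    using form_domain_H1[OF f] form_domain_H1[OF h] form_domain_H1[OF ae[OF f g fg]]
      H1_cong(2)[OF form_domain_H1[OF f] g fg]
    by (intro energy_form_cong) (auto intro: H1_weak_deriv)
  show "energy_form d \<Omega> (\<lambda>x. c * f x + g x) h = c * energy_form d \<Omega> f h + energy_form d \<Omega> g h"
    if "f \<in> ?V" "g \<in> ?V" "h \<in> ?V" for f g h c
  proof -
    note f = form_domain_H1[OF that(1)] and g = form_domain_H1[OF that(2)] and h = form_domain_H1[OF that(3)]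
    have "energy_form d \<Omega> (\<lambda>x. c * f x + g x) h = (\<Sum>i<d. L2_inner M (\<lambda>x. c * D i f x + D i g x) (D i h))"
      using H1_lincomb[OF f g] h by (intro energy_form_cong) (auto intro: H1_weak_deriv L2_lincomb f g)
    also have "\<dots> = (\<Sum>i<d. c * L2_inner M (D i f) (D i h) + L2_inner M (D i g) (D i h))"
    proof (rule sum.cong[OF refl])
      fix i assume "i \<in> {..<d}"
      then have i: "i < d" by simp
      show "L2_inner M (\<lambda>x. c * D i f x + D i g x) (D i h) = c * L2_inner M (D i f) (D i h) + L2_inner M (D i g) (D i h)"
        using L2_integrable_mult_cnj[OF H1_weak_deriv(1)[OF f i] H1_weak_deriv(1)[OF h i]]
          L2_integrable_mult_cnj[OF H1_weak_deriv(1)[OF g i] H1_weak_deriv(1)[OF h i]]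
        by (simp add: L2_inner_def distrib_right mult.assoc)
    qed
    finally show ?thesis by (simp add: energy_form_sum f g h sum.distrib sum_distrib_left)
  qed
  show "energy_form d \<Omega> g f = cnj (energy_form d \<Omega> f g)" if "f \<in> ?V" "g \<in> ?V" for f g
  proof -
    have "L2_inner M (D i g) (D i f) = cnj (L2_inner M (D i f) (D i g))" for i
      unfolding L2_inner_def by (subst Bochner_Integration.integral_cnj[symmetric]) (simp add: mult.commute)
    then show ?thesis using that by (simp add: energy_form_sum form_domain_H1)
  qed
  show "0 \<le> Re (energy_form d \<Omega> f f)" if "f \<in> ?V" for f
    using that by (auto simp: energy_form_sum form_domain_H1 L2_norm_eq_inner H1_weak_deriv intro!: sum_nonneg simp del: of_real_power)
  show "AE x in M. g x = 0" if g: "g \<in> L2 M" and orth: "\<forall>f\<in>?V. L2_inner M g f = 0" for g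
  proof (rule fundamental_lemma_M[OF g])
    fix \<phi> assume "\<phi> \<in> test_functions d \<Omega>"
    then have "L2_inner M g (\<lambda>x. cnj (\<phi> x)) = 0" using orth test_form_domain[OF test_cnj] by blast
    then show "(\<integral>x. g x * \<phi> x \<partial>M) = 0" by (simp add: L2_inner_def)
  qed
  fix F :: "nat \<Rightarrow> point \<Rightarrow> complex"
  assume F: "\<forall>n. F n \<in> ?V"
    and cau: "\<forall>e>0. \<exists>N. \<forall>m\<ge>N. \<forall>n\<ge>N. (L2_norm M (\<lambda>x. F m x - F n x))\<^sup>2
           + Re (energy_form d \<Omega> (\<lambda>x. F m x - F n x) (\<lambda>x. F m x - F n x)) < e"
  have FH: "F n \<in> H" for n using F by (intro form_domain_H1) blast
  define S where "S = (\<lambda>m n. (L2_norm M (\<lambda>x. F m x - F n x))\<^sup>2 + (\<Sum>i<d. (L2_norm M (\<lambda>x. D i (F m) x - D i (F n) x))\<^sup>2))"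
  have cauS: "\<exists>N. \<forall>m\<ge>N. \<forall>n\<ge>N. S m n < e" if "e > 0" for e
    using cau that unfolding S_def energy_form_diff[OF FH FH] by blast
  have cauL: "\<exists>f\<in>L2 M. (\<lambda>n. L2_norm M (\<lambda>x. G n x - f x)) \<longlonglongrightarrow> 0"
    if G: "\<And>n. G n \<in> L2 M" and le: "\<And>m n. (L2_norm M (\<lambda>x. G m x - G n x))\<^sup>2 \<le> S m n"
    for G :: "nat \<Rightarrow> point \<Rightarrow> complex"
  proof (rule L2_complete[OF G])
    fix e :: real assume e: "e > 0"
    then obtain N where N: "\<forall>m\<ge>N. \<forall>n\<ge>N. S m n < e\<^sup>2" using cauS[of "e\<^sup>2"] by auto
    have "L2_norm M (\<lambda>x. G m x - G n x) < e" if "m \<ge> N" "n \<ge> N" for m n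
    proof (rule power2_less_imp_less)
      show "(L2_norm M (\<lambda>x. G m x - G n x))\<^sup>2 < e\<^sup>2" using le[of m n] N that by (meson le_less_trans)
    qed (use e in simp)
    then show "\<exists>N. \<forall>m\<ge>N. \<forall>n\<ge>N. L2_norm M (\<lambda>x. G m x - G n x) < e" by blast
  qed
  have "\<exists>f\<in>L2 M. (\<lambda>n. L2_norm M (\<lambda>x. F n x - f x)) \<longlonglongrightarrow> 0"
    by (rule cauL) (auto intro: H1_L2 FH simp: S_def sum_nonneg)
  then obtain f where f: "f \<in> L2 M" "(\<lambda>n. L2_norm M (\<lambda>x. F n x - f x)) \<longlonglongrightarrow> 0" by blast
  have "\<exists>g\<in>L2 M. (\<lambda>n. L2_norm M (\<lambda>x. D i (F n) x - g x)) \<longlonglongrightarrow> 0" if i: "i < d" for i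
  proof (rule cauL)
    show "(L2_norm M (\<lambda>x. D i (F m) x - D i (F n) x))\<^sup>2 \<le> S m n" for m n
      using member_le_sum[of i "{..<d}" "\<lambda>i. (L2_norm M (\<lambda>x. D i (F m) x - D i (F n) x))\<^sup>2"] i
      by (simp add: S_def add_increasing)
  qed (rule H1_weak_deriv[OF FH i])
  then have "\<forall>i. \<exists>g. i < d \<longrightarrow> g \<in> L2 M \<and> (\<lambda>n. L2_norm M (\<lambda>x. D i (F n) x - g x)) \<longlonglongrightarrow> 0" by blast
  from choice[OF this] obtain g where g: "\<And>i. i < d \<Longrightarrow> g i \<in> L2 M"
    "\<And>i. i < d \<Longrightarrow> (\<lambda>n. L2_norm M (\<lambda>x. D i (F n) x - g i x)) \<longlonglongrightarrow> 0" by blast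
  have w: "is_weak_deriv d \<Omega> i f (g i)" if i: "i < d" for i
    by (rule is_weak_deriv_limit[OF i H1_L2[OF FH] H1_weak_deriv(1)[OF FH i] f(1) g(1)[OF i]
        H1_weak_deriv(2)[OF FH i] f(2) g(2)[OF i]])
  have fH: "f \<in> H" by (rule H1_I[OF f(1) conjI[OF g(1) w]])
  have "L2_norm M (\<lambda>x. D i (F n) x - D i f x) = L2_norm M (\<lambda>x. D i (F n) x - g i x)" if i: "i < d" for i n
    by (rule L2_norm_cong_AE[OF L2_measurable[OF L2_diff[OF H1_weak_deriv(1)[OF FH i] H1_weak_deriv(1)[OF fH i]]]
        L2_measurable[OF L2_diff[OF H1_weak_deriv(1)[OF FH i] g(1)[OF i]]]],
        use weak_deriv_AE[OF i g(1)[OF i] w[OF i]] in eventually_elim, simp)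
  then have conv: "H1_conv F f" using f(2) g(2) by (simp add: H1_conv_def)
  have "f \<in> ?V"
    using fH F H10_closed[OF fH _ conv] by (auto simp: form_domain_cases split: if_splits)
  moreover have "(\<lambda>n. (L2_norm M (\<lambda>x. F n x - f x))\<^sup>2
           + Re (energy_form d \<Omega> (\<lambda>x. F n x - f x) (\<lambda>x. F n x - f x))) \<longlonglongrightarrow> 0"
    using conv unfolding H1_norm_tendsto_iff[OF FH fH, symmetric] energy_form_diff[OF FH fH] .
  ultimately show "\<exists>f\<in>?V. (\<lambda>n. (L2_norm M (\<lambda>x. F n x - f x))\<^sup>2
           + Re (energy_form d \<Omega> (\<lambda>x. F n x - f x) (\<lambda>x. F n x - f x))) \<longlonglongrightarrow> 0" by blast
qed

lemma laplacian_form_operator: "laplacian b d \<Omega> = form_operator M (form_domain b d \<Omega>) (energy_form d \<Omega>)"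
  by (simp add: laplacian_def form_operator_def)

end

section \<open>Reflections\<close>

definition flip :: "nat set \<Rightarrow> point \<Rightarrow> point" where
  "flip A x = (\<lambda>j. if j \<in> A then - x j else x j)"

lemma flip_flip: "flip A (flip B x) = flip (sym_diff A B) x"
  by (auto simp: flip_def)

lemma flip_involution [simp]: "flip A (flip A x) = x"
  by (auto simp: flip_def)

lemma flip_Rd [simp]: "A \<subseteq> {..<d} \<Longrightarrow> x \<in> Rd d \<Longrightarrow> flip A x \<in> Rd d"
  by (auto simp: flip_def Rd_def PiE_iff extensional_def)

lemma flip_upd: "flip A (x(i := t)) = (flip A x)(i := if i \<in> A then - t else t)"
  by (auto simp: flip_def)

lemma continuous_on_flip: "continuous_on X (flip A)"
proof (rule continuous_on_coordinatewise_then_product)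
  have c: "continuous_on X (\<lambda>x :: point. x j)" for j
    by (rule continuous_on_subset[OF continuous_on_product_coordinates]) simp
  show "continuous_on X (\<lambda>x. flip A x j)" for j
    unfolding flip_def by (cases "j \<in> A") (auto intro: continuous_on_minus c)
qed

text \<open>The character (-1)^|c \<inter> A| of the reflection group, whose elements are sets of
  axes under symmetric difference. The product over all axes makes it multiplicative factor by
  factor in both arguments.\<close>

definition chi :: "nat \<Rightarrow> nat set \<Rightarrow> nat set \<Rightarrow> complex" where
  "chi d c A = (\<Prod>j<d. if j \<in> c \<and> j \<in> A then -1 else 1)"

lemma chi_sym_diff_left: "chi d (sym_diff c e) A = chi d c A * chi d e A"
  unfolding chi_def prod.distrib[symmetric] by (rule prod.cong) auto

lemma chi_sym_diff_right: "chi d c (sym_diff A B) = chi d c A * chi d c B"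
  unfolding chi_def prod.distrib[symmetric] by (rule prod.cong) auto

lemma chi_square [simp]: "chi d c A * chi d c A = 1"
  unfolding chi_def prod.distrib[symmetric] by (rule prod.neutral) auto

lemma chi_singleton: "i < d \<Longrightarrow> chi d {i} A = (if i \<in> A then -1 else 1)"
  unfolding chi_def by (subst prod.remove[of _ i]) (auto intro!: prod.neutral)

lemma chi_cnj [simp]: "cnj (chi d c A) = chi d c A"
  unfolding chi_def by (simp add: if_distrib cong: if_cong)

lemma chi_norm [simp]: "cmod (chi d c A) = 1"
  unfolding chi_def by (simp add: if_distrib flip: prod_norm cong: if_cong)

text \<open>
  The set \<open>c\<close> consists of the axes in which the sum is odd. With this normalization the sum serves
  both as the isometric extension of functions that vanish outside the orthant and, restricted to
  the orthant, as the adjoint of this extension.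
\<close>

definition reflect_sum :: "nat \<Rightarrow> nat set \<Rightarrow> (point \<Rightarrow> complex) \<Rightarrow> point \<Rightarrow> complex" where
  "reflect_sum d c g x = complex_of_real (1 / sqrt (2 ^ d)) * (\<Sum>A\<in>Pow {..<d}. chi d c A * g (flip A x))"

lemma reflect_sum_lincomb:
  "reflect_sum d c (\<lambda>x. k * f x + g x) = (\<lambda>x. k * reflect_sum d c f x + reflect_sum d c g x)"
  by (rule ext) (simp only: reflect_sum_def distrib_left sum.distrib sum_distrib_left mult_ac)

lemma reflect_sum_diff:
  "reflect_sum d c (\<lambda>x. f x - g x) = (\<lambda>x. reflect_sum d c f x - reflect_sum d c g x)"
  using reflect_sum_lincomb[of d c "-1" g f] by simp

lemma reflect_sum_cnj: "reflect_sum d c (\<lambda>x. cnj (g x)) x = cnj (reflect_sum d c g x)"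
  by (simp add: reflect_sum_def cnj_sum)

lemma reflect_sum_cong:
  assumes "\<And>x. x \<in> Rd d \<Longrightarrow> f x = g x" "x \<in> Rd d"
  shows "reflect_sum d c f x = reflect_sum d c g x"
  using assms by (auto simp: reflect_sum_def intro!: sum.cong)

lemma orthant_flip_iff:
  assumes "x \<in> orthant d" "A \<subseteq> {..<d}"
  shows "flip A x \<in> orthant d \<longleftrightarrow> A = {}"
proof
  assume fl: "flip A x \<in> orthant d"
  show "A = {}"
  proof (rule equals0I)
    fix j assume "j \<in> A"
    then have "j < d" using assms(2) by blast
    then have "x j > 0" "flip A x j > 0" using assms(1) fl by (auto simp: orthant_def PiE_iff)
    then show False using \<open>j \<in> A\<close> by (simp add: flip_def)
  qed
qed (use assms in \<open>simp add: flip_def\<close>)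

lemma orthant_subset: "orthant d \<subseteq> Rd d"
  using box_domain_orthant[of d] by (simp add: box_domain_def)

text \<open>Among the reflections of \<open>flip A x\<close> exactly one, B = A, lies in the
  orthant, so the inner sum has one term. The 2^d equal terms of the outer sum cancel the two
  factors 2^(-d/2). Hence \<open>reflect_ext\<close> is a right inverse of the reflection
  sum.\<close>

lemma reflect_sum_reflect_sum:
  assumes x: "x \<in> orthant d"
  shows "reflect_sum d c (reflect_sum d c (\<lambda>x. indicator (orthant d) x * u x)) x = u x"
proof -
  let ?P = "Pow {..<d}" and ?k = "complex_of_real (1 / sqrt (2 ^ d))"
  let ?u = "\<lambda>x. indicator (orthant d) x * u x"
  have inner: "(\<Sum>B\<in>?P. chi d c B * ?u (flip B (flip A x))) = chi d c A * u x" if A: "A \<in> ?P" for A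
  proof -
    have "chi d c B * ?u (flip B (flip A x)) = (if B = A then chi d c A * u x else 0)" if B: "B \<in> ?P" for B
    proof -
      have "flip B (flip A x) \<in> orthant d \<longleftrightarrow> sym_diff B A = {}"
        unfolding flip_flip by (rule orthant_flip_iff[OF x]) (use A B in auto)
      then show ?thesis by (auto simp: indicator_def)
    qed
    then have "(\<Sum>B\<in>?P. chi d c B * ?u (flip B (flip A x))) = (\<Sum>B\<in>?P. if B = A then chi d c A * u x else 0)"
      by (rule sum.cong[OF refl])
    then show ?thesis using A by (simp add: sum.delta)
  qed
  have "reflect_sum d c (reflect_sum d c ?u) x
      = ?k * (\<Sum>A\<in>?P. chi d c A * (?k * (\<Sum>B\<in>?P. chi d c B * ?u (flip B (flip A x)))))"
    by (simp only: reflect_sum_def)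
  also have "\<dots> = ?k * (\<Sum>A\<in>?P. chi d c A * (?k * (chi d c A * u x)))"
    by (rule arg_cong[where f = "\<lambda>y. ?k * y"], rule sum.cong[OF refl]) (simp only: inner)
  also have "\<dots> = ?k * (\<Sum>A\<in>?P. ?k * u x)"
  proof (rule arg_cong[where f = "\<lambda>y. ?k * y"], rule sum.cong[OF refl])
    fix A
    have "chi d c A * (?k * (chi d c A * u x)) = (chi d c A * chi d c A) * (?k * u x)"
      by (simp only: mult_ac)
    then show "chi d c A * (?k * (chi d c A * u x)) = ?k * u x" by simp
  qed
  also have "\<dots> = ?k * (of_nat (2 ^ d) * (?k * u x))"
    by (simp only: sum_constant card_Pow finite_lessThan card_lessThan)
  also have "\<dots> = complex_of_real ((1 / sqrt (2 ^ d)) * (2 ^ d) * (1 / sqrt (2 ^ d))) * u x"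
    by (simp only: of_real_mult of_real_power of_real_numeral of_nat_power of_nat_numeral mult_ac)
  also have "(1 / sqrt (2 ^ d)) * (2 ^ d) * (1 / sqrt (2 ^ d)) = (1::real)"
    by (simp add: field_simps)
  finally show ?thesis by (simp only: of_real_1 mult_1)
qed

subsection \<open>Invariance of Lebesgue measure\<close>

lemma flip_measurable_bleb:
  assumes "A \<subseteq> {..<d}"
  shows "flip A \<in> measurable (bleb d) (bleb d)"
proof -
  have "flip A \<in> measurable (bleb d) (PiM {..<d} (\<lambda>_. lborel))"
  proof (rule measurable_PiM_single')
    show "(\<lambda>x. flip A x i) \<in> measurable (bleb d) lborel" for i
      using coordinate_measurable_bleb[of i d] by (cases "i \<in> A") (simp_all add: flip_def)
    show "(\<lambda>x. flip A x) \<in> space (bleb d) \<rightarrow> (\<Pi>\<^sub>E i\<in>{..<d}. space lborel)"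
      using assms flip_Rd[OF assms] by (auto simp: Rd_def)
  qed
  then show ?thesis by (simp add: bleb_def)
qed

text \<open>A product measure is determined by its values on boxes, and a reflected box has sides
  reflected one at a time.\<close>

lemma distr_flip_bleb:
  assumes A: "A \<subseteq> {..<d}"
  shows "distr (bleb d) (bleb d) (flip A) = bleb d"
proof -
  have "distr (bleb d) (bleb d) (flip A) = PiM {..<d} (\<lambda>_. lborel)"
  proof (rule lborel_product.PiM_eqI)
    show "sets (distr (bleb d) (bleb d) (flip A)) = sets (PiM {..<d} (\<lambda>_. lborel))"
      by (simp add: bleb_def)
    fix B :: "nat \<Rightarrow> real set"
    assume B: "\<And>i. i \<in> {..<d} \<Longrightarrow> B i \<in> sets lborel"
    define C where "C = (\<lambda>j. if j \<in> A then uminus -` B j else B j)"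
    have Cb: "C j \<in> sets borel" if "j < d" for j
    proof -
      have "uminus -` B j \<in> sets borel"
        using measurable_sets[of uminus borel borel "B j"] B[of j] that by simp
      then show ?thesis using B[of j] that by (simp add: C_def)
    qed
    have "flip A -` PiE {..<d} B \<inter> Rd d = PiE {..<d} C"
    proof (intro set_eqI iffI)
      fix x assume x: "x \<in> flip A -` PiE {..<d} B \<inter> Rd d"
      have "x j \<in> C j" if j: "j < d" for j
      proof -
        have "flip A x j \<in> B j" using x j by auto
        then show ?thesis by (simp add: C_def flip_def split: if_splits)
      qed
      then show "x \<in> PiE {..<d} C" using x by (simp add: PiE_iff Rd_def)
    next
      fix x assume x: "x \<in> PiE {..<d} C"
      then have R: "x \<in> Rd d" by (simp add: PiE_iff Rd_def)
      have "flip A x j \<in> B j" if "j < d" for j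
      proof -
        have "x j \<in> C j" using x that by auto
        then show ?thesis by (simp add: C_def flip_def split: if_splits)
      qed
      then show "x \<in> flip A -` PiE {..<d} B \<inter> Rd d"
        using R flip_Rd[OF A R] by (simp add: PiE_iff Rd_def)
    qed
    moreover have "PiE {..<d} B \<in> sets (bleb d)" using B by (intro PiE_sets_bleb) simp
    ultimately have "emeasure (distr (bleb d) (bleb d) (flip A)) (PiE {..<d} B) = emeasure (bleb d) (PiE {..<d} C)"
      by (simp add: emeasure_distr[OF flip_measurable_bleb[OF A]])
    also have "\<dots> = (\<Prod>j<d. emeasure lborel (C j))" by (rule emeasure_bleb_PiE[OF Cb])
    also have "\<dots> = (\<Prod>j<d. emeasure lborel (B j))"
    proof (rule prod.cong[OF refl])
      fix j assume j: "j \<in> {..<d}"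
      have "emeasure lborel (B j) = emeasure (distr lborel borel uminus) (B j)" by (simp add: lborel_distr_uminus)
      also have "\<dots> = emeasure lborel (uminus -` B j)" using B[OF j] by (simp add: emeasure_distr)
      finally show "emeasure lborel (C j) = emeasure lborel (B j)" by (simp add: C_def)
    qed
    finally show "emeasure (distr (bleb d) (bleb d) (flip A)) (PiE {..<d} B) = (\<Prod>j\<in>{..<d}. emeasure lborel (B j))" .
  qed simp
  then show ?thesis by (simp add: bleb_def)
qed

lemma complete_measure_leb: "complete_measure (leb d)"
  unfolding leb_eq by (rule completion.complete_measure_axioms)

text \<open>Measurability for the completed sigma-algebra requires preimages of null sets to be
  null, so it rests on the invariance of the measure before completion.\<close>

lemma
  assumes A: "A \<subseteq> {..<d}"
  shows flip_measurable_leb: "flip A \<in> measurable (leb d) (leb d)"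
    and distr_flip_leb: "distr (leb d) (leb d) (flip A) = leb d"
proof -
  interpret complete_measure "leb d" by (rule complete_measure_leb)
  have m: "flip A \<in> measurable (leb d) (bleb d)"
    unfolding leb_eq by (rule measurable_completion[OF flip_measurable_bleb[OF A]])
  have eq: "distr (leb d) (bleb d) (flip A) = bleb d"
    unfolding leb_eq by (simp add: distr_completion[OF flip_measurable_bleb[OF A]] distr_flip_bleb[OF A])
  show "flip A \<in> measurable (leb d) (leb d)"
    using measurable_completion2[OF m] by (simp add: eq flip: leb_eq)
  show "distr (leb d) (leb d) (flip A) = leb d"
    using completion_distr_eq[OF m] by (simp add: eq flip: leb_eq)
qed

context
  fixes A :: "nat set" and d :: nat
  assumes A: "A \<subseteq> {..<d}"
begin

lemma measurable_flip_comp: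
  fixes g :: "point \<Rightarrow> 'b::topological_space"
  shows "g \<in> borel_measurable (leb d) \<Longrightarrow> (\<lambda>x. g (flip A x)) \<in> borel_measurable (leb d)"
  by (rule measurable_compose[OF flip_measurable_leb[OF A]])

lemma integral_flip:
  fixes g :: "point \<Rightarrow> 'b::{banach, second_countable_topology}"
  assumes "g \<in> borel_measurable (leb d)"
  shows "(\<integral>x. g (flip A x) \<partial>leb d) = (\<integral>x. g x \<partial>leb d)"
  using integral_distr[OF flip_measurable_leb[OF A] assms] by (simp add: distr_flip_leb[OF A])

lemma integrable_flip:
  fixes g :: "point \<Rightarrow> 'b::{banach, second_countable_topology}"
  assumes "integrable (leb d) g"
  shows "integrable (leb d) (\<lambda>x. g (flip A x))"
  using assms integrable_distr_eq[OF flip_measurable_leb[OF A], of g] by (simp add: distr_flip_leb[OF A])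

lemma L2_flip:
  assumes "g \<in> L2 (leb d)"
  shows "(\<lambda>x. g (flip A x)) \<in> L2 (leb d)"
  using assms integrable_flip[of "\<lambda>x. (cmod (g x))\<^sup>2"] measurable_flip_comp[of g] by (simp add: L2_def)

lemma L2_norm_flip:
  assumes "g \<in> L2 (leb d)"
  shows "L2_norm (leb d) (\<lambda>x. g (flip A x)) = L2_norm (leb d) g"
  using L2_measurable[OF assms] integral_flip[of "\<lambda>x. (cmod (g x))\<^sup>2"] by (simp add: L2_norm_def)

lemma AE_flip:
  assumes "AE x in leb d. P x"
  shows "AE x in leb d. P (flip A x)"
proof -
  have "AE x in distr (leb d) (leb d) (flip A). P x" unfolding distr_flip_leb[OF A] by (rule assms)
  then show ?thesis by (rule AE_distrD[OF flip_measurable_leb[OF A]])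
qed

end

lemma reflect_sum_L2: "g \<in> L2 (leb d) \<Longrightarrow> reflect_sum d c g \<in> L2 (leb d)"
  unfolding reflect_sum_def by (intro L2_mult L2_sum L2_flip) auto

text \<open>A crude bound, enough for continuity. The contractivity onto the orthant is obtained
  later from the adjoint.\<close>

lemma reflect_sum_norm_le:
  assumes g: "g \<in> L2 (leb d)"
  shows "L2_norm (leb d) (reflect_sum d c g) \<le> 2 ^ d * L2_norm (leb d) g"
proof -
  have L: "(\<lambda>x. chi d c A * g (flip A x)) \<in> L2 (leb d)" if "A \<in> Pow {..<d}" for A
    using that g by (intro L2_mult L2_flip) auto
  have "L2_norm (leb d) (reflect_sum d c g)
      = \<bar>1 / sqrt (2 ^ d)\<bar> * L2_norm (leb d) (\<lambda>x. \<Sum>A\<in>Pow {..<d}. chi d c A * g (flip A x))"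
    unfolding reflect_sum_def L2_norm_mult by (simp only: norm_of_real)
  also have "\<dots> \<le> 1 * L2_norm (leb d) (\<lambda>x. \<Sum>A\<in>Pow {..<d}. chi d c A * g (flip A x))"
    by (rule mult_right_mono) (simp_all add: divide_le_eq)
  also have "\<dots> \<le> (\<Sum>A\<in>Pow {..<d}. L2_norm (leb d) (\<lambda>x. chi d c A * g (flip A x)))"
    by (simp only: mult_1) (rule L2_norm_sum_le[OF L])
  also have "\<dots> = (\<Sum>A\<in>Pow {..<d}. L2_norm (leb d) g)"
    using g by (intro sum.cong refl) (simp add: L2_norm_mult L2_norm_flip)
  finally show ?thesis by (simp add: card_Pow)
qed

lemma reflect_sum_cong_AE:
  assumes "AE x in leb d. f x = g x"
  shows "AE x in leb d. reflect_sum d c f x = reflect_sum d c g x"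
proof -
  have "AE x in leb d. \<forall>A\<in>Pow {..<d}. f (flip A x) = g (flip A x)"
    using assms by (intro AE_finite_allI AE_flip) auto
  then show ?thesis
  proof eventually_elim
    case (elim x)
    show ?case unfolding reflect_sum_def
      by (rule arg_cong[where f = "\<lambda>y. complex_of_real (1 / sqrt (2 ^ d)) * y"], rule sum.cong[OF refl])
        (simp add: elim)
  qed
qed

text \<open>Each reflection is an involution that preserves the measure, hence symmetric for the
  bilinear pairing, and the characters are real.\<close>

lemma reflect_sum_adjoint:
  assumes f: "f \<in> L2 (leb d)" and g: "g \<in> L2 (leb d)"
  shows "(\<integral>x. reflect_sum d c f x * g x \<partial>leb d) = (\<integral>x. f x * reflect_sum d c g x \<partial>leb d)"
proof -
  let ?P = "Pow {..<d}" and ?k = "complex_of_real (1 / sqrt (2 ^ d))"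
  have i1: "integrable (leb d) (\<lambda>x. f (flip A x) * g x)" if "A \<in> ?P" for A
    using that f g by (intro L2_integrable_mult L2_flip) auto
  have i2: "integrable (leb d) (\<lambda>x. f x * g (flip A x))" if "A \<in> ?P" for A
    using that f g by (intro L2_integrable_mult L2_flip) auto
  have eq: "(\<integral>x. f (flip A x) * g x \<partial>leb d) = (\<integral>x. f x * g (flip A x) \<partial>leb d)" if "A \<in> ?P" for A
    using that integral_flip[of A d "\<lambda>x. f x * g (flip A x)"] i2[OF that] by (auto dest: borel_measurable_integrable)
  have "(\<integral>x. reflect_sum d c f x * g x \<partial>leb d) = (\<integral>x. (\<Sum>A\<in>?P. (?k * chi d c A) * (f (flip A x) * g x)) \<partial>leb d)"
    unfolding reflect_sum_def
    by (simp only: sum_distrib_left sum_distrib_right mult.assoc)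
  also have "\<dots> = (\<Sum>A\<in>?P. (?k * chi d c A) * (\<integral>x. f (flip A x) * g x \<partial>leb d))"
    using i1 by (simp add: Bochner_Integration.integral_sum del: Pow_iff)
  also have "\<dots> = (\<Sum>A\<in>?P. (?k * chi d c A) * (\<integral>x. f x * g (flip A x) \<partial>leb d))"
    by (rule sum.cong[OF refl]) (simp only: eq)
  also have "\<dots> = (\<integral>x. (\<Sum>A\<in>?P. (?k * chi d c A) * (f x * g (flip A x))) \<partial>leb d)"
    using i2 by (simp add: Bochner_Integration.integral_sum del: Pow_iff)
  also have "\<dots> = (\<integral>x. f x * reflect_sum d c g x \<partial>leb d)"
    unfolding reflect_sum_def
    by (intro Bochner_Integration.integral_cong refl) (simp only: sum_distrib_left mult_ac)
  finally show ?thesis .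
qed

subsection \<open>Reflections of test functions\<close>

lemma smooth_flip:
  assumes \<phi>: "smooth d \<phi>" and A: "A \<subseteq> {..<d}"
  shows "smooth d (\<lambda>x. \<phi> (flip A x))"
    and "x \<in> Rd d \<Longrightarrow> i < d \<Longrightarrow>
      partial_deriv i (\<lambda>x. \<phi> (flip A x)) x = chi d {i} A * partial_deriv i \<phi> (flip A x)"
proof -
  have deriv: "((\<lambda>t. k * \<psi> (flip A (x(i := t)))) has_vector_derivative
      k * chi d {i} A * partial_deriv i \<psi> (flip A x)) (at (x i))"
    if \<psi>: "smooth d \<psi>" and x: "x \<in> Rd d" and i: "i < d" for \<psi> x i k
  proof -
    define s :: real where "s = (if i \<in> A then -1 else 1)"
    have fl: "flip A (x(i := t)) = (flip A x)(i := s * t)" for t by (simp add: flip_upd s_def)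
    have at: "flip A x i = s * x i" by (simp add: flip_def s_def)
    have "((\<lambda>t. \<psi> ((flip A x)(i := t))) has_vector_derivative partial_deriv i \<psi> (flip A x)) (at (s * x i))"
      using smooth_has_partial_deriv[OF \<psi> flip_Rd[OF A x] i] by (simp only: at)
    moreover have "((\<lambda>t. s * t) has_vector_derivative s) (at (x i))"
      by (auto intro!: derivative_eq_intros)
    ultimately have "((\<lambda>t. \<psi> ((flip A x)(i := s * t))) has_vector_derivative s *\<^sub>R partial_deriv i \<psi> (flip A x)) (at (x i))"
      using vector_diff_chain_at[of "\<lambda>t. s * t" s "x i" "\<lambda>t. \<psi> ((flip A x)(i := t))"] by (simp add: o_def)
    from has_vector_derivative_mult_right[OF this, of k]
    have "((\<lambda>t. k * \<psi> (flip A (x(i := t)))) has_vector_derivative k * (s *\<^sub>R partial_deriv i \<psi> (flip A x))) (at (x i))"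
      by (simp only: fl)
    moreover have "chi d {i} A = complex_of_real s" by (simp add: chi_singleton[OF i] s_def)
    ultimately show ?thesis by (simp add: scaleR_conv_of_real mult.assoc)
  qed
  show "partial_deriv i (\<lambda>x. \<phi> (flip A x)) x = chi d {i} A * partial_deriv i \<phi> (flip A x)"
    if "x \<in> Rd d" "i < d" for x i
    using deriv[OF \<phi> that, of 1] by (intro partial_deriv_eq) simp
  show "smooth d (\<lambda>x. \<phi> (flip A x))"
  proof (rule smooth_coinduct[of "\<lambda>\<eta>. \<exists>\<psi> k. smooth d \<psi> \<and> \<eta> = (\<lambda>x. k * \<psi> (flip A x))"])
    show "\<exists>\<psi> k. smooth d \<psi> \<and> (\<lambda>x. \<phi> (flip A x)) = (\<lambda>x. k * \<psi> (flip A x))"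
      using \<phi> by (intro exI[of _ \<phi>] exI[of _ 1]) simp
    fix \<eta> assume "\<exists>\<psi> k. smooth d \<psi> \<and> \<eta> = (\<lambda>x. k * \<psi> (flip A x))"
    then obtain \<psi> k where \<psi>: "smooth d \<psi>" "\<eta> = (\<lambda>x. k * \<psi> (flip A x))" by blast
    have "continuous_on (Rd d) (\<lambda>x. \<psi> (flip A x))"
      by (rule continuous_on_compose2[OF smooth_continuous[OF \<psi>(1)] continuous_on_flip]) (use A in auto)
    then show "continuous_on (Rd d) \<eta>" unfolding \<psi>(2) by (intro continuous_intros)
    fix i assume i: "i < d"
    show "\<exists>\<psi>'. (\<exists>\<psi> k. smooth d \<psi> \<and> \<psi>' = (\<lambda>x. k * \<psi> (flip A x))) \<and>
        (\<forall>x\<in>Rd d. ((\<lambda>t. \<eta> (x(i := t))) has_vector_derivative \<psi>' x) (at (x i)))"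
      unfolding \<psi>(2) using deriv[OF \<psi>(1) _ i] smooth_partial_deriv[OF \<psi>(1) i]
      by (intro exI[of _ "\<lambda>x. k * chi d {i} A * partial_deriv i \<psi> (flip A x)"]) blast
  qed
qed

text \<open>Differentiating along axis i brings out the sign of the reflection, which is the
  character of {i}; so the parity in that axis is toggled and all others are kept.\<close>

lemma smooth_reflect_sum:
  assumes \<phi>: "smooth d \<phi>"
  shows "smooth d (reflect_sum d c \<phi>)"
    and "x \<in> Rd d \<Longrightarrow> i < d \<Longrightarrow>
      partial_deriv i (reflect_sum d c \<phi>) x = reflect_sum d (sym_diff c {i}) (partial_deriv i \<phi>) x"
proof -
  let ?k = "complex_of_real (1 / sqrt (2 ^ d))"
  have eq: "reflect_sum d c \<phi> = (\<lambda>x. \<Sum>A\<in>Pow {..<d}. (?k * chi d c A) * \<phi> (flip A x))"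
    by (rule ext) (simp only: reflect_sum_def sum_distrib_left mult.assoc)
  have sm: "smooth d (\<lambda>x. (?k * chi d c A) * \<phi> (flip A x))" if "A \<in> Pow {..<d}" for A
    using that by (intro smooth_mult smooth_const smooth_flip(1)[OF \<phi>]) auto
  then show "smooth d (reflect_sum d c \<phi>)" unfolding eq by (rule smooth_sum)
  fix x i assume x: "x \<in> Rd d" and i: "i < d"
  have "partial_deriv i (reflect_sum d c \<phi>) x
      = (\<Sum>A\<in>Pow {..<d}. partial_deriv i (\<lambda>x. (?k * chi d c A) * \<phi> (flip A x)) x)"
    unfolding eq by (rule partial_deriv_sum[OF sm x i])
  also have "\<dots> = (\<Sum>A\<in>Pow {..<d}. ?k * (chi d (sym_diff c {i}) A * partial_deriv i \<phi> (flip A x)))"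
  proof (rule sum.cong[OF refl])
    fix A assume "A \<in> Pow {..<d}"
    then have A: "A \<subseteq> {..<d}" by simp
    have "((\<lambda>t. (?k * chi d c A) * \<phi> (flip A (x(i := t)))) has_vector_derivative
        (?k * chi d c A) * partial_deriv i (\<lambda>x. \<phi> (flip A x)) x) (at (x i))"
      by (rule has_vector_derivative_mult_right[OF smooth_has_partial_deriv[OF smooth_flip(1)[OF \<phi> A] x i]])
    then have "partial_deriv i (\<lambda>x. (?k * chi d c A) * \<phi> (flip A x)) x
        = (?k * chi d c A) * partial_deriv i (\<lambda>x. \<phi> (flip A x)) x"
      by (rule partial_deriv_eq)
    also have "\<dots> = (?k * chi d c A) * (chi d {i} A * partial_deriv i \<phi> (flip A x))"
      by (simp only: smooth_flip(2)[OF \<phi> A x i])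
    finally show "partial_deriv i (\<lambda>x. (?k * chi d c A) * \<phi> (flip A x)) x
        = ?k * (chi d (sym_diff c {i}) A * partial_deriv i \<phi> (flip A x))"
      by (simp only: chi_sym_diff_left mult.assoc)
  qed
  finally show "partial_deriv i (reflect_sum d c \<phi>) x = reflect_sum d (sym_diff c {i}) (partial_deriv i \<phi>) x"
    by (simp only: reflect_sum_def sum_distrib_left)
qed

lemma test_reflect_sum:
  assumes "\<phi> \<in> test_functions d \<Omega>" "\<Omega> \<subseteq> Rd d"
  shows "reflect_sum d c \<phi> \<in> test_functions d (Rd d)"
proof -
  obtain C where C: "smooth d \<phi>" "compact C" "C \<subseteq> \<Omega>" "\<And>x. x \<in> Rd d \<Longrightarrow> x \<notin> C \<Longrightarrow> \<phi> x = 0"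
    using assms(1) by (rule test_functionsE) blast
  show ?thesis
  proof (rule test_functionsI[OF smooth_reflect_sum(1)[OF C(1)]])
    show "compact (\<Union>A\<in>Pow {..<d}. flip A ` C)"
      by (intro compact_UN compact_continuous_image continuous_on_flip C(2)) simp
    show "(\<Union>A\<in>Pow {..<d}. flip A ` C) \<subseteq> Rd d" using C(3) assms(2) by auto
    fix x assume x: "x \<in> Rd d" "x \<notin> (\<Union>A\<in>Pow {..<d}. flip A ` C)"
    have "\<phi> (flip A x) = 0" if A: "A \<in> Pow {..<d}" for A
    proof (rule C(4))
      show "flip A x \<in> Rd d" using A x(1) by simp
      show "flip A x \<notin> C"
      proof
        assume "flip A x \<in> C"
        then have "flip A (flip A x) \<in> flip A ` C" by (rule imageI)
        then show False using x(2) A by auto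
      qed
    qed
    then show "reflect_sum d c \<phi> x = 0" by (simp add: reflect_sum_def)
  qed
qed

text \<open>On the wall x_i = 0 the reflections by A and by A with i toggled agree at x, while their
  signs are opposite.\<close>

lemma reflect_sum_odd:
  assumes i: "i < d" "i \<in> c" and x: "x i = 0"
  shows "reflect_sum d c \<phi> x = 0"
proof -
  let ?P = "Pow {..<d}"
  let ?s = "\<Sum>A\<in>?P. chi d c A * \<phi> (flip A x)"
  have "?s = (\<Sum>A\<in>?P. chi d c (sym_diff A {i}) * \<phi> (flip (sym_diff A {i}) x))"
  proof (rule sum.reindex_bij_witness[of _ "\<lambda>A. sym_diff A {i}" "\<lambda>A. sym_diff A {i}"])
    have sd: "sym_diff (sym_diff B {i}) {i} = B" for B by auto
    fix B
    show "sym_diff (sym_diff B {i}) {i} = B" "sym_diff (sym_diff B {i}) {i} = B" by (rule sd)+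
    show "sym_diff B {i} \<in> ?P" "sym_diff B {i} \<in> ?P" if "B \<in> ?P" using that i by auto
    show "chi d c (sym_diff (sym_diff B {i}) {i}) * \<phi> (flip (sym_diff (sym_diff B {i}) {i}) x) = chi d c B * \<phi> (flip B x)"
      by (simp only: sd)
  qed
  also have "\<dots> = (\<Sum>A\<in>?P. - (chi d c A * \<phi> (flip A x)))"
  proof (rule sum.cong[OF refl])
    fix A
    have "flip (sym_diff A {i}) x = flip A x" using x by (auto simp: flip_def)
    moreover have "chi d c {i} = -1"
      using i chi_singleton[OF i(1), of c] by (simp add: chi_def conj_commute)
    ultimately show "chi d c (sym_diff A {i}) * \<phi> (flip (sym_diff A {i}) x) = - (chi d c A * \<phi> (flip A x))"
      by (simp only: chi_sym_diff_right mult_minus1_right mult_minus_left)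
  qed
  also have "\<dots> = - ?s" by (rule sum_negf)
  finally have "?s = 0" by simp
  then show ?thesis by (simp add: reflect_sum_def)
qed

subsection \<open>Cutting off near the walls of the orthant\<close>

text \<open>Vanishes as soon as some x_j <= 1/n. It keeps away from the walls only; the compactness
  of the support comes from the test function that it multiplies.\<close>

definition wall_cutoff :: "nat \<Rightarrow> nat \<Rightarrow> point \<Rightarrow> complex" where
  "wall_cutoff d n x = (\<Prod>j<d. complex_of_real (flat 1 (-1 + real n * x j)))"

lemma smooth_wall_cutoff: "smooth d (wall_cutoff d n)"
  unfolding wall_cutoff_def by (intro smooth_prod smooth_flat) auto

lemma prod_flat_bound: "cmod (\<Prod>j\<in>J. complex_of_real (flat 1 (g j))) \<le> 1"
proof -
  have "cmod (\<Prod>j\<in>J. complex_of_real (flat 1 (g j))) = (\<Prod>j\<in>J. flat 1 (g j))"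
    by (simp add: flat_one_bounds flip: prod_norm)
  also have "\<dots> \<le> (\<Prod>j\<in>J. 1 :: real)" by (intro prod_mono conjI flat_one_bounds)
  finally show ?thesis by simp
qed

lemma wall_cutoff_tendsto:
  assumes "x \<in> orthant d"
  shows "(\<lambda>n. wall_cutoff d n x) \<longlonglongrightarrow> 1"
proof -
  have "(\<lambda>n. wall_cutoff d n x) \<longlonglongrightarrow> (\<Prod>j<d. complex_of_real 1)"
    unfolding wall_cutoff_def
  proof (intro tendsto_prod tendsto_of_real)
    fix j assume "j \<in> {..<d}"
    then have "x j > 0" using assms by (auto simp: orthant_def PiE_iff)
    from flat_one_tendsto[OF this] show "(\<lambda>n. flat 1 (-1 + real n * x j)) \<longlonglongrightarrow> 1" by simp
  qed
  then show ?thesis by simp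
qed

lemma wall_cutoff_partial_deriv:
  assumes i: "i < d" and x: "x \<in> Rd d"
  shows "partial_deriv i (wall_cutoff d n) x
    = complex_of_real (real n * flat (flat_deriv 1) (-1 + real n * x i))
      * (\<Prod>j\<in>{..<d} - {i}. complex_of_real (flat 1 (-1 + real n * x j)))"
proof -
  have "((\<lambda>t. complex_of_real (flat 1 (-1 + real n * (x(i := t)) i))) has_vector_derivative
      complex_of_real (real n * flat (flat_deriv 1) (-1 + real n * x i))) (at (x i))"
    using smooth_has_partial_deriv[OF smooth_flat[OF i] x i, of 1 "-1" "real n"]
    by (simp only: partial_deriv_flat)
  from has_vector_derivative_mult_left[OF this, of "\<Prod>j\<in>{..<d} - {i}. complex_of_real (flat 1 (-1 + real n * x j))"]
  have d: "((\<lambda>t. complex_of_real (flat 1 (-1 + real n * (x(i := t)) i))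
        * (\<Prod>j\<in>{..<d} - {i}. complex_of_real (flat 1 (-1 + real n * x j)))) has_vector_derivative
      complex_of_real (real n * flat (flat_deriv 1) (-1 + real n * x i))
      * (\<Prod>j\<in>{..<d} - {i}. complex_of_real (flat 1 (-1 + real n * x j)))) (at (x i))" .
  have "wall_cutoff d n (x(i := t)) = complex_of_real (flat 1 (-1 + real n * (x(i := t)) i))
        * (\<Prod>j\<in>{..<d} - {i}. complex_of_real (flat 1 (-1 + real n * x j)))" for t
  proof -
    have "(\<Prod>j\<in>{..<d} - {i}. complex_of_real (flat 1 (-1 + real n * (x(i := t)) j)))
        = (\<Prod>j\<in>{..<d} - {i}. complex_of_real (flat 1 (-1 + real n * x j)))"
      by (rule prod.cong) auto
    then show ?thesis
      unfolding wall_cutoff_def using i by (subst prod.remove[of _ i]) auto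
  qed
  then show ?thesis using d by (intro partial_deriv_eq) (simp only:)
qed

text \<open>At a fixed x > 0 the argument s = n x - 1 is eventually at least n x / 2 and the
  derivative at most 1/s^2, so the factor n is outweighed.\<close>

lemma flat_deriv_one_tendsto:
  assumes x: "x > 0"
  shows "(\<lambda>n. real n * flat (flat_deriv 1) (-1 + real n * x)) \<longlonglongrightarrow> 0"
proof (rule tendsto_sandwich[OF _ _ tendsto_const])
  have nonneg: "0 \<le> flat (flat_deriv 1) s" for s
    by (simp add: flat_def flat_deriv_def poly_monom)
  show "\<forall>\<^sub>F n in sequentially. 0 \<le> real n * flat (flat_deriv 1) (-1 + real n * x)"
    using nonneg by simp
  show "(\<lambda>n. 4 / x\<^sup>2 * (1 / real n)) \<longlonglongrightarrow> 0"
    using tendsto_mult[OF tendsto_const[of "4 / x\<^sup>2"] lim_1_over_n] by simp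
  obtain N :: nat where N: "2 / x < real N" using reals_Archimedean2 by blast
  have "real n * flat (flat_deriv 1) (-1 + real n * x) \<le> 4 / x\<^sup>2 * (1 / real n)" if "n \<ge> N" for n
  proof -
    have n: "2 / x < real n" using N that by linarith
    then have n0: "real n > 0" using x by (smt (verit) divide_pos_pos)
    have nx: "2 < real n * x" using n x by (simp add: field_simps)
    define s where "s = -1 + real n * x"
    have s: "s > 0" using nx by (simp add: s_def)
    have "y \<le> 2 * (-1 + y)" if "2 < y" for y :: real using that by simp
    from this[OF nx] have s2: "real n * x \<le> 2 * s" unfolding s_def .
    have "flat (flat_deriv 1) s = (1 / s)\<^sup>2 * exp (- 1 / s)"
      using s by (simp add: flat_def flat_deriv_def poly_monom)
    also have "\<dots> \<le> (1 / s)\<^sup>2 * 1" using s by (intro mult_left_mono) auto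
    also have "\<dots> \<le> (2 / (real n * x))\<^sup>2 * 1"
      using s s2 nx by (intro mult_right_mono power_mono) (auto simp: field_simps)
    finally have "real n * flat (flat_deriv 1) s \<le> real n * (2 / (real n * x))\<^sup>2"
      using n0 by (intro mult_left_mono) auto
    also have "\<dots> = 4 / x\<^sup>2 * (1 / real n)" using n0 x by (simp add: field_simps power2_eq_square)
    finally show ?thesis by (simp add: s_def)
  qed
  then show "\<forall>\<^sub>F n in sequentially. real n * flat (flat_deriv 1) (-1 + real n * x) \<le> 4 / x\<^sup>2 * (1 / real n)"
    by (auto simp: eventually_sequentially)
qed

lemma wall_cutoff_test:
  assumes \<psi>: "\<psi> \<in> test_functions d (Rd d)"
  shows "(\<lambda>x. wall_cutoff d (Suc n) x * \<psi> x) \<in> test_functions d (orthant d)"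
proof -
  obtain C where C: "smooth d \<psi>" "compact C" "C \<subseteq> Rd d" "\<And>x. x \<in> Rd d \<Longrightarrow> x \<notin> C \<Longrightarrow> \<psi> x = 0"
    using \<psi> by (rule test_functionsE) blast
  let ?K = "C \<inter> (\<Inter>j\<in>{..<d}. {x. 1 / real (Suc n) \<le> x j})"
  show ?thesis
  proof (rule test_functionsI[OF smooth_mult[OF smooth_wall_cutoff C(1)]])
    have "closed {x :: point. 1 / real (Suc n) \<le> x j}" for j
      by (intro closed_Collect_le continuous_on_const continuous_on_product_coordinates)
    then show "compact ?K" using C(2) by (intro compact_Int_closed closed_INT) auto
    show "?K \<subseteq> orthant d"
    proof
      fix x assume x: "x \<in> ?K"
      have "0 < x j" if "j < d" for j
      proof -
        have "1 / real (Suc n) \<le> x j" using x that by blast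
        then show ?thesis by (rule less_le_trans[rotated]) simp
      qed
      then show "x \<in> orthant d" using x C(3) by (auto simp: orthant_def Rd_def PiE_iff)
    qed
    fix x assume x: "x \<in> Rd d" "x \<notin> ?K"
    show "wall_cutoff d (Suc n) x * \<psi> x = 0"
    proof (cases "x \<in> C")
      case True
      then obtain j where j: "j < d" "x j < 1 / real (Suc n)" using x(2) by (auto simp: not_le)
      then have "real (Suc n) * x j < 1" by (simp add: field_simps)
      then have "flat 1 (-1 + real (Suc n) * x j) = 0" by (simp only: flat_def) simp
      then have "wall_cutoff d (Suc n) x = 0"
        unfolding wall_cutoff_def using j(1) by (intro prod_zero) (auto simp del: of_nat_Suc)
      then show ?thesis by simp
    qed (use C(4)[OF x(1)] in simp)
  qed
qed

text \<open>Mean value inequality along axis i, starting from the wall, where the function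
  vanishes.\<close>

lemma test_odd_bound:
  assumes \<psi>: "\<psi> \<in> test_functions d (Rd d)" and i: "i < d"
    and B: "\<And>x. x \<in> Rd d \<Longrightarrow> cmod (partial_deriv i \<psi> x) \<le> B"
    and odd: "\<And>x. x \<in> Rd d \<Longrightarrow> x i = 0 \<Longrightarrow> \<psi> x = 0" and x: "x \<in> Rd d"
  shows "cmod (\<psi> x) \<le> B * \<bar>x i\<bar>"
proof -
  have "norm (\<psi> (x(i := x i)) - \<psi> (x(i := 0))) \<le> B * norm (x i - 0)"
  proof (rule differentiable_bound[where S = UNIV and f' = "\<lambda>t h. h *\<^sub>R partial_deriv i \<psi> (x(i := t))"])
    fix t
    show "((\<lambda>t. \<psi> (x(i := t))) has_derivative (\<lambda>h. h *\<^sub>R partial_deriv i \<psi> (x(i := t)))) (at t within UNIV)"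
      using smooth_has_partial_deriv[OF test_smooth[OF \<psi>] Rd_upd[OF x i] i, of t]
      by (simp add: has_vector_derivative_def)
    show "onorm (\<lambda>h. h *\<^sub>R partial_deriv i \<psi> (x(i := t))) \<le> B"
      using B[OF Rd_upd[OF x i, of t]] by (simp add: onorm_scaleR_left[OF bounded_linear_ident] onorm_id)
  qed auto
  moreover have "\<psi> (x(i := 0)) = 0" by (rule odd[OF Rd_upd[OF x i]]) simp
  ultimately show ?thesis by simp
qed

lemma L2_dominated_convergence:
  fixes F :: "nat \<Rightarrow> 'a \<Rightarrow> complex"
  assumes F: "\<And>n. F n \<in> borel_measurable N" and f: "f \<in> borel_measurable N"
    and G: "integrable N (\<lambda>x. (G x)\<^sup>2)"
    and bound: "\<And>n. AE x in N. cmod (F n x - f x) \<le> G x" and lim: "AE x in N. (\<lambda>n. F n x) \<longlonglongrightarrow> f x"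
  shows "(\<lambda>n. L2_norm N (\<lambda>x. F n x - f x)) \<longlonglongrightarrow> 0"
proof -
  have "(\<lambda>n. \<integral>x. (cmod (F n x - f x))\<^sup>2 \<partial>N) \<longlonglongrightarrow> (\<integral>x. 0 \<partial>N)"
  proof (rule integral_dominated_convergence[OF _ _ G])
    show "(\<lambda>x. (cmod (F n x - f x))\<^sup>2) \<in> borel_measurable N" for n using F f by simp
    show "AE x in N. (\<lambda>n. (cmod (F n x - f x))\<^sup>2) \<longlonglongrightarrow> 0"
      using lim
    proof eventually_elim
      case (elim x)
      then have "(\<lambda>n. F n x - f x) \<longlonglongrightarrow> 0" by (simp add: LIM_zero_iff)
      from tendsto_power[OF tendsto_norm[OF this], of 2] show ?case by simp
    qed
    show "AE x in N. norm ((cmod (F n x - f x))\<^sup>2) \<le> (G x)\<^sup>2" for n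
      using bound[of n] by eventually_elim (simp add: power_mono)
  qed simp
  then show ?thesis unfolding L2_norm_def using tendsto_real_sqrt by fastforce
qed

interpretation orth: box_domain_locale d "orthant d" for d
  by standard (rule box_domain_orthant)

lemma leb_on_Rd [simp]: "leb_on d (Rd d) = leb d"
proof (rule measure_eqI)
  have s: "A \<inter> Rd d = A" if "A \<in> sets (leb d)" for A
    using sets.sets_into_space[OF that] by auto
  show "sets (leb_on d (Rd d)) = sets (leb d)"
    using s by (auto simp: sets_restrict_space image_iff Int_commute)
  fix A assume "A \<in> sets (leb_on d (Rd d))"
  then show "emeasure (leb_on d (Rd d)) A = emeasure (leb d) A"
    using sets.top[of "leb d"] sets.sets_into_space[of A "leb_on d (Rd d)"]
    by (intro emeasure_restrict_space) (auto simp: space_restrict_space)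
qed

text \<open>The rewrite rule lets the instance speak of \<open>leb d\<close> instead of its
  restriction to the whole space.\<close>

interpretation whole: box_domain_locale d "Rd d" rewrites "leb_on d (Rd d) = leb d" for d
  by (rule box_domain_locale.intro[OF box_domain_Rd]) simp

lemma wall_cutoff_L2_tendsto:
  assumes \<psi>: "\<psi> \<in> test_functions d (Rd d)"
  shows "(\<lambda>n. L2_norm (leb_on d (orthant d)) (\<lambda>x. wall_cutoff d (Suc n) x * \<psi> x - \<psi> x)) \<longlonglongrightarrow> 0"
proof -
  let ?M = "leb_on d (orthant d)"
  have L: "\<psi> \<in> L2 ?M" "(\<lambda>x. wall_cutoff d (Suc n) x * \<psi> x) \<in> L2 ?M" for n
    using orth.test_L2_M[OF \<psi>] orth.test_L2_M[OF wall_cutoff_test[OF \<psi>] orthant_subset] by simp_all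
  show ?thesis
  proof (rule L2_dominated_convergence[where G = "\<lambda>x. 2 * cmod (\<psi> x)"])
    show "integrable ?M (\<lambda>x. (2 * cmod (\<psi> x))\<^sup>2)"
      using L2_integrable_sq[OF L(1)] by (simp add: power_mult_distrib)
    show "AE x in ?M. cmod (wall_cutoff d (Suc n) x * \<psi> x - \<psi> x) \<le> 2 * cmod (\<psi> x)" for n
    proof (rule AE_I2)
      fix x
      have "cmod (wall_cutoff d (Suc n) x) \<le> 1" unfolding wall_cutoff_def by (rule prod_flat_bound)
      then have "cmod (wall_cutoff d (Suc n) x * \<psi> x) \<le> cmod (\<psi> x)"
        by (simp add: norm_mult mult_left_le_one_le)
      then show "cmod (wall_cutoff d (Suc n) x * \<psi> x - \<psi> x) \<le> 2 * cmod (\<psi> x)"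
        using norm_triangle_ineq4[of "wall_cutoff d (Suc n) x * \<psi> x" "\<psi> x"] by linarith
    qed
    show "AE x in ?M. (\<lambda>n. wall_cutoff d (Suc n) x * \<psi> x) \<longlonglongrightarrow> \<psi> x"
    proof (rule AE_I2)
      fix x assume "x \<in> space ?M"
      then have "x \<in> orthant d" by (simp add: orth.space_M)
      from tendsto_mult[OF LIMSEQ_Suc[OF wall_cutoff_tendsto[OF this]] tendsto_const[of "\<psi> x"]]
      show "(\<lambda>n. wall_cutoff d (Suc n) x * \<psi> x) \<longlonglongrightarrow> \<psi> x" by simp
    qed
  qed (use L in \<open>auto intro: L2_measurable\<close>)
qed

text \<open>
  The derivative of the cutoff is of size \<open>n\<close> near the wall \<open>x\<^sub>i = 0\<close>, where the test function is
  of size \<open>x\<^sub>i\<close> by oddness; the product stays bounded and its support shrinks.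
\<close>

lemma wall_cutoff_deriv_L2_tendsto:
  assumes \<psi>: "\<psi> \<in> test_functions d (Rd d)" and i: "i < d"
    and odd: "\<And>x. x \<in> Rd d \<Longrightarrow> x i = 0 \<Longrightarrow> \<psi> x = 0"
  shows "(\<lambda>n. L2_norm (leb_on d (orthant d))
    (\<lambda>x. partial_deriv i (\<lambda>x. wall_cutoff d (Suc n) x * \<psi> x) x - partial_deriv i \<psi> x)) \<longlonglongrightarrow> 0"
proof -
  let ?M = "leb_on d (orthant d)"
  let ?P = "\<lambda>n x. \<Prod>j\<in>{..<d} - {i}. complex_of_real (flat 1 (-1 + real (Suc n) * x j))"
  let ?f = "\<lambda>n x. real (Suc n) * flat (flat_deriv 1) (-1 + real (Suc n) * x i)"
  note pd = test_partial_deriv[OF \<psi> i]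
  obtain N B where B: "N > 0" "B \<ge> 0" "\<And>x. x \<in> Rd d \<Longrightarrow> cmod (partial_deriv i \<psi> x) \<le> B * indicator (obox d (\<lambda>_. - N) (\<lambda>_. N)) x"
    by (rule test_bounded[OF pd order_refl]) blast
  obtain N' B' where B': "N' > 0" "B' \<ge> 0" "\<And>x. x \<in> Rd d \<Longrightarrow> cmod (\<psi> x) \<le> B' * indicator (obox d (\<lambda>_. - N') (\<lambda>_. N')) x"
    by (rule test_bounded[OF \<psi> order_refl]) blast
  have Ble: "cmod (partial_deriv i \<psi> x) \<le> B" if "x \<in> Rd d" for x
    using B(3)[OF that] B(2) by (cases "x \<in> obox d (\<lambda>_. - N) (\<lambda>_. N)") auto
  \<comment> \<open>The first summand dominates the error in the cutoff times the derivative of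
    \<psi>, the second the term with the differentiated cutoff, which lives on a box that contains
    the support of \<psi>.\<close>
  define G where "G = (\<lambda>x. 2 * cmod (partial_deriv i \<psi> x) + 2 * B * indicator (obox d (\<lambda>_. - N') (\<lambda>_. N')) x)"
  have eq: "partial_deriv i (\<lambda>x. wall_cutoff d (Suc n) x * \<psi> x) x
      = wall_cutoff d (Suc n) x * partial_deriv i \<psi> x + complex_of_real (?f n x) * ?P n x * \<psi> x"
    if "x \<in> Rd d" for x n
    using partial_deriv_mult[OF smooth_wall_cutoff test_smooth[OF \<psi>] that i]
    by (simp only: wall_cutoff_partial_deriv[OF i that])
  have small: "cmod (complex_of_real (?f n x) * ?P n x * \<psi> x) \<le> 2 * B * indicator (obox d (\<lambda>_. - N') (\<lambda>_. N')) x"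
    if x: "x \<in> Rd d" for x n
  proof (cases "x \<in> obox d (\<lambda>_. - N') (\<lambda>_. N')")
    case True
    have "cmod (complex_of_real (?f n x) * ?P n x * \<psi> x) = \<bar>?f n x\<bar> * cmod (?P n x) * cmod (\<psi> x)"
      by (simp only: norm_mult norm_of_real)
    also have "\<dots> \<le> \<bar>?f n x\<bar> * 1 * (B * \<bar>x i\<bar>)"
    proof (rule mult_mono[OF mult_left_mono[OF prod_flat_bound abs_ge_zero] _ _ norm_ge_zero])
      show "cmod (\<psi> x) \<le> B * \<bar>x i\<bar>" by (rule test_odd_bound[OF \<psi> i Ble odd x])
    qed (rule mult_nonneg_nonneg[OF abs_ge_zero zero_le_one])
    also have "\<dots> = B * \<bar>?f n x * x i\<bar>"
    proof -
      have "\<bar>F\<bar> * 1 * (B * \<bar>x i\<bar>) = B * \<bar>F * x i\<bar>" for F by (simp add: abs_mult)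
      then show ?thesis .
    qed
    also have "\<dots> \<le> B * 2"
    proof (rule mult_left_mono[OF _ B(2)])
      have "-1 + real (Suc n) * x i = real (Suc n) * x i - 1" by (simp only: diff_conv_add_uminus add.commute)
      then show "\<bar>?f n x * x i\<bar> \<le> 2"
        using flat_deriv_one_bound[of "real (Suc n)" "x i"] by (simp only:)
    qed
    finally show ?thesis using True by simp
  next
    case False
    then show ?thesis using B'(3)[OF x] by simp
  qed
  have L: "partial_deriv i \<psi> \<in> L2 ?M"
    "partial_deriv i (\<lambda>x. wall_cutoff d (Suc n) x * \<psi> x) \<in> L2 ?M" for n
    using orth.test_L2_M[OF pd order_refl] orth.test_L2_M[OF test_partial_deriv[OF wall_cutoff_test[OF \<psi>] i] orthant_subset]
    by simp_all
  show ?thesis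
  proof (rule L2_dominated_convergence[where G = G])
    have g: "(\<lambda>x. complex_of_real (2 * cmod (partial_deriv i \<psi> x)) + complex_of_real (2 * B) * indicator (obox d (\<lambda>_. - N') (\<lambda>_. N')) x) \<in> L2 ?M"
    proof (intro L2_add L2_mult orth.L2_restrict indicator_obox_L2)
      have "(\<lambda>x. complex_of_real (cmod (partial_deriv i \<psi> x))) \<in> L2 (leb d)"
        using test_L2(1)[OF pd order_refl] by (auto simp: L2_def intro!: borel_measurable_of_real borel_measurable_norm)
      from L2_mult[OF this, of 2] show "(\<lambda>x. complex_of_real (2 * cmod (partial_deriv i \<psi> x))) \<in> L2 (leb d)"
        by (simp only: of_real_mult of_real_numeral)
    qed
    have "(cmod (complex_of_real (2 * cmod (partial_deriv i \<psi> x)) + complex_of_real (2 * B) * indicator (obox d (\<lambda>_. - N') (\<lambda>_. N')) x))\<^sup>2 = (G x)\<^sup>2" for x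
    proof -
      have "complex_of_real (2 * cmod (partial_deriv i \<psi> x)) + complex_of_real (2 * B) * indicator (obox d (\<lambda>_. - N') (\<lambda>_. N')) x
          = complex_of_real (G x)"
        by (simp add: G_def indicator_def)
      then show ?thesis by (simp only: norm_of_real power2_abs)
    qed
    then show "integrable ?M (\<lambda>x. (G x)\<^sup>2)" using L2_integrable_sq[OF g] by (simp only:)
    show "AE x in ?M. cmod (partial_deriv i (\<lambda>x. wall_cutoff d (Suc n) x * \<psi> x) x - partial_deriv i \<psi> x) \<le> G x" for n
    proof (rule AE_I2)
      fix x assume "x \<in> space ?M"
      then have x: "x \<in> Rd d" using orthant_subset by (auto simp: orth.space_M)
      have "cmod (wall_cutoff d (Suc n) x) \<le> 1" unfolding wall_cutoff_def by (rule prod_flat_bound)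
      then have "cmod (wall_cutoff d (Suc n) x * partial_deriv i \<psi> x) \<le> cmod (partial_deriv i \<psi> x)"
        by (simp add: norm_mult mult_left_le_one_le)
      then show "cmod (partial_deriv i (\<lambda>x. wall_cutoff d (Suc n) x * \<psi> x) x - partial_deriv i \<psi> x) \<le> G x"
        unfolding eq[OF x] G_def
        using small[OF x, of n]
          norm_triangle_ineq4[of "wall_cutoff d (Suc n) x * partial_deriv i \<psi> x + complex_of_real (?f n x) * ?P n x * \<psi> x" "partial_deriv i \<psi> x"]
          norm_triangle_ineq[of "wall_cutoff d (Suc n) x * partial_deriv i \<psi> x" "complex_of_real (?f n x) * ?P n x * \<psi> x"]
        by linarith
    qed
    show "AE x in ?M. (\<lambda>n. partial_deriv i (\<lambda>x. wall_cutoff d (Suc n) x * \<psi> x) x) \<longlonglongrightarrow> partial_deriv i \<psi> x"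
    proof (rule AE_I2)
      fix x assume "x \<in> space ?M"
      then have xo: "x \<in> orthant d" by (simp add: orth.space_M)
      then have x: "x \<in> Rd d" and xi: "x i > 0" using i by (auto simp: orthant_def Rd_def PiE_iff)
      have "(\<lambda>n. complex_of_real (?f n x) * ?P n x * \<psi> x) \<longlonglongrightarrow> 0"
      proof (rule Lim_null_comparison)
        show "\<forall>\<^sub>F n in sequentially. norm (complex_of_real (?f n x) * ?P n x * \<psi> x) \<le> \<bar>?f n x\<bar> * cmod (\<psi> x)"
        proof (intro always_eventually allI)
          fix n
          have "norm (complex_of_real (?f n x) * ?P n x * \<psi> x) = \<bar>?f n x\<bar> * cmod (?P n x) * cmod (\<psi> x)"
            by (simp only: norm_mult norm_of_real)
          also have "\<dots> \<le> \<bar>?f n x\<bar> * 1 * cmod (\<psi> x)"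
            by (intro mult_right_mono mult_left_mono prod_flat_bound) auto
          finally show "norm (complex_of_real (?f n x) * ?P n x * \<psi> x) \<le> \<bar>?f n x\<bar> * cmod (\<psi> x)" by simp
        qed
        have "(\<lambda>n. \<bar>?f n x\<bar>) \<longlonglongrightarrow> 0"
          by (rule tendsto_rabs_zero[OF LIMSEQ_Suc[OF flat_deriv_one_tendsto[OF xi]]])
        from tendsto_mult[OF this tendsto_const[of "cmod (\<psi> x)"]]
        show "(\<lambda>n. \<bar>?f n x\<bar> * cmod (\<psi> x)) \<longlonglongrightarrow> 0" by simp
      qed
      from tendsto_add[OF tendsto_mult[OF LIMSEQ_Suc[OF wall_cutoff_tendsto[OF xo]] tendsto_const[of "partial_deriv i \<psi> x"]] this]
      show "(\<lambda>n. partial_deriv i (\<lambda>x. wall_cutoff d (Suc n) x * \<psi> x) x) \<longlonglongrightarrow> partial_deriv i \<psi> x"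
        unfolding eq[OF x] by (simp only: mult_1 add_0_right)
    qed
  qed (use L in \<open>auto intro: L2_measurable\<close>)
qed

subsection \<open>Reflections and Sobolev spaces\<close>

lemma test_zero_outside:
  assumes "\<phi> \<in> test_functions d \<Omega>" "x \<in> Rd d" "x \<notin> \<Omega>"
  shows "\<phi> x = 0"
  using assms by (auto elim!: test_functionsE)

lemma integral_test_orthant:
  assumes "\<eta> \<in> test_functions d (orthant d)"
  shows "(\<integral>x. h x * \<eta> x \<partial>leb_on d (orthant d)) = (\<integral>x. h x * \<eta> x \<partial>leb d)"
  unfolding orth.integral_M
proof (rule Bochner_Integration.integral_cong)
  fix x assume "x \<in> space (leb d)"
  then show "indicator (orthant d) x * (h x * \<eta> x) = h x * \<eta> x"
    using test_zero_outside[OF assms] by (cases "x \<in> orthant d") auto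
qed simp

definition reflect_ext :: "nat \<Rightarrow> nat set \<Rightarrow> (point \<Rightarrow> complex) \<Rightarrow> point \<Rightarrow> complex" where
  "reflect_ext d c u = reflect_sum d c (\<lambda>x. indicator (orthant d) x * u x)"

lemma sym_diff_twice [simp]: "sym_diff (sym_diff c e) e = c"
  by blast

lemma AE_leb_I: "(\<And>x. x \<in> Rd d \<Longrightarrow> P x) \<Longrightarrow> AE x in leb d. P x"
  by (rule AE_I2) simp

lemma integral_leb_cong:
  "(\<And>x. x \<in> Rd d \<Longrightarrow> f x = g x) \<Longrightarrow> (\<integral>x. f x \<partial>leb d) = (\<integral>x. g x \<partial>leb d)"
  by (rule Bochner_Integration.integral_cong) auto

lemma reflect_ext_L2: "u \<in> L2 (leb_on d (orthant d)) \<Longrightarrow> reflect_ext d c u \<in> L2 (leb d)"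
  unfolding reflect_ext_def orth.L2_M_iff by (rule reflect_sum_L2)

lemma reflect_sum_L2_orthant: "f \<in> L2 (leb d) \<Longrightarrow> reflect_sum d c f \<in> L2 (leb_on d (orthant d))"
  by (intro orth.L2_restrict reflect_sum_L2)

lemma reflect_sum_partial_deriv:
  assumes "\<phi> \<in> test_functions d (Rd d)" "i < d" "x \<in> Rd d"
  shows "partial_deriv i (reflect_sum d (sym_diff c {i}) \<phi>) x = reflect_sum d c (partial_deriv i \<phi>) x"
  using smooth_reflect_sum(2)[OF test_smooth[OF assms(1)] assms(3,2), of "sym_diff c {i}"] by simp

text \<open>The sum is moved to the test function by the adjoint, the weak derivative is used on the
  whole space, and moving back toggles the parity in axis i.\<close>

lemma reflect_sum_weak_deriv:
  assumes i: "i < d" and f: "f \<in> L2 (leb d)" and g: "g \<in> L2 (leb d)" and w: "is_weak_deriv d (Rd d) i f g"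
  shows "is_weak_deriv d (orthant d) i (reflect_sum d c f) (reflect_sum d (sym_diff c {i}) g)"
  unfolding is_weak_deriv_def
proof
  fix \<phi> assume \<phi>O: "\<phi> \<in> test_functions d (orthant d)"
  then have \<phi>: "\<phi> \<in> test_functions d (Rd d)" by (rule test_mono[OF _ orthant_subset])
  let ?\<psi> = "reflect_sum d (sym_diff c {i}) \<phi>"
  have \<psi>: "?\<psi> \<in> test_functions d (Rd d)" by (rule test_reflect_sum[OF \<phi> order_refl])
  have "(\<integral>x. reflect_sum d c f x * partial_deriv i \<phi> x \<partial>leb_on d (orthant d))
      = (\<integral>x. reflect_sum d c f x * partial_deriv i \<phi> x \<partial>leb d)"
    by (rule integral_test_orthant[OF test_partial_deriv[OF \<phi>O i]])
  also have "\<dots> = (\<integral>x. f x * reflect_sum d c (partial_deriv i \<phi>) x \<partial>leb d)"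
    by (rule reflect_sum_adjoint[OF f test_L2(1)[OF test_partial_deriv[OF \<phi> i] order_refl]])
  also have "\<dots> = (\<integral>x. f x * partial_deriv i ?\<psi> x \<partial>leb d)"
    by (intro integral_leb_cong) (simp only: reflect_sum_partial_deriv[OF \<phi> i])
  also have "\<dots> = - (\<integral>x. g x * ?\<psi> x \<partial>leb d)"
    using w \<psi> unfolding is_weak_deriv_def leb_on_Rd by blast
  also have "(\<integral>x. g x * ?\<psi> x \<partial>leb d) = (\<integral>x. reflect_sum d (sym_diff c {i}) g x * \<phi> x \<partial>leb d)"
    by (rule reflect_sum_adjoint[OF g test_L2(1)[OF \<phi> order_refl], symmetric])
  also have "\<dots> = (\<integral>x. reflect_sum d (sym_diff c {i}) g x * \<phi> x \<partial>leb_on d (orthant d))"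
    by (rule integral_test_orthant[OF \<phi>O, symmetric])
  finally show "(\<integral>x. reflect_sum d c f x * partial_deriv i \<phi> x \<partial>leb_on d (orthant d))
      = - (\<integral>x. reflect_sum d (sym_diff c {i}) g x * \<phi> x \<partial>leb_on d (orthant d))" .
qed

text \<open>Isolates what the boundary condition must provide: integration by parts on the orthant
  against reflected test functions, which may reach the walls.\<close>

lemma reflect_ext_weak_deriv:
  assumes i: "i < d" and u: "u \<in> L2 (leb_on d (orthant d))" and w: "w \<in> L2 (leb_on d (orthant d))"
    and eq: "\<And>\<phi>. \<phi> \<in> test_functions d (Rd d) \<Longrightarrow>
      (\<integral>x. u x * partial_deriv i (reflect_sum d (sym_diff c {i}) \<phi>) x \<partial>leb_on d (orthant d))
      = - (\<integral>x. w x * reflect_sum d (sym_diff c {i}) \<phi> x \<partial>leb_on d (orthant d))"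
  shows "is_weak_deriv d (Rd d) i (reflect_ext d c u) (reflect_ext d (sym_diff c {i}) w)"
  unfolding is_weak_deriv_def leb_on_Rd
proof
  fix \<phi> assume \<phi>: "\<phi> \<in> test_functions d (Rd d)"
  let ?\<psi> = "reflect_sum d (sym_diff c {i}) \<phi>"
  have "(\<integral>x. reflect_ext d c u x * partial_deriv i \<phi> x \<partial>leb d)
      = (\<integral>x. indicator (orthant d) x * u x * reflect_sum d c (partial_deriv i \<phi>) x \<partial>leb d)"
    unfolding reflect_ext_def using u unfolding orth.L2_M_iff
    by (rule reflect_sum_adjoint[OF _ test_L2(1)[OF test_partial_deriv[OF \<phi> i] order_refl]])
  also have "\<dots> = (\<integral>x. u x * partial_deriv i ?\<psi> x \<partial>leb_on d (orthant d))"
    unfolding orth.integral_M by (intro integral_leb_cong) (simp only: reflect_sum_partial_deriv[OF \<phi> i] mult.assoc)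
  also have "\<dots> = - (\<integral>x. w x * ?\<psi> x \<partial>leb_on d (orthant d))" by (rule eq[OF \<phi>])
  also have "(\<integral>x. w x * ?\<psi> x \<partial>leb_on d (orthant d)) = (\<integral>x. indicator (orthant d) x * w x * ?\<psi> x \<partial>leb d)"
    unfolding orth.integral_M by (simp only: mult.assoc)
  also have "\<dots> = (\<integral>x. reflect_ext d (sym_diff c {i}) w x * \<phi> x \<partial>leb d)"
    unfolding reflect_ext_def using w unfolding orth.L2_M_iff
    by (rule reflect_sum_adjoint[OF _ test_L2(1)[OF \<phi> order_refl], symmetric])
  finally show "(\<integral>x. reflect_ext d c u x * partial_deriv i \<phi> x \<partial>leb d)
      = - (\<integral>x. reflect_ext d (sym_diff c {i}) w x * \<phi> x \<partial>leb d)" .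
qed

text \<open>Needed for Neumann conditions, where only \<psi> can cancel the boundary term at x_i =
  0. \<psi> is cut off near all walls, but oddness is required in the axis i alone, since the other
  factors of the cutoff are not differentiated.\<close>

lemma weak_deriv_odd_test:
  assumes i: "i < d" and u: "u \<in> L2 (leb_on d (orthant d))" and w: "w \<in> L2 (leb_on d (orthant d))"
    and wd: "is_weak_deriv d (orthant d) i u w"
    and \<psi>: "\<psi> \<in> test_functions d (Rd d)" and odd: "\<And>x. x \<in> Rd d \<Longrightarrow> x i = 0 \<Longrightarrow> \<psi> x = 0"
  shows "(\<integral>x. u x * partial_deriv i \<psi> x \<partial>leb_on d (orthant d)) = - (\<integral>x. w x * \<psi> x \<partial>leb_on d (orthant d))"
proof (rule LIMSEQ_unique)
  let ?M = "leb_on d (orthant d)"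
  let ?\<psi> = "\<lambda>n x. wall_cutoff d (Suc n) x * \<psi> x"
  have t: "?\<psi> n \<in> test_functions d (orthant d)" for n by (rule wall_cutoff_test[OF \<psi>])
  have L: "?\<psi> n \<in> L2 ?M" "partial_deriv i (?\<psi> n) \<in> L2 ?M" "\<psi> \<in> L2 ?M" "partial_deriv i \<psi> \<in> L2 ?M" for n
    using orth.test_L2_M[OF t orthant_subset] orth.test_L2_M[OF test_partial_deriv[OF t i] orthant_subset]
      orth.test_L2_M[OF \<psi> order_refl] orth.test_L2_M[OF test_partial_deriv[OF \<psi> i] order_refl] by blast+
  show "(\<lambda>n. \<integral>x. u x * partial_deriv i (?\<psi> n) x \<partial>?M) \<longlonglongrightarrow> (\<integral>x. u x * partial_deriv i \<psi> x \<partial>?M)"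
  proof -
    have "(\<lambda>n. L2_norm ?M (\<lambda>x. partial_deriv i (?\<psi> n) x - partial_deriv i \<psi> x)) \<longlonglongrightarrow> 0"
      by (rule wall_cutoff_deriv_L2_tendsto[OF \<psi> i odd])
    from tendsto_integral_mult_L2[OF L(2,4) u this] show ?thesis by (simp only: mult.commute)
  qed
  have "(\<lambda>n. \<integral>x. u x * partial_deriv i (?\<psi> n) x \<partial>?M) = (\<lambda>n. - (\<integral>x. w x * ?\<psi> n x \<partial>?M))"
    using wd t unfolding is_weak_deriv_def by blast
  moreover have "(\<lambda>n. \<integral>x. w x * ?\<psi> n x \<partial>?M) \<longlonglongrightarrow> (\<integral>x. w x * \<psi> x \<partial>?M)"
    using tendsto_integral_mult_L2[OF L(1,3) w wall_cutoff_L2_tendsto[OF \<psi>]] by (simp only: mult.commute)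
  ultimately show "(\<lambda>n. \<integral>x. u x * partial_deriv i (?\<psi> n) x \<partial>?M) \<longlonglongrightarrow> - (\<integral>x. w x * \<psi> x \<partial>?M)"
    by (simp only: tendsto_minus)
qed

text \<open>Here u takes care of the walls: it is approximated by test functions of the orthant, for
  which \<psi> may be arbitrary near the walls.\<close>

lemma H10_integration_by_parts:
  assumes u: "u \<in> H10 d (orthant d)" and i: "i < d" and \<psi>: "\<psi> \<in> test_functions d (Rd d)"
  shows "(\<integral>x. u x * partial_deriv i \<psi> x \<partial>leb_on d (orthant d))
    = - (\<integral>x. weak_deriv d (orthant d) i u x * \<psi> x \<partial>leb_on d (orthant d))"
proof -
  let ?M = "leb_on d (orthant d)" and ?D = "weak_deriv d (orthant d) i"
  obtain \<phi> where t: "\<And>n. \<phi> n \<in> test_functions d (orthant d)" and conv: "orth.H1_conv d \<phi> u"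
    using u unfolding orth.H10_iff by blast
  have c: "(\<lambda>n. L2_norm ?M (\<lambda>x. \<phi> n x - u x)) \<longlonglongrightarrow> 0" "(\<lambda>n. L2_norm ?M (\<lambda>x. ?D (\<phi> n) x - ?D u x)) \<longlonglongrightarrow> 0"
    using conv i unfolding orth.H1_conv_def by blast+
  have L: "\<phi> n \<in> L2 ?M" "?D (\<phi> n) \<in> L2 ?M" "u \<in> L2 ?M" "?D u \<in> L2 ?M" for n
    using orth.H1_L2[OF orth.test_H1[OF t]] orth.H1_weak_deriv(1)[OF orth.test_H1[OF t] i]
      orth.H1_L2[OF orth.H10_H1[OF u]] orth.H1_weak_deriv(1)[OF orth.H10_H1[OF u] i] by blast+
  note \<psi>L = orth.test_L2_M[OF \<psi> order_refl] orth.test_L2_M[OF test_partial_deriv[OF \<psi> i] order_refl]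
  have 1: "(\<lambda>n. \<integral>x. \<phi> n x * partial_deriv i \<psi> x \<partial>?M) \<longlonglongrightarrow> (\<integral>x. u x * partial_deriv i \<psi> x \<partial>?M)"
    by (rule tendsto_integral_mult_L2[OF L(1,3) \<psi>L(2) c(1)])
  have "(\<integral>x. \<phi> n x * partial_deriv i \<psi> x \<partial>?M) = - (\<integral>x. ?D (\<phi> n) x * \<psi> x \<partial>?M)" for n
  proof -
    have tR: "\<phi> n \<in> test_functions d (Rd d)" by (rule test_mono[OF t orthant_subset])
    have "(\<integral>x. \<phi> n x * partial_deriv i \<psi> x \<partial>?M) = (\<integral>x. \<phi> n x * partial_deriv i \<psi> x \<partial>leb d)"
      using integral_test_orthant[OF t, of "partial_deriv i \<psi>"] by (simp only: mult.commute)
    also have "\<dots> = - (\<integral>x. partial_deriv i (\<phi> n) x * \<psi> x \<partial>leb d)"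
      by (rule test_integration_by_parts[OF tR \<psi> order_refl i])
    also have "(\<integral>x. partial_deriv i (\<phi> n) x * \<psi> x \<partial>leb d) = (\<integral>x. partial_deriv i (\<phi> n) x * \<psi> x \<partial>?M)"
      using integral_test_orthant[OF test_partial_deriv[OF t i], of \<psi>] by (simp only: mult.commute)
    also have "\<dots> = (\<integral>x. ?D (\<phi> n) x * \<psi> x \<partial>?M)"
    proof (rule integral_cong_AE)
      have "partial_deriv i (\<phi> n) \<in> L2 ?M"
        by (rule orth.test_L2_M[OF test_partial_deriv[OF t i] orthant_subset])
      then show "(\<lambda>x. partial_deriv i (\<phi> n) x * \<psi> x) \<in> borel_measurable ?M"
        "(\<lambda>x. ?D (\<phi> n) x * \<psi> x) \<in> borel_measurable ?M"
        using \<psi>L(1) L(2)[of n] by (auto intro!: borel_measurable_times dest!: L2_measurable)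
      have "AE x in ?M. ?D (\<phi> n) x = partial_deriv i (\<phi> n) x"
        by (rule orth.weak_deriv_AE[OF i orth.test_L2_M[OF test_partial_deriv[OF t i] orthant_subset] orth.test_weak_deriv[OF t i]])
      then show "AE x in ?M. partial_deriv i (\<phi> n) x * \<psi> x = ?D (\<phi> n) x * \<psi> x" by eventually_elim simp
    qed
    finally show ?thesis .
  qed
  moreover have "(\<lambda>n. \<integral>x. ?D (\<phi> n) x * \<psi> x \<partial>?M) \<longlonglongrightarrow> (\<integral>x. ?D u x * \<psi> x \<partial>?M)"
    by (rule tendsto_integral_mult_L2[OF L(2,4) \<psi>L(1) c(2)])
  ultimately have "(\<lambda>n. \<integral>x. \<phi> n x * partial_deriv i \<psi> x \<partial>?M) \<longlonglongrightarrow> - (\<integral>x. ?D u x * \<psi> x \<partial>?M)"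
    by (simp only: tendsto_minus)
  with 1 show ?thesis by (rule LIMSEQ_unique)
qed

fun odd_axes :: "boundary \<Rightarrow> nat \<Rightarrow> nat set" where
  "odd_axes Dirichlet d = {..<d}"
| "odd_axes Neumann d = {}"

lemma reflect_sum_H1:
  assumes f: "f \<in> H1 d (Rd d)"
  shows "reflect_sum d c f \<in> H1 d (orthant d)"
    and "i < d \<Longrightarrow> AE x in leb_on d (orthant d).
      weak_deriv d (orthant d) i (reflect_sum d c f) x = reflect_sum d (sym_diff c {i}) (weak_deriv d (Rd d) i f) x"
proof -
  have w: "reflect_sum d (sym_diff c {i}) (weak_deriv d (Rd d) i f) \<in> L2 (leb_on d (orthant d))"
    "is_weak_deriv d (orthant d) i (reflect_sum d c f) (reflect_sum d (sym_diff c {i}) (weak_deriv d (Rd d) i f))"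
    if i: "i < d" for i
    using reflect_sum_L2_orthant[OF whole.H1_weak_deriv(1)[OF f i]]
      reflect_sum_weak_deriv[OF i whole.H1_L2[OF f] whole.H1_weak_deriv[OF f i]] by blast+
  show "reflect_sum d c f \<in> H1 d (orthant d)"
  proof (rule orth.H1_I[OF reflect_sum_L2_orthant[OF whole.H1_L2[OF f]]])
    fix i assume "i < d"
    from w[OF this] show "reflect_sum d (sym_diff c {i}) (weak_deriv d (Rd d) i f) \<in> L2 (leb_on d (orthant d))
      \<and> is_weak_deriv d (orthant d) i (reflect_sum d c f) (reflect_sum d (sym_diff c {i}) (weak_deriv d (Rd d) i f))"
      by blast
  qed
  show "AE x in leb_on d (orthant d).
      weak_deriv d (orthant d) i (reflect_sum d c f) x = reflect_sum d (sym_diff c {i}) (weak_deriv d (Rd d) i f) x"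
    if i: "i < d" by (rule orth.weak_deriv_AE[OF i w[OF i]])
qed

text \<open>In the Neumann case the only odd axis after toggling is i, so the reflected test
  function vanishes on the wall x_i = 0. In the Dirichlet case it is even in axis i, and u has to
  vanish instead.\<close>

lemma reflect_ext_is_weak_deriv:
  assumes u: "u \<in> form_domain b d (orthant d)" and i: "i < d"
  shows "is_weak_deriv d (Rd d) i (reflect_ext d (odd_axes b d) u)
    (reflect_ext d (sym_diff (odd_axes b d) {i}) (weak_deriv d (orthant d) i u))"
proof -
  note H = orth.form_domain_H1[OF u]
  show ?thesis
  proof (rule reflect_ext_weak_deriv[OF i orth.H1_L2[OF H] orth.H1_weak_deriv(1)[OF H i]])
    fix \<phi> assume \<phi>: "\<phi> \<in> test_functions d (Rd d)"
    let ?\<psi> = "reflect_sum d (sym_diff (odd_axes b d) {i}) \<phi>"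
    have \<psi>: "?\<psi> \<in> test_functions d (Rd d)" by (rule test_reflect_sum[OF \<phi> order_refl])
    show "(\<integral>x. u x * partial_deriv i ?\<psi> x \<partial>leb_on d (orthant d))
      = - (\<integral>x. weak_deriv d (orthant d) i u x * ?\<psi> x \<partial>leb_on d (orthant d))"
    proof (cases b)
      case Dirichlet
      then have "u \<in> H10 d (orthant d)" using u by simp
      from H10_integration_by_parts[OF this i \<psi>] show ?thesis .
    next
      case Neumann
      show ?thesis
      proof (rule weak_deriv_odd_test[OF i orth.H1_L2[OF H] orth.H1_weak_deriv[OF H i] \<psi>])
        fix x :: point assume "x i = 0"
        then show "?\<psi> x = 0" using Neumann by (intro reflect_sum_odd[OF i]) auto
      qed
    qed
  qed
qed

lemma reflect_ext_H1:
  assumes u: "u \<in> form_domain b d (orthant d)"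
  shows "reflect_ext d (odd_axes b d) u \<in> H1 d (Rd d)"
    and "i < d \<Longrightarrow> AE x in leb d. weak_deriv d (Rd d) i (reflect_ext d (odd_axes b d) u) x
      = reflect_ext d (sym_diff (odd_axes b d) {i}) (weak_deriv d (orthant d) i u) x"
proof -
  note H = orth.form_domain_H1[OF u]
  have w: "reflect_ext d (sym_diff (odd_axes b d) {i}) (weak_deriv d (orthant d) i u) \<in> L2 (leb d)" if i: "i < d" for i
    by (rule reflect_ext_L2[OF orth.H1_weak_deriv(1)[OF H i]])
  show "reflect_ext d (odd_axes b d) u \<in> H1 d (Rd d)"
  proof (rule whole.H1_I[OF reflect_ext_L2[OF orth.H1_L2[OF H]]])
    fix i assume "i < d"
    from w[OF this] reflect_ext_is_weak_deriv[OF u this]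
    show "reflect_ext d (sym_diff (odd_axes b d) {i}) (weak_deriv d (orthant d) i u) \<in> L2 (leb d)
      \<and> is_weak_deriv d (Rd d) i (reflect_ext d (odd_axes b d) u)
          (reflect_ext d (sym_diff (odd_axes b d) {i}) (weak_deriv d (orthant d) i u))" by blast
  qed
  show "AE x in leb d. weak_deriv d (Rd d) i (reflect_ext d (odd_axes b d) u) x
      = reflect_ext d (sym_diff (odd_axes b d) {i}) (weak_deriv d (orthant d) i u) x" if i: "i < d"
    by (rule whole.weak_deriv_AE[OF i w[OF i] reflect_ext_is_weak_deriv[OF u i]])
qed

lemma L2_restrict_space:
  assumes W: "W \<in> sets (leb d)" and f: "f \<in> L2 (leb d)"
  shows "f \<in> L2 (leb_on d W)" and "L2_norm (leb_on d W) f \<le> L2_norm (leb d) f"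
proof -
  have W': "W \<inter> space (leb d) \<in> sets (leb d)" using W by (metis sets.Int_space_eq2)
  have i: "integrable (leb d) (\<lambda>x. indicat_real W x *\<^sub>R (cmod (f x))\<^sup>2)"
    by (rule integrable_mult_indicator[OF W L2_integrable_sq[OF f]])
  then show "f \<in> L2 (leb_on d W)"
    using L2_measurable[OF f] by (simp add: L2_def integrable_restrict_space[OF W'] measurable_restrict_space1)
  show "L2_norm (leb_on d W) f \<le> L2_norm (leb d) f"
    unfolding L2_norm_def integral_restrict_space[OF W']
    by (intro real_sqrt_le_mono integral_mono i L2_integrable_sq[OF f]) (simp add: indicator_def)
qed

lemma reflect_sum_tendsto:
  assumes F: "\<And>n::nat. F n \<in> L2 (leb d)" and f: "f \<in> L2 (leb d)"
    and lim: "(\<lambda>n. L2_norm (leb d) (\<lambda>x. F n x - f x)) \<longlonglongrightarrow> 0"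
  shows "(\<lambda>n. L2_norm (leb d) (\<lambda>x. reflect_sum d c (F n) x - reflect_sum d c f x)) \<longlonglongrightarrow> 0"
    and "(\<lambda>n. L2_norm (leb_on d (orthant d)) (\<lambda>x. reflect_sum d c (F n) x - reflect_sum d c f x)) \<longlonglongrightarrow> 0"
proof -
  have L: "(\<lambda>x. F n x - f x) \<in> L2 (leb d)" for n by (rule L2_diff[OF F f])
  have eq: "(\<lambda>x. reflect_sum d c (F n) x - reflect_sum d c f x) = reflect_sum d c (\<lambda>x. F n x - f x)" for n
    by (simp only: reflect_sum_diff)
  have lim': "(\<lambda>n. 2 ^ d * L2_norm (leb d) (\<lambda>x. F n x - f x)) \<longlonglongrightarrow> 0"
    using tendsto_mult[OF tendsto_const[of "2 ^ d"] lim] by simp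
  show 1: "(\<lambda>n. L2_norm (leb d) (\<lambda>x. reflect_sum d c (F n) x - reflect_sum d c f x)) \<longlonglongrightarrow> 0"
    unfolding eq
    by (rule tendsto_sandwich[OF _ _ tendsto_const lim'])
      (use reflect_sum_norm_le[OF L] in \<open>simp_all only: L2_norm_nonneg eventually_True\<close>)
  show "(\<lambda>n. L2_norm (leb_on d (orthant d)) (\<lambda>x. reflect_sum d c (F n) x - reflect_sum d c f x)) \<longlonglongrightarrow> 0"
    by (rule tendsto_sandwich[OF _ _ tendsto_const 1])
      (use L2_restrict_space(2)[OF orth.domain_sets reflect_sum_L2[OF L]] in \<open>simp_all only: eq L2_norm_nonneg eventually_True\<close>)
qed

context box_domain_locale
begin

text \<open>Allows known representatives of the derivatives in place of the chosen ones.\<close>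

lemma H1_convI:
  assumes F: "\<And>n. F n \<in> H1 d \<Omega>" and f: "f \<in> H1 d \<Omega>"
    and l: "(\<lambda>n. L2_norm (leb_on d \<Omega>) (\<lambda>x. F n x - f x)) \<longlonglongrightarrow> 0"
    and G: "\<And>i n. i < d \<Longrightarrow> G i n \<in> L2 (leb_on d \<Omega>)" "\<And>i. i < d \<Longrightarrow> g i \<in> L2 (leb_on d \<Omega>)"
    and DG: "\<And>i n. i < d \<Longrightarrow> AE x in leb_on d \<Omega>. weak_deriv d \<Omega> i (F n) x = G i n x"
    and Dg: "\<And>i. i < d \<Longrightarrow> AE x in leb_on d \<Omega>. weak_deriv d \<Omega> i f x = g i x"
    and lG: "\<And>i. i < d \<Longrightarrow> (\<lambda>n. L2_norm (leb_on d \<Omega>) (\<lambda>x. G i n x - g i x)) \<longlonglongrightarrow> 0"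
  shows "H1_conv F f"
  unfolding H1_conv_def
proof (intro conjI l allI impI)
  fix i assume i: "i < d"
  have "L2_norm (leb_on d \<Omega>) (\<lambda>x. weak_deriv d \<Omega> i (F n) x - weak_deriv d \<Omega> i f x)
      = L2_norm (leb_on d \<Omega>) (\<lambda>x. G i n x - g i x)" for n
  proof (rule L2_norm_cong_AE)
    show "(\<lambda>x. weak_deriv d \<Omega> i (F n) x - weak_deriv d \<Omega> i f x) \<in> borel_measurable (leb_on d \<Omega>)"
      by (rule L2_measurable[OF L2_diff[OF H1_weak_deriv(1)[OF F i] H1_weak_deriv(1)[OF f i]]])
    show "(\<lambda>x. G i n x - g i x) \<in> borel_measurable (leb_on d \<Omega>)"
      by (rule L2_measurable[OF L2_diff[OF G(1)[OF i] G(2)[OF i]]])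
    show "AE x in leb_on d \<Omega>. weak_deriv d \<Omega> i (F n) x - weak_deriv d \<Omega> i f x = G i n x - g i x"
      using DG[OF i, of n] Dg[OF i] by eventually_elim simp
  qed
  then show "(\<lambda>n. L2_norm (leb_on d \<Omega>) (\<lambda>x. weak_deriv d \<Omega> i (F n) x - weak_deriv d \<Omega> i f x)) \<longlonglongrightarrow> 0"
    using lG[OF i] by (simp only:)
qed

end

text \<open>Vanishing on every wall lets the cutoffs converge in all derivatives at once, so \<psi>
  is a limit of test functions of the orthant.\<close>

lemma test_walls_H10:
  assumes \<psi>: "\<psi> \<in> test_functions d (Rd d)" and H: "\<psi> \<in> H1 d (orthant d)"
    and wd: "\<And>i. i < d \<Longrightarrow> is_weak_deriv d (orthant d) i \<psi> (partial_deriv i \<psi>)"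
    and odd: "\<And>i x. i < d \<Longrightarrow> x \<in> Rd d \<Longrightarrow> x i = 0 \<Longrightarrow> \<psi> x = 0"
  shows "\<psi> \<in> H10 d (orthant d)"
proof (rule orth.H1_conv_test_H10[OF H])
  let ?\<psi> = "\<lambda>n x. wall_cutoff d (Suc n) x * \<psi> x"
  show t: "?\<psi> n \<in> test_functions d (orthant d)" for n by (rule wall_cutoff_test[OF \<psi>])
  show "orth.H1_conv d ?\<psi> \<psi>"
  proof (rule orth.H1_convI[where G = "\<lambda>i n. partial_deriv i (?\<psi> n)" and g = "\<lambda>i. partial_deriv i \<psi>"])
    show "?\<psi> n \<in> H1 d (orthant d)" for n by (rule orth.test_H1[OF t])
    show "(\<lambda>n. L2_norm (leb_on d (orthant d)) (\<lambda>x. ?\<psi> n x - \<psi> x)) \<longlonglongrightarrow> 0" by (rule wall_cutoff_L2_tendsto[OF \<psi>])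
    fix i assume i: "i < d"
    show L: "partial_deriv i (?\<psi> n) \<in> L2 (leb_on d (orthant d))" for n
      by (rule orth.test_L2_M[OF test_partial_deriv[OF t i] orthant_subset])
    show L': "partial_deriv i \<psi> \<in> L2 (leb_on d (orthant d))"
      by (rule orth.test_L2_M[OF test_partial_deriv[OF \<psi> i] order_refl])
    show "AE x in leb_on d (orthant d). weak_deriv d (orthant d) i (?\<psi> n) x = partial_deriv i (?\<psi> n) x" for n
      by (rule orth.weak_deriv_AE[OF i L orth.test_weak_deriv[OF t i]])
    show "AE x in leb_on d (orthant d). weak_deriv d (orthant d) i \<psi> x = partial_deriv i \<psi> x"
      by (rule orth.weak_deriv_AE[OF i L' wd[OF i]])
    show "(\<lambda>n. L2_norm (leb_on d (orthant d)) (\<lambda>x. partial_deriv i (?\<psi> n) x - partial_deriv i \<psi> x)) \<longlonglongrightarrow> 0"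
      by (rule wall_cutoff_deriv_L2_tendsto[OF \<psi> i odd[OF i]])
  qed (rule H)
qed

text \<open>For a test function the odd reflection sum vanishes on all walls; the general case
  follows since \<open>H10\<close> is closed and the sum is continuous in H1.\<close>

lemma reflect_sum_H10:
  assumes f: "f \<in> H10 d (Rd d)"
  shows "reflect_sum d {..<d} f \<in> H10 d (orthant d)"
proof -
  note fH = whole.H10_H1[OF f]
  obtain \<phi> where t: "\<And>n. \<phi> n \<in> test_functions d (Rd d)" and conv: "whole.H1_conv d \<phi> f"
    using f unfolding whole.H10_iff by blast
  have \<phi>H: "\<phi> n \<in> H1 d (Rd d)" for n by (rule whole.test_H1[OF t])
  have c: "(\<lambda>n. L2_norm (leb d) (\<lambda>x. \<phi> n x - f x)) \<longlonglongrightarrow> 0"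
    "i < d \<Longrightarrow> (\<lambda>n. L2_norm (leb d) (\<lambda>x. weak_deriv d (Rd d) i (\<phi> n) x - weak_deriv d (Rd d) i f x)) \<longlonglongrightarrow> 0" for i
    using conv unfolding whole.H1_conv_def by blast+
  have in10: "reflect_sum d {..<d} (\<phi> n) \<in> H10 d (orthant d)" for n
  proof (rule test_walls_H10)
    show \<psi>: "reflect_sum d {..<d} (\<phi> n) \<in> test_functions d (Rd d)" by (rule test_reflect_sum[OF t order_refl])
    show "reflect_sum d {..<d} (\<phi> n) \<in> H1 d (orthant d)" by (rule reflect_sum_H1(1)[OF \<phi>H])
    show "reflect_sum d {..<d} (\<phi> n) x = 0" if "i < d" "x \<in> Rd d" "x i = 0" for i x
      using that by (intro reflect_sum_odd) auto
    fix i assume i: "i < d"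
    show "is_weak_deriv d (orthant d) i (reflect_sum d {..<d} (\<phi> n)) (partial_deriv i (reflect_sum d {..<d} (\<phi> n)))"
      unfolding is_weak_deriv_def
    proof
      fix \<eta> assume \<eta>: "\<eta> \<in> test_functions d (orthant d)"
      have "(\<integral>x. reflect_sum d {..<d} (\<phi> n) x * partial_deriv i \<eta> x \<partial>leb_on d (orthant d))
        = (\<integral>x. reflect_sum d {..<d} (\<phi> n) x * partial_deriv i \<eta> x \<partial>leb d)"
        by (rule integral_test_orthant[OF test_partial_deriv[OF \<eta> i]])
      also have "\<dots> = - (\<integral>x. partial_deriv i (reflect_sum d {..<d} (\<phi> n)) x * \<eta> x \<partial>leb d)"
        by (rule test_integration_by_parts[OF \<psi> test_mono[OF \<eta> orthant_subset] order_refl i])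
      also have "(\<integral>x. partial_deriv i (reflect_sum d {..<d} (\<phi> n)) x * \<eta> x \<partial>leb d)
        = (\<integral>x. partial_deriv i (reflect_sum d {..<d} (\<phi> n)) x * \<eta> x \<partial>leb_on d (orthant d))"
        by (rule integral_test_orthant[OF \<eta>, symmetric])
      finally show "(\<integral>x. reflect_sum d {..<d} (\<phi> n) x * partial_deriv i \<eta> x \<partial>leb_on d (orthant d))
        = - (\<integral>x. partial_deriv i (reflect_sum d {..<d} (\<phi> n)) x * \<eta> x \<partial>leb_on d (orthant d))" .
    qed
  qed
  show ?thesis
  proof (rule orth.H10_closed[OF reflect_sum_H1(1)[OF fH] in10])
    show "orth.H1_conv d (\<lambda>n. reflect_sum d {..<d} (\<phi> n)) (reflect_sum d {..<d} f)"
    proof (rule orth.H1_convI[where G = "\<lambda>i n. reflect_sum d (sym_diff {..<d} {i}) (weak_deriv d (Rd d) i (\<phi> n))"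
          and g = "\<lambda>i. reflect_sum d (sym_diff {..<d} {i}) (weak_deriv d (Rd d) i f)"])
      show "reflect_sum d {..<d} (\<phi> n) \<in> H1 d (orthant d)" for n by (rule reflect_sum_H1(1)[OF \<phi>H])
      show "reflect_sum d {..<d} f \<in> H1 d (orthant d)" by (rule reflect_sum_H1(1)[OF fH])
      show "(\<lambda>n. L2_norm (leb_on d (orthant d)) (\<lambda>x. reflect_sum d {..<d} (\<phi> n) x - reflect_sum d {..<d} f x)) \<longlonglongrightarrow> 0"
        by (rule reflect_sum_tendsto(2)[OF whole.H1_L2[OF \<phi>H] whole.H1_L2[OF fH] c(1)])
      fix i assume i: "i < d"
      show "reflect_sum d (sym_diff {..<d} {i}) (weak_deriv d (Rd d) i (\<phi> n)) \<in> L2 (leb_on d (orthant d))" for n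
        by (rule reflect_sum_L2_orthant[OF whole.H1_weak_deriv(1)[OF \<phi>H i]])
      show "reflect_sum d (sym_diff {..<d} {i}) (weak_deriv d (Rd d) i f) \<in> L2 (leb_on d (orthant d))"
        by (rule reflect_sum_L2_orthant[OF whole.H1_weak_deriv(1)[OF fH i]])
      show "AE x in leb_on d (orthant d). weak_deriv d (orthant d) i (reflect_sum d {..<d} (\<phi> n)) x
          = reflect_sum d (sym_diff {..<d} {i}) (weak_deriv d (Rd d) i (\<phi> n)) x" for n
        by (rule reflect_sum_H1(2)[OF \<phi>H i])
      show "AE x in leb_on d (orthant d). weak_deriv d (orthant d) i (reflect_sum d {..<d} f) x
          = reflect_sum d (sym_diff {..<d} {i}) (weak_deriv d (Rd d) i f) x"
        by (rule reflect_sum_H1(2)[OF fH i])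
      show "(\<lambda>n. L2_norm (leb_on d (orthant d)) (\<lambda>x. reflect_sum d (sym_diff {..<d} {i}) (weak_deriv d (Rd d) i (\<phi> n)) x
          - reflect_sum d (sym_diff {..<d} {i}) (weak_deriv d (Rd d) i f) x)) \<longlonglongrightarrow> 0"
        by (rule reflect_sum_tendsto(2)[OF whole.H1_weak_deriv(1)[OF \<phi>H i] whole.H1_weak_deriv(1)[OF fH i] c(2)[OF i]])
    qed
  qed
qed

lemma reflect_ext_tendsto:
  assumes F: "\<And>n::nat. F n \<in> L2 (leb_on d (orthant d))" and f: "f \<in> L2 (leb_on d (orthant d))"
    and lim: "(\<lambda>n. L2_norm (leb_on d (orthant d)) (\<lambda>x. F n x - f x)) \<longlonglongrightarrow> 0"
  shows "(\<lambda>n. L2_norm (leb d) (\<lambda>x. reflect_ext d c (F n) x - reflect_ext d c f x)) \<longlonglongrightarrow> 0"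
  unfolding reflect_ext_def
proof (rule reflect_sum_tendsto(1))
  show "(\<lambda>n. L2_norm (leb d) (\<lambda>x. indicator (orthant d) x * F n x - indicator (orthant d) x * f x)) \<longlonglongrightarrow> 0"
    using lim unfolding orth.L2_norm_M by (simp only: right_diff_distrib)
qed (use F f in \<open>simp_all only: orth.L2_M_iff\<close>)

text \<open>A test function of the orthant vanishes near the walls, so its reflections fit together
  to a test function on the whole space. Approximation gives the rest.\<close>

lemma reflect_ext_H10:
  assumes u: "u \<in> H10 d (orthant d)"
  shows "reflect_ext d {..<d} u \<in> H10 d (Rd d)"
proof -
  note uH = orth.H10_H1[OF u]
  obtain \<phi> where t: "\<And>n. \<phi> n \<in> test_functions d (orthant d)" and conv: "orth.H1_conv d \<phi> u"
    using u unfolding orth.H10_iff by blast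
  have \<phi>H: "\<phi> n \<in> H1 d (orthant d)" for n by (rule orth.test_H1[OF t])
  have c: "(\<lambda>n. L2_norm (leb_on d (orthant d)) (\<lambda>x. \<phi> n x - u x)) \<longlonglongrightarrow> 0"
    "i < d \<Longrightarrow> (\<lambda>n. L2_norm (leb_on d (orthant d)) (\<lambda>x. weak_deriv d (orthant d) i (\<phi> n) x - weak_deriv d (orthant d) i u x)) \<longlonglongrightarrow> 0" for i
    using conv unfolding orth.H1_conv_def by blast+
  have D: "\<phi> n \<in> form_domain Dirichlet d (orthant d)" "u \<in> form_domain Dirichlet d (orthant d)" for n
    using orth.test_H10[OF t] u by simp_all
  note ext\<phi> = reflect_ext_H1[OF D(1), simplified odd_axes.simps]
  note extu = reflect_ext_H1[OF D(2), simplified odd_axes.simps]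
  have in10: "reflect_ext d {..<d} (\<phi> n) \<in> H10 d (Rd d)" for n
  proof (rule whole.H10_cong[OF whole.test_H10[OF test_reflect_sum[OF t orthant_subset]]])
    show "reflect_ext d {..<d} (\<phi> n) \<in> L2 (leb d)" by (rule reflect_ext_L2[OF orth.H1_L2[OF \<phi>H]])
    show "AE x in leb d. reflect_sum d {..<d} (\<phi> n) x = reflect_ext d {..<d} (\<phi> n) x"
      unfolding reflect_ext_def
    proof (intro AE_leb_I reflect_sum_cong)
      fix x assume "x \<in> Rd d"
      then show "\<phi> n x = indicator (orthant d) x * \<phi> n x"
        using test_zero_outside[OF t[of n]] by (cases "x \<in> orthant d") auto
    qed
  qed
  show ?thesis
  proof (rule whole.H10_closed[OF extu(1) in10])
    show "whole.H1_conv d (\<lambda>n. reflect_ext d {..<d} (\<phi> n)) (reflect_ext d {..<d} u)"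
    proof (rule whole.H1_convI[where G = "\<lambda>i n. reflect_ext d (sym_diff {..<d} {i}) (weak_deriv d (orthant d) i (\<phi> n))"
          and g = "\<lambda>i. reflect_ext d (sym_diff {..<d} {i}) (weak_deriv d (orthant d) i u)"])
      show "reflect_ext d {..<d} (\<phi> n) \<in> H1 d (Rd d)" for n by (rule ext\<phi>(1))
      show "reflect_ext d {..<d} u \<in> H1 d (Rd d)" by (rule extu(1))
      show "(\<lambda>n. L2_norm (leb d) (\<lambda>x. reflect_ext d {..<d} (\<phi> n) x - reflect_ext d {..<d} u x)) \<longlonglongrightarrow> 0"
        by (rule reflect_ext_tendsto[OF orth.H1_L2[OF \<phi>H] orth.H1_L2[OF uH] c(1)])
      fix i assume i: "i < d"
      show "reflect_ext d (sym_diff {..<d} {i}) (weak_deriv d (orthant d) i (\<phi> n)) \<in> L2 (leb d)" for n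
        by (rule reflect_ext_L2[OF orth.H1_weak_deriv(1)[OF \<phi>H i]])
      show "reflect_ext d (sym_diff {..<d} {i}) (weak_deriv d (orthant d) i u) \<in> L2 (leb d)"
        by (rule reflect_ext_L2[OF orth.H1_weak_deriv(1)[OF uH i]])
      show "AE x in leb d. weak_deriv d (Rd d) i (reflect_ext d {..<d} (\<phi> n)) x
          = reflect_ext d (sym_diff {..<d} {i}) (weak_deriv d (orthant d) i (\<phi> n)) x" for n
        by (rule ext\<phi>(2)[OF i])
      show "AE x in leb d. weak_deriv d (Rd d) i (reflect_ext d {..<d} u) x
          = reflect_ext d (sym_diff {..<d} {i}) (weak_deriv d (orthant d) i u) x"
        by (rule extu(2)[OF i])
      show "(\<lambda>n. L2_norm (leb d) (\<lambda>x. reflect_ext d (sym_diff {..<d} {i}) (weak_deriv d (orthant d) i (\<phi> n)) x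
          - reflect_ext d (sym_diff {..<d} {i}) (weak_deriv d (orthant d) i u) x)) \<longlonglongrightarrow> 0"
        by (rule reflect_ext_tendsto[OF orth.H1_weak_deriv(1)[OF \<phi>H i] orth.H1_weak_deriv(1)[OF uH i] c(2)[OF i]])
    qed
  qed
qed

section \<open>Reflection sum and extension as an adjoint pair between the Laplacians\<close>

lemma reflect_sum_form_domain:
  assumes "f \<in> form_domain b d (Rd d)"
  shows "reflect_sum d (odd_axes b d) f \<in> form_domain b d (orthant d)"
  using assms reflect_sum_H10[of f d] reflect_sum_H1(1)[of f d "{}"] by (cases b) auto

lemma reflect_ext_form_domain:
  assumes "u \<in> form_domain b d (orthant d)"
  shows "reflect_ext d (odd_axes b d) u \<in> form_domain b d (Rd d)"
  using assms reflect_ext_H10[of u d] reflect_ext_H1(1)[OF assms] by (cases b) auto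

lemma reflect_inner:
  assumes f: "f \<in> L2 (leb d)" and g: "g \<in> L2 (leb_on d (orthant d))"
  shows "L2_inner (leb_on d (orthant d)) (reflect_sum d c f) g = L2_inner (leb d) f (reflect_ext d c g)"
proof -
  have g': "(\<lambda>x. cnj (indicator (orthant d) x * g x)) \<in> L2 (leb d)" using g by (simp only: orth.L2_M_iff L2_cnj)
  have "L2_inner (leb_on d (orthant d)) (reflect_sum d c f) g
      = (\<integral>x. reflect_sum d c f x * cnj (indicator (orthant d) x * g x) \<partial>leb d)"
    unfolding L2_inner_def orth.integral_M by (intro integral_leb_cong) (simp add: indicator_def)
  also have "\<dots> = (\<integral>x. f x * reflect_sum d c (\<lambda>x. cnj (indicator (orthant d) x * g x)) x \<partial>leb d)"
    by (rule reflect_sum_adjoint[OF f g'])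
  also have "\<dots> = L2_inner (leb d) f (reflect_ext d c g)"
    unfolding L2_inner_def reflect_ext_def by (simp only: reflect_sum_cnj)
  finally show ?thesis .
qed

text \<open>Moving the sum from f to g turns the form on the orthant into the form on the whole
  space at the extension of g, which is an admissible test element there. The derivatives on both
  sides carry the same toggled parity, so the adjoint relation applies axis by axis.\<close>

lemma reflect_sum_laplacian:
  assumes "(f, h) \<in> laplacian b d (Rd d)"
  shows "(reflect_sum d (odd_axes b d) f, reflect_sum d (odd_axes b d) h) \<in> laplacian b d (orthant d)"
proof -
  let ?c = "odd_axes b d" and ?M = "leb_on d (orthant d)"
  have f: "f \<in> form_domain b d (Rd d)" and h: "h \<in> L2 (leb d)"
    and eq: "\<And>g. g \<in> form_domain b d (Rd d) \<Longrightarrow> energy_form d (Rd d) f g = L2_inner (leb d) (\<lambda>x. - h x) g"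
    using assms by (auto simp: laplacian_def)
  note fH = whole.form_domain_H1[OF f]
  show ?thesis
    unfolding laplacian_def mem_Collect_eq prod.case
  proof (intro conjI ballI reflect_sum_form_domain[OF f] reflect_sum_L2_orthant[OF h])
    fix g assume g: "g \<in> form_domain b d (orthant d)"
    note gH = orth.form_domain_H1[OF g]
    have "energy_form d (orthant d) (reflect_sum d ?c f) g
        = (\<Sum>i<d. L2_inner ?M (reflect_sum d (sym_diff ?c {i}) (weak_deriv d (Rd d) i f)) (weak_deriv d (orthant d) i g))"
      by (rule orth.energy_form_cong[OF reflect_sum_H1(1)[OF fH] gH reflect_sum_L2_orthant[OF whole.H1_weak_deriv(1)[OF fH]]
            orth.H1_weak_deriv(1)[OF gH] reflect_sum_H1(2)[OF fH] AE_I2[OF refl]])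
    also have "\<dots> = (\<Sum>i<d. L2_inner (leb d) (weak_deriv d (Rd d) i f) (reflect_ext d (sym_diff ?c {i}) (weak_deriv d (orthant d) i g)))"
      by (intro sum.cong refl reflect_inner whole.H1_weak_deriv(1)[OF fH] orth.H1_weak_deriv(1)[OF gH]) simp_all
    also have "\<dots> = energy_form d (Rd d) f (reflect_ext d ?c g)"
      by (rule whole.energy_form_cong[symmetric, OF fH reflect_ext_H1(1)[OF g] whole.H1_weak_deriv(1)[OF fH]
            reflect_ext_L2[OF orth.H1_weak_deriv(1)[OF gH]] AE_I2[OF refl] reflect_ext_H1(2)[OF g]])
    also have "\<dots> = L2_inner (leb d) (\<lambda>x. - h x) (reflect_ext d ?c g)"
      by (rule eq[OF reflect_ext_form_domain[OF g]])
    also have "\<dots> = L2_inner ?M (reflect_sum d ?c (\<lambda>x. - h x)) g"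
      by (rule reflect_inner[OF L2_uminus[OF h] orth.H1_L2[OF gH], symmetric])
    also have "reflect_sum d ?c (\<lambda>x. - h x) = (\<lambda>x. - reflect_sum d ?c h x)"
      by (rule ext) (simp add: reflect_sum_def sum_negf)
    finally show "energy_form d (orthant d) (reflect_sum d ?c f) g = L2_inner ?M (\<lambda>x. - reflect_sum d ?c h x) g" .
  qed
qed

subsection \<open>Reflection of the heat semigroups\<close>

lemma indicator_unit_obox_norm: "L2_norm (leb d) (indicator (obox d (\<lambda>_. 0) (\<lambda>_. 1))) = 1"
proof -
  have "(\<integral>x. (cmod (indicator (obox d (\<lambda>_. 0) (\<lambda>_. 1)) x))\<^sup>2 \<partial>leb d) = (\<integral>x. indicator (obox d (\<lambda>_. 0) (\<lambda>_. 1)) x \<partial>leb d)"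
    by (intro Bochner_Integration.integral_cong refl) (simp add: indicator_def)
  also have "\<dots> = measure (leb d) (obox d (\<lambda>_. 0) (\<lambda>_. 1))" by (simp add: Int_absorb2[OF obox_subset])
  also have "\<dots> = 1"
  proof -
    have "emeasure (bleb d) (obox d (\<lambda>_. 0) (\<lambda>_. 1)) = 1"
      unfolding obox_def by (subst emeasure_bleb_PiE) simp_all
    then show ?thesis by (simp add: leb_eq measure_def emeasure_completion)
  qed
  finally show ?thesis by (simp add: L2_norm_def)
qed

lemma (in box_domain_locale) nontrivial_L2:
  assumes "obox d (\<lambda>_. 0) (\<lambda>_. 1) \<subseteq> \<Omega>"
  shows "nontrivial_L2 (leb_on d \<Omega>)"
  unfolding nontrivial_L2_def
proof (intro bexI)
  show "L2_norm (leb_on d \<Omega>) (indicator (obox d (\<lambda>_. 0) (\<lambda>_. 1))) \<noteq> 0"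
  proof -
    have "(\<lambda>x. indicator \<Omega> x * indicator (obox d (\<lambda>_. 0) (\<lambda>_. 1)) x) = (indicator (obox d (\<lambda>_. 0) (\<lambda>_. 1)) :: point \<Rightarrow> complex)"
      using assms by (auto simp: indicator_def fun_eq_iff)
    then show ?thesis unfolding L2_norm_M using indicator_unit_obox_norm by simp
  qed
  show "indicator (obox d (\<lambda>_. 0) (\<lambda>_. 1)) \<in> L2 (leb_on d \<Omega>)"
    by (rule L2_restrict[OF indicator_obox_L2])
qed

text \<open>Existence from the generation theorem justifies the choice in the definition; afterwards
  the semigroup is known through these two properties only.\<close>

lemma (in box_domain_locale) heat_semigroup:
  assumes "nontrivial_L2 (leb_on d \<Omega>)"
  shows "C0_semigroup (leb_on d \<Omega>) (heat_semigroup b d \<Omega>)"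
    and "C0_generator (leb_on d \<Omega>) (heat_semigroup b d \<Omega>) = laplacian b d \<Omega>"
proof -
  have "\<exists>U. C0_semigroup (leb_on d \<Omega>) U \<and> C0_generator (leb_on d \<Omega>) U = laplacian b d \<Omega>"
    using closed_form_generates_semigroup[OF assms closed_energy_form] unfolding laplacian_form_operator .
  from someI_ex[OF this] show "C0_semigroup (leb_on d \<Omega>) (heat_semigroup b d \<Omega>)"
    "C0_generator (leb_on d \<Omega>) (heat_semigroup b d \<Omega>) = laplacian b d \<Omega>"
    unfolding heat_semigroup_def by blast+
qed

lemma nontrivial_L2_whole: "nontrivial_L2 (leb d)"
  by (rule whole.nontrivial_L2[OF obox_subset])

lemma nontrivial_L2_orthant: "nontrivial_L2 (leb_on d (orthant d))"
proof (rule orth.nontrivial_L2)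
  show "obox d (\<lambda>_. 0) (\<lambda>_. 1) \<subseteq> orthant d"
    unfolding obox_def orthant_def by (rule PiE_mono) auto
qed

text \<open>The extension followed by its adjoint is the identity on the orthant.\<close>

lemma reflect_norm_ext:
  assumes u: "u \<in> L2 (leb_on d (orthant d))"
  shows "L2_norm (leb d) (reflect_ext d c u) = L2_norm (leb_on d (orthant d)) u"
proof -
  let ?M = "leb_on d (orthant d)"
  have "complex_of_real ((L2_norm (leb d) (reflect_ext d c u))\<^sup>2) = L2_inner (leb d) (reflect_ext d c u) (reflect_ext d c u)"
    by (rule L2_norm_eq_inner[OF reflect_ext_L2[OF u], symmetric])
  also have "\<dots> = L2_inner ?M (reflect_sum d c (reflect_ext d c u)) u"
    by (rule reflect_inner[OF reflect_ext_L2[OF u] u, symmetric])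
  also have "\<dots> = L2_inner ?M u u"
    unfolding L2_inner_def reflect_ext_def
    by (intro Bochner_Integration.integral_cong refl) (simp add: orth.space_M reflect_sum_reflect_sum)
  also have "\<dots> = complex_of_real ((L2_norm ?M u)\<^sup>2)" by (rule L2_norm_eq_inner[OF u])
  finally have "(L2_norm (leb d) (reflect_ext d c u))\<^sup>2 = (L2_norm ?M u)\<^sup>2" by (simp only: of_real_eq_iff)
  then show ?thesis using L2_norm_nonneg power2_eq_imp_eq by blast
qed

lemma L2_inner_Cauchy_Schwarz:
  assumes "f \<in> L2 M" "g \<in> L2 M"
  shows "cmod (L2_inner M f g) \<le> L2_norm M f * L2_norm M g"
proof -
  have "L2_norm M (\<lambda>x. cnj (g x)) = L2_norm M g" by (simp add: L2_norm_def)
  then show ?thesis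
    using L2_Cauchy_Schwarz[of f M "\<lambda>x. cnj (g x)"] assms unfolding L2_inner_def by simp
qed

text \<open>The adjoint of an isometry is a contraction: |R f|^2 = <f, E R f> <= |f| |R f|.\<close>

lemma reflect_norm_sum:
  assumes f: "f \<in> L2 (leb d)"
  shows "L2_norm (leb_on d (orthant d)) (reflect_sum d c f) \<le> L2_norm (leb d) f"
proof -
  let ?M = "leb_on d (orthant d)" and ?R = "reflect_sum d c f"
  have R: "?R \<in> L2 ?M" by (rule reflect_sum_L2_orthant[OF f])
  have "complex_of_real ((L2_norm ?M ?R)\<^sup>2) = L2_inner (leb d) f (reflect_ext d c ?R)"
    using L2_norm_eq_inner[OF R] reflect_inner[OF f R, of c] by simp
  then have "cmod (complex_of_real ((L2_norm ?M ?R)\<^sup>2)) \<le> L2_norm (leb d) f * L2_norm (leb d) (reflect_ext d c ?R)"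
    using L2_inner_Cauchy_Schwarz[OF f reflect_ext_L2[OF R]] by (simp only:)
  then have "(L2_norm ?M ?R)\<^sup>2 \<le> L2_norm (leb d) f * L2_norm ?M ?R"
    unfolding reflect_norm_ext[OF R] by (simp only: norm_of_real abs_power2)
  then have "L2_norm ?M ?R * L2_norm ?M ?R \<le> L2_norm (leb d) f * L2_norm ?M ?R" by (simp only: power2_eq_square)
  then show ?thesis
    using L2_norm_nonneg[of "leb d" f] L2_norm_nonneg[of ?M ?R]
    by (cases "L2_norm ?M ?R = 0") (simp_all add: less_le)
qed

lemma reflect_sum_heat:
  assumes t: "t \<ge> 0" and f: "f \<in> L2 (leb d)"
  shows "AE x in leb_on d (orthant d). reflect_sum d (odd_axes b d) (heat_semigroup b d (Rd d) t f) x
    = heat_semigroup b d (orthant d) t (reflect_sum d (odd_axes b d) f) x"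
proof (rule closed_form_semigroups_intertwining[OF nontrivial_L2_whole nontrivial_L2_orthant
      whole.closed_energy_form whole.heat_semigroup(1)[OF nontrivial_L2_whole]
      whole.heat_semigroup(2)[OF nontrivial_L2_whole, unfolded whole.laplacian_form_operator]
      orth.closed_energy_form orth.heat_semigroup(1)[OF nontrivial_L2_orthant]
      orth.heat_semigroup(2)[OF nontrivial_L2_orthant, unfolded orth.laplacian_form_operator]
      reflect_sum_L2_orthant _ _ _ t f])
  show "AE x in leb_on d (orthant d). reflect_sum d (odd_axes b d) (\<lambda>y. k * f y + g y) x
      = k * reflect_sum d (odd_axes b d) f x + reflect_sum d (odd_axes b d) g x" for f g k
    by (simp add: reflect_sum_lincomb)
  show "L2_norm (leb_on d (orthant d)) (reflect_sum d (odd_axes b d) f) \<le> 1 * L2_norm (leb d) f"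
    if "f \<in> L2 (leb d)" for f using reflect_norm_sum[OF that] by simp
  show "(reflect_sum d (odd_axes b d) f, reflect_sum d (odd_axes b d) h)
      \<in> form_operator (leb_on d (orthant d)) (form_domain b d (orthant d)) (energy_form d (orthant d))"
    if "(f, h) \<in> form_operator (leb d) (form_domain b d (Rd d)) (energy_form d (Rd d))" for f h
    using reflect_sum_laplacian that unfolding whole.laplacian_form_operator orth.laplacian_form_operator by blast
qed

subsection \<open>Reflection of thick sets\<close>

definition reflect_set :: "nat \<Rightarrow> point set \<Rightarrow> point set" where
  "reflect_set d W = (\<Union>A\<in>Pow {..<d}. flip A -` W \<inter> Rd d)"

lemma reflect_set_subset: "reflect_set d W \<subseteq> Rd d"
  by (auto simp: reflect_set_def)

lemma reflect_set_sets:
  assumes "W \<in> sets (leb d)"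
  shows "reflect_set d W \<in> sets (leb d)"
  unfolding reflect_set_def
proof (rule sets.finite_UN)
  fix A assume "A \<in> Pow {..<d}"
  then show "flip A -` W \<inter> Rd d \<in> sets (leb d)"
    using measurable_sets[OF flip_measurable_leb assms, of A] by simp
qed simp

lemma reflect_set_iff:
  assumes W: "W \<subseteq> orthant d" and x: "x \<in> orthant d" and A: "A \<subseteq> {..<d}"
  shows "flip A x \<in> reflect_set d W \<longleftrightarrow> x \<in> W"
proof
  assume "flip A x \<in> reflect_set d W"
  then obtain B where B: "B \<subseteq> {..<d}" "flip (sym_diff B A) x \<in> W"
    by (auto simp: reflect_set_def flip_flip)
  have "sym_diff B A = {}"
    using orthant_flip_iff[OF x, of "sym_diff B A"] B A W by blast
  moreover have "flip {} x = x" by (simp add: flip_def)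
  ultimately show "x \<in> W" using B(2) by (simp only:)
next
  assume "x \<in> W"
  then have "flip A (flip A x) \<in> W" by simp
  moreover have "flip A x \<in> Rd d" using x orthant_subset A by (intro flip_Rd) auto
  ultimately show "flip A x \<in> reflect_set d W" using A unfolding reflect_set_def by blast
qed

text \<open>All reflections of a point of the orthant lie in the reflected set or none does, so its
  indicator is a common factor. Hence a control supported on the reflected set is turned into one
  supported on W.\<close>

lemma reflect_sum_indicator:
  assumes W: "W \<subseteq> orthant d" and x: "x \<in> orthant d"
  shows "reflect_sum d c (\<lambda>y. indicator (reflect_set d W) y * v y) x = indicator W x * reflect_sum d c v x"
proof -
  have "(\<Sum>A\<in>Pow {..<d}. chi d c A * (indicator (reflect_set d W) (flip A x) * v (flip A x)))
      = (\<Sum>A\<in>Pow {..<d}. indicator W x * (chi d c A * v (flip A x)))"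
  proof (rule sum.cong[OF refl])
    fix A assume "A \<in> Pow {..<d}"
    then have "flip A x \<in> reflect_set d W \<longleftrightarrow> x \<in> W" using reflect_set_iff[OF W x] by blast
    then show "chi d c A * (indicator (reflect_set d W) (flip A x) * v (flip A x)) = indicator W x * (chi d c A * v (flip A x))"
      by (simp add: indicator_def)
  qed
  then have "(\<Sum>A\<in>Pow {..<d}. chi d c A * (indicator (reflect_set d W) (flip A x) * v (flip A x)))
      = indicator W x * (\<Sum>A\<in>Pow {..<d}. chi d c A * v (flip A x))"
    by (simp only: sum_distrib_left)
  then show ?thesis unfolding reflect_sum_def by (simp only: mult.left_commute)
qed

lemma L2_indicator_mult: "W \<in> sets M \<Longrightarrow> f \<in> L2 M \<Longrightarrow> (\<lambda>x. indicator W x * f x) \<in> L2 M"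
  by (rule L2_bounded_mult[where C = 1]) (auto simp: indicator_def intro: borel_measurable_indicator)

lemma L2_norm_restrict:
  assumes "W \<in> sets (leb d)"
  shows "L2_norm (leb_on d W) f = L2_norm (leb d) (\<lambda>x. indicator W x * f x)"
proof -
  have "W \<inter> space (leb d) \<in> sets (leb d)" using assms by (metis sets.Int_space_eq2)
  moreover have "indicator W x *\<^sub>R (cmod (f x))\<^sup>2 = (cmod (indicator W x * f x))\<^sup>2" for x
    by (simp add: indicator_def)
  ultimately show ?thesis by (simp add: L2_norm_def integral_restrict_space)
qed

lemma reflect_norm_restrict:
  assumes W: "W \<subseteq> orthant d" "W \<in> sets (leb d)" and v: "v \<in> L2 (leb d)"
  shows "L2_norm (leb_on d W) (reflect_sum d c v) \<le> L2_norm (leb_on d (reflect_set d W)) v"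
proof -
  let ?v = "\<lambda>y. indicator (reflect_set d W) y * v y"
  have S: "reflect_set d W \<in> sets (leb d)" by (rule reflect_set_sets[OF W(2)])
  have v': "?v \<in> L2 (leb d)" by (rule L2_indicator_mult[OF S v])
  have "indicator W x * reflect_sum d c v x = indicator (orthant d) x * reflect_sum d c ?v x" for x
    using W(1) reflect_sum_indicator[OF W(1), of x c v] by (cases "x \<in> orthant d") (auto simp: indicator_def)
  then have "L2_norm (leb_on d W) (reflect_sum d c v) = L2_norm (leb_on d (orthant d)) (reflect_sum d c ?v)"
    unfolding L2_norm_restrict[OF W(2)] orth.L2_norm_M by (simp only:)
  also have "\<dots> \<le> L2_norm (leb d) ?v" by (rule reflect_norm_sum[OF v'])
  finally show ?thesis unfolding L2_norm_restrict[OF S] .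
qed

lemma hyperplane_null:
  assumes "j < d"
  shows "{y \<in> Rd d. y j = 0} \<in> null_sets (leb d)"
proof -
  have eq: "{y \<in> Rd d. y j = 0} = PiE {..<d} (\<lambda>k. if k = j then {0} else UNIV)"
  proof (intro equalityI subsetI)
    fix y assume "y \<in> {y \<in> Rd d. y j = 0}"
    then have "y \<in> extensional {..<d}" "y j = 0" by (simp_all add: Rd_def PiE_iff)
    then show "y \<in> PiE {..<d} (\<lambda>k. if k = j then {0} else UNIV)" by (simp add: PiE_iff)
  next
    fix y :: point assume y: "y \<in> PiE {..<d} (\<lambda>k. if k = j then {0} else UNIV)"
    then have "y \<in> extensional {..<d}" by (simp add: PiE_iff)
    moreover have "y j \<in> (if j = j then {0} else UNIV)" by (rule PiE_mem[OF y]) (simp add: assms)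
    ultimately show "y \<in> {y \<in> Rd d. y j = 0}" by (simp add: Rd_def PiE_iff)
  qed
  have s: "(if k = j then {0 :: real} else UNIV) \<in> sets borel" for k by simp
  have "emeasure (bleb d) {y \<in> Rd d. y j = 0} = (\<Prod>k<d. emeasure lborel (if k = j then {0 :: real} else UNIV))"
    unfolding eq by (rule emeasure_bleb_PiE[OF s])
  also have "\<dots> = 0" by (rule prod_zero) (use assms in auto)
  finally have "{y \<in> Rd d. y j = 0} \<in> null_sets (bleb d)"
    using PiE_sets_bleb[OF s, of d] unfolding eq by (intro null_setsI)
  then show ?thesis unfolding leb_eq by (rule null_sets_completionI)
qed

text \<open>
  Of the two halves of \<open>[x\<^sub>j, x\<^sub>j + 2 a\<^sub>j]\<close> one lies on one side of the origin, so every box of the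
  doubled side lengths contains a reflected copy of a box of the original side lengths in the
  closed orthant.
\<close>

lemma thick_reflect_set:
  assumes S: "thick d \<gamma> a S"
  shows "thick d (\<gamma> / 2 ^ d) (\<lambda>j. 2 * a j) (reflect_set d (orthant d \<inter> S))"
proof -
  have \<gamma>: "0 < \<gamma>" "\<gamma> \<le> 1" and a: "\<And>j. j < d \<Longrightarrow> 0 < a j" and Ss: "S \<in> sets (leb d)"
    and th: "\<And>x. x \<in> Rd d \<Longrightarrow> \<gamma> * (\<Prod>j<d. a j) \<le> measure (leb d) (S \<inter> PiE {..<d} (\<lambda>j. {x j..x j + a j}))"
    using S by (auto simp: thick_def)
  let ?S' = "reflect_set d (orthant d \<inter> S)"
  have OS: "orthant d \<inter> S \<in> sets (leb d)" using orth.domain_sets Ss by blast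
  have "\<gamma> / 2 ^ d * (\<Prod>j<d. 2 * a j) \<le> measure (leb d) (?S' \<inter> PiE {..<d} (\<lambda>j. {x j..x j + 2 * a j}))"
    if x: "x \<in> Rd d" for x
  proof -
    \<comment> \<open>The axes in which the left half of the doubled interval lies on the negative
      side. There that half is reflected; in the other axes the right half is taken, which is
      nonnegative. \<open>z\<close> is the lower corner of the resulting box.\<close>
    define A where "A = {j\<in>{..<d}. x j + a j < 0}"
    define z where "z = (\<lambda>j\<in>{..<d}. if j \<in> A then - x j - a j else x j + a j)"
    let ?B = "PiE {..<d} (\<lambda>j. {z j..z j + a j})" and ?C = "PiE {..<d} (\<lambda>j. {x j..x j + 2 * a j})"
    have A: "A \<subseteq> {..<d}" by (auto simp: A_def)
    have z: "z \<in> Rd d" by (simp add: z_def Rd_def)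
    have z0: "0 \<le> z j" if "j < d" for j using that by (auto simp: z_def A_def)
    have BC: "?B \<in> sets (leb d)" "?C \<in> sets (leb d)" by (auto intro!: bleb_sets_leb PiE_sets_bleb)
    \<comment> \<open>The box lies only in the closed orthant, whereas \<open>orthant\<close> is
      open, so the walls are removed as a null set.\<close>
    let ?N = "\<Union>j<d. {y \<in> Rd d. y j = 0}"
    have N: "?N \<in> null_sets (leb d)" by (rule null_sets_UN') (auto intro: hyperplane_null)
    have sub: "?B - ?N \<subseteq> orthant d"
    proof
      fix y assume y: "y \<in> ?B - ?N"
      have yE: "y \<in> extensional {..<d}" and yz: "\<And>j. j < d \<Longrightarrow> z j \<le> y j" using y by (auto simp: PiE_iff)
      have "y \<in> Rd d" using yE by (simp add: Rd_def PiE_iff)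
      then have "y j \<noteq> 0" if "j < d" for j using y that by blast
      then have "0 < y j" if "j < d" for j using z0[OF that] yz[OF that] that by (metis less_le order.trans)
      then show "y \<in> orthant d" using yE by (simp add: orthant_def PiE_iff)
    qed
    \<comment> \<open>The factors 2 of the sides cancel the division of \<gamma> by 2^d: all mass
      found comes from a single box of the original size.\<close>
    have "\<gamma> / 2 ^ d * (\<Prod>j<d. 2 * a j) = \<gamma> * (\<Prod>j<d. a j)" by (simp add: prod.distrib)
    also have "\<dots> \<le> measure (leb d) (S \<inter> ?B)" by (rule th[OF z])
    also have "\<dots> = measure (leb d) (S \<inter> ?B - ?N)" using Ss BC N by (simp add: measure_Diff_null_set)
    also have "\<dots> = measure (leb d) (flip A -` (S \<inter> ?B - ?N) \<inter> Rd d)"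
    proof -
      have "S \<inter> ?B - ?N \<in> sets (leb d)" using Ss BC N by blast
      from measure_distr[OF flip_measurable_leb[OF A] this] show ?thesis
        unfolding distr_flip_leb[OF A] by simp
    qed
    also have "\<dots> \<le> measure (leb d) (?S' \<inter> ?C)"
    proof (rule measure_mono_fmeasurable)
      show "flip A -` (S \<inter> ?B - ?N) \<inter> Rd d \<in> sets (leb d)"
        using measurable_sets[OF flip_measurable_leb[OF A], of "S \<inter> ?B - ?N"] Ss BC N by auto
      have "emeasure (leb d) ?C < \<infinity>"
      proof -
        have "emeasure (bleb d) ?C = (\<Prod>j<d. emeasure lborel {x j..x j + 2 * a j})" by (rule emeasure_bleb_PiE) simp
        also have "\<dots> < \<infinity>"
        proof -
          have "emeasure lborel {x j..x j + 2 * a j} < \<infinity>" for j by (rule emeasure_bounded_finite) simp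
          then show ?thesis by (auto simp: less_top[symmetric] ennreal_prod_eq_top)
        qed
        finally show ?thesis by (simp add: leb_eq emeasure_completion PiE_sets_bleb)
      qed
      then have "?C \<in> fmeasurable (leb d)" using BC by (simp add: fmeasurable_def)
      then have "?C \<inter> ?S' \<in> fmeasurable (leb d)" by (rule fmeasurable_Int_fmeasurable[OF _ reflect_set_sets[OF OS]])
      then show "?S' \<inter> ?C \<in> fmeasurable (leb d)" by (simp only: Int_commute)
      show "flip A -` (S \<inter> ?B - ?N) \<inter> Rd d \<subseteq> ?S' \<inter> ?C"
      proof
        fix y assume y: "y \<in> flip A -` (S \<inter> ?B - ?N) \<inter> Rd d"
        then have fy: "flip A y \<in> S" "flip A y \<in> ?B" "flip A y \<in> ?B - ?N" and yR: "y \<in> Rd d" by auto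
        have "flip A y \<in> orthant d \<inter> S" using sub fy by blast
        then have 1: "y \<in> ?S'" using A yR unfolding reflect_set_def by blast
        have "x j \<le> y j \<and> y j \<le> x j + 2 * a j" if j: "j < d" for j
        proof -
          have "z j \<le> flip A y j" "flip A y j \<le> z j + a j" using fy(2) j by (auto simp: PiE_iff)
          then show ?thesis using j a[OF j] by (auto simp: z_def flip_def split: if_splits)
        qed
        then have "y \<in> ?C" using yR by (simp add: Rd_def PiE_iff)
        with 1 show "y \<in> ?S' \<inter> ?C" by blast
      qed
    qed
    finally show ?thesis .
  qed
  moreover have "\<gamma> / 2 ^ d \<le> 1"
  proof -
    have "(1 :: real) \<le> 2 ^ d" by simp
    with \<gamma>(2) have "\<gamma> \<le> 2 ^ d" by linarith
    then show ?thesis by simp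
  qed
  ultimately show ?thesis unfolding thick_def using \<gamma> a reflect_set_sets[OF OS] by auto
qed

subsection \<open>Reflection of controls\<close>

text \<open>Evaluation at a point x turns the simple integral into an integral of a complex
  function, whose linearity can then be used.\<close>

lemma
  assumes N: "finite_measure N" and s: "simple_function N s"
  shows integrable_simple_eval: "integrable N (\<lambda>t. s t x :: complex)"
    and L2_simple_integral_eq: "L2_simple_integral N s x = (\<integral>t. s t x \<partial>N)"
proof -
  interpret finite_measure N by (rule N)
  have fin: "finite (s ` space N)" and ms: "s -` {g} \<inter> space N \<in> sets N" for g
    using simple_functionD[OF s] by blast+
  have eq: "s t x = (\<Sum>g\<in>s ` space N. indicat_real (s -` {g} \<inter> space N) t *\<^sub>R g x)" if t: "t \<in> space N" for t
  proof -
    have "(\<Sum>g\<in>s ` space N. indicat_real (s -` {g} \<inter> space N) t *\<^sub>R g x) = (\<Sum>g\<in>s ` space N. if g = s t then g x else 0)"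
      using t by (intro sum.cong refl) (simp add: indicator_def)
    also have "\<dots> = s t x" using t fin by simp
    finally show ?thesis ..
  qed
  have i: "integrable N (\<lambda>t. indicat_real (s -` {g} \<inter> space N) t *\<^sub>R g x)" for g :: "_ \<Rightarrow> complex"
    using ms[of g] by (intro integrable_scaleR_left integrable_real_indicator) (simp_all add: less_top[symmetric])
  have "integrable N (\<lambda>t. \<Sum>g\<in>s ` space N. indicat_real (s -` {g} \<inter> space N) t *\<^sub>R g x)"
    by (intro Bochner_Integration.integrable_sum i)
  then show "integrable N (\<lambda>t. s t x)"
    by (subst Bochner_Integration.integrable_cong[OF refl eq]) assumption+
  have "(\<integral>t. s t x \<partial>N) = (\<integral>t. (\<Sum>g\<in>s ` space N. indicat_real (s -` {g} \<inter> space N) t *\<^sub>R g x) \<partial>N)"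
    by (rule Bochner_Integration.integral_cong[OF refl eq])
  also have "\<dots> = (\<Sum>g\<in>s ` space N. \<integral>t. indicat_real (s -` {g} \<inter> space N) t *\<^sub>R g x \<partial>N)"
    by (intro Bochner_Integration.integral_sum i)
  also have "\<dots> = (\<Sum>g\<in>s ` space N. measure N (s -` {g} \<inter> space N) *\<^sub>R g x)"
  proof (intro sum.cong refl)
    fix g
    have "integrable N (indicat_real (s -` {g} \<inter> space N))"
      using ms[of g] by (intro integrable_real_indicator) (simp_all add: less_top[symmetric])
    then show "(\<integral>t. indicat_real (s -` {g} \<inter> space N) t *\<^sub>R g x \<partial>N) = measure N (s -` {g} \<inter> space N) *\<^sub>R g x"
      by (simp add: Int_absorb2)
  qed
  finally show "L2_simple_integral N s x = (\<integral>t. s t x \<partial>N)"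
    by (simp add: L2_simple_integral_def scaleR_conv_of_real)
qed

lemma L2_simple_reflect:
  assumes "L2_simple N (leb d) s"
  shows "L2_simple N (leb_on d (orthant d)) (\<lambda>t. reflect_sum d c (s t))"
proof -
  have s: "simple_function N s" and L: "\<And>t. t \<in> space N \<Longrightarrow> s t \<in> L2 (leb d)"
    and fin: "emeasure N {t \<in> space N. s t \<noteq> (\<lambda>_. 0)} \<noteq> \<infinity>"
    using assms by (simp_all add: L2_simple_def)
  have "{t \<in> space N. s t \<noteq> (\<lambda>_. 0)} = s -` (- {\<lambda>_. 0}) \<inter> space N" by blast
  then have "{t \<in> space N. s t \<noteq> (\<lambda>_. 0)} \<in> sets N" using simple_functionD(2)[OF s] by (simp only:)
  moreover have "reflect_sum d c (\<lambda>_. 0) = (\<lambda>_. 0)" by (simp add: reflect_sum_def fun_eq_iff)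
  then have "{t \<in> space N. reflect_sum d c (s t) \<noteq> (\<lambda>_. 0)} \<subseteq> {t \<in> space N. s t \<noteq> (\<lambda>_. 0)}" by force
  ultimately have "emeasure N {t \<in> space N. reflect_sum d c (s t) \<noteq> (\<lambda>_. 0)} \<le> emeasure N {t \<in> space N. s t \<noteq> (\<lambda>_. 0)}"
    by (intro emeasure_mono)
  then have "emeasure N {t \<in> space N. reflect_sum d c (s t) \<noteq> (\<lambda>_. 0)} \<noteq> \<infinity>" using fin by (auto simp: top_unique)
  then show ?thesis
    unfolding L2_simple_def using simple_function_compose1[OF s, of "reflect_sum d c"] reflect_sum_L2_orthant[OF L] by simp
qed

text \<open>The value of a reflection sum at x involves finitely many point evaluations, and these
  commute with the simple integral.\<close>

lemma L2_simple_integral_reflect: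
  assumes N: "finite_measure N" and s: "L2_simple N (leb d) s"
  shows "L2_simple_integral N (\<lambda>t. reflect_sum d c (s t)) = reflect_sum d c (L2_simple_integral N s)"
proof
  fix x
  have s': "simple_function N s" using s by (simp add: L2_simple_def)
  note i = integrable_simple_eval[OF N s']
  have "L2_simple_integral N (\<lambda>t. reflect_sum d c (s t)) x = (\<integral>t. reflect_sum d c (s t) x \<partial>N)"
    by (rule L2_simple_integral_eq[OF N simple_function_compose1[OF s']])
  also have "\<dots> = complex_of_real (1 / sqrt (2 ^ d)) * (\<integral>t. (\<Sum>A\<in>Pow {..<d}. chi d c A * s t (flip A x)) \<partial>N)"
    unfolding reflect_sum_def by (rule integral_mult_right_zero)
  also have "(\<integral>t. (\<Sum>A\<in>Pow {..<d}. chi d c A * s t (flip A x)) \<partial>N) = (\<Sum>A\<in>Pow {..<d}. \<integral>t. chi d c A * s t (flip A x) \<partial>N)"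
    by (intro Bochner_Integration.integral_sum integrable_mult_right i)
  also have "\<dots> = (\<Sum>A\<in>Pow {..<d}. chi d c A * (\<integral>t. s t (flip A x) \<partial>N))"
    by (simp only: integral_mult_right_zero)
  also have "complex_of_real (1 / sqrt (2 ^ d)) * \<dots> = reflect_sum d c (L2_simple_integral N s) x"
    unfolding reflect_sum_def by (simp only: L2_simple_integral_eq[OF N s'])
  finally show "L2_simple_integral N (\<lambda>t. reflect_sum d c (s t)) x = reflect_sum d c (L2_simple_integral N s) x" .
qed

lemma reflect_norm_diff:
  assumes f: "f \<in> L2 (leb d)" and s: "s \<in> L2 (leb d)" and g: "g \<in> L2 (leb_on d (orthant d))"
    and ae: "AE x in leb_on d (orthant d). g x = reflect_sum d c f x"
  shows "L2_norm (leb_on d (orthant d)) (\<lambda>x. g x - reflect_sum d c s x) \<le> L2_norm (leb d) (\<lambda>x. f x - s x)"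
proof -
  let ?M = "leb_on d (orthant d)"
  have "L2_norm ?M (\<lambda>x. g x - reflect_sum d c s x) = L2_norm ?M (\<lambda>x. reflect_sum d c f x - reflect_sum d c s x)"
  proof (rule L2_norm_cong_AE)
    show "(\<lambda>x. g x - reflect_sum d c s x) \<in> borel_measurable ?M"
      by (rule L2_measurable[OF L2_diff[OF g reflect_sum_L2_orthant[OF s]]])
    show "(\<lambda>x. reflect_sum d c f x - reflect_sum d c s x) \<in> borel_measurable ?M"
      by (rule L2_measurable[OF L2_diff[OF reflect_sum_L2_orthant[OF f] reflect_sum_L2_orthant[OF s]]])
    show "AE x in ?M. g x - reflect_sum d c s x = reflect_sum d c f x - reflect_sum d c s x"
      using ae by eventually_elim simp
  qed
  also have "(\<lambda>x. reflect_sum d c f x - reflect_sum d c s x) = reflect_sum d c (\<lambda>x. f x - s x)"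
    by (simp only: reflect_sum_diff)
  finally show ?thesis using reflect_norm_sum[OF L2_diff[OF f s]] by (simp only:)
qed

lemma L2_strongly_measurable_reflect:
  assumes F: "L2_strongly_measurable N (leb d) F"
    and G: "\<And>t. t \<in> space N \<Longrightarrow> G t \<in> L2 (leb_on d (orthant d))"
    and ae: "\<And>t. t \<in> space N \<Longrightarrow> AE x in leb_on d (orthant d). G t x = reflect_sum d c (F t) x"
  shows "L2_strongly_measurable N (leb_on d (orthant d)) G"
proof -
  obtain s where s: "\<And>n. L2_simple N (leb d) (s n)"
    and lim: "AE t in N. (\<lambda>n::nat. L2_norm (leb d) (\<lambda>x. F t x - s n t x)) \<longlonglongrightarrow> 0"
    and F': "\<And>t. t \<in> space N \<Longrightarrow> F t \<in> L2 (leb d)"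
    using F unfolding L2_strongly_measurable_def by blast
  have sL: "s n t \<in> L2 (leb d)" if "t \<in> space N" for n t using s[of n] that by (simp add: L2_simple_def)
  have "AE t in N. (\<lambda>n. L2_norm (leb_on d (orthant d)) (\<lambda>x. G t x - reflect_sum d c (s n t) x)) \<longlonglongrightarrow> 0"
    using lim AE_space
  proof eventually_elim
    case (elim t)
    show ?case
    proof (rule tendsto_sandwich[OF _ _ tendsto_const elim(1)])
      show "\<forall>\<^sub>F n in sequentially. 0 \<le> L2_norm (leb_on d (orthant d)) (\<lambda>x. G t x - reflect_sum d c (s n t) x)" by simp
      show "\<forall>\<^sub>F n in sequentially. L2_norm (leb_on d (orthant d)) (\<lambda>x. G t x - reflect_sum d c (s n t) x)
          \<le> L2_norm (leb d) (\<lambda>x. F t x - s n t x)"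
        by (intro always_eventually allI reflect_norm_diff[OF F'[OF elim(2)] sL[OF elim(2)] G[OF elim(2)] ae[OF elim(2)]])
    qed
  qed
  then show ?thesis
    unfolding L2_strongly_measurable_def
    by (intro conjI ballI G exI[of _ "\<lambda>n t. reflect_sum d c (s n t)"] allI L2_simple_reflect s)
qed

text \<open>Contractivity carries the simple approximants of F to simple approximants of G with no
  larger error. Agreement of G with the reflected integrand is asked for almost everywhere in x
  only, as the intertwining of the semigroups gives no more.\<close>

lemma has_L2_integral_reflect:
  assumes N: "finite_measure N" and F: "has_L2_integral N (leb d) F w"
    and G: "\<And>t. t \<in> space N \<Longrightarrow> G t \<in> L2 (leb_on d (orthant d))"
    and ae: "\<And>t. t \<in> space N \<Longrightarrow> AE x in leb_on d (orthant d). G t x = reflect_sum d c (F t) x"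
  shows "has_L2_integral N (leb_on d (orthant d)) G (reflect_sum d c w)"
proof -
  let ?M = "leb_on d (orthant d)"
  obtain s where s: "\<And>n. L2_simple N (leb d) (s n)"
    and l1: "(\<lambda>n::nat. \<integral>\<^sup>+t. ennreal (L2_norm (leb d) (\<lambda>x. F t x - s n t x)) \<partial>N) \<longlonglongrightarrow> 0"
    and l2: "(\<lambda>n. L2_norm (leb d) (\<lambda>x. L2_simple_integral N (s n) x - w x)) \<longlonglongrightarrow> 0"
    and Fm: "L2_strongly_measurable N (leb d) F" and w: "w \<in> L2 (leb d)"
    using F unfolding has_L2_integral_def by blast
  have F': "\<And>t. t \<in> space N \<Longrightarrow> F t \<in> L2 (leb d)" using Fm by (simp add: L2_strongly_measurable_def)
  have sL: "s n t \<in> L2 (leb d)" if "t \<in> space N" for n t using s[of n] that by (simp add: L2_simple_def)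
  let ?s = "\<lambda>n t. reflect_sum d c (s n t)"
  have "(\<lambda>n. \<integral>\<^sup>+t. ennreal (L2_norm ?M (\<lambda>x. G t x - ?s n t x)) \<partial>N) \<longlonglongrightarrow> 0"
  proof (rule tendsto_sandwich[OF _ _ tendsto_const l1])
    show "\<forall>\<^sub>F n in sequentially. (\<integral>\<^sup>+t. ennreal (L2_norm ?M (\<lambda>x. G t x - ?s n t x)) \<partial>N)
        \<le> (\<integral>\<^sup>+t. ennreal (L2_norm (leb d) (\<lambda>x. F t x - s n t x)) \<partial>N)"
      by (intro always_eventually allI nn_integral_mono ennreal_leI reflect_norm_diff[OF F' sL G ae])
  qed simp
  moreover have "(\<lambda>n. L2_norm ?M (\<lambda>x. L2_simple_integral N (?s n) x - reflect_sum d c w x)) \<longlonglongrightarrow> 0"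
    unfolding L2_simple_integral_reflect[OF N s]
  proof (rule reflect_sum_tendsto(2)[OF _ w l2])
    show "L2_simple_integral N (s n) \<in> L2 (leb d)" for n
    proof -
      have "(\<lambda>x. \<Sum>g\<in>s n ` space N. of_real (measure N (s n -` {g} \<inter> space N)) * g x) \<in> L2 (leb d)"
        by (intro L2_sum L2_mult) (use sL in blast)
      then show ?thesis by (simp add: L2_simple_integral_def[abs_def])
    qed
  qed
  ultimately show ?thesis
    unfolding has_L2_integral_def
    using L2_strongly_measurable_reflect[OF Fm G ae] reflect_sum_L2_orthant[OF w] L2_simple_reflect[OF s]
    by (intro conjI exI[of _ ?s] allI)
qed

text \<open>Strong measurability only gives convergence almost everywhere. Completeness of the
  measure makes the modification on a null set measurable.\<close>

lemma borel_measurable_AE_LIMSEQ: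
  fixes f :: "nat \<Rightarrow> 'a \<Rightarrow> real"
  assumes N: "complete_measure N" and f: "\<And>n. f n \<in> borel_measurable N"
    and lim: "AE t in N. (\<lambda>n. f n t) \<longlonglongrightarrow> g t"
  shows "g \<in> borel_measurable N"
  unfolding borel_measurable_iff_le
proof
  fix a
  have h: "(\<lambda>t. lim (\<lambda>n. f n t)) \<in> borel_measurable N" by (rule borel_measurable_lim_metric[OF f])
  show "{t \<in> space N. g t \<le> a} \<in> sets N"
  proof (rule complete_measure.in_sets_AE[OF N])
    show "{t \<in> space N. lim (\<lambda>n. f n t) \<le> a} \<in> sets N" using h unfolding borel_measurable_iff_le by blast
    show "AE t in N. t \<in> {t \<in> space N. lim (\<lambda>n. f n t) \<le> a} \<longleftrightarrow> t \<in> {t \<in> space N. g t \<le> a}"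
      using lim by eventually_elim (simp add: limI)
  qed blast
qed

lemma complete_measure_lebesgue_on:
  assumes "S \<in> sets lebesgue"
  shows "complete_measure (lebesgue_on S)"
proof
  fix A B :: "'a set" assume "B \<subseteq> A" "A \<in> null_sets (lebesgue_on S)"
  then have "A \<in> null_sets lebesgue" "A \<subseteq> S" using assms by (auto simp: null_sets_restrict_space)
  then have "B \<in> sets lebesgue" using \<open>B \<subseteq> A\<close> completion.complete by blast
  then show "B \<in> sets (lebesgue_on S)"
    using assms \<open>A \<subseteq> S\<close> \<open>B \<subseteq> A\<close> by (auto simp: sets_restrict_space_iff)
qed

text \<open>The norms of the simple approximants converge by the reverse triangle
  inequality.\<close>

lemma L2_norm_strongly_measurable:
  assumes N: "complete_measure N" and F: "L2_strongly_measurable N M F"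
  shows "(\<lambda>t. L2_norm M (F t)) \<in> borel_measurable N"
proof -
  obtain s where s: "\<And>n. L2_simple N M (s n)"
    and lim: "AE t in N. (\<lambda>n::nat. L2_norm M (\<lambda>x. F t x - s n t x)) \<longlonglongrightarrow> 0"
    and F': "\<And>t. t \<in> space N \<Longrightarrow> F t \<in> L2 M"
    using F unfolding L2_strongly_measurable_def by blast
  have "(\<lambda>t. L2_norm M (s n t)) \<in> borel_measurable N" for n
  proof -
    have "simple_function N (s n)" using s[of n] by (simp add: L2_simple_def)
    from simple_function_compose1[OF this, of "L2_norm M"] show ?thesis by (rule borel_measurable_simple_function)
  qed
  moreover have "AE t in N. (\<lambda>n. L2_norm M (s n t)) \<longlonglongrightarrow> L2_norm M (F t)"
    using lim AE_space
  proof eventually_elim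
    case (elim t)
    have "\<bar>L2_norm M (s n t) - L2_norm M (F t)\<bar> \<le> L2_norm M (\<lambda>x. F t x - s n t x)" for n
    proof -
      have L: "s n t \<in> L2 M" using s[of n] elim(2) by (simp add: L2_simple_def)
      have "L2_norm M (F t) \<le> L2_norm M (\<lambda>x. F t x - s n t x) + L2_norm M (s n t)"
        using L2_norm_triangle[OF L2_diff[OF F'[OF elim(2)] L] L] by simp
      moreover have "L2_norm M (s n t) \<le> L2_norm M (\<lambda>x. s n t x - F t x) + L2_norm M (F t)"
        using L2_norm_triangle[OF L2_diff[OF L F'[OF elim(2)]] F'[OF elim(2)]] by simp
      moreover have "L2_norm M (\<lambda>x. s n t x - F t x) = L2_norm M (\<lambda>x. F t x - s n t x)" by (rule L2_norm_minus_commute)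
      ultimately show ?thesis by linarith
    qed
    then have "(\<lambda>n. L2_norm M (s n t) - L2_norm M (F t)) \<longlonglongrightarrow> 0"
      by (intro Lim_null_comparison[OF _ elim(1)] always_eventually) simp
    then show ?case by (simp only: LIM_zero_iff)
  qed
  ultimately show ?thesis by (rule borel_measurable_AE_LIMSEQ[OF N])
qed

lemma L2_strongly_measurable_restrict:
  assumes F: "L2_strongly_measurable N (leb d) F" and W: "W \<in> sets (leb d)"
  shows "L2_strongly_measurable N (leb_on d W) F"
proof -
  obtain s where s: "\<And>n. L2_simple N (leb d) (s n)"
    and lim: "AE t in N. (\<lambda>n::nat. L2_norm (leb d) (\<lambda>x. F t x - s n t x)) \<longlonglongrightarrow> 0"
    and F': "\<And>t. t \<in> space N \<Longrightarrow> F t \<in> L2 (leb d)"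
    using F unfolding L2_strongly_measurable_def by blast
  have sL: "s n t \<in> L2 (leb d)" if "t \<in> space N" for n t using s[of n] that by (simp add: L2_simple_def)
  have "AE t in N. (\<lambda>n. L2_norm (leb_on d W) (\<lambda>x. F t x - s n t x)) \<longlonglongrightarrow> 0"
    using lim AE_space
  proof eventually_elim
    case (elim t)
    show ?case
    proof (rule tendsto_sandwich[OF _ _ tendsto_const elim(1)])
      show "\<forall>\<^sub>F n in sequentially. L2_norm (leb_on d W) (\<lambda>x. F t x - s n t x) \<le> L2_norm (leb d) (\<lambda>x. F t x - s n t x)"
        by (intro always_eventually allI L2_restrict_space[OF W] L2_diff F'[OF elim(2)] sL[OF elim(2)])
    qed simp
  qed
  moreover have "L2_simple N (leb_on d W) (s n)" for n
    using s[of n] L2_restrict_space(1)[OF W] by (simp add: L2_simple_def)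
  ultimately show ?thesis
    unfolding L2_strongly_measurable_def using L2_restrict_space(1)[OF W F'] by blast
qed

section \<open>Reflected controls as functions of time\<close>

lemma L2_time_reflect:
  assumes v: "v \<in> L2_time T (leb d)"
  shows "(\<lambda>t. reflect_sum d c (v t)) \<in> L2_time T (leb_on d (orthant d))"
proof -
  let ?N = "lebesgue_on {0<..<T}" and ?M = "leb_on d (orthant d)"
  have vm: "L2_strongly_measurable ?N (leb d) v" and vi: "integrable ?N (\<lambda>t. (L2_norm (leb d) (v t))\<^sup>2)"
    using v by (simp_all add: L2_time_def)
  have vL: "\<And>t. t \<in> space ?N \<Longrightarrow> v t \<in> L2 (leb d)" using vm unfolding L2_strongly_measurable_def by blast
  have m: "L2_strongly_measurable ?N ?M (\<lambda>t. reflect_sum d c (v t))"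
    by (rule L2_strongly_measurable_reflect[OF vm reflect_sum_L2_orthant[OF vL] AE_I2[OF refl]])
  have "integrable ?N (\<lambda>t. (L2_norm ?M (reflect_sum d c (v t)))\<^sup>2)"
  proof (rule Bochner_Integration.integrable_bound[OF vi])
    have "complete_measure ?N" by (rule complete_measure_lebesgue_on) simp
    from L2_norm_strongly_measurable[OF this m]
    show "(\<lambda>t. (L2_norm ?M (reflect_sum d c (v t)))\<^sup>2) \<in> borel_measurable ?N" by (rule borel_measurable_power)
    show "AE t in ?N. norm ((L2_norm ?M (reflect_sum d c (v t)))\<^sup>2) \<le> norm ((L2_norm (leb d) (v t))\<^sup>2)"
      using AE_space
    proof eventually_elim
      case (elim t)
      then show ?case using reflect_norm_sum[OF vL[OF elim], of c] by (simp add: power_mono)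
    qed
  qed
  with m show ?thesis by (simp add: L2_time_def)
qed

lemma L2_time_norm_reflect:
  assumes v: "v \<in> L2_time T (leb d)" and W: "W \<subseteq> orthant d" "W \<in> sets (leb d)"
  shows "L2_time_norm T (leb_on d W) (\<lambda>t. reflect_sum d c (v t)) \<le> L2_time_norm T (leb_on d (reflect_set d W)) v"
  unfolding L2_time_norm_def
proof (intro real_sqrt_le_mono integral_mono')
  let ?N = "lebesgue_on {0<..<T}" and ?W = "reflect_set d W"
  have vm: "L2_strongly_measurable ?N (leb d) v" and vi: "integrable ?N (\<lambda>t. (L2_norm (leb d) (v t))\<^sup>2)"
    using v by (simp_all add: L2_time_def)
  have vL: "\<And>t. t \<in> space ?N \<Longrightarrow> v t \<in> L2 (leb d)" using vm unfolding L2_strongly_measurable_def by blast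
  note S = reflect_set_sets[OF W(2)]
  \<comment> \<open>Without integrability the integral of the majorant would be 0 by convention, and
    the comparison would fail.\<close>
  show "integrable ?N (\<lambda>t. (L2_norm (leb_on d ?W) (v t))\<^sup>2)"
  proof (rule Bochner_Integration.integrable_bound[OF vi])
    have "complete_measure ?N" by (rule complete_measure_lebesgue_on) simp
    from L2_norm_strongly_measurable[OF this L2_strongly_measurable_restrict[OF vm S]]
    show "(\<lambda>t. (L2_norm (leb_on d ?W) (v t))\<^sup>2) \<in> borel_measurable ?N" by (rule borel_measurable_power)
    show "AE t in ?N. norm ((L2_norm (leb_on d ?W) (v t))\<^sup>2) \<le> norm ((L2_norm (leb d) (v t))\<^sup>2)"
      using AE_space
    proof eventually_elim
      case (elim t)
      then show ?case using L2_restrict_space(2)[OF S vL[OF elim]] by (simp add: power_mono)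
    qed
  qed
  fix t assume "t \<in> space ?N"
  from reflect_norm_restrict[OF W vL[OF this], of c]
  show "(L2_norm (leb_on d W) (reflect_sum d c (v t)))\<^sup>2 \<le> (L2_norm (leb_on d ?W) (v t))\<^sup>2"
    by (rule power_mono) simp
qed simp

text \<open>The reflection sum is applied to the identity that expresses null-control of the
  extended datum. It passes through the indicator, the semigroup and the time integral, and the
  extended datum returns to u.\<close>

lemma null_controls_reflect:
  assumes u: "u \<in> L2 (leb_on d (orthant d))" and T: "T > 0" and W: "W \<subseteq> orthant d" "W \<in> sets (leb d)"
    and v: "v \<in> null_controls b d (Rd d) (reflect_set d W) T (reflect_ext d (odd_axes b d) u)"
  shows "(\<lambda>t. reflect_sum d (odd_axes b d) (v t)) \<in> null_controls b d (orthant d) W T u"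
proof -
  let ?N = "lebesgue_on {0<..<T}" and ?M = "leb_on d (orthant d)" and ?c = "odd_axes b d" and ?S = "reflect_set d W"
  let ?H = "heat_semigroup b d (Rd d)" and ?HO = "heat_semigroup b d (orthant d)"
  have vt: "v \<in> L2_time T (leb d)" using v unfolding null_controls_def leb_on_Rd by blast
  obtain w where int: "has_L2_integral ?N (leb d) (\<lambda>s. ?H (T - s) (\<lambda>x. indicator ?S x * v s x)) w"
    and zero: "AE x in leb d. ?H T (reflect_ext d ?c u) x + w x = 0"
    using v unfolding null_controls_def leb_on_Rd by blast
  have vL: "v t \<in> L2 (leb d)" if "t \<in> space ?N" for t
    using vt that unfolding L2_time_def L2_strongly_measurable_def by blast
  note sg = orth.heat_semigroup(1)[OF nontrivial_L2_orthant, where b = b and d = d]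
  note S = reflect_set_sets[OF W(2)]
  have fin: "finite_measure ?N"
    using T by (intro finite_measureI) (simp add: emeasure_restrict_space)
  have WM: "W \<in> sets ?M" using W orth.domain_Int[of d] by (simp add: sets_restrict_space_iff)
  have "has_L2_integral ?N ?M (\<lambda>s. ?HO (T - s) (\<lambda>x. indicator W x * reflect_sum d ?c (v s) x)) (reflect_sum d ?c w)"
  proof (rule has_L2_integral_reflect[OF fin int])
    fix s assume s: "s \<in> space ?N"
    then have Ts: "T - s \<ge> 0" by simp
    let ?f = "\<lambda>x. indicator ?S x * v s x" and ?g = "\<lambda>x. indicator W x * reflect_sum d ?c (v s) x"
    have f: "?f \<in> L2 (leb d)" by (rule L2_indicator_mult[OF S vL[OF s]])
    have g: "?g \<in> L2 ?M" by (rule L2_indicator_mult[OF WM reflect_sum_L2_orthant[OF vL[OF s]]])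
    show "?HO (T - s) ?g \<in> L2 ?M" by (rule C0_semigroup_in[OF sg Ts g])
    have "AE x in ?M. ?g x = reflect_sum d ?c ?f x"
      by (rule AE_I2) (simp add: orth.space_M reflect_sum_indicator[OF W(1)])
    from C0_semigroup_cong_AE[OF sg Ts g reflect_sum_L2_orthant[OF f] this] reflect_sum_heat[OF Ts f, of b]
    show "AE x in ?M. ?HO (T - s) ?g x = reflect_sum d ?c (?H (T - s) ?f) x" by eventually_elim simp
  qed
  moreover have "AE x in ?M. ?HO T u x + reflect_sum d ?c w x = 0"
  proof -
    have E: "reflect_ext d ?c u \<in> L2 (leb d)" by (rule reflect_ext_L2[OF u])
    have T0: "T \<ge> 0" using T by simp
    have "AE x in ?M. u x = reflect_sum d ?c (reflect_ext d ?c u) x"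
      unfolding reflect_ext_def by (rule AE_I2) (simp add: orth.space_M reflect_sum_reflect_sum)
    note 1 = C0_semigroup_cong_AE[OF sg T0 u reflect_sum_L2_orthant[OF E] this]
    \<comment> \<open>The factor 1 gives the sum the shape k f + g that
      \<open>reflect_sum_lincomb\<close> rewrites.\<close>
    have "AE x in leb d. 1 * ?H T (reflect_ext d ?c u) x + w x = 0" using zero by simp
    from reflect_sum_cong_AE[OF this, of ?c]
    have "AE x in leb d. reflect_sum d ?c (?H T (reflect_ext d ?c u)) x + reflect_sum d ?c w x = 0"
      unfolding reflect_sum_lincomb by (simp add: reflect_sum_def)
    then have "AE x in ?M. reflect_sum d ?c (?H T (reflect_ext d ?c u)) x + reflect_sum d ?c w x = 0"
      unfolding orth.AE_M_iff by eventually_elim simp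
    with 1 reflect_sum_heat[OF T0 E, of b] show ?thesis by eventually_elim simp
  qed
  ultimately show ?thesis
    using L2_time_reflect[OF vt] unfolding null_controls_def by blast
qed

text \<open>The assumption on K is applied to the whole space with L = 1. Its condition on the side
  lengths is tied to the equation of the domain with the cube, which is refuted here.\<close>

lemma Rd_neq_cube:
  assumes "d \<ge> 1"
  shows "Rd d \<noteq> cube d 1"
proof -
  have "(\<lambda>j\<in>{..<d}. 2 :: real) \<in> Rd d" by (simp add: Rd_def)
  moreover have "(\<lambda>j\<in>{..<d}. 2 :: real) \<notin> cube d 1"
  proof
    assume "(\<lambda>j\<in>{..<d}. 2 :: real) \<in> cube d 1"
    then have "(\<lambda>j\<in>{..<d}. 2 :: real) 0 \<in> {0<..<1}" unfolding cube_def by (rule PiE_mem) (use assms in simp)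
    then show False using assms by simp
  qed
  ultimately show ?thesis by metis
qed

theorem proposition2p5:
  fixes K \<gamma> T :: real and d :: nat and a :: "nat \<Rightarrow> real" and S :: "point set" and b :: boundary
  assumes "universal_control_constant K"
    and "d \<ge> 1"
    and "thick d \<gamma> a S"
    and "T > 0"
  shows "null_controllable b d (orthant d) (orthant d \<inter> S) T \<and>
    control_cost b d (orthant d) (orthant d \<inter> S) T \<le>
      ennreal (1 / sqrt T * ((2 * K) ^ d / \<gamma>) powr (K * real d / 2) *
        exp (4 * K * (\<Sum>j<d. a j)\<^sup>2 * (ln ((2 * K) ^ d / \<gamma>))\<^sup>2 / (2 * T)))"
proof -
  let ?W = "orthant d \<inter> S" and ?M = "leb_on d (orthant d)" and ?E = "reflect_ext d (odd_axes b d)"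
  let ?B = "1 / sqrt T * ((2 * K) ^ d / \<gamma>) powr (K * real d / 2) *
        exp (4 * K * (\<Sum>j<d. a j)\<^sup>2 * (ln ((2 * K) ^ d / \<gamma>))\<^sup>2 / (2 * T))"
  let ?S = "reflect_set d ?W"
  have W: "?W \<subseteq> orthant d" "?W \<in> sets (leb d)"
    using assms(3) orth.domain_sets by (auto simp: thick_def)
  have RS: "Rd d \<inter> ?S = ?S" using reflect_set_subset by blast
  have "Rd d = cube d 1 \<longrightarrow> (\<forall>j<d. 2 * a j \<le> 1)" using Rd_neq_cube[OF assms(2)] by blast
  note U = assms(1)[unfolded universal_control_constant_def, THEN conjunct2, THEN spec, THEN mp, OF assms(2),
      THEN spec[where x = 1], THEN mp, OF zero_less_one, THEN bspec[where x = "Rd d"], OF insertI1,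
      THEN spec[where x = b], THEN spec, THEN spec, THEN spec, THEN mp, OF thick_reflect_set[OF assms(3)],
      THEN mp, OF this, THEN spec, THEN mp, OF assms(4), unfolded RS]
  have "K ^ d / (\<gamma> / 2 ^ d) = (2 * K) ^ d / \<gamma>" by (simp add: power_mult_distrib)
  moreover have "K * (\<Sum>j<d. 2 * a j)\<^sup>2 = 4 * K * (\<Sum>j<d. a j)\<^sup>2"
    by (simp add: power_mult_distrib flip: sum_distrib_left)
  ultimately have cost: "control_cost b d (Rd d) ?S T \<le> ennreal ?B"
    using U by (simp only:)
  have "null_controllable b d (orthant d) ?W T"
    unfolding null_controllable_def
  proof
    fix u assume u: "u \<in> L2 ?M"
    then obtain v where "v \<in> null_controls b d (Rd d) ?S T (?E u)"
      using U reflect_ext_L2[OF u] unfolding null_controllable_def leb_on_Rd by blast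
    from null_controls_reflect[OF u assms(4) W this] show "null_controls b d (orthant d) ?W T u \<noteq> {}" by blast
  qed
  moreover have "control_cost b d (orthant d) ?W T \<le> control_cost b d (Rd d) ?S T"
    unfolding control_cost_def
  proof (rule SUP_least)
    fix u assume "u \<in> {u \<in> L2 ?M. L2_norm ?M u = 1}"
    then have u: "u \<in> L2 ?M" "L2_norm ?M u = 1" by simp_all
    \<comment> \<open>The extension is isometric, so a unit datum on the orthant competes in the
      supremum for the whole space.\<close>
    have E: "?E u \<in> {u \<in> L2 (leb_on d (Rd d)). L2_norm (leb_on d (Rd d)) u = 1}"
      using reflect_ext_L2[OF u(1)] reflect_norm_ext[OF u(1)] u(2) by simp
    have "(INF v\<in>null_controls b d (orthant d) ?W T u. ennreal (L2_time_norm T (leb_on d ?W) v))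
        \<le> (INF v\<in>null_controls b d (Rd d) ?S T (?E u). ennreal (L2_time_norm T (leb_on d ?S) v))"
    proof (rule INF_mono)
      fix v assume v: "v \<in> null_controls b d (Rd d) ?S T (?E u)"
      then have "v \<in> L2_time T (leb d)" unfolding null_controls_def leb_on_Rd by blast
      from null_controls_reflect[OF u(1) assms(4) W v] L2_time_norm_reflect[OF this W]
      show "\<exists>v'\<in>null_controls b d (orthant d) ?W T u.
          ennreal (L2_time_norm T (leb_on d ?W) v') \<le> ennreal (L2_time_norm T (leb_on d ?S) v)"
        by (blast intro: ennreal_leI)
    qed
    also have "\<dots> \<le> (SUP u\<in>{u \<in> L2 (leb_on d (Rd d)). L2_norm (leb_on d (Rd d)) u = 1}.
        INF v\<in>null_controls b d (Rd d) ?S T u. ennreal (L2_time_norm T (leb_on d ?S) v))"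
      by (rule SUP_upper[OF E])
    finally show "(INF v\<in>null_controls b d (orthant d) ?W T u. ennreal (L2_time_norm T (leb_on d ?W) v))
        \<le> (SUP u\<in>{u \<in> L2 (leb_on d (Rd d)). L2_norm (leb_on d (Rd d)) u = 1}.
        INF v\<in>null_controls b d (Rd d) ?S T u. ennreal (L2_time_norm T (leb_on d ?S) v))" .
  qed
  ultimately show ?thesis using cost by (blast intro: order.trans)
qed

end
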